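(* Let $\varphi: P^m \to N^n$ be an isometric immersion of a complete non-compact Riemannian manifold $P^m$ into a Riemannian manifold $N^n$ with bounded geometry. Assume that the mean curvature vector of $\varphi$ has constant length. Then $P^m$ is properly immersed in $N^n$ (i.e. $\varphi$ is a proper map) if and only if, for all $t>0$, the extrinsic ball $\varphi^{-1}(B^N_t)$ of radius $t$ has finite volume, $\operatorname{Vol}(\varphi^{-1}(B^N_t)) < \infty$, where $B^N_t$ denotes any geodesic ball of radius $t$ in $N$.
   Context: A complete and non-compact Riemannian manifold $N$ has bounded geometry if its sectional curvatures are bounded from above, $K_N\le b$ for some $b\in\mathbb{R}^+$, and its injectivity radius $i_0(N)=\inf\{i_N(p): p\in N\}$ is positive (possibly $+\infty$), where $i_N(p)$ is the injectivity radius at $p$. $\operatorname{Vol}$ is the $m$-dimensional Riemannian volume of $P$. The mean curvature vector is the (normalized) trace of the second fundamental form of $\varphi$. *)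

theory Defs
  imports "HOL-Analysis.Analysis"
begin

section \<open>Smooth maps between Euclidean spaces\<close>

text \<open>Intended for open \<open>S\<close> and finite-dimensional domain, where it is the usual notion of
  \<open>k\<close>-fold continuous differentiability.\<close>

fun Ck_on :: "nat \<Rightarrow> ('a::real_normed_vector \<Rightarrow> 'b::real_normed_vector) \<Rightarrow> 'a set \<Rightarrow> bool" where
  "Ck_on 0 f S \<longleftrightarrow> continuous_on S f"
| "Ck_on (Suc k) f S \<longleftrightarrow>
     (\<forall>z\<in>S. f differentiable (at z)) \<and> (\<forall>v. Ck_on k (\<lambda>z. frechet_derivative f (at z) v) S)"

definition smooth_on :: "('a::real_normed_vector \<Rightarrow> 'b::real_normed_vector) \<Rightarrow> 'a set \<Rightarrow> bool" where
  "smooth_on f S \<longleftrightarrow> (\<forall>k. Ck_on k f S)"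


section \<open>Riemannian manifolds\<close>

text \<open>The underlying set is a whole (Hausdorff, second countable) type \<open>'p\<close>; the dimension is
  \<open>CARD('m)\<close>. A chart \<open>(U, x)\<close> is a coordinate map \<open>x\<close> together with its domain \<open>U\<close>; values
  of \<open>x\<close> outside \<open>U\<close> are irrelevant. A tangent vector at \<open>p\<close> is described by its components
  with respect to a chart around \<open>p\<close>, and the metric tensor is given by its component form:
  \<open>metric M c p u v\<close> is the inner product of the tangent vectors at \<open>p\<close> that have components
  \<open>u\<close> and \<open>v\<close> in the chart \<open>c\<close>.\<close>

type_synonym ('p, 'm) chart = "'p set \<times> ('p \<Rightarrow> real^'m)"

record ('p, 'm) riem =
  atlas :: "('p, 'm::finite) chart set"
  metric :: "('p, 'm::finite) chart \<Rightarrow> 'p \<Rightarrow> real^'m \<Rightarrow> real^'m \<Rightarrow> real"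

definition chart_inv :: "('p, 'm::finite) chart \<Rightarrow> real^'m \<Rightarrow> 'p" where
  "chart_inv c = inv_into (fst c) (snd c)"

definition is_chart :: "('p::topological_space, 'm::finite) chart \<Rightarrow> bool" where
  "is_chart c \<longleftrightarrow> open (fst c) \<and> open (snd c ` fst c) \<and>
     homeomorphism (fst c) (snd c ` fst c) (snd c) (chart_inv c)"

definition transition :: "('p, 'm::finite) chart \<Rightarrow> ('p, 'm) chart \<Rightarrow> real^'m \<Rightarrow> real^'m" where
  "transition c d = snd d \<circ> chart_inv c"

definition smooth_atlas :: "('p::topological_space, 'm::finite) chart set \<Rightarrow> bool" where
  "smooth_atlas A \<longleftrightarrow>
     (\<forall>c\<in>A. is_chart c) \<and> (\<Union>c\<in>A. fst c) = UNIV \<and>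
     (\<forall>c\<in>A. \<forall>d\<in>A. smooth_on (transition c d) (snd c ` (fst c \<inter> fst d)))"

definition inner_product :: "('v::real_vector \<Rightarrow> 'v \<Rightarrow> real) \<Rightarrow> bool" where
  "inner_product B \<longleftrightarrow>
     bilinear B \<and> (\<forall>u v. B u v = B v u) \<and> (\<forall>u. u \<noteq> 0 \<longrightarrow> B u u > 0)"

definition coord_metric ::
    "('p, 'm::finite) riem \<Rightarrow> ('p, 'm) chart \<Rightarrow> real^'m \<Rightarrow> real^'m \<Rightarrow> real^'m \<Rightarrow> real" where
  "coord_metric M c z = metric M c (chart_inv c z)"

definition riemannian_metric :: "('p, 'm::finite) riem \<Rightarrow> bool" where
  "riemannian_metric M \<longleftrightarrow>
     (\<forall>c\<in>atlas M. \<forall>p\<in>fst c. inner_product (metric M c p)) \<and>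
     (\<forall>c\<in>atlas M. \<forall>u v. smooth_on (\<lambda>z. coord_metric M c z u v) (snd c ` fst c)) \<and>
     (\<forall>c\<in>atlas M. \<forall>d\<in>atlas M. \<forall>p\<in>fst c \<inter> fst d. \<forall>u v.
        metric M c p u v =
        metric M d p (frechet_derivative (transition c d) (at (snd c p)) u)
                     (frechet_derivative (transition c d) (at (snd c p)) v))"

text \<open>Manifolds are connected, as usual in Riemannian geometry; this is what makes the Riemannian
  distance below finite.\<close>

definition riemannian_manifold ::
    "('p::{t2_space,second_countable_topology}, 'm::finite) riem \<Rightarrow> bool" where
  "riemannian_manifold M \<longleftrightarrow>
     connected (UNIV :: 'p set) \<and> smooth_atlas (atlas M) \<and> riemannian_metric M"


section \<open>Length, distance, completeness\<close>

definition C1_segment :: "('p::topological_space, 'm::finite) riem \<Rightarrow> real \<Rightarrow> real \<Rightarrow> (real \<Rightarrow> 'p) \<Rightarrow> bool" where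
  "C1_segment M a b \<gamma> \<longleftrightarrow> continuous_on {a..b} \<gamma> \<and>
     (\<forall>c\<in>atlas M. let J = {s\<in>{a..b}. \<gamma> s \<in> fst c} in
        (\<forall>s\<in>J. (snd c \<circ> \<gamma>) differentiable (at s within {a..b})) \<and>
        continuous_on J (\<lambda>s. vector_derivative (snd c \<circ> \<gamma>) (at s within {a..b})))"

definition piecewise_C1_curve :: "('p::topological_space, 'm::finite) riem \<Rightarrow> (real \<Rightarrow> 'p) \<Rightarrow> bool" where
  "piecewise_C1_curve M \<gamma> \<longleftrightarrow>
     (\<exists>n t. t 0 = 0 \<and> t n = 1 \<and> (\<forall>i<n. t i < t (Suc i) \<and> C1_segment M (t i) (t (Suc i)) \<gamma>))"

text \<open>The speed does not depend on the selected chart. At the finitely many corners of a piecewise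
  \<open>C\<^sup>1\<close> curve the value is arbitrary, which does not affect the length.\<close>

definition speed :: "('p, 'm::finite) riem \<Rightarrow> (real \<Rightarrow> 'p) \<Rightarrow> real \<Rightarrow> real" where
  "speed M \<gamma> s =
     (let c = (SOME c. c \<in> atlas M \<and> \<gamma> s \<in> fst c);
          v = vector_derivative (snd c \<circ> \<gamma>) (at s)
      in sqrt (metric M c (\<gamma> s) v v))"

definition curve_length :: "('p, 'm::finite) riem \<Rightarrow> (real \<Rightarrow> 'p) \<Rightarrow> real" where
  "curve_length M \<gamma> = integral {0..1} (speed M \<gamma>)"

definition riem_dist :: "('p::topological_space, 'm::finite) riem \<Rightarrow> 'p \<Rightarrow> 'p \<Rightarrow> real" where
  "riem_dist M p q = Inf {curve_length M \<gamma> |\<gamma>. piecewise_C1_curve M \<gamma> \<and> \<gamma> 0 = p \<and> \<gamma> 1 = q}"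

definition complete_riem :: "('p::topological_space, 'm::finite) riem \<Rightarrow> bool" where
  "complete_riem M \<longleftrightarrow> Metric_space.mcomplete UNIV (riem_dist M)"

definition geodesic_ball :: "('p::topological_space, 'm::finite) riem \<Rightarrow> 'p \<Rightarrow> real \<Rightarrow> 'p set" where
  "geodesic_ball M q t = {x. riem_dist M q x < t}"


section \<open>Levi-Civita connection and sectional curvature\<close>

text \<open>Index-free Christoffel symbols: in the chart \<open>c\<close>, \<open>christoffel M c z u v\<close> is the component
  vector of the covariant derivative, in direction \<open>u\<close>, of the vector field with constant
  components \<open>v\<close>. It is determined by the Koszul formula.\<close>

definition christoffel ::
    "('p, 'm::finite) riem \<Rightarrow> ('p, 'm) chart \<Rightarrow> real^'m \<Rightarrow> real^'m \<Rightarrow> real^'m \<Rightarrow> real^'m" where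
  "christoffel M c z u v =
     (THE a. \<forall>w. coord_metric M c z a w =
        (frechet_derivative (\<lambda>y. coord_metric M c y v w) (at z) u
       + frechet_derivative (\<lambda>y. coord_metric M c y u w) (at z) v
       - frechet_derivative (\<lambda>y. coord_metric M c y u v) (at z) w) / 2)"

text \<open>Sign convention: \<open>R(u,v)w = \<nabla>\<^sub>u\<nabla>\<^sub>vw - \<nabla>\<^sub>v\<nabla>\<^sub>uw\<close> for fields with constant components.\<close>

definition curvature ::
    "('p, 'm::finite) riem \<Rightarrow> ('p, 'm) chart \<Rightarrow> real^'m \<Rightarrow> real^'m \<Rightarrow> real^'m \<Rightarrow> real^'m \<Rightarrow> real^'m" where
  "curvature M c z u v w =
     frechet_derivative (\<lambda>y. christoffel M c y v w) (at z) u
   - frechet_derivative (\<lambda>y. christoffel M c y u w) (at z) v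
   + christoffel M c z u (christoffel M c z v w)
   - christoffel M c z v (christoffel M c z u w)"

definition sectional_curvature ::
    "('p, 'm::finite) riem \<Rightarrow> ('p, 'm) chart \<Rightarrow> 'p \<Rightarrow> real^'m \<Rightarrow> real^'m \<Rightarrow> real" where
  "sectional_curvature M c p u v =
     metric M c p (curvature M c (snd c p) u v v) u /
     (metric M c p u u * metric M c p v v - (metric M c p u v)\<^sup>2)"

definition sectional_curvature_le :: "('p, 'm::finite) riem \<Rightarrow> real \<Rightarrow> bool" where
  "sectional_curvature_le M b \<longleftrightarrow>
     (\<forall>c\<in>atlas M. \<forall>p\<in>fst c. \<forall>u v. u \<noteq> v \<and> independent {u, v} \<longrightarrow> sectional_curvature M c p u v \<le> b)"


section \<open>Geodesics, exponential map, injectivity radius\<close>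

definition geodesic_on ::
    "('p::topological_space, 'm::finite) riem \<Rightarrow> real set \<Rightarrow> (real \<Rightarrow> 'p) \<Rightarrow> bool" where
  "geodesic_on M I \<gamma> \<longleftrightarrow> continuous_on I \<gamma> \<and>
     (\<forall>c\<in>atlas M. \<forall>s\<in>I. \<gamma> s \<in> fst c \<longrightarrow>
        (let y = snd c \<circ> \<gamma>; y' = (\<lambda>s. vector_derivative y (at s)) in
           y differentiable (at s) \<and>
           (y' has_vector_derivative - christoffel M c (y s) (y' s) (y' s)) (at s)))"

text \<open>\<open>has_exp M c p v q\<close>: the exponential map at \<open>p\<close> is defined at the tangent vector with
  components \<open>v\<close> in the chart \<open>c\<close>, with value \<open>q\<close>.\<close>

definition has_exp ::
    "('p::topological_space, 'm::finite) riem \<Rightarrow> ('p, 'm) chart \<Rightarrow> 'p \<Rightarrow> real^'m \<Rightarrow> 'p \<Rightarrow> bool" where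
  "has_exp M c p v q \<longleftrightarrow>
     (\<exists>a b \<gamma>. a < 0 \<and> 1 < b \<and> geodesic_on M {a<..<b} \<gamma> \<and> \<gamma> 0 = p \<and>
        ((snd c \<circ> \<gamma>) has_vector_derivative v) (at 0) \<and> \<gamma> 1 = q)"

definition exp_map ::
    "('p::topological_space, 'm::finite) riem \<Rightarrow> ('p, 'm) chart \<Rightarrow> 'p \<Rightarrow> real^'m \<Rightarrow> 'p" where
  "exp_map M c p v = (THE q. has_exp M c p v q)"

definition diffeo_onto_image ::
    "('p::topological_space, 'm::finite) riem \<Rightarrow> (real^'m) set \<Rightarrow> (real^'m \<Rightarrow> 'p) \<Rightarrow> bool" where
  "diffeo_onto_image M B E \<longleftrightarrow>
     inj_on E B \<and> continuous_on B E \<and> open (E ` B) \<and>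
     (\<forall>d\<in>atlas M. smooth_on (snd d \<circ> E) (B \<inter> E -` fst d) \<and>
        smooth_on (inv_into B E \<circ> chart_inv d) (snd d ` (E ` B \<inter> fst d)))"

definition injectivity_radius_at :: "('p::topological_space, 'm::finite) riem \<Rightarrow> 'p \<Rightarrow> ereal" where
  "injectivity_radius_at M p =
     Sup {ereal r |r. 0 < r \<and> (\<exists>c\<in>atlas M. p \<in> fst c \<and>
       (let B = {v. sqrt (metric M c p v v) < r} in
          (\<forall>v\<in>B. \<exists>q. has_exp M c p v q) \<and> diffeo_onto_image M B (exp_map M c p)))}"

definition injectivity_radius :: "('p::topological_space, 'm::finite) riem \<Rightarrow> ereal" where
  "injectivity_radius M = (INF p. injectivity_radius_at M p)"

definition bounded_geometry :: "('p::topological_space, 'm::finite) riem \<Rightarrow> bool" where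
  "bounded_geometry M \<longleftrightarrow>
     complete_riem M \<and> \<not> compact (UNIV :: 'p set) \<and>
     (\<exists>b>0. sectional_curvature_le M b) \<and> injectivity_radius M > 0"


section \<open>Riemannian volume\<close>

text \<open>The unique Borel measure with density \<open>sqrt (det g\<^sub>i\<^sub>j)\<close> in every chart.\<close>

definition volume_density ::
    "('p, 'm::finite) riem \<Rightarrow> ('p, 'm) chart \<Rightarrow> real^'m \<Rightarrow> real" where
  "volume_density M c z = sqrt (det (\<chi> i j. coord_metric M c z (axis i 1) (axis j 1)))"

definition riem_volume :: "('p::topological_space, 'm::finite) riem \<Rightarrow> 'p measure" where
  "riem_volume M =
     (THE \<mu>. sets \<mu> = sets borel \<and>
        (\<forall>c\<in>atlas M. \<forall>A\<in>sets borel. A \<subseteq> fst c \<longrightarrow>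
           emeasure \<mu> A = (\<integral>\<^sup>+z\<in>snd c ` A. ennreal (volume_density M c z) \<partial>lborel)))"


section \<open>Isometric immersions and mean curvature\<close>

definition local_rep ::
    "('p \<Rightarrow> 'q) \<Rightarrow> ('p, 'm::finite) chart \<Rightarrow> ('q, 'n::finite) chart \<Rightarrow> real^'m \<Rightarrow> real^'n" where
  "local_rep \<phi> c d = snd d \<circ> \<phi> \<circ> chart_inv c"

definition differential ::
    "('p \<Rightarrow> 'q) \<Rightarrow> ('p, 'm::finite) chart \<Rightarrow> ('q, 'n::finite) chart \<Rightarrow> 'p \<Rightarrow> real^'m \<Rightarrow> real^'n" where
  "differential \<phi> c d p = frechet_derivative (local_rep \<phi> c d) (at (snd c p))"

definition smooth_map ::
    "('p::topological_space, 'm::finite) riem \<Rightarrow> ('q::topological_space, 'n::finite) riem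
      \<Rightarrow> ('p \<Rightarrow> 'q) \<Rightarrow> bool" where
  "smooth_map P N \<phi> \<longleftrightarrow> continuous_on UNIV \<phi> \<and>
     (\<forall>c\<in>atlas P. \<forall>d\<in>atlas N. smooth_on (local_rep \<phi> c d) (snd c ` (fst c \<inter> \<phi> -` fst d)))"

definition isometric_immersion ::
    "('p::topological_space, 'm::finite) riem \<Rightarrow> ('q::topological_space, 'n::finite) riem
      \<Rightarrow> ('p \<Rightarrow> 'q) \<Rightarrow> bool" where
  "isometric_immersion P N \<phi> \<longleftrightarrow> smooth_map P N \<phi> \<and>
     (\<forall>c\<in>atlas P. \<forall>d\<in>atlas N. \<forall>p\<in>fst c \<inter> \<phi> -` fst d.
        inj (differential \<phi> c d p) \<and>
        (\<forall>u v. metric N d (\<phi> p) (differential \<phi> c d p u) (differential \<phi> c d p v) = metric P c p u v))"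

text \<open>The second fundamental form via the Gauss formula: the covariant derivative in \<open>N\<close>, along
  \<open>\<phi>\<close> and in direction \<open>u\<close>, of the image of the field with constant components \<open>v\<close>, minus the
  image of its covariant derivative in \<open>P\<close>. The result is given in components of the chart \<open>d\<close>
  around \<open>\<phi> p\<close>.\<close>

definition second_fundamental_form ::
    "('p, 'm::finite) riem \<Rightarrow> ('q, 'n::finite) riem \<Rightarrow> ('p \<Rightarrow> 'q)
      \<Rightarrow> ('p, 'm) chart \<Rightarrow> ('q, 'n) chart \<Rightarrow> 'p \<Rightarrow> real^'m \<Rightarrow> real^'m \<Rightarrow> real^'n" where
  "second_fundamental_form P N \<phi> c d p u v =
     frechet_derivative (\<lambda>z. frechet_derivative (local_rep \<phi> c d) (at z) v) (at (snd c p)) u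
   + christoffel N d (snd d (\<phi> p)) (differential \<phi> c d p u) (differential \<phi> c d p v)
   - differential \<phi> c d p (christoffel P c (snd c p) u v)"

definition orthonormal_basis :: "(real^'m \<Rightarrow> real^'m \<Rightarrow> real) \<Rightarrow> (real^'m::finite) set \<Rightarrow> bool" where
  "orthonormal_basis B E \<longleftrightarrow> finite E \<and> card E = CARD('m) \<and>
     (\<forall>u\<in>E. \<forall>v\<in>E. B u v = (if u = v then 1 else 0))"

text \<open>The value does not depend on the selected orthonormal basis of the tangent space.\<close>

definition mean_curvature_vector ::
    "('p, 'm::finite) riem \<Rightarrow> ('q, 'n::finite) riem \<Rightarrow> ('p \<Rightarrow> 'q)
      \<Rightarrow> ('p, 'm) chart \<Rightarrow> ('q, 'n) chart \<Rightarrow> 'p \<Rightarrow> real^'n" where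
  "mean_curvature_vector P N \<phi> c d p =
     (1 / real CARD('m)) *\<^sub>R
       (\<Sum>e\<in>(SOME E. orthonormal_basis (metric P c p) E). second_fundamental_form P N \<phi> c d p e e)"

definition constant_mean_curvature_length ::
    "('p, 'm::finite) riem \<Rightarrow> ('q, 'n::finite) riem \<Rightarrow> ('p \<Rightarrow> 'q) \<Rightarrow> bool" where
  "constant_mean_curvature_length P N \<phi> \<longleftrightarrow>
     (\<exists>h. \<forall>c\<in>atlas P. \<forall>d\<in>atlas N. \<forall>p\<in>fst c \<inter> \<phi> -` fst d.
        let H = mean_curvature_vector P N \<phi> c d p in sqrt (metric N d (\<phi> p) H H) = h)"


section \<open>Proper maps\<close>

text \<open>The library's \<open>proper_map\<close> means closed with compact fibres; between manifolds this is the
  usual condition on preimages of compact sets.\<close>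

lemma proper_map_iff_compact_vimage:
  fixes f :: "'a::t2_space \<Rightarrow> 'b::{t2_space,first_countable_topology}"
  assumes f: "continuous_on UNIV f"
  shows "proper_map euclidean euclidean f \<longleftrightarrow> (\<forall>K. compact K \<longrightarrow> compact (f -` K))"
proof -
  have closedI: "closed S" if S: "\<And>K. compact K \<Longrightarrow> closed (S \<inter> K)" for S :: "'b set"
    unfolding closed_sequential_limits
  proof (intro allI impI)
    fix x :: "nat \<Rightarrow> 'b" and l assume x: "(\<forall>n. x n \<in> S) \<and> x \<longlonglongrightarrow> l"
    then have "closed (S \<inter> insert l (range x))"
      using compactin_sequence_with_limit[of euclidean x l "range x"] by (intro S) auto
    with x show "l \<in> S"
      unfolding closed_sequential_limits by (metis IntD1 IntI insertI2 rangeI)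
  qed
  show ?thesis
  proof
    assume "proper_map euclidean euclidean f"
    then show "\<forall>K. compact K \<longrightarrow> compact (f -` K)"
      using compactin_proper_map_preimage[of euclidean euclidean f]
      by (auto simp: vimage_def)
  next
    assume K: "\<forall>K. compact K \<longrightarrow> compact (f -` K)"
    have "closed (f ` C)" if "closed C" for C
    proof (rule closedI)
      fix K :: "'b set" assume "compact K"
      then have "compact (f ` (C \<inter> f -` K))"
        using K f that
        by (meson closed_Int_compact compact_continuous_image continuous_on_subset subset_UNIV)
      moreover have "f ` (C \<inter> f -` K) = f ` C \<inter> K" by auto
      ultimately show "closed (f ` C \<inter> K)" by (simp add: compact_imp_closed)
    qed
    moreover have "compact {x. f x = y}" for y
      using K[rule_format, of "{y}"] by (simp add: vimage_def)
    ultimately show "proper_map euclidean euclidean f"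
      by (simp add: proper_map_def closed_map_def)
  qed
qed

end

theory Submission
  imports Defs
begin

text \<open>If \<open>\<phi>\<close> is proper, then \<open>\<phi>\<^sup>-\<^sup>1(B\<^sub>t)\<close> lies in the preimage of a closed ball of \<open>N\<close>, which is compact by
  Hopf--Rinow, and compact sets have finite volume.

  If \<open>\<phi>\<close> is not proper, then the preimage of some compact set is closed but not compact, hence
  unbounded by Hopf--Rinow on \<open>P\<close>, and it contains points \<open>x\<^sub>n\<close> at mutual distance at least \<open>1\<close> whose
  images accumulate at some \<open>q \<in> N\<close>. As \<open>\<phi>\<close> does not increase distances, the balls of a fixed small
  radius \<open>R\<close> around the \<open>x\<^sub>n\<close> are disjoint and lie in one extrinsic ball. Their volumes are bounded
  below uniformly by a monotonicity formula, so this extrinsic ball has infinite volume.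

  The monotonicity formula: freeze the metric of \<open>N\<close> at \<open>\<phi>(p\<^sub>0)\<close> in a fixed chart \<open>y\<close> near \<open>q\<close>, and let
  \<open>F(p)\<close> be half of the squared frozen length of \<open>y(\<phi>(p)) - y(\<phi>(p\<^sub>0))\<close>. On the ball of radius \<open>R\<close> around
  \<open>p\<^sub>0\<close> the Gauss formula and the bound on the mean curvature give \<open>\<Delta>F \<ge> m(1 - AR)\<close>, and moreover
  \<open>\<bar>\<nabla>F\<bar> \<le> (1 + AR) d\<close> for the distance \<open>d\<close> from \<open>p\<^sub>0\<close>, where \<open>A\<close> does not depend on \<open>p\<^sub>0\<close>. Integrating \<open>\<Delta>F\<close>
  against the cutoff \<open>((R - d)\<^sub>+)\<^sup>2\<close> yields a differential inequality in \<open>R\<close> that bounds the volume of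
  the ball from below by a multiple of \<open>R\<^sup>m\<close>. Only \<open>d\<close> being Lipschitz is used, not its smoothness,
  so that neither curvature nor injectivity radius of \<open>N\<close> enter.\<close>

section \<open>Change of variables in \<open>\<real>\<^sup>n\<close>\<close>

text \<open>The exponent comes from flat space: for F = |x|^2 / 2 one has \<Delta>F = m and
  |\<nabla>F| = d. Let I(R) be the integral of ((R - d)_+)^2; its derivative is twice the integral
  of (R - d)_+, and d = R - (R - d) on the support. Testing then gives m I \<le> R I' - 2 I, so I /
  R^(m + 2) increases. In general both relations hold up to factors 1 + O(A R), which cost only a
  constant factor. The obstacle is that d need not be differentiable. Since a lower volume bound
  needs one direction only, the divergence theorem is proved as an inequality: moving points along z
  + h X(z) in coordinates and comparing integrals requires just a bound on the decrease of the
  cutoff along X, and the triangle inequality for d provides it. A partition of unity (\<theta>_j)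
  passes from charts to the manifold; the extra terms in \<nabla>\<theta>_j cancel because the sum
  of the \<theta>_j is constant near the ball. The choice and description operators in volume,
  Christoffel symbols and mean curvature call for existence, uniqueness or chart invariance before
  any of this can be said.\<close>

text \<open>The library's change of variables theorem wants a well-ordered index type; every finite type
  has a well-ordered copy.\<close>

typedef 'a wo = "UNIV :: 'a set" morphisms of_wo to_wo ..

lemma to_wo_of_wo [simp]: "to_wo (of_wo x) = x" "of_wo (to_wo y) = y"
  by (simp_all add: of_wo_inverse to_wo_inverse)

lemma bij_to_wo: "bij to_wo"
  by (rule bij_betw_byWitness[of _ of_wo]) auto

lemma bij_of_wo: "bij of_wo"
  by (rule bij_betw_byWitness[of _ to_wo]) auto

instance wo :: (finite) finite
  by standard (metis bij_to_wo bij_betw_finite finite_code)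

text \<open>Comparing ranks in \<open>nat\<close> makes well-foundedness of the order an instance of
  induction on \<open>nat\<close>.\<close>

definition wo_rank :: "'a::finite wo \<Rightarrow> nat" where
  "wo_rank = (SOME f. inj f)"

lemma inj_wo_rank: "inj wo_rank"
  unfolding wo_rank_def using finite_imp_inj_to_nat_seg[OF finite[of "UNIV :: 'a wo set"]]
  by (intro someI_ex[of inj]) auto

instantiation wo :: (finite) wellorder
begin

definition "x \<le> y \<longleftrightarrow> wo_rank x \<le> wo_rank y"
definition "x < y \<longleftrightarrow> wo_rank x < wo_rank y"

instance
proof
  fix x y z :: "'a wo"
  show "x < y \<longleftrightarrow> x \<le> y \<and> \<not> y \<le> x" "x \<le> x" "x \<le> y \<or> y \<le> x"
    unfolding less_eq_wo_def less_wo_def by linarith+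
  show "x \<le> z" if "x \<le> y" "y \<le> z"
    using that unfolding less_eq_wo_def by linarith
  show "x = y" if "x \<le> y" "y \<le> x"
    using that injD[OF inj_wo_rank, of x y] unfolding less_eq_wo_def by linarith
next
  fix P :: "'a wo \<Rightarrow> bool" and a
  assume "\<And>x. (\<And>y. y < x \<Longrightarrow> P y) \<Longrightarrow> P x"
  then show "P a"
    unfolding less_wo_def by (induction a rule: measure_induct_rule[where f = wo_rank]) blast
qed

end

definition vec_wo :: "real^'a \<Rightarrow> real^'a::finite wo" where
  "vec_wo v = (\<chi> i. v $ of_wo i)"

definition unvec_wo :: "real^'a::finite wo \<Rightarrow> real^'a" where
  "unvec_wo v = (\<chi> i. v $ to_wo i)"

lemma vec_wo_inverse [simp]: "unvec_wo (vec_wo v) = v" "vec_wo (unvec_wo w) = w"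
  by (simp_all add: vec_wo_def unvec_wo_def vec_eq_iff)

lemma inj_vec_wo: "inj vec_wo" and inj_unvec_wo: "inj unvec_wo"
  by (metis injI vec_wo_inverse)+

lemma image_vec_wo: "vec_wo ` A = unvec_wo -` A"
  by (force simp: image_iff)

lemma linear_vec_wo: "linear vec_wo" and linear_unvec_wo: "linear unvec_wo"
  by (auto intro!: linearI simp: vec_wo_def unvec_wo_def vec_eq_iff)

lemma bounded_linear_vec_wo: "bounded_linear vec_wo" and
  bounded_linear_unvec_wo: "bounded_linear unvec_wo"
  by (simp_all add: linear_vec_wo linear_unvec_wo linear_conv_bounded_linear[symmetric])

lemma measurable_vec_wo [measurable]: "vec_wo \<in> borel_measurable borel"
  by (intro borel_measurable_continuous_onI linear_continuous_on bounded_linear_vec_wo)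

lemma measurable_unvec_wo [measurable]: "unvec_wo \<in> borel_measurable borel"
  by (intro borel_measurable_continuous_onI linear_continuous_on bounded_linear_unvec_wo)

lemma prod_Basis_cart:
  fixes f :: "real^'a::finite \<Rightarrow> 'c::comm_monoid_mult"
  shows "(\<Prod>b\<in>Basis. f b) = (\<Prod>i\<in>UNIV. f (axis i 1))"
proof -
  have "bij_betw (\<lambda>i::'a. axis i (1::real)) UNIV Basis"
    by (auto simp: bij_betw_def Basis_vec_def axis_eq_axis intro!: injI)
  from prod.reindex_bij_betw[OF this, of f] show ?thesis by simp
qed

text \<open>Lebesgue measure is determined by its values on boxes, and renaming coordinates turns a
  box into a box with the same side lengths.\<close>

lemma distr_vec_wo: "distr lborel borel (vec_wo :: real^'a \<Rightarrow> real^'a::finite wo) = lborel"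
proof (rule lborel_eqI[symmetric])
  fix l u :: "real^'a wo"
  assume *: "\<And>b. b \<in> Basis \<Longrightarrow> l \<bullet> b \<le> u \<bullet> b"
  have lu: "l $ i \<le> u $ i" for i
    using *[of "axis i 1"] by (simp add: axis_in_Basis_iff inner_axis)
  have "vec_wo -` box l u = box (unvec_wo l) (unvec_wo u)"
    by (auto simp: mem_box_cart unvec_wo_def vec_wo_def) (metis to_wo_of_wo)+
  then have "emeasure (distr lborel borel vec_wo) (box l u) = emeasure lborel (box (unvec_wo l) (unvec_wo u))"
    by (subst emeasure_distr) auto
  also have "\<dots> = (\<Prod>b\<in>Basis. (unvec_wo u - unvec_wo l) \<bullet> b)"
    by (rule emeasure_lborel_box) (auto simp: Basis_vec_def inner_axis unvec_wo_def lu)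
  also have "(\<Prod>b\<in>Basis. (unvec_wo u - unvec_wo l) \<bullet> b) = (\<Prod>i\<in>UNIV. (u - l) $ to_wo i)"
    by (simp add: prod_Basis_cart inner_axis unvec_wo_def)
  also have "\<dots> = (\<Prod>i\<in>UNIV. (u - l) $ i)"
    by (rule prod.reindex_bij_betw[OF bij_to_wo, of "\<lambda>i. (u - l) $ i"])
  finally show "emeasure (distr lborel borel vec_wo) (box l u) = (\<Prod>b\<in>Basis. (u - l) \<bullet> b)"
    by (simp add: prod_Basis_cart inner_axis)
qed simp

lemma emeasure_vec_wo_image:
  fixes A :: "(real^'a::finite) set"
  assumes "A \<in> sets borel"
  shows "emeasure lborel (vec_wo ` A) = emeasure lborel A"
proof -
  have "vec_wo ` A \<in> sets borel"
    unfolding image_vec_wo using assms measurable_sets[OF measurable_unvec_wo assms] by simp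
  then have "emeasure (distr lborel borel vec_wo) (vec_wo ` A) = emeasure lborel (vec_wo -` vec_wo ` A)"
    by (subst emeasure_distr) auto
  then show ?thesis
    by (simp add: distr_vec_wo inj_vimage_image_eq inj_vec_wo)
qed

text \<open>In the Leibniz formula, conjugation by the bijection \<open>of_wo\<close> is a
  sign-preserving bijection between the permutations that index the two sums.\<close>

lemma det_wo:
  fixes A :: "real^'a^'a::finite"
  shows "det (\<chi> i j. A $ of_wo i $ of_wo j) = det A"
proof -
  have *: "map_permutation UNIV of_wo p permutes UNIV" if "p permutes UNIV" for p :: "'a wo \<Rightarrow> 'a wo"
    using map_permutation_permutes[OF bij_of_wo that] .
  have **: "map_permutation UNIV to_wo p permutes UNIV" if "p permutes UNIV" for p :: "'a \<Rightarrow> 'a"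
    using map_permutation_permutes[OF bij_to_wo that] .
  have "(\<Sum>p | p permutes UNIV. of_int (sign p) * (\<Prod>i\<in>UNIV. A $ of_wo i $ of_wo (p i))) =
     (\<Sum>p | p permutes UNIV. of_int (sign p) * (\<Prod>i\<in>UNIV. A $ i $ p i))"
  proof (rule sum.reindex_bij_witness[of _ "map_permutation UNIV to_wo" "map_permutation UNIV of_wo"],
      goal_cases)
    case (1 p) then show ?case by (auto intro: map_permutation_compose_inv[OF bij_of_wo])
  next
    case (2 p) then show ?case using * by auto
  next
    case (3 p) then show ?case by (auto intro: map_permutation_compose_inv[OF bij_to_wo])
  next
    case (4 p) then show ?case using ** by auto
  next
    case (5 p)
    then have "(\<Prod>i\<in>UNIV. A $ i $ map_permutation UNIV of_wo p i) = (\<Prod>i\<in>UNIV. A $ of_wo i $ of_wo (p i))"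
      by (subst prod.reindex_bij_betw[OF bij_of_wo, symmetric])
        (simp add: map_permutation_apply bij_of_wo[THEN bij_is_inj])
    then show ?case
      using 5 by (simp add: sign_map_permutation bij_of_wo[THEN bij_is_inj])
  qed
  then show ?thesis
    by (simp add: det_def)
qed

lemma det_matrix_wo:
  fixes L :: "real^'a \<Rightarrow> real^'a::finite"
  shows "det (matrix (vec_wo \<circ> L \<circ> unvec_wo)) = det (matrix L)"
proof -
  have "unvec_wo (axis j 1) = axis (of_wo j) 1" for j :: "'a wo"
    unfolding unvec_wo_def axis_def vec_eq_iff by auto
  then have "matrix (vec_wo \<circ> L \<circ> unvec_wo) = (\<chi> i j. matrix L $ of_wo i $ of_wo j)"
    by (simp add: matrix_def vec_wo_def)
  then show ?thesis by (simp add: det_wo)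
qed

text \<open>\<open>has_measure_differentiable_image\<close> couples finiteness of the image with
  integrability of the Jacobian. The nonnegative integral also covers images of infinite
  measure.\<close>

lemma emeasure_lborel_image_wellorder:
  fixes T :: "real^'n::{finite,wellorder} \<Rightarrow> real^'n::_"
  assumes A: "A \<in> sets borel" and TA: "T ` A \<in> sets borel" and inj: "inj_on T A"
    and T': "\<And>z. z \<in> A \<Longrightarrow> (T has_derivative T' z) (at z)"
    and meas: "(\<lambda>z. indicator A z * \<bar>det (matrix (T' z))\<bar>) \<in> borel_measurable borel"
  shows "emeasure lborel (T ` A) = (\<integral>\<^sup>+z\<in>A. ennreal \<bar>det (matrix (T' z))\<bar> \<partial>lborel)"
proof -
  let ?d = "\<lambda>z. \<bar>det (matrix (T' z))\<bar>"
  have AL: "A \<in> sets lebesgue" using A by simp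
  note * = has_measure_differentiable_image[OF AL has_derivative_at_withinI[OF T'] inj]
  have eq: "(\<integral>\<^sup>+z\<in>A. ennreal (?d z) \<partial>lborel) = (\<integral>\<^sup>+z. ennreal (indicator A z * ?d z) \<partial>lborel)"
    by (intro nn_integral_cong) (auto simp: indicator_def)
  show ?thesis
  proof (cases "emeasure lborel (T ` A) < \<infinity>")
    case True
    then have TAl: "T ` A \<in> lmeasurable"
      using TA by (auto simp: fmeasurable_def)
    then have "(?d has_integral measure lebesgue (T ` A)) A"
      using * by blast
    then have "(\<integral>\<^sup>+z\<in>A. ennreal (?d z) \<partial>lborel) = ennreal (measure lebesgue (T ` A))"
      by (intro nn_integral_has_integral_lebesgue') auto
    moreover have "emeasure lborel (T ` A) = emeasure lebesgue (T ` A)"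
      using TA by simp
    ultimately show ?thesis
      using emeasure_eq_measure2[OF TAl] by metis
  next
    \<comment> \<open>A finite integral would make the Jacobian integrable on \<open>A\<close>, and
      the image would then have finite measure.\<close>
    case False
    have "(\<integral>\<^sup>+z. ennreal (indicator A z * ?d z) \<partial>lborel) = \<infinity>"
    proof (rule ccontr)
      assume "(\<integral>\<^sup>+z. ennreal (indicator A z * ?d z) \<partial>lborel) \<noteq> \<infinity>"
      then obtain r where "0 \<le> r" "(\<integral>\<^sup>+z. ennreal (indicator A z * ?d z) \<partial>lborel) = ennreal r"
        by (cases "(\<integral>\<^sup>+z. ennreal (indicator A z * ?d z) \<partial>lborel)" rule: ennreal_cases) auto
      then have "((\<lambda>z. indicator A z * ?d z) has_integral r) UNIV"
        using meas by (intro nn_integral_has_integral) (auto simp: indicator_def)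
      then have "((\<lambda>z. if z \<in> A then ?d z else 0) has_integral r) UNIV"
        by (rule has_integral_cong[THEN iffD1, rotated]) (auto simp: indicator_def)
      then have "(?d has_integral r) A"
        by (simp add: has_integral_restrict_UNIV)
      then have "T ` A \<in> lmeasurable" using * by blast
      then show False using False TA by (auto simp: fmeasurable_def)
    qed
    with False eq show ?thesis
      by (simp add: less_top[symmetric])
  qed
qed

text \<open>Conjugation with the relabelling \<open>vec_wo\<close> reduces this to a well-ordered
  index type; neither measures nor determinants change under it.\<close>

lemma emeasure_lborel_image:
  fixes T :: "real^'a \<Rightarrow> real^'a::finite"
  assumes A: "A \<in> sets borel" and TA: "T ` A \<in> sets borel" and inj: "inj_on T A"
    and T': "\<And>z. z \<in> A \<Longrightarrow> (T has_derivative T' z) (at z)"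
    and meas: "(\<lambda>z. indicator A z * \<bar>det (matrix (T' z))\<bar>) \<in> borel_measurable borel"
  shows "emeasure lborel (T ` A) = (\<integral>\<^sup>+z\<in>A. ennreal \<bar>det (matrix (T' z))\<bar> \<partial>lborel)"
proof -
  let ?S = "vec_wo \<circ> T \<circ> unvec_wo" and ?S' = "\<lambda>w. vec_wo \<circ> T' (unvec_wo w) \<circ> unvec_wo"
  let ?B = "vec_wo ` A"
  have img: "?S ` ?B = vec_wo ` (T ` A)" by (auto simp: image_comp)
  have B: "?B \<in> sets borel" and SB: "?S ` ?B \<in> sets borel"
    unfolding img unfolding image_vec_wo
    using measurable_sets[OF measurable_unvec_wo A] measurable_sets[OF measurable_unvec_wo TA] by auto
  have iB: "indicator ?B w = indicator A (unvec_wo w)" for w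
    by (auto simp: indicator_def image_vec_wo)
  have "emeasure lborel (T ` A) = emeasure lborel (?S ` ?B)"
    unfolding img by (rule emeasure_vec_wo_image[symmetric, OF TA])
  also have "\<dots> = (\<integral>\<^sup>+w\<in>?B. ennreal \<bar>det (matrix (?S' w))\<bar> \<partial>lborel)"
  proof (rule emeasure_lborel_image_wellorder[OF B SB])
    show "inj_on ?S ?B"
      by (intro comp_inj_on) (simp_all add: inj image_image inj_on_subset[OF inj_vec_wo]
          inj_on_subset[OF inj_unvec_wo])
    show "(?S has_derivative ?S' w) (at w)" if w: "w \<in> ?B" for w
    proof -
      have "(T has_derivative T' (unvec_wo w)) (at (unvec_wo w))"
        using w by (intro T') auto
      from diff_chain_at[OF diff_chain_at[OF
          bounded_linear_imp_has_derivative[OF bounded_linear_unvec_wo] this]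
          bounded_linear_imp_has_derivative[OF bounded_linear_vec_wo]]
      show ?thesis by (simp add: o_assoc)
    qed
    show "(\<lambda>w. indicator ?B w * \<bar>det (matrix (?S' w))\<bar>) \<in> borel_measurable borel"
      using measurable_compose[OF measurable_unvec_wo meas] by (simp add: iB det_matrix_wo)
  qed
  also have "\<dots> = (\<integral>\<^sup>+w. ennreal (indicator A (unvec_wo w) * \<bar>det (matrix (T' (unvec_wo w)))\<bar>)
      \<partial>distr lborel borel vec_wo)"
    unfolding distr_vec_wo
    by (intro nn_integral_cong) (auto simp: det_matrix_wo indicator_def image_vec_wo)
  also have "\<dots> = (\<integral>\<^sup>+z. ennreal (indicator A z * \<bar>det (matrix (T' z))\<bar>) \<partial>lborel)"
    using measurable_compose[OF measurable_unvec_wo meas]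
    by (subst nn_integral_distr) auto
  also have "\<dots> = (\<integral>\<^sup>+z\<in>A. ennreal \<bar>det (matrix (T' z))\<bar> \<partial>lborel)"
    by (intro nn_integral_cong) (auto simp: indicator_def)
  finally show ?thesis .
qed

section \<open>A divergence inequality for compactly supported fields\<close>

text \<open>The derivative of \<open>det (mat 1 + s *\<^sub>R A)\<close> in \<open>s\<close>, by the
  product rule in the Leibniz formula. The explicit polynomial makes joint continuity in
  \<open>A\<close> and \<open>s\<close> evident.\<close>

definition det_line_deriv :: "real^'n^'n \<Rightarrow> real \<Rightarrow> real" where
  "det_line_deriv A s = (\<Sum>p | p permutes (UNIV :: 'n::finite set). of_int (sign p) *
     (\<Sum>i\<in>UNIV. A $ i $ p i * (\<Prod>j\<in>UNIV - {i}. (mat 1 + s *\<^sub>R A) $ j $ p j)))"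

lemma has_field_derivative_det_line:
  "((\<lambda>s. det (mat 1 + s *\<^sub>R A)) has_field_derivative det_line_deriv A s) (at s)"
  unfolding det_def det_line_deriv_def
  by (intro DERIV_sum DERIV_cmult has_field_derivative_prod) (auto intro!: derivative_eq_intros)

lemma det_line_deriv_0: "det_line_deriv A 0 = trace A" for A :: "real^'n^'n::finite"
proof -
  have "(\<Sum>i\<in>UNIV. A $ i $ p i * (\<Prod>j\<in>UNIV - {i}. (mat 1 :: real^'n^'n) $ j $ p j)) =
      (if p = id then trace A else 0)" if p: "p permutes (UNIV :: 'n set)" for p
  proof (cases "p = id")
    case True
    then show ?thesis by (simp add: mat_def trace_def)
  next
    case False
    \<comment> \<open>A permutation that fixes every point except possibly \<open>i\<close> also
      fixes \<open>i\<close>. So a permutation other than \<open>id\<close> still meets an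
      off-diagonal zero after row \<open>i\<close> is left out.\<close>
    have "\<exists>j\<in>UNIV - {i}. p j \<noteq> j" for i :: 'n
    proof (rule ccontr)
      assume "\<not> (\<exists>j\<in>UNIV - {i}. p j \<noteq> j)"
      then have "p j = j" if "j \<noteq> i" for j using that by auto
      then have "p = id"
        using permutes_inj[OF p] by (metis (no_types) eq_id_iff injD)
      with False show False by simp
    qed
    then have "\<exists>j\<in>UNIV - {i}. j \<noteq> p j" for i :: 'n by metis
    then have 0: "(\<Prod>j\<in>UNIV - {i}. (mat 1 :: real^'n^'n) $ j $ p j) = 0" for i :: 'n
      by (intro prod_zero) (auto simp: mat_def)
    from False show ?thesis unfolding 0 by simp
  qed
  then have "det_line_deriv A 0 =
      (\<Sum>p | p permutes (UNIV :: 'n set). of_int (sign p) * (if p = id then trace A else 0))"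
    unfolding det_line_deriv_def by (intro sum.cong) auto
  also have "\<dots> = (\<Sum>p\<in>{id :: 'n \<Rightarrow> 'n}. trace A)"
    by (rule sum.mono_neutral_cong_right) (auto simp: permutes_id finite_permutations)
  finally show ?thesis by simp
qed

text \<open>Mean value theorem in the line parameter, the derivative being bounded on the compact
  set \<open>C \<times> {0..1}\<close>. Uniformity in \<open>A\<close> later gives a positive
  Jacobian and an integrable majorant for its difference quotient.\<close>

lemma det_line_bound:
  fixes C :: "(real^'n^'n::finite) set"
  assumes "compact C"
  obtains B where "B > 0" "\<And>A h. A \<in> C \<Longrightarrow> 0 \<le> h \<Longrightarrow> h \<le> 1 \<Longrightarrow> \<bar>det (mat 1 + h *\<^sub>R A) - 1\<bar> \<le> B * h"
proof -
  have "continuous_on (C \<times> {0..1}) (\<lambda>x. det_line_deriv (fst x) (snd x))"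
    unfolding det_line_deriv_def by (intro continuous_intros)
  then have "compact ((\<lambda>x. det_line_deriv (fst x) (snd x)) ` (C \<times> {0..1}))"
    by (intro compact_continuous_image compact_Times assms) auto
  then obtain B where B: "B > 0" "\<And>y. y \<in> (\<lambda>x. det_line_deriv (fst x) (snd x)) ` (C \<times> {0..1}) \<Longrightarrow> norm y \<le> B"
    by (meson bounded_pos compact_imp_bounded)
  have "\<bar>det (mat 1 + h *\<^sub>R A) - 1\<bar> \<le> B * h" if A: "A \<in> C" and h: "0 \<le> h" "h \<le> 1" for A h
  proof -
    have "norm (det (mat 1 + h *\<^sub>R A) - det (mat 1 + 0 *\<^sub>R A)) \<le> B * norm (h - 0)"
    proof (rule field_differentiable_bound[where S = "{0..h}"])
      show "((\<lambda>s. det (mat 1 + s *\<^sub>R A)) has_field_derivative det_line_deriv A s) (at s within {0..h})" for s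
        using has_field_derivative_det_line has_field_derivative_at_within by blast
      show "norm (det_line_deriv A s) \<le> B" if "s \<in> {0..h}" for s
        using that A h by (intro B(2)) force
    qed (use h in auto)
    then show ?thesis using h by simp
  qed
  with B(1) that show thesis by blast
qed

text \<open>For small \<open>h\<close> the map \<open>z \<mapsto> z + h X z\<close> is a bijection of \<open>K\<close> with Jacobian
  \<open>1 + h div X + O(h\<^sup>2)\<close>; comparing \<open>\<integral> \<psi>\<close> before and after gives the claim without
  differentiating \<open>\<psi>\<close>.\<close>

lemma divergence_inequality:
  fixes X :: "real^'m \<Rightarrow> real^'m::finite" and \<psi> l :: "real^'m \<Rightarrow> real"
  assumes X': "\<And>z. (X has_derivative X' z) (at z)"
    and contX': "\<And>v. continuous_on UNIV (\<lambda>z. X' z v)"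
    and K: "compact K" "\<And>z. z \<notin> K \<Longrightarrow> X z = 0"
    and \<psi>: "continuous_on K \<psi>" and l: "continuous_on K l"
    and step: "\<And>\<epsilon>. \<epsilon> > 0 \<Longrightarrow> \<forall>\<^sub>F h in at_right 0. \<forall>z\<in>K. \<psi> z - \<psi> (z + h *\<^sub>R X z) \<le> h * (l z + \<epsilon>)"
  shows "(LINT z:K|lborel. \<psi> z * trace (matrix (X' z))) \<le> (LINT z:K|lborel. l z)"
proof -
  have Kb [measurable]: "K \<in> sets borel"
    using K(1) by (simp add: borel_compact)
  have Kfin: "emeasure lborel K < \<infinity>"
    using emeasure_bounded_finite[OF compact_imp_bounded[OF K(1)]] by simp
  have contX: "continuous_on S X" for S
    by (rule has_derivative_continuous_on[OF has_derivative_at_withinI[OF X']])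
  have contM: "continuous_on S (\<lambda>z. matrix (X' z))" for S
    unfolding matrix_def
    by (intro continuous_on_vec_lambda continuous_on_component continuous_on_subset[OF contX']) auto
  have X'0: "X' z = (\<lambda>v. 0)" if "z \<notin> K" for z
  proof -
    have "(X has_derivative (\<lambda>v. 0)) (at z)"
      by (rule has_derivative_transform_within_open[where s = "- K" and f = "\<lambda>z. 0"])
        (use that K in \<open>auto simp: compact_imp_closed open_Compl\<close>)
    then show ?thesis using X' has_derivative_unique by blast
  qed
  have blX': "bounded_linear (X' z)" for z
    using X' has_derivative_bounded_linear by blast
  \<comment> \<open>The finitely many columns of the derivative are bounded on \<open>K\<close>, and
    off \<open>K\<close> the derivative vanishes. \<open>B\<close> becomes the Lipschitz constant of
    \<open>X\<close>.\<close>
  obtain B where B: "B > 0" "\<And>z v. norm (X' z v) \<le> B * norm v"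
  proof -
    have "bounded ((\<lambda>z. X' z (axis i 1)) ` K)" for i
      by (intro compact_imp_bounded compact_continuous_image continuous_on_subset[OF contX'] K) auto
    then have "\<exists>b>0. \<forall>z\<in>K. norm (X' z (axis i 1)) \<le> b" for i
      by (simp add: bounded_pos)
    then obtain b where b: "\<And>i. b i > 0" "\<And>i z. z \<in> K \<Longrightarrow> norm (X' z (axis i 1)) \<le> b i"
      by metis
    have "norm (X' z v) \<le> (\<Sum>i\<in>UNIV. b i) * norm v" if z: "z \<in> K" for z v
    proof -
      have "X' z v = X' z (\<Sum>i\<in>UNIV. v $ i *\<^sub>R axis i 1)"
        by (simp add: basis_expansion scalar_mult_eq_scaleR[symmetric])
      also have "\<dots> = (\<Sum>i\<in>UNIV. v $ i *\<^sub>R X' z (axis i 1))"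
        using blX'[of z] by (simp add: linear_sum linear_cmul bounded_linear.linear)
      also have "norm \<dots> \<le> (\<Sum>i\<in>UNIV. b i * norm v)"
        by (rule sum_norm_le)
          (use b z component_le_norm_cart[of v] in \<open>auto simp: mult.commute[of "b _"] intro!: mult_mono\<close>)
      finally show ?thesis by (simp add: sum_distrib_right)
    qed
    moreover have "(\<Sum>i\<in>UNIV. b i) > 0" by (intro sum_pos b) auto
    ultimately show thesis
      using X'0 that[of "\<Sum>i\<in>UNIV. b i"] by (metis norm_ge_zero mult_nonneg_nonneg less_imp_le norm_zero)
  qed
  have lip: "norm (X z - X w) \<le> B * norm (z - w)" for z w
    by (rule differentiable_bound[of UNIV X X'])
      (use X' B in \<open>auto intro!: onorm_le has_derivative_at_withinI\<close>)
  define T where "T h z = z + h *\<^sub>R X z" for h z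
  define J where "J h z = mat 1 + h *\<^sub>R matrix (X' z)" for h z
  have T': "(T h has_derivative (\<lambda>v. v + h *\<^sub>R X' z v)) (at z)" for h z
    unfolding T_def by (intro derivative_intros X')
  have matT: "matrix (\<lambda>v. v + h *\<^sub>R X' z v) = J h z" for h z
    by (auto simp: matrix_def J_def vec_eq_iff mat_def axis_def)
  have "compact ((\<lambda>z. matrix (X' z)) ` K)"
    by (intro compact_continuous_image contM K)
  then obtain D where D: "D > 0"
    "\<And>A h. A \<in> (\<lambda>z. matrix (X' z)) ` K \<Longrightarrow> 0 \<le> h \<Longrightarrow> h \<le> 1 \<Longrightarrow> \<bar>det (mat 1 + h *\<^sub>R A) - 1\<bar> \<le> D * h"
    using det_line_bound by blast
  obtain M where M: "M > 0" "\<And>z. z \<in> K \<Longrightarrow> \<bar>\<psi> z\<bar> \<le> M"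
    using compact_imp_bounded[OF compact_continuous_image[OF \<psi> K(1)]] unfolding bounded_pos by auto
  \<comment> \<open>For \<open>h * B < 1\<close> the field \<open>h X\<close> is a contraction: this
    gives injectivity, and Banach's fixed point theorem solves \<open>T h z = w\<close>. Points
    outside \<open>K\<close> are fixed, so injectivity forces \<open>T h\<close> to preserve
    \<open>K\<close>.\<close>
  have bij: "bij (T h)" and TK: "T h z \<in> K \<longleftrightarrow> z \<in> K" if h: "0 < h" "h * B < 1" for h z
  proof -
    have inj: "inj (T h)"
    proof (rule injI)
      fix z w assume "T h z = T h w"
      then have "z - w = h *\<^sub>R (X w - X z)" by (simp add: T_def algebra_simps)
      then have "norm (z - w) = h * norm (X w - X z)" using h by simp
      also have "\<dots> \<le> h * (B * norm (z - w))"
        using lip[of w z] h by (simp add: norm_minus_commute)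
      finally have "(1 - h * B) * norm (z - w) \<le> 0" by (simp add: algebra_simps)
      then show "z = w" using h by (simp add: mult_le_0_iff)
    qed
    have "\<exists>z. T h z = w" for w
    proof -
      have "\<exists>!z. w - h *\<^sub>R X z = z"
      proof (rule banach_fix_type[of "h * B"])
        show "\<forall>x y. dist (w - h *\<^sub>R X x) (w - h *\<^sub>R X y) \<le> h * B * dist x y"
        proof (intro allI)
          fix x y
          have "dist (w - h *\<^sub>R X x) (w - h *\<^sub>R X y) = h * norm (X y - X x)"
            using h by (simp add: dist_norm scaleR_diff_right[symmetric] del: scaleR_diff_right)
          also have "\<dots> \<le> h * (B * norm (x - y))"
            using lip[of y x] h by (simp add: norm_minus_commute)
          finally show "dist (w - h *\<^sub>R X x) (w - h *\<^sub>R X y) \<le> h * B * dist x y"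
            by (simp add: dist_norm mult.assoc)
        qed
      qed (use h B in auto)
      then show ?thesis unfolding T_def by (metis add.commute diff_add_cancel)
    qed
    with inj show "bij (T h)" by (metis bijI surjI)
    show "T h z \<in> K \<longleftrightarrow> z \<in> K"
    proof
      assume "T h z \<in> K"
      then show "z \<in> K" using K(2)[of z] by (cases "z \<in> K") (auto simp: T_def)
    next
      assume "z \<in> K"
      show "T h z \<in> K"
      proof (rule ccontr)
        assume "T h z \<notin> K"
        then have "T h (T h z) = T h z" using K(2) by (simp add: T_def[of h "T h z"])
        then have "T h z = z" using inj by (metis injD)
        with \<open>T h z \<notin> K\<close> \<open>z \<in> K\<close> show False by simp
      qed
    qed
  qed
  have Tm [measurable]: "T h \<in> borel_measurable borel" for h
    unfolding T_def by (intro borel_measurable_continuous_onI continuous_intros contX)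
  have Jm [measurable]: "(\<lambda>z. det (J h z)) \<in> borel_measurable borel" for h
    unfolding J_def det_def by (intro borel_measurable_continuous_onI continuous_intros contM)
  have \<psi>m [measurable]: "(\<lambda>z. indicator K z *\<^sub>R \<psi> z) \<in> borel_measurable borel"
    using \<psi> Kb by (intro borel_measurable_continuous_on_indicator) auto
  have cov: "(LINT z|lborel. indicator K z *\<^sub>R \<psi> z) =
      (LINT z|lborel. indicator K z *\<^sub>R (\<psi> (T h z) * \<bar>det (J h z)\<bar>))" if h: "0 < h" "h * B < 1" for h
  proof -
    \<comment> \<open>\<open>T h\<close> pushes the measure whose density is its Jacobian to
      Lebesgue measure. Stated for measures, this transforms integrals of functions of either
      sign.\<close>
    have "lborel = distr (density lborel (\<lambda>z. ennreal \<bar>det (J h z)\<bar>)) borel (T h)"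
    proof (rule measure_eqI)
      fix A :: "(real^'m) set" assume "A \<in> sets lborel"
      then have A [measurable]: "A \<in> sets borel" by simp
      have TA: "T h ` (T h -` A) = A"
        using bij[OF h] by (simp add: bij_is_surj surj_image_vimage_eq)
      have A' [measurable]: "T h -` A \<in> sets borel"
        using measurable_sets[OF Tm A] by simp
      have "emeasure lborel (T h ` (T h -` A)) =
          (\<integral>\<^sup>+z\<in>T h -` A. ennreal \<bar>det (matrix (\<lambda>v. v + h *\<^sub>R X' z v))\<bar> \<partial>lborel)"
      proof (rule emeasure_lborel_image[OF A' _ _ T'])
        show "T h ` (T h -` A) \<in> sets borel" unfolding TA by (rule A)
        show "inj_on (T h) (T h -` A)" by (rule inj_on_subset[OF bij_is_inj[OF bij[OF h]] subset_UNIV])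
      qed (simp add: matT)
      then show "emeasure lborel A = emeasure (distr (density lborel (\<lambda>z. ennreal \<bar>det (J h z)\<bar>)) borel (T h)) A"
        unfolding TA by (simp add: emeasure_distr emeasure_density matT)
    qed simp
    then have "(LINT z|lborel. indicator K z *\<^sub>R \<psi> z) =
        (LINT z|distr (density lborel (\<lambda>z. ennreal \<bar>det (J h z)\<bar>)) borel (T h). indicator K z *\<^sub>R \<psi> z)"
      by simp
    also have "\<dots> = (LINT z|density lborel (\<lambda>z. ennreal \<bar>det (J h z)\<bar>). indicator K (T h z) *\<^sub>R \<psi> (T h z))"
      by (rule integral_distr) (use \<psi>m in simp_all)
    also have "\<dots> = (LINT z|lborel. \<bar>det (J h z)\<bar> *\<^sub>R (indicator K (T h z) *\<^sub>R \<psi> (T h z)))"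
      by (subst integral_density) (use measurable_compose[OF Tm \<psi>m] in auto)
    also have "\<dots> = (LINT z|lborel. indicator K z *\<^sub>R (\<psi> (T h z) * \<bar>det (J h z)\<bar>))"
      by (intro Bochner_Integration.integral_cong) (auto simp: indicator_def TK[OF h])
    finally show ?thesis .
  qed
  have le: "(LINT z:K|lborel. \<psi> z * trace (matrix (X' z))) \<le>
      (LINT z:K|lborel. l z) + \<epsilon> * measure lborel K" if \<epsilon>: "\<epsilon> > 0" for \<epsilon>
  proof -
    obtain \<delta> where \<delta>: "\<delta> > 0" "\<And>h z. 0 < h \<Longrightarrow> h < \<delta> \<Longrightarrow> z \<in> K \<Longrightarrow> \<psi> z - \<psi> (T h z) \<le> h * (l z + \<epsilon>)"
      using step[OF \<epsilon>] unfolding eventually_at_right_field T_def by auto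
    \<comment> \<open>The four entries secure the step estimate, the determinant bound, bijectivity
      of \<open>T h\<close> and, through \<open>D * h < 1\<close>, a positive Jacobian, which
      removes the absolute value.\<close>
    define \<eta> where "\<eta> = Min {\<delta>, 1, 1 / B, 1 / D}"
    have \<eta>: "\<eta> > 0" using \<delta> B D by (simp add: \<eta>_def)
    have small: "h < \<delta>" "h \<le> 1" "h * B < 1" "D * h < 1" if "h < \<eta>" for h
      using that B D by (auto simp: \<eta>_def field_simps)
    define q where "q h z = (\<bar>det (J h z)\<bar> - 1) / h" for h z
    have q: "\<bar>q h z\<bar> \<le> D" "q h z = (det (J h z) - 1) / h" if "0 < h" "h < \<eta>" "z \<in> K" for h z
    proof -
      have *: "\<bar>det (J h z) - 1\<bar> \<le> D * h"
        unfolding J_def using that small[of h] by (intro D(2)) auto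
      then have "det (J h z) > 0" using small[of h] that by linarith
      then show 2: "q h z = (det (J h z) - 1) / h" by (simp add: q_def)
      show "\<bar>q h z\<bar> \<le> D" unfolding 2 using * that by (simp add: field_simps)
    qed
    have intq: "integrable lborel (\<lambda>z. indicator K z *\<^sub>R (\<psi> (T h z) * q h z))"
      if h: "0 < h" "h < \<eta>" for h
    proof (rule integrableI_bounded_set[where A = K and B = "M * D"])
      have "(\<lambda>z. (indicator K (T h z) *\<^sub>R \<psi> (T h z)) * q h z) \<in> borel_measurable lborel"
        using measurable_compose[OF Tm \<psi>m] unfolding q_def by simp
      then show "(\<lambda>z. indicator K z *\<^sub>R (\<psi> (T h z) * q h z)) \<in> borel_measurable lborel"
        by (rule measurable_cong[THEN iffD1, rotated]) (use h small in \<open>auto simp: indicator_def TK\<close>)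
      show "AE z in lborel. z \<in> K \<longrightarrow> norm (indicator K z *\<^sub>R (\<psi> (T h z) * q h z)) \<le> M * D"
        using h small[of h] q(1)[OF h] M by (intro AE_I2) (auto simp: abs_mult TK intro!: mult_mono)
    qed (use Kfin in auto)
    have int\<psi>: "integrable lborel (\<lambda>z. indicator K z *\<^sub>R \<psi> z)"
      and intl: "integrable lborel (\<lambda>z. indicator K z *\<^sub>R l z)"
      by (rule borel_integrable_compact[OF K(1)], fact)+
    have intc: "integrable lborel (\<lambda>z. indicator K z *\<^sub>R \<epsilon>)"
      using Kfin by simp
    \<comment> \<open>Writing the Jacobian in \<open>cov\<close> as \<open>1 + h * q h z\<close>
      exhibits \<open>h\<close> times the integral of \<open>\<psi> (T h z) * q h z\<close> as the
      total loss of \<open>\<psi>\<close> along the step, and \<open>step\<close> bounds that loss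
      pointwise.\<close>
    have upper: "(LINT z|lborel. indicator K z *\<^sub>R (\<psi> (T h z) * q h z)) \<le>
        (LINT z|lborel. indicator K z *\<^sub>R l z) + \<epsilon> * measure lborel K" if h: "0 < h" "h < \<eta>" for h
    proof -
      have m1: "(\<lambda>z. indicator K z *\<^sub>R \<psi> (T h z)) \<in> borel_measurable lborel"
        using measurable_compose[OF Tm[of h] \<psi>m] h small[of h] by (simp add: indicator_def TK)
      have int1: "integrable lborel (\<lambda>z. indicator K z *\<^sub>R \<psi> (T h z))"
        by (rule integrableI_bounded_set[where A = K and B = M])
          (use Kfin m1 M h small in \<open>auto simp: TK\<close>)
      have "(LINT z|lborel. indicator K z *\<^sub>R \<psi> z) =
         (LINT z|lborel. indicator K z *\<^sub>R \<psi> (T h z) + h * (indicator K z *\<^sub>R (\<psi> (T h z) * q h z)))"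
        using h small[of h] by (subst cov) (auto intro!: Bochner_Integration.integral_cong simp: q_def field_simps indicator_def)
      also have "\<dots> = (LINT z|lborel. indicator K z *\<^sub>R \<psi> (T h z)) + h * (LINT z|lborel. indicator K z *\<^sub>R (\<psi> (T h z) * q h z))"
        using intq[OF h] int1 by simp
      finally have "h * (LINT z|lborel. indicator K z *\<^sub>R (\<psi> (T h z) * q h z)) =
          (LINT z|lborel. indicator K z *\<^sub>R \<psi> z - indicator K z *\<^sub>R \<psi> (T h z))"
        using int1 int\<psi> by simp
      also have "\<dots> \<le> (LINT z|lborel. h * (indicator K z *\<^sub>R l z + indicator K z *\<^sub>R \<epsilon>))"
        by (intro integral_mono Bochner_Integration.integrable_diff integrable_mult_right
              Bochner_Integration.integrable_add int1 int\<psi> intl intc)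
          (use \<delta>(2) h small in \<open>auto simp: indicator_def\<close>)
      also have "\<dots> = h * ((LINT z|lborel. indicator K z *\<^sub>R l z) + \<epsilon> * measure lborel K)"
        using intl intc by simp
      finally show ?thesis using h by simp
    qed
    \<comment> \<open>The \<open>+ 2\<close> keeps \<open>h n\<close> strictly below
      \<open>\<eta>\<close> even for \<open>n = 0\<close>.\<close>
    define h where "h n = \<eta> / (real n + 2)" for n :: nat
    have h: "0 < h n" "h n < \<eta>" for n
      using \<eta> by (auto simp: h_def field_simps intro: add_pos_nonneg)
    have h0: "h \<longlonglongrightarrow> 0"
      unfolding h_def by real_asymp
    have h0': "filterlim h (at 0) sequentially"
      using h0 h by (auto simp: filterlim_at intro!: always_eventually) (metis less_irrefl)
    \<comment> \<open>Dominated convergence with majorant \<open>M * D\<close> on \<open>K\<close>: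
      the quotient \<open>q\<close> tends to the trace, the derivative of the determinant at the
      identity.\<close>
    have "(\<lambda>n. LINT z|lborel. indicator K z *\<^sub>R (\<psi> (T (h n) z) * q (h n) z))
        \<longlonglongrightarrow> (LINT z|lborel. indicator K z *\<^sub>R (\<psi> z * trace (matrix (X' z))))"
    proof (rule integral_dominated_convergence[where w = "\<lambda>z. indicator K z *\<^sub>R (M * D)"])
      show "integrable lborel (\<lambda>z. indicator K z *\<^sub>R (M * D))" using Kfin by simp
      show "AE z in lborel. (\<lambda>n. indicator K z *\<^sub>R (\<psi> (T (h n) z) * q (h n) z))
          \<longlonglongrightarrow> indicator K z *\<^sub>R (\<psi> z * trace (matrix (X' z)))"
      proof (rule AE_I2)
        fix z
        show "(\<lambda>n. indicator K z *\<^sub>R (\<psi> (T (h n) z) * q (h n) z))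
          \<longlonglongrightarrow> indicator K z *\<^sub>R (\<psi> z * trace (matrix (X' z)))"
        proof (cases "z \<in> K")
          case True
          have "(\<lambda>n. T (h n) z) \<longlonglongrightarrow> z + 0 *\<^sub>R X z"
            unfolding T_def by (intro tendsto_intros h0)
          then have "(\<lambda>n. T (h n) z) \<longlonglongrightarrow> z" by simp
          moreover have "T (h n) z \<in> K" for n
            using TK[of "h n" z] True h small by auto
          ultimately have 1: "(\<lambda>n. \<psi> (T (h n) z)) \<longlonglongrightarrow> \<psi> z"
            using \<psi> True unfolding continuous_on_sequentially by (auto simp: o_def)
          have "((\<lambda>s. (det (J s z) - 1) / s) \<longlongrightarrow> trace (matrix (X' z))) (at 0)"
            using has_field_derivative_det_line[of "matrix (X' z)" 0]
            by (simp add: has_field_derivative_iff det_line_deriv_0 J_def)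
          from filterlim_compose[OF this h0'] have "(\<lambda>n. q (h n) z) \<longlonglongrightarrow> trace (matrix (X' z))"
            using q(2)[OF h True] by simp
          with 1 show ?thesis by (intro tendsto_intros)
        qed simp
      qed
      show "AE z in lborel. norm (indicator K z *\<^sub>R (\<psi> (T (h n) z) * q (h n) z)) \<le> indicator K z *\<^sub>R (M * D)" for n
        using q(1)[OF h] M small[of "h n"] h[of n]
        by (intro AE_I2) (auto simp: indicator_def abs_mult TK intro!: mult_mono)
      show "(\<lambda>z. indicator K z *\<^sub>R (\<psi> (T (h n) z) * q (h n) z)) \<in> borel_measurable lborel" for n
        by (rule borel_measurable_integrable[OF intq[OF h]])
      have "continuous_on K (\<lambda>z. \<psi> z * trace (matrix (X' z)))"
        unfolding trace_def by (intro continuous_intros \<psi> contM)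
      then show "(\<lambda>z. indicator K z *\<^sub>R (\<psi> z * trace (matrix (X' z)))) \<in> borel_measurable lborel"
        using borel_measurable_continuous_on_indicator[OF Kb, of "\<lambda>z. \<psi> z * trace (matrix (X' z))"]
        by simp
    qed
    from LIMSEQ_le_const2[OF this] upper[OF h] show ?thesis
      unfolding set_lebesgue_integral_def by blast
  qed
  show ?thesis
  proof (rule field_le_epsilon)
    fix e :: real assume "e > 0"
    \<comment> \<open>The summand 1 in the denominator covers a null set \<open>K\<close>.\<close>
    then have "(LINT z:K|lborel. \<psi> z * trace (matrix (X' z))) \<le>
      (LINT z:K|lborel. l z) + e / (measure lborel K + 1) * measure lborel K"
      by (intro le) (simp add: add_nonneg_pos)
    also have "e / (measure lborel K + 1) * measure lborel K \<le> e"
      using \<open>e > 0\<close> measure_nonneg[of lborel K] add_nonneg_pos[of "measure lborel K" 1]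
      by (simp add: divide_le_eq)
    finally show "(LINT z:K|lborel. \<psi> z * trace (matrix (X' z))) \<le> (LINT z:K|lborel. l z) + e" by simp
  qed
qed

section \<open>Inner products on coordinate space\<close>

lemma inner_productD:
  assumes "inner_product B"
  shows "bilinear B" "B u v = B v u" "u \<noteq> 0 \<Longrightarrow> B u u > 0" "B u u \<ge> 0" "B 0 v = 0" "B u 0 = 0"
proof -
  show 1: "bilinear B" "B u v = B v u" "u \<noteq> 0 \<Longrightarrow> B u u > 0"
    using assms by (auto simp: inner_product_def)
  show 2: "B 0 v = 0" "B u 0 = 0"
    using 1 by (auto simp: bilinear_lzero bilinear_rzero)
  show "B u u \<ge> 0"
    using 1 2 by (cases "u = 0") (auto simp: bilinear_lzero less_imp_le)
qed

lemmas bilinear_simps = bilinear_ladd bilinear_radd bilinear_lmul bilinear_rmul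
  bilinear_lneg bilinear_rneg bilinear_lsub bilinear_rsub

lemma inner_product_Cauchy_Schwarz:
  assumes "inner_product B"
  shows "B u v \<le> sqrt (B u u) * sqrt (B v v)"
proof (cases "v = 0")
  case True
  then show ?thesis using inner_productD(5,6)[OF assms] by simp
next
  case False
  note ip = inner_productD[OF assms]
  have vv: "B v v > 0" using False ip(3) by blast
  define t where "t = B u v / B v v"
  have "0 \<le> B (u - t *\<^sub>R v) (u - t *\<^sub>R v)" by (rule ip(4))
  also have "\<dots> = B u u - (B u v)\<^sup>2 / B v v"
    using vv by (simp add: bilinear_simps[OF ip(1)] ip(2)[of v u] t_def field_simps power2_eq_square)
  finally have "(B u v)\<^sup>2 \<le> B u u * B v v"
    using vv by (simp add: field_simps)
  then have "sqrt ((B u v)\<^sup>2) \<le> sqrt (B u u * B v v)" by (rule real_sqrt_le_mono)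
  then show ?thesis by (simp add: real_sqrt_mult)
qed

lemma bilinear_expansion:
  fixes B :: "real^'m::finite \<Rightarrow> real^'k::finite \<Rightarrow> real"
  assumes "bilinear B"
  shows "B u v = (\<Sum>i\<in>UNIV. \<Sum>j\<in>UNIV. u $ i * v $ j * B (axis i 1) (axis j 1))"
proof -
  have "B u v = B (\<Sum>i\<in>UNIV. u $ i *\<^sub>R axis i 1) (\<Sum>j\<in>UNIV. v $ j *\<^sub>R axis j 1)"
    using basis_expansion[of u] basis_expansion[of v] by (simp add: scalar_mult_eq_scaleR)
  also have "\<dots> = (\<Sum>(i, j)\<in>UNIV \<times> UNIV. B (u $ i *\<^sub>R axis i 1) (v $ j *\<^sub>R axis j 1))"
    by (rule bilinear_sum[OF assms])
  finally show ?thesis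
    by (simp add: sum.cartesian_product bilinear_simps[OF assms] ac_simps)
qed

lemma inner_product_inner: "inner_product (\<bullet>)"
  unfolding inner_product_def
  by (auto simp: bilinear_def inner_commute intro!: linearI inner_add_left inner_add_right)

lemma continuous_on_inner_product:
  fixes B :: "real^'m::finite \<Rightarrow> real^'m \<Rightarrow> real"
  assumes "inner_product B" "continuous_on S u" "continuous_on S v"
  shows "continuous_on S (\<lambda>s. B (u s) (v s))"
  by (subst bilinear_expansion[OF inner_productD(1)[OF assms(1)]])
    (intro continuous_intros assms(2-))

lemma bounded_linear_inner_product_left:
  fixes B :: "real^'m::finite \<Rightarrow> real^'m \<Rightarrow> real"
  assumes "inner_product B"
  shows "bounded_linear (\<lambda>u. B u v)"
  using inner_productD(1)[OF assms] by (simp add: bilinear_def linear_conv_bounded_linear)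

section \<open>Charts\<close>

lemma continuous_on_locally:
  assumes "\<And>s. s \<in> A \<Longrightarrow> \<exists>W. open W \<and> s \<in> W \<and> continuous_on (A \<inter> W) f"
  shows "continuous_on A f"
  unfolding continuous_on_def
proof
  fix s assume s: "s \<in> A"
  then obtain W where W: "open W" "s \<in> W" "continuous_on (A \<inter> W) f" using assms by blast
  then have "(f \<longlongrightarrow> f s) (at s within A \<inter> W)"
    using s by (simp add: continuous_on_def)
  moreover have "at s within A \<inter> W = at s within A"
    using W by (intro at_within_nhd[of s W]) auto
  ultimately show "(f \<longlongrightarrow> f s) (at s within A)" by simp
qed

text \<open>The chain rule with \<open>h \<circ> x = y\<close> demanded only near the point.
  Instances are changes of chart, with \<open>h\<close> a transition map, and composition with
  \<phi>, with \<open>h\<close> a local representative.\<close>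

lemma curve_chart_change:
  fixes \<gamma> :: "real \<Rightarrow> 'p::topological_space"
  assumes V: "open V" "\<gamma> s \<in> V" and \<gamma>: "continuous_on A \<gamma>" "s \<in> A"
    and h: "\<And>p. p \<in> V \<Longrightarrow> h (x p) = y p" "(h has_derivative H) (at (x (\<gamma> s)))"
    and v: "((x \<circ> \<gamma>) has_vector_derivative v) (at s within A)"
  shows "((y \<circ> \<gamma>) has_vector_derivative H v) (at s within A)"
proof -
  have "((h \<circ> (x \<circ> \<gamma>)) has_vector_derivative H v) (at s within A)"
    using vector_derivative_diff_chain_within[OF v, of h H] h(2) has_derivative_at_withinI by auto
  moreover have "\<forall>\<^sub>F s' in at s within A. (h \<circ> (x \<circ> \<gamma>)) s' = (y \<circ> \<gamma>) s'"
  proof -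
    have "(\<gamma> \<longlongrightarrow> \<gamma> s) (at s within A)" using \<gamma> by (simp add: continuous_on_def)
    then have "\<forall>\<^sub>F s' in at s within A. \<gamma> s' \<in> V" using V topological_tendstoD by blast
    then show ?thesis by eventually_elim (simp add: h(1))
  qed
  ultimately show ?thesis
    unfolding has_vector_derivative_def
    by (rule has_derivative_transform_eventually) (use \<gamma> V h(1) in auto)
qed

lemma has_derivative_frechet:
  "f differentiable (at z) \<Longrightarrow> (f has_derivative frechet_derivative f (at z)) (at z)"
  by (simp add: frechet_derivative_works)

lemma linear_frechet: "f differentiable (at z) \<Longrightarrow> linear (frechet_derivative f (at z))"
  by (metis frechet_derivative_works has_derivative_linear)

lemma smooth_onD:
  assumes "smooth_on f S"
  shows "z \<in> S \<Longrightarrow> f differentiable (at z)"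
    and "continuous_on S (\<lambda>z. frechet_derivative f (at z) v)"
    and "continuous_on S f"
    and "smooth_on (\<lambda>z. frechet_derivative f (at z) v) S"
proof -
  have "Ck_on (Suc k) f S" for k using assms by (simp add: smooth_on_def)
  then have *: "z \<in> S \<Longrightarrow> f differentiable (at z)" "Ck_on k (\<lambda>z. frechet_derivative f (at z) v) S" for k v z
    by (auto simp del: )
  show "z \<in> S \<Longrightarrow> f differentiable (at z)" by (rule *)
  show "continuous_on S (\<lambda>z. frechet_derivative f (at z) v)" using *(2)[of 0] by simp
  show "continuous_on S f" using assms by (metis Ck_on.simps(1) smooth_on_def)
  show "smooth_on (\<lambda>z. frechet_derivative f (at z) v) S" unfolding smooth_on_def using *(2) by blast
qed

abbreviation chart_im :: "('p, 'm::finite) chart \<Rightarrow> (real^'m) set" where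
  "chart_im c \<equiv> snd c ` fst c"

locale riemannian =
  fixes M :: "('p::{t2_space,second_countable_topology}, 'm::finite) riem"
  assumes manifold: "riemannian_manifold M"
begin

lemma chartD:
  assumes "c \<in> atlas M"
  shows "open (fst c)" "open (chart_im c)" "continuous_on (fst c) (snd c)"
    "continuous_on (chart_im c) (chart_inv c)"
    "p \<in> fst c \<Longrightarrow> chart_inv c (snd c p) = p"
    "z \<in> chart_im c \<Longrightarrow> chart_inv c z \<in> fst c"
    "z \<in> chart_im c \<Longrightarrow> snd c (chart_inv c z) = z"
proof -
  have "is_chart c" using assms manifold by (auto simp: riemannian_manifold_def smooth_atlas_def)
  then have h: "open (fst c)" "open (chart_im c)"
    "homeomorphism (fst c) (chart_im c) (snd c) (chart_inv c)"
    unfolding is_chart_def by blast+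
  show "open (fst c)" "open (chart_im c)" by fact+
  show "continuous_on (fst c) (snd c)" "continuous_on (chart_im c) (chart_inv c)"
    using h(3) unfolding homeomorphism_def by blast+
  show *: "p \<in> fst c \<Longrightarrow> chart_inv c (snd c p) = p" for p
    using h(3) unfolding homeomorphism_def by blast
  show "z \<in> chart_im c \<Longrightarrow> chart_inv c z \<in> fst c" "z \<in> chart_im c \<Longrightarrow> snd c (chart_inv c z) = z"
    using * by auto
qed

lemma ex_chart: obtains c where "c \<in> atlas M" "p \<in> fst c"
proof -
  have "p \<in> (\<Union>c\<in>atlas M. fst c)"
    using manifold unfolding riemannian_manifold_def smooth_atlas_def by simp
  then show thesis using that by blast
qed

lemma some_chart:
  assumes "c = (SOME c. c \<in> atlas M \<and> p \<in> fst c)"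
  shows "c \<in> atlas M" "p \<in> fst c"
  unfolding assms using someI_ex[of "\<lambda>c. c \<in> atlas M \<and> p \<in> fst c"] ex_chart[of p] by blast+

lemma inj_on_chart: "c \<in> atlas M \<Longrightarrow> inj_on (snd c) (fst c)"
  by (metis chartD(5) inj_onI)

lemma open_chart_image:
  assumes c: "c \<in> atlas M" and V: "open V" "V \<subseteq> fst c"
  shows "open (snd c ` V)"
proof -
  have "snd c ` V = chart_im c \<inter> chart_inv c -` V"
  proof (intro equalityI subsetI)
    fix z assume "z \<in> chart_im c \<inter> chart_inv c -` V"
    then show "z \<in> snd c ` V" by (metis IntD1 IntD2 chartD(7)[OF c] imageI vimageD)
  qed (use V chartD(5)[OF c] in auto)
  then show ?thesis
    using continuous_open_preimage[OF chartD(4)[OF c] chartD(2)[OF c] V(1)] by simp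
qed

lemma open_chart_inv_image:
  assumes c: "c \<in> atlas M" and V: "open V" "V \<subseteq> chart_im c"
  shows "open (chart_inv c ` V)"
proof -
  have "chart_inv c ` V = fst c \<inter> snd c -` V"
  proof (intro equalityI subsetI)
    fix p assume "p \<in> fst c \<inter> snd c -` V"
    then show "p \<in> chart_inv c ` V" by (metis IntD1 IntD2 chartD(5)[OF c] imageI vimageD)
  qed (use V chartD(6,7)[OF c] in auto)
  then show ?thesis
    using continuous_open_preimage[OF chartD(3)[OF c] chartD(1)[OF c] V(1)] by simp
qed

lemma compact_chart_inv_image:
  assumes "c \<in> atlas M" "compact V" "V \<subseteq> chart_im c"
  shows "compact (chart_inv c ` V)"
  using assms by (intro compact_continuous_image continuous_on_subset[OF chartD(4)[OF assms(1)]])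

lemma transition:
  assumes "c \<in> atlas M" "d \<in> atlas M"
  shows "smooth_on (transition c d) (snd c ` (fst c \<inter> fst d))"
    and "p \<in> fst c \<Longrightarrow> transition c d (snd c p) = snd d p"
  using assms manifold chartD(5)[OF assms(1)]
  by (auto simp: riemannian_manifold_def smooth_atlas_def transition_def)

lemma transition_differentiable:
  assumes "c \<in> atlas M" "d \<in> atlas M" "p \<in> fst c \<inter> fst d"
  shows "transition c d differentiable (at (snd c p))"
  using smooth_onD(1)[OF transition(1)[OF assms(1,2)]] assms(3) by blast

lemma inner_product_metric: "c \<in> atlas M \<Longrightarrow> p \<in> fst c \<Longrightarrow> inner_product (metric M c p)"
  using manifold by (auto simp: riemannian_manifold_def riemannian_metric_def)

lemma inner_product_coord_metric:
  "c \<in> atlas M \<Longrightarrow> z \<in> chart_im c \<Longrightarrow> inner_product (coord_metric M c z)"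
  unfolding coord_metric_def by (intro inner_product_metric chartD)

lemma coord_metric_eq: "c \<in> atlas M \<Longrightarrow> p \<in> fst c \<Longrightarrow> coord_metric M c (snd c p) = metric M c p"
  by (simp add: coord_metric_def[abs_def] chartD)

lemma smooth_coord_metric: "c \<in> atlas M \<Longrightarrow> smooth_on (\<lambda>z. coord_metric M c z u v) (chart_im c)"
  using manifold by (auto simp: riemannian_manifold_def riemannian_metric_def)

lemma metric_change:
  assumes "c \<in> atlas M" "d \<in> atlas M" "p \<in> fst c \<inter> fst d"
  shows "metric M c p u v = metric M d p (frechet_derivative (transition c d) (at (snd c p)) u)
                     (frechet_derivative (transition c d) (at (snd c p)) v)"
  using assms manifold unfolding riemannian_manifold_def riemannian_metric_def by blast

text \<open>Smoothness of the metric is given for fixed vector arguments; expansion in the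
  coordinate basis makes it jointly continuous in point and vectors.\<close>

lemma continuous_on_coord_metric [continuous_intros]:
  assumes c: "c \<in> atlas M" and f: "continuous_on S f" "\<And>s. s \<in> S \<Longrightarrow> f s \<in> chart_im c"
    and u: "continuous_on S u" and v: "continuous_on S v"
  shows "continuous_on S (\<lambda>s. coord_metric M c (f s) (u s) (v s))"
proof -
  have "continuous_on S (\<lambda>s. \<Sum>i\<in>UNIV. \<Sum>j\<in>UNIV. u s $ i * v s $ j * coord_metric M c (f s) (axis i 1) (axis j 1))"
    by (intro continuous_intros u v
      continuous_on_compose2[OF smooth_onD(3)[OF smooth_coord_metric[OF c]] f(1)]) (use f in auto)
  then show ?thesis
    by (rule continuous_on_eq)
      (use bilinear_expansion[OF inner_productD(1)[OF inner_product_coord_metric[OF c f(2)]]] in auto)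
qed

section \<open>Piecewise continuously differentiable curves\<close>

text \<open>The one-sided derivatives at the ends make this continuous on all of
  \<open>{a..b}\<close>, whereas \<open>speed\<close> is arbitrary there; \<open>speed\<close>
  inherits integrability from it.\<close>

definition seg_speed :: "real \<Rightarrow> real \<Rightarrow> (real \<Rightarrow> 'p) \<Rightarrow> real \<Rightarrow> real" where
  "seg_speed a b \<gamma> s =
     (let c = (SOME c. c \<in> atlas M \<and> \<gamma> s \<in> fst c);
          v = vector_derivative (snd c \<circ> \<gamma>) (at s within {a..b})
      in sqrt (metric M c (\<gamma> s) v v))"

lemma C1_segmentD:
  assumes "C1_segment M a b \<gamma>"
  shows "continuous_on {a..b} \<gamma>"
    and "c \<in> atlas M \<Longrightarrow> s \<in> {a..b} \<Longrightarrow> \<gamma> s \<in> fst c \<Longrightarrow>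
      ((snd c \<circ> \<gamma>) has_vector_derivative vector_derivative (snd c \<circ> \<gamma>) (at s within {a..b})) (at s within {a..b})"
    and "c \<in> atlas M \<Longrightarrow>
      continuous_on {s\<in>{a..b}. \<gamma> s \<in> fst c} (\<lambda>s. vector_derivative (snd c \<circ> \<gamma>) (at s within {a..b}))"
  using assms by (auto simp: C1_segment_def Let_def vector_derivative_works[symmetric])

text \<open>The velocity in the selected chart is the image of \<open>v\<close> under the
  differential of the transition map, which preserves the metric. Derivatives within
  \<open>{a..b}\<close> are unique because \<open>a < b\<close>.\<close>

lemma seg_speed_chart:
  assumes ab: "a < b" and \<gamma>: "C1_segment M a b \<gamma>" and s: "s \<in> {a..b}" and c: "c \<in> atlas M" "\<gamma> s \<in> fst c"
  defines "v \<equiv> vector_derivative (snd c \<circ> \<gamma>) (at s within {a..b})"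
  shows "seg_speed a b \<gamma> s = sqrt (metric M c (\<gamma> s) v v)"
proof -
  define d where "d = (SOME c. c \<in> atlas M \<and> \<gamma> s \<in> fst c)"
  note d = some_chart[OF d_def]
  define w where "w = vector_derivative (snd d \<circ> \<gamma>) (at s within {a..b})"
  let ?T = "frechet_derivative (transition c d) (at (snd c (\<gamma> s)))"
  have "((snd d \<circ> \<gamma>) has_vector_derivative ?T v) (at s within {a..b})"
  proof (rule curve_chart_change[where V = "fst c \<inter> fst d" and h = "transition c d" and x = "snd c" and H = ?T])
    show "open (fst c \<inter> fst d)" using c d chartD by blast
    show "(transition c d has_derivative ?T) (at (snd c (\<gamma> s)))"
      using c d by (intro has_derivative_frechet transition_differentiable) auto
  qed (use c d transition(2) C1_segmentD[OF \<gamma>] s in \<open>auto simp: v_def\<close>)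
  moreover have "((snd d \<circ> \<gamma>) has_vector_derivative w) (at s within {a..b})"
    using C1_segmentD(2)[OF \<gamma> d(1) s d(2)] by (simp add: w_def)
  ultimately have "w = ?T v"
    using vector_derivative_unique_within_closed_interval ab s
    by (metis cbox_interval)
  then have "metric M c (\<gamma> s) v v = metric M d (\<gamma> s) w w"
    using metric_change[OF c(1) d(1)] c d by simp
  then show ?thesis
    by (simp add: seg_speed_def d_def[symmetric] w_def Let_def)
qed

lemma continuous_on_seg_speed:
  assumes ab: "a < b" and \<gamma>: "C1_segment M a b \<gamma>"
  shows "continuous_on {a..b} (seg_speed a b \<gamma>)"
proof (rule continuous_on_locally)
  fix s assume s: "s \<in> {a..b}"
  obtain c where c: "c \<in> atlas M" "\<gamma> s \<in> fst c" by (rule ex_chart)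
  obtain W where W: "open W" "W \<inter> {a..b} = \<gamma> -` fst c \<inter> {a..b}"
    using continuous_on_open_invariant[THEN iffD1, OF C1_segmentD(1)[OF \<gamma>], rule_format, OF chartD(1)[OF c(1)]]
    by auto
  have J: "{a..b} \<inter> W = {s\<in>{a..b}. \<gamma> s \<in> fst c}" using W(2) by blast
  have "continuous_on {s\<in>{a..b}. \<gamma> s \<in> fst c} (\<lambda>s. snd c (\<gamma> s))"
    by (rule continuous_on_compose2[OF chartD(3)[OF c(1)] continuous_on_subset[OF C1_segmentD(1)[OF \<gamma>]]]) auto
  then have "continuous_on ({a..b} \<inter> W) (\<lambda>s. sqrt (coord_metric M c (snd c (\<gamma> s))
      (vector_derivative (snd c \<circ> \<gamma>) (at s within {a..b})) (vector_derivative (snd c \<circ> \<gamma>) (at s within {a..b}))))"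
    unfolding J by (intro continuous_intros c C1_segmentD(3)[OF \<gamma>]) auto
  then have "continuous_on ({a..b} \<inter> W) (seg_speed a b \<gamma>)"
    by (rule continuous_on_eq) (auto simp: J seg_speed_chart[OF ab \<gamma> _ c(1)] coord_metric_eq c)
  with W s c show "\<exists>W. open W \<and> s \<in> W \<and> continuous_on ({a..b} \<inter> W) (seg_speed a b \<gamma>)" by blast
qed

lemma speed_eq_seg_speed: "s \<in> {a<..<b} \<Longrightarrow> speed M \<gamma> s = seg_speed a b \<gamma> s"
  by (simp add: speed_def seg_speed_def at_within_Icc_at)

lemma speed_nonneg: "speed M \<gamma> s \<ge> 0"
proof -
  define d where "d = (SOME c. c \<in> atlas M \<and> \<gamma> s \<in> fst c)"
  note d = some_chart[OF d_def]
  show ?thesis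
    using inner_productD(4)[OF inner_product_metric[OF d]]
    by (simp add: speed_def Let_def d_def[symmetric])
qed

end

section \<open>Restriction, reparametrisation and joining of curves\<close>

lemma C1_segmentI:
  assumes "a < b" "continuous_on {a..b} \<gamma>"
    and "\<And>c s. c \<in> atlas M \<Longrightarrow> s \<in> {a..b} \<Longrightarrow> \<gamma> s \<in> fst c \<Longrightarrow>
      ((snd c \<circ> \<gamma>) has_vector_derivative v c s) (at s within {a..b})"
    and "\<And>c. c \<in> atlas M \<Longrightarrow> continuous_on {s\<in>{a..b}. \<gamma> s \<in> fst c} (v c)"
  shows "C1_segment M a b \<gamma>"
proof -
  have eq: "vector_derivative (snd c \<circ> \<gamma>) (at s within {a..b}) = v c s"
    if "c \<in> atlas M" "s \<in> {a..b}" "\<gamma> s \<in> fst c" for c s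
    using vector_derivative_within_cbox[of a b s "snd c \<circ> \<gamma>" "v c s"] assms(1) assms(3)[OF that] that by simp
  show ?thesis
    unfolding C1_segment_def Let_def
  proof (intro conjI ballI assms(2))
    fix c s assume "c \<in> atlas M" "s \<in> {s \<in> {a..b}. \<gamma> s \<in> fst c}"
    then show "snd c \<circ> \<gamma> differentiable at s within {a..b}"
      using assms(3) differentiableI_vector by blast
  next
    fix c assume c: "c \<in> atlas M"
    show "continuous_on {s \<in> {a..b}. \<gamma> s \<in> fst c} (\<lambda>s. vector_derivative (snd c \<circ> \<gamma>) (at s within {a..b}))"
      by (rule continuous_on_eq[OF assms(4)[OF c]]) (use c eq in auto)
  qed
qed

lemma C1_segmentE:
  assumes "C1_segment M a b \<gamma>"
  obtains v where "continuous_on {a..b} \<gamma>"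
    and "\<And>c s. c \<in> atlas M \<Longrightarrow> s \<in> {a..b} \<Longrightarrow> \<gamma> s \<in> fst c \<Longrightarrow>
      ((snd c \<circ> \<gamma>) has_vector_derivative v c s) (at s within {a..b})"
    and "\<And>c. c \<in> atlas M \<Longrightarrow> continuous_on {s\<in>{a..b}. \<gamma> s \<in> fst c} (v c)"
  by (rule that[of "\<lambda>c s. vector_derivative (snd c \<circ> \<gamma>) (at s within {a..b})"])
    (use assms in \<open>auto simp: C1_segment_def Let_def vector_derivative_works[symmetric]\<close>)

lemma C1_segment_subset:
  assumes \<gamma>: "C1_segment M a b \<gamma>" and "a \<le> a'" "a' < b'" "b' \<le> b"
  shows "C1_segment M a' b' \<gamma>"
proof -
  have sub: "{a'..b'} \<subseteq> {a..b}" using assms by auto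
  obtain v where v: "continuous_on {a..b} \<gamma>"
    "\<And>c s. c \<in> atlas M \<Longrightarrow> s \<in> {a..b} \<Longrightarrow> \<gamma> s \<in> fst c \<Longrightarrow>
      ((snd c \<circ> \<gamma>) has_vector_derivative v c s) (at s within {a..b})"
    "\<And>c. c \<in> atlas M \<Longrightarrow> continuous_on {s\<in>{a..b}. \<gamma> s \<in> fst c} (v c)"
    using C1_segmentE[OF \<gamma>] by blast
  show ?thesis
  proof (rule C1_segmentI[where v = v])
    show "((snd c \<circ> \<gamma>) has_vector_derivative v c s) (at s within {a'..b'})"
      if "c \<in> atlas M" "s \<in> {a'..b'}" "\<gamma> s \<in> fst c" for c s
      by (rule has_vector_derivative_within_subset[OF v(2) sub]) (use that sub in auto)
    show "continuous_on {s \<in> {a'..b'}. \<gamma> s \<in> fst c} (v c)" if "c \<in> atlas M" for c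
      by (rule continuous_on_subset[OF v(3)[OF that]]) (use sub in auto)
  qed (use assms continuous_on_subset[OF v(1) sub] in auto)
qed

lemma C1_segment_cong:
  assumes "C1_segment M a b \<gamma>" "\<And>s. s \<in> {a..b} \<Longrightarrow> \<gamma> s = \<gamma>' s" "a < b"
  shows "C1_segment M a b \<gamma>'"
proof -
  obtain v where v: "continuous_on {a..b} \<gamma>"
    "\<And>c s. c \<in> atlas M \<Longrightarrow> s \<in> {a..b} \<Longrightarrow> \<gamma> s \<in> fst c \<Longrightarrow>
      ((snd c \<circ> \<gamma>) has_vector_derivative v c s) (at s within {a..b})"
    "\<And>c. c \<in> atlas M \<Longrightarrow> continuous_on {s\<in>{a..b}. \<gamma> s \<in> fst c} (v c)"
    using C1_segmentE[OF assms(1)] by blast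
  have eq: "{s \<in> {a..b}. \<gamma>' s \<in> fst c} = {s \<in> {a..b}. \<gamma> s \<in> fst c}" for c
    using assms(2) by auto
  show ?thesis
  proof (rule C1_segmentI[where v = v])
    show "((snd c \<circ> \<gamma>') has_vector_derivative v c s) (at s within {a..b})"
      if "c \<in> atlas M" "s \<in> {a..b}" "\<gamma>' s \<in> fst c" for c s
      by (rule has_vector_derivative_transform[OF _ _ v(2)]) (use that assms(2) in auto)
    show "continuous_on {s \<in> {a..b}. \<gamma>' s \<in> fst c} (v c)" if "c \<in> atlas M" for c
      unfolding eq by (rule v(3)[OF that])
    show "continuous_on {a..b} \<gamma>'"
      by (rule continuous_on_eq[OF v(1) assms(2)])
  qed fact
qed

text \<open>Only the image of the interval is prescribed, so negative \<alpha>, that is reversal, is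
  included.\<close>

lemma C1_segment_affine:
  fixes \<alpha> \<beta> :: real
  assumes \<gamma>: "C1_segment M A B \<gamma>" and "a < b" and im: "(\<lambda>s. \<alpha> * s + \<beta>) ` {a..b} = {A..B}"
  shows "C1_segment M a b (\<lambda>s. \<gamma> (\<alpha> * s + \<beta>))"
proof -
  let ?f = "\<lambda>s. \<alpha> * s + \<beta>"
  have cf: "continuous_on S ?f" for S by (intro continuous_intros)
  obtain v where v: "continuous_on {A..B} \<gamma>"
    "\<And>c s. c \<in> atlas M \<Longrightarrow> s \<in> {A..B} \<Longrightarrow> \<gamma> s \<in> fst c \<Longrightarrow>
      ((snd c \<circ> \<gamma>) has_vector_derivative v c s) (at s within {A..B})"
    "\<And>c. c \<in> atlas M \<Longrightarrow> continuous_on {s\<in>{A..B}. \<gamma> s \<in> fst c} (v c)"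
    using C1_segmentE[OF \<gamma>] by blast
  have mem: "?f s \<in> {A..B}" if "s \<in> {a..b}" for s using that im by blast
  show ?thesis
  proof (rule C1_segmentI[where v = "\<lambda>c s. \<alpha> *\<^sub>R v c (?f s)"])
    show "continuous_on {a..b} (\<lambda>s. \<gamma> (?f s))"
      by (rule continuous_on_compose2[OF v(1) cf]) (use mem in auto)
    show "((snd c \<circ> (\<lambda>s. \<gamma> (?f s))) has_vector_derivative \<alpha> *\<^sub>R v c (?f s)) (at s within {a..b})"
      if "c \<in> atlas M" "s \<in> {a..b}" "\<gamma> (?f s) \<in> fst c" for c s
    proof -
      have "(?f has_vector_derivative \<alpha>) (at s within {a..b})"
        by (auto intro!: derivative_eq_intros)
      from vector_diff_chain_within[OF this, of "snd c \<circ> \<gamma>" "v c (?f s)"]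
      show ?thesis using v(2)[OF that(1) mem[OF that(2)] that(3)] unfolding im by (simp add: o_def)
    qed
    show "continuous_on {s \<in> {a..b}. \<gamma> (?f s) \<in> fst c} (\<lambda>s. \<alpha> *\<^sub>R v c (?f s))" if "c \<in> atlas M" for c
      by (intro continuous_intros continuous_on_compose2[OF v(3)[OF that] cf]) (use mem in auto)
  qed fact
qed

text \<open>Generated by joining instead of an indexed subdivision, so that facts about segments
  pass to curves by rule induction and the parameter interval is free. \<open>pc_curve_iff\<close>
  gives the agreement on \<open>{0..1}\<close>.\<close>

inductive pc_curve :: "('p::topological_space, 'm::finite) riem \<Rightarrow> (real \<Rightarrow> 'p) \<Rightarrow> real \<Rightarrow> real \<Rightarrow> bool"
  for M \<gamma> where
  seg: "a < b \<Longrightarrow> C1_segment M a b \<gamma> \<Longrightarrow> pc_curve M \<gamma> a b"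
| join: "pc_curve M \<gamma> a b \<Longrightarrow> pc_curve M \<gamma> b c \<Longrightarrow> pc_curve M \<gamma> a c"

lemma pc_curve_less: "pc_curve M \<gamma> a b \<Longrightarrow> a < b"
  by (induction rule: pc_curve.induct) auto

lemma pc_curve_continuous_on: "pc_curve M \<gamma> a b \<Longrightarrow> continuous_on {a..b} \<gamma>"
proof (induction rule: pc_curve.induct)
  case (seg a b)
  then show ?case by (simp add: C1_segment_def)
next
  case (join a b c)
  have "{a..c} = {a..b} \<union> {b..c}"
    using pc_curve_less[OF join(1)] pc_curve_less[OF join(2)] by auto
  then show ?case using join continuous_on_closed_Un[of "{a..b}" "{b..c}" \<gamma>] by simp
qed

lemma pc_curve_cong:
  assumes "pc_curve M \<gamma> a b" "\<And>s. s \<in> {a..b} \<Longrightarrow> \<gamma> s = \<gamma>' s"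
  shows "pc_curve M \<gamma>' a b"
  using assms
proof (induction rule: pc_curve.induct)
  case (seg a b)
  then show ?case using C1_segment_cong pc_curve.seg by blast
next
  case (join a b c)
  then show ?case
    using pc_curve_less[OF join(1)] pc_curve_less[OF join(2)]
    by (intro pc_curve.join[of _ _ a b c]) auto
qed

lemma pc_curve_split:
  assumes "pc_curve M \<gamma> a b" "a < s" "s < b"
  shows "pc_curve M \<gamma> a s" "pc_curve M \<gamma> s b"
proof -
  have "pc_curve M \<gamma> a s \<and> pc_curve M \<gamma> s b"
    using assms
  proof (induction rule: pc_curve.induct)
    case (seg a b)
    then show ?case by (auto intro!: pc_curve.seg intro: C1_segment_subset)
  next
    case (join a b c)
    then show ?case by (cases s b rule: linorder_cases) (auto intro: pc_curve.join)
  qed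
  then show "pc_curve M \<gamma> a s" "pc_curve M \<gamma> s b" by auto
qed

lemma pc_curve_affine:
  fixes \<alpha> \<beta> :: real
  assumes "pc_curve M \<gamma> A B" "\<alpha> \<noteq> 0"
  defines "a \<equiv> min ((A - \<beta>) / \<alpha>) ((B - \<beta>) / \<alpha>)" and "b \<equiv> max ((A - \<beta>) / \<alpha>) ((B - \<beta>) / \<alpha>)"
  shows "pc_curve M (\<lambda>s. \<gamma> (\<alpha> * s + \<beta>)) a b"
  unfolding a_def b_def using assms(1)
proof (induction rule: pc_curve.induct)
  case (seg A B)
  let ?a = "min ((A - \<beta>) / \<alpha>) ((B - \<beta>) / \<alpha>)" and ?b = "max ((A - \<beta>) / \<alpha>) ((B - \<beta>) / \<alpha>)"
  have "(\<lambda>s. \<alpha> * s + \<beta>) ` {?a..?b} = {A..B}"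
  proof (intro equalityI subsetI)
    fix t assume "t \<in> (\<lambda>s. \<alpha> * s + \<beta>) ` {?a..?b}"
    then show "t \<in> {A..B}"
      using \<open>\<alpha> \<noteq> 0\<close> \<open>A < B\<close>
      by (cases "\<alpha> > 0") (auto simp: min_def max_def field_simps split: if_splits)
  next
    fix t assume "t \<in> {A..B}"
    then have "(t - \<beta>) / \<alpha> \<in> {?a..?b}"
      using \<open>\<alpha> \<noteq> 0\<close> by (cases "\<alpha> > 0") (auto simp: min_le_iff_disj le_max_iff_disj field_simps)
    then show "t \<in> (\<lambda>s. \<alpha> * s + \<beta>) ` {?a..?b}"
      using \<open>\<alpha> \<noteq> 0\<close> by (intro image_eqI[of _ _ "(t - \<beta>) / \<alpha>"]) auto
  qed
  moreover have "?a < ?b"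
    using \<open>\<alpha> \<noteq> 0\<close> \<open>A < B\<close> by (cases "\<alpha> > 0") (auto simp: min_def max_def field_simps)
  ultimately show ?case
    using seg by (intro pc_curve.seg C1_segment_affine)
next
  case (join A B C)
  have "A < B" "B < C" using join pc_curve_less by auto
  then show ?case
    using join \<open>\<alpha> \<noteq> 0\<close> pc_curve.join
    by (cases "\<alpha> > 0") (auto simp: min_def max_def divide_le_cancel split: if_splits)
qed

lemma pc_curve_iff: "piecewise_C1_curve M \<gamma> \<longleftrightarrow> pc_curve M \<gamma> 0 1"
proof
  assume "piecewise_C1_curve M \<gamma>"
  then obtain n t where t: "t 0 = 0" "t n = 1" "\<forall>i<n. t i < t (Suc i) \<and> C1_segment M (t i) (t (Suc i)) \<gamma>"
    by (auto simp: piecewise_C1_curve_def)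
  have "k < n \<Longrightarrow> pc_curve M \<gamma> 0 (t (Suc k))" for k
  proof (induction k)
    case 0
    then show ?case using t by (metis pc_curve.seg)
  next
    case (Suc k)
    then have "pc_curve M \<gamma> 0 (t (Suc k))" "pc_curve M \<gamma> (t (Suc k)) (t (Suc (Suc k)))"
      using t by (auto intro: pc_curve.seg)
    then show ?case by (rule pc_curve.join)
  qed
  moreover have "n \<noteq> 0" using t by (metis zero_neq_one)
  ultimately show "pc_curve M \<gamma> 0 1" using t by (metis lessI not0_implies_Suc)
next
  have "\<exists>n t. t 0 = a \<and> t n = b \<and> (\<forall>i<n. t i < t (Suc i) \<and> C1_segment M (t i) (t (Suc i)) \<gamma>)"
    if "pc_curve M \<gamma> a b" for a b
    using that
  proof (induction rule: pc_curve.induct)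
    case (seg a b)
    then show ?case by (intro exI[of _ 1] exI[of _ "\<lambda>i. if i = 0 then a else b"]) auto
  next
    case (join a b c)
    then obtain n t n' t' where t: "t 0 = a" "t n = b" "\<And>i. i < n \<Longrightarrow> t i < t (Suc i) \<and> C1_segment M (t i) (t (Suc i)) \<gamma>"
      and t': "t' 0 = b" "t' n' = c" "\<And>i. i < n' \<Longrightarrow> t' i < t' (Suc i) \<and> C1_segment M (t' i) (t' (Suc i)) \<gamma>"
      by metis
    let ?t = "\<lambda>i. if i < n then t i else t' (i - n)"
    have "?t i < ?t (Suc i) \<and> C1_segment M (?t i) (?t (Suc i)) \<gamma>" if "i < n + n'" for i
    proof -
      consider "Suc i < n" | "Suc i = n" | "i \<ge> n" by linarith
      then show ?thesis
      proof cases
        case 3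
        then show ?thesis using t'(3)[of "i - n"] that by (simp add: Suc_diff_le)
      qed (use t(3)[of i] t(2) t'(1) in auto)
    qed
    moreover have "?t 0 = a" "?t (n + n') = c" using t t' by auto
    ultimately show ?case by (intro exI[of _ "n + n'"] exI[of _ ?t]) blast
  qed
  then show "pc_curve M \<gamma> 0 1 \<Longrightarrow> piecewise_C1_curve M \<gamma>"
    unfolding piecewise_C1_curve_def by blast
qed

section \<open>The Riemannian distance\<close>

context riemannian
begin

text \<open>The finite set collects ends and corners, where \<open>speed\<close> is arbitrary and
  which integrals ignore. Elsewhere the curve has a velocity in every chart around the point, and
  each of these computes the speed.\<close>

lemma pc_curve_speed:
  assumes "pc_curve M \<gamma> a b"
  shows "\<exists>S. finite S \<and> speed M \<gamma> integrable_on {a..b} \<and>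
    (\<forall>s\<in>{a..b} - S. s \<in> {a<..<b} \<and> (\<forall>c\<in>atlas M. \<gamma> s \<in> fst c \<longrightarrow>
       (\<exists>v. ((snd c \<circ> \<gamma>) has_vector_derivative v) (at s) \<and> speed M \<gamma> s = sqrt (metric M c (\<gamma> s) v v))))"
  using assms
proof (induction rule: pc_curve.induct)
  case (seg a b)
  have "speed M \<gamma> integrable_on {a..b}"
  proof (rule integrable_spike_finite[of "{a, b}"])
    show "seg_speed a b \<gamma> integrable_on {a..b}"
      by (rule integrable_continuous_real[OF continuous_on_seg_speed[OF seg]])
  qed (auto simp: speed_eq_seg_speed)
  moreover have key: "\<exists>v. ((snd c \<circ> \<gamma>) has_vector_derivative v) (at s) \<and> speed M \<gamma> s = sqrt (metric M c (\<gamma> s) v v)"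
    if s: "s \<in> {a<..<b}" and c: "c \<in> atlas M" "\<gamma> s \<in> fst c" for s c
  proof -
    have s': "s \<in> {a..b}" "at s within {a..b} = at s" using s by (auto simp: at_within_Icc_at)
    show ?thesis
      using C1_segmentD(2)[OF seg(2) c(1) s'(1) c(2)] seg_speed_chart[OF seg s'(1) c]
        speed_eq_seg_speed[OF s, of \<gamma>] unfolding s'(2) by auto
  qed
  ultimately show ?case by (intro exI[of _ "{a, b}"] conjI ballI impI key) auto
next
  case (join a b c)
  obtain S where S: "finite S" "speed M \<gamma> integrable_on {a..b}"
    "\<forall>s\<in>{a..b} - S. s \<in> {a<..<b} \<and> (\<forall>c\<in>atlas M. \<gamma> s \<in> fst c \<longrightarrow>
     (\<exists>v. ((snd c \<circ> \<gamma>) has_vector_derivative v) (at s) \<and> speed M \<gamma> s = sqrt (metric M c (\<gamma> s) v v)))"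
    using join.IH(1) by blast
  obtain S' where S': "finite S'" "speed M \<gamma> integrable_on {b..c}"
    "\<forall>s\<in>{b..c} - S'. s \<in> {b<..<c} \<and> (\<forall>c\<in>atlas M. \<gamma> s \<in> fst c \<longrightarrow>
     (\<exists>v. ((snd c \<circ> \<gamma>) has_vector_derivative v) (at s) \<and> speed M \<gamma> s = sqrt (metric M c (\<gamma> s) v v)))"
    using join.IH(2) by blast
  have less: "a < b" "b < c" using join pc_curve_less by auto
  have "speed M \<gamma> integrable_on {a..c}"
    using less S(2) S'(2) by (intro Henstock_Kurzweil_Integration.integrable_combine[of a b c]) auto
  moreover have "s \<in> {a<..<c} \<and> (\<forall>c\<in>atlas M. \<gamma> s \<in> fst c \<longrightarrow>
     (\<exists>v. ((snd c \<circ> \<gamma>) has_vector_derivative v) (at s) \<and> speed M \<gamma> s = sqrt (metric M c (\<gamma> s) v v)))"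
    if "s \<in> {a..c} - (S \<union> S')" for s
  proof (cases "s \<le> b")
    case True
    then have "s \<in> {a..b} - S" using that by auto
    from S(3)[rule_format, OF this] less show ?thesis by auto
  next
    case False
    then have "s \<in> {b..c} - S'" using that by auto
    from S'(3)[rule_format, OF this] less show ?thesis by auto
  qed
  ultimately show ?case using S(1) S'(1) by (intro exI[of _ "S \<union> S'"]) blast
qed

lemma pc_curve_integrable: "pc_curve M \<gamma> a b \<Longrightarrow> speed M \<gamma> integrable_on {a..b}"
  using pc_curve_speed by blast

lemma length_nonneg: "integral {a..b} (speed M \<gamma>) \<ge> 0"
  by (cases "speed M \<gamma> integrable_on {a..b}")
    (auto intro!: integral_nonneg speed_nonneg simp: not_integrable_integral)

lemma length_split:
  assumes "pc_curve M \<gamma> a b" "a < s" "s < b"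
  shows "integral {a..s} (speed M \<gamma>) + integral {s..b} (speed M \<gamma>) = integral {a..b} (speed M \<gamma>)"
  using assms pc_curve_integrable[OF assms(1)]
  by (intro Henstock_Kurzweil_Integration.integral_combine) auto

lemma metric_scale:
  assumes "c \<in> atlas M" "p \<in> fst c"
  shows "metric M c p (\<alpha> *\<^sub>R v) (\<alpha> *\<^sub>R v) = \<alpha>\<^sup>2 * metric M c p v v"
  using inner_productD(1)[OF inner_product_metric[OF assms]]
  by (simp add: bilinear_simps power2_eq_square)

lemma speed_affine:
  fixes \<alpha> \<beta> :: real
  assumes "\<And>c. c \<in> atlas M \<Longrightarrow> \<gamma> (\<alpha> * s + \<beta>) \<in> fst c \<Longrightarrow>
      \<exists>v. ((snd c \<circ> \<gamma>) has_vector_derivative v) (at (\<alpha> * s + \<beta>))"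
  shows "speed M (\<lambda>s. \<gamma> (\<alpha> * s + \<beta>)) s = \<bar>\<alpha>\<bar> * speed M \<gamma> (\<alpha> * s + \<beta>)"
proof -
  let ?t = "\<alpha> * s + \<beta>"
  define c where "c = (SOME c. c \<in> atlas M \<and> \<gamma> ?t \<in> fst c)"
  note c = some_chart[OF c_def]
  obtain v where v: "((snd c \<circ> \<gamma>) has_vector_derivative v) (at ?t)"
    using assms[OF c] by blast
  have "((\<lambda>s. \<alpha> * s + \<beta>) has_vector_derivative \<alpha>) (at s)"
    by (auto intro!: derivative_eq_intros)
  from vector_diff_chain_at[OF this v]
  have "((snd c \<circ> (\<lambda>s. \<gamma> (\<alpha> * s + \<beta>))) has_vector_derivative \<alpha> *\<^sub>R v) (at s)"
    by (simp add: o_def)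
  then have "vector_derivative (snd c \<circ> (\<lambda>s. \<gamma> (\<alpha> * s + \<beta>))) (at s) = \<alpha> *\<^sub>R v"
    by (rule vector_derivative_at)
  moreover have "vector_derivative (snd c \<circ> \<gamma>) (at ?t) = v"
    by (rule vector_derivative_at[OF v])
  ultimately show ?thesis
    by (simp add: speed_def Let_def c_def[symmetric] metric_scale[OF c] real_sqrt_mult)
qed

text \<open>The factor \<open>\<bar>\<alpha>\<bar>\<close> of the speed cancels that of the
  substitution; \<open>min\<close> and \<open>max\<close> name the ends of the preimage interval for
  either orientation.\<close>

lemma has_integral_speed_affine:
  fixes \<alpha> \<beta> :: real
  assumes \<gamma>: "pc_curve M \<gamma> A B" and \<alpha>: "\<alpha> \<noteq> 0"
  defines "a \<equiv> min ((A - \<beta>) / \<alpha>) ((B - \<beta>) / \<alpha>)" and "b \<equiv> max ((A - \<beta>) / \<alpha>) ((B - \<beta>) / \<alpha>)"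
  shows "integral {a..b} (speed M (\<lambda>s. \<gamma> (\<alpha> * s + \<beta>))) = integral {A..B} (speed M \<gamma>)"
proof -
  obtain S where S: "finite S" "speed M \<gamma> integrable_on {A..B}"
    "\<forall>s\<in>{A..B} - S. s \<in> {A<..<B} \<and> (\<forall>c\<in>atlas M. \<gamma> s \<in> fst c \<longrightarrow>
       (\<exists>v. ((snd c \<circ> \<gamma>) has_vector_derivative v) (at s) \<and> speed M \<gamma> s = sqrt (metric M c (\<gamma> s) v v)))"
    using pc_curve_speed[OF \<gamma>] by blast
  let ?L = "integral {A..B} (speed M \<gamma>)"
  have AB: "A < B" using \<gamma> by (rule pc_curve_less)
  have mem: "\<alpha> * s + \<beta> \<in> {A..B}" if "s \<in> {a..b}" for s
    using that \<alpha> AB unfolding a_def b_def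
    by (cases "\<alpha> > 0") (auto simp: min_def max_def field_simps split: if_splits)
  have im: "(\<lambda>x. (1 / \<alpha>) *\<^sub>R x + -((1 / \<alpha>) *\<^sub>R \<beta>)) ` cbox A B = {a..b}"
  proof (intro equalityI subsetI)
    fix t assume "t \<in> (\<lambda>x. (1 / \<alpha>) *\<^sub>R x + -((1 / \<alpha>) *\<^sub>R \<beta>)) ` cbox A B"
    then show "t \<in> {a..b}"
      using \<alpha> AB unfolding a_def b_def
      by (cases "\<alpha> > 0") (auto simp: min_le_iff_disj le_max_iff_disj field_simps)
  next
    fix t assume "t \<in> {a..b}"
    from mem[OF this] show "t \<in> (\<lambda>x. (1 / \<alpha>) *\<^sub>R x + -((1 / \<alpha>) *\<^sub>R \<beta>)) ` cbox A B"
      using \<alpha> by (intro image_eqI[of _ _ "\<alpha> * t + \<beta>"]) (auto simp: field_simps)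
  qed
  have "(speed M \<gamma> has_integral ?L) (cbox A B)"
    using S(2) by (simp add: integrable_integral)
  from has_integral_affinity[OF this \<alpha>, of \<beta>]
  have "((\<lambda>x. speed M \<gamma> (\<alpha> * x + \<beta>)) has_integral (1 / \<bar>\<alpha>\<bar>) * ?L) {a..b}"
    unfolding im by simp
  from has_integral_mult_right[OF this, of "\<bar>\<alpha>\<bar>"]
  have "((\<lambda>x. \<bar>\<alpha>\<bar> * speed M \<gamma> (\<alpha> * x + \<beta>)) has_integral ?L) {a..b}"
    using \<alpha> by simp
  then have "(speed M (\<lambda>s. \<gamma> (\<alpha> * s + \<beta>)) has_integral ?L) {a..b}"
  proof (rule has_integral_spike_finite[rotated 2])
    show "finite ((\<lambda>s. \<alpha> * s + \<beta>) -` S)"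
      using \<alpha> S(1) by (intro finite_vimageI) (auto simp: inj_def)
    fix s assume s: "s \<in> {a..b} - (\<lambda>s. \<alpha> * s + \<beta>) -` S"
    then have "\<alpha> * s + \<beta> \<in> {A..B} - S" using mem by auto
    from S(3)[rule_format, OF this] show "speed M (\<lambda>s. \<gamma> (\<alpha> * s + \<beta>)) s = \<bar>\<alpha>\<bar> * speed M \<gamma> (\<alpha> * s + \<beta>)"
      by (intro speed_affine) blast
  qed
  then show ?thesis by (rule integral_unique)
qed

text \<open>Free parameter intervals make concatenation and reversal easy, while
  \<open>joinsE\<close> moves a curve to any prescribed interval, so that the infimum is still the
  one in \<open>riem_dist\<close>.\<close>

definition joins :: "'p \<Rightarrow> 'p \<Rightarrow> real \<Rightarrow> bool" where
  "joins p q L \<longleftrightarrow> (\<exists>\<gamma> a b. pc_curve M \<gamma> a b \<and> \<gamma> a = p \<and> \<gamma> b = q \<and> integral {a..b} (speed M \<gamma>) = L)"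

lemma joinsE:
  assumes "joins p q L" "a < b"
  obtains \<gamma> where "pc_curve M \<gamma> a b" "\<gamma> a = p" "\<gamma> b = q" "integral {a..b} (speed M \<gamma>) = L"
proof -
  obtain \<gamma> A B where \<gamma>: "pc_curve M \<gamma> A B" "\<gamma> A = p" "\<gamma> B = q" "integral {A..B} (speed M \<gamma>) = L"
    using assms(1) unfolding joins_def by blast
  define \<alpha> where "\<alpha> = (B - A) / (b - a)"
  define \<beta> where "\<beta> = A - \<alpha> * a"
  have \<alpha>: "\<alpha> > 0" using pc_curve_less[OF \<gamma>(1)] assms(2) by (simp add: \<alpha>_def)
  have "\<alpha> * (b - a) = B - A" using assms(2) by (simp add: \<alpha>_def)
  then have ends: "\<alpha> * a + \<beta> = A" "\<alpha> * b + \<beta> = B"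
    by (auto simp: \<beta>_def algebra_simps)
  then have "(A - \<beta>) / \<alpha> = a" "(B - \<beta>) / \<alpha> = b" using \<alpha> by (auto simp: field_simps)
  then have "pc_curve M (\<lambda>s. \<gamma> (\<alpha> * s + \<beta>)) a b" "integral {a..b} (speed M (\<lambda>s. \<gamma> (\<alpha> * s + \<beta>))) = L"
    using pc_curve_affine[OF \<gamma>(1), of \<alpha> \<beta>] has_integral_speed_affine[OF \<gamma>(1), of \<alpha> \<beta>] \<alpha> \<gamma>(4) assms(2)
    by (auto simp: min_def max_def)
  then show thesis using that ends \<gamma> by blast
qed

lemma joins_nonneg: "joins p q L \<Longrightarrow> L \<ge> 0"
  unfolding joins_def using length_nonneg by blast

lemma joins_sym: assumes "joins p q L" shows "joins q p L"
proof -
  obtain \<gamma> where \<gamma>: "pc_curve M \<gamma> 0 1" "\<gamma> 0 = p" "\<gamma> 1 = q" "integral {0..1} (speed M \<gamma>) = L"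
    using joinsE[OF assms, of 0 1] by auto
  have "pc_curve M (\<lambda>s. \<gamma> (-1 * s + 1)) 0 1" "integral {0..1} (speed M (\<lambda>s. \<gamma> (-1 * s + 1))) = L"
    using pc_curve_affine[OF \<gamma>(1), of "-1" 1] has_integral_speed_affine[OF \<gamma>(1), of "-1" 1] \<gamma>(4) by auto
  moreover have "\<gamma> (-1 * 0 + 1) = q" "\<gamma> (-1 * 1 + 1) = p" using \<gamma> by auto
  ultimately show ?thesis unfolding joins_def by blast
qed

lemma speed_cong:
  assumes "open W" "s \<in> W" "\<And>t. t \<in> W \<Longrightarrow> \<gamma> t = \<gamma>' t"
  shows "speed M \<gamma> s = speed M \<gamma>' s"
proof -
  have "vector_derivative (f \<circ> \<gamma>) (at s) = vector_derivative (f \<circ> \<gamma>') (at s)" for f :: "'p \<Rightarrow> real^'m"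
    using assms by (intro vector_derivative_cong_eq) (auto simp: eventually_nhds)
  then show ?thesis using assms by (simp add: speed_def Let_def)
qed

lemma joins_trans:
  assumes "joins p q L" "joins q r L'"
  shows "joins p r (L + L')"
proof -
  obtain \<gamma> where \<gamma>: "pc_curve M \<gamma> 0 1" "\<gamma> 0 = p" "\<gamma> 1 = q" "integral {0..1} (speed M \<gamma>) = L"
    using joinsE[OF assms(1), of 0 1] by auto
  obtain \<gamma>' where \<gamma>': "pc_curve M \<gamma>' 1 2" "\<gamma>' 1 = q" "\<gamma>' 2 = r" "integral {1..2} (speed M \<gamma>') = L'"
    using joinsE[OF assms(2), of 1 2] by auto
  define \<eta> where "\<eta> s = (if s \<le> 1 then \<gamma> s else \<gamma>' s)" for s
  have \<eta>: "pc_curve M \<eta> 0 1" "pc_curve M \<eta> 1 2"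
    by (rule pc_curve_cong[OF \<gamma>(1)], use \<gamma> in \<open>simp add: \<eta>_def\<close>)
      (rule pc_curve_cong[OF \<gamma>'(1)], use \<gamma> \<gamma>' in \<open>auto simp add: \<eta>_def\<close>)
  then have pc: "pc_curve M \<eta> 0 2" by (rule pc_curve.join)
  \<comment> \<open>Away from the junction the glued curve agrees with one of the pieces on an open
    set, as equality of two-sided derivatives requires; the end points are spikes.\<close>
  have "integral {0..1} (speed M \<eta>) = L"
    unfolding \<gamma>(4)[symmetric]
    by (rule integral_spike[of "{0, 1}"]) (auto simp: \<eta>_def intro!: speed_cong[of "{..<1}"])
  moreover have "integral {1..2} (speed M \<eta>) = L'"
    unfolding \<gamma>'(4)[symmetric]
    by (rule integral_spike[of "{1, 2}"]) (auto simp: \<eta>_def intro!: speed_cong[of "{1<..}"])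
  ultimately have "integral {0..2} (speed M \<eta>) = L + L'"
    using length_split[OF pc, of 1] by simp
  with pc \<gamma> \<gamma>' show ?thesis unfolding joins_def by (intro exI[of _ \<eta>] exI[of _ 0] exI[of _ 2]) (auto simp: \<eta>_def)
qed

lemma riem_dist_eq: "riem_dist M p q = Inf {L. joins p q L}"
proof -
  have "{curve_length M \<gamma> |\<gamma>. piecewise_C1_curve M \<gamma> \<and> \<gamma> 0 = p \<and> \<gamma> 1 = q} = {L. joins p q L}"
  proof (intro equalityI subsetI)
    fix L assume "L \<in> {curve_length M \<gamma> |\<gamma>. piecewise_C1_curve M \<gamma> \<and> \<gamma> 0 = p \<and> \<gamma> 1 = q}"
    then show "L \<in> {L. joins p q L}"
      unfolding joins_def pc_curve_iff curve_length_def by blast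
  next
    fix L assume "L \<in> {L. joins p q L}"
    then obtain \<gamma> where "pc_curve M \<gamma> 0 1" "\<gamma> 0 = p" "\<gamma> 1 = q" "integral {0..1} (speed M \<gamma>) = L"
      using joinsE[of p q L 0 1] by auto
    then show "L \<in> {curve_length M \<gamma> |\<gamma>. piecewise_C1_curve M \<gamma> \<and> \<gamma> 0 = p \<and> \<gamma> 1 = q}"
      unfolding pc_curve_iff curve_length_def by blast
  qed
  then show ?thesis by (simp add: riem_dist_def)
qed

lemma riem_dist_le: "joins p q L \<Longrightarrow> riem_dist M p q \<le> L"
  unfolding riem_dist_eq by (intro cInf_lower bdd_belowI[of _ 0]) (auto intro: joins_nonneg)

lemma segment_point: "s \<in> {0..1} \<Longrightarrow> z + s *\<^sub>R (w - z) \<in> closed_segment z w" for z w :: "real^'m"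
  unfolding closed_segment_def by (intro CollectI exI[of _ s]) (auto simp: algebra_simps)

text \<open>Straight coordinate segments supply the upper bounds on distances near a point. In any
  other chart their velocity is the image under the differential of the transition map.\<close>

lemma joins_segment:
  assumes c: "c \<in> atlas M" and seg: "closed_segment z w \<subseteq> chart_im c"
  shows "joins (chart_inv c z) (chart_inv c w)
    (integral {0..1} (\<lambda>s. sqrt (coord_metric M c (z + s *\<^sub>R (w - z)) (w - z) (w - z))))"
proof -
  let ?l = "\<lambda>s. z + s *\<^sub>R (w - z)"
  define \<gamma> where "\<gamma> s = chart_inv c (?l s)" for s
  have mem: "?l s \<in> chart_im c" if "s \<in> {0..1}" for s
    using segment_point[OF that] seg by blast
  have cl: "continuous_on S ?l" for S by (intro continuous_intros)
  have dl: "(?l has_vector_derivative (w - z)) (at s within S)" for s S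
    by (auto intro!: derivative_eq_intros)
  have cont: "continuous_on {0..1} \<gamma>"
    unfolding \<gamma>_def by (rule continuous_on_compose2[OF chartD(4)[OF c] cl]) (use mem in auto)
  have in_c: "\<gamma> s \<in> fst c" "snd c (\<gamma> s) = ?l s" if "s \<in> {0..1}" for s
    using mem[OF that] chartD[OF c] by (auto simp: \<gamma>_def)
  have dc: "((snd c \<circ> \<gamma>) has_vector_derivative (w - z)) (at s within {0..1})" if "s \<in> {0..1}" for s
    by (rule has_vector_derivative_transform[OF that _ dl]) (use in_c in auto)
  have C1: "C1_segment M 0 1 \<gamma>"
  proof (rule C1_segmentI[where v = "\<lambda>d s. frechet_derivative (transition c d) (at (?l s)) (w - z)"])
    show "((snd d \<circ> \<gamma>) has_vector_derivative frechet_derivative (transition c d) (at (?l s)) (w - z))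
        (at s within {0..1})" if d: "d \<in> atlas M" "s \<in> {0..1}" "\<gamma> s \<in> fst d" for d s
    proof (rule curve_chart_change[where V = "fst c \<inter> fst d" and h = "transition c d" and x = "snd c"
          and H = "frechet_derivative (transition c d) (at (?l s))"])
      show "open (fst c \<inter> fst d)" using c d chartD by blast
      show "(transition c d has_derivative frechet_derivative (transition c d) (at (?l s))) (at (snd c (\<gamma> s)))"
        using c d in_c by (metis IntI has_derivative_frechet transition_differentiable)
    qed (use c d transition(2) cont in_c dc in auto)
    show "continuous_on {s \<in> {0..1}. \<gamma> s \<in> fst d} (\<lambda>s. frechet_derivative (transition c d) (at (?l s)) (w - z))"
      if d: "d \<in> atlas M" for d
      by (rule continuous_on_compose2[OF smooth_onD(2)[OF transition(1)[OF c d]] cl])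
        (use in_c in \<open>force simp: image_iff\<close>)
  qed (use cont in auto)
  then have pc: "pc_curve M \<gamma> 0 1" by (simp add: pc_curve.seg)
  have "integral {0..1} (speed M \<gamma>) = integral {0..1} (\<lambda>s. sqrt (coord_metric M c (?l s) (w - z) (w - z)))"
  proof (rule integral_spike[of "{0, 1}"])
    fix s :: real assume s: "s \<in> {0..1} - {0, 1}"
    then have s': "s \<in> {0<..<1}" "s \<in> {0..1}" by auto
    have "vector_derivative (snd c \<circ> \<gamma>) (at s within {0..1}) = w - z"
      using vector_derivative_within_cbox[of 0 1 s "snd c \<circ> \<gamma>" "w - z"] dc s' by simp
    then show "sqrt (coord_metric M c (?l s) (w - z) (w - z)) = speed M \<gamma> s"
      using seg_speed_chart[OF _ C1 s'(2) c in_c(1)[OF s'(2)]] speed_eq_seg_speed[OF s'(1), of \<gamma>]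
        coord_metric_eq[OF c in_c(1)[OF s'(2)]] in_c(2)[OF s'(2)] by simp
  qed auto
  with pc show ?thesis
    unfolding joins_def by (intro exI[of _ \<gamma>] exI[of _ 0] exI[of _ 1]) (auto simp: \<gamma>_def)
qed

lemma riem_dist_segment_le:
  assumes c: "c \<in> atlas M" and seg: "closed_segment z w \<subseteq> chart_im c"
    and b: "\<And>y. y \<in> closed_segment z w \<Longrightarrow> sqrt (coord_metric M c y (w - z) (w - z)) \<le> b"
  shows "riem_dist M (chart_inv c z) (chart_inv c w) \<le> b"
proof -
  have mem: "z + s *\<^sub>R (w - z) \<in> closed_segment z w" if "s \<in> {0..1}" for s
    by (rule segment_point[OF that])
  have "integral {0..1} (\<lambda>s. sqrt (coord_metric M c (z + s *\<^sub>R (w - z)) (w - z) (w - z))) \<le> integral {0..1::real} (\<lambda>s. b)"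
    by (intro integral_le integrable_continuous_real continuous_intros c b mem) (use mem seg in auto)
  then show ?thesis using riem_dist_le[OF joins_segment[OF c seg]] by simp
qed

text \<open>By homogeneity unit vectors suffice, and on the compact set
  \<open>C \<times> sphere 0 1\<close> the norm attains a positive minimum and a maximum.\<close>

lemma ellipticity:
  assumes c: "c \<in> atlas M" and C: "compact C" "C \<subseteq> chart_im c"
  obtains k K where "k > 0" "K > 0"
    "\<And>z u. z \<in> C \<Longrightarrow> k * norm u \<le> sqrt (coord_metric M c z u u)"
    "\<And>z u. z \<in> C \<Longrightarrow> sqrt (coord_metric M c z u u) \<le> K * norm u"
proof (cases "C = {}")
  case True
  then show thesis using that[of 1 1] by auto
next
  case False
  let ?S = "C \<times> sphere (0 :: real^'m) 1" and ?f = "\<lambda>(z, u). sqrt (coord_metric M c z u u)"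
  have cS: "compact ?S" by (intro compact_Times C compact_sphere)
  have neS: "?S \<noteq> {}" using False by (auto intro!: exI[of _ "axis undefined 1"])
  have cf: "continuous_on ?S ?f"
    unfolding case_prod_unfold by (intro continuous_intros c) (use C in auto)
  obtain x where x: "x \<in> ?S" "\<And>y. y \<in> ?S \<Longrightarrow> ?f x \<le> ?f y"
    using continuous_attains_inf[OF cS neS cf] by blast
  obtain x' where x': "x' \<in> ?S" "\<And>y. y \<in> ?S \<Longrightarrow> ?f y \<le> ?f x'"
    using continuous_attains_sup[OF cS neS cf] by blast
  have pos: "?f y > 0" if "y \<in> ?S" for y
  proof -
    have "fst y \<in> chart_im c" "snd y \<noteq> 0" using that C by auto
    then show ?thesis
      using inner_productD(3)[OF inner_product_coord_metric[OF c], of "fst y" "snd y"]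
      by (simp add: case_prod_unfold)
  qed
  have scale: "sqrt (coord_metric M c z u u) = norm u * ?f (z, u /\<^sub>R norm u)" if "z \<in> C" "u \<noteq> 0" for z u
  proof -
    note bl = inner_productD(1)[OF inner_product_coord_metric[OF c, of z]]
    have "coord_metric M c z u u = coord_metric M c z (norm u *\<^sub>R (u /\<^sub>R norm u)) (norm u *\<^sub>R (u /\<^sub>R norm u))"
      using that by simp
    also have "\<dots> = (norm u)\<^sup>2 * coord_metric M c z (u /\<^sub>R norm u) (u /\<^sub>R norm u)"
      using C that by (subst bilinear_simps[OF bl], blast)+ (simp add: power2_eq_square)
    finally show ?thesis by (simp add: real_sqrt_mult)
  qed
  have "?f x * norm u \<le> sqrt (coord_metric M c z u u) \<and> sqrt (coord_metric M c z u u) \<le> ?f x' * norm u"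
    if z: "z \<in> C" for z u
  proof (cases "u = 0")
    case True
    then show ?thesis
      using z C inner_productD(5)[OF inner_product_coord_metric[OF c, of z]] by auto
  next
    case False
    then have "(z, u /\<^sub>R norm u) \<in> ?S" using z by simp
    from x(2)[OF this] x'(2)[OF this] show ?thesis
      unfolding scale[OF z False] by (simp add: mult.commute mult_left_mono)
  qed
  with that[of "?f x" "?f x'"] pos x(1) x'(1) show thesis by blast
qed

end

lemma inner_product_norm_equiv:
  fixes B :: "real^'m::finite \<Rightarrow> real^'m \<Rightarrow> real"
  assumes B: "inner_product B"
  obtains k where "k > 0" "\<And>u. k * norm u \<le> sqrt (B u u)"
proof -
  let ?S = "sphere (0 :: real^'m) 1" and ?f = "\<lambda>u. sqrt (B u u)"
  have neS: "?S \<noteq> {}" by (auto intro!: exI[of _ "axis undefined 1"])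
  have cf: "continuous_on ?S ?f"
    by (intro continuous_intros continuous_on_inner_product B)
  obtain x where x: "x \<in> ?S" "\<And>y. y \<in> ?S \<Longrightarrow> ?f x \<le> ?f y"
    using continuous_attains_inf[OF compact_sphere neS cf] by blast
  have "x \<noteq> 0" using x(1) by auto
  then have "?f x > 0" using inner_productD(3)[OF B, of x] by simp
  moreover have "?f x * norm u \<le> ?f u" for u
  proof (cases "u = 0")
    case True
    then show ?thesis using inner_productD(5)[OF B] by simp
  next
    case False
    have "B u u = B (norm u *\<^sub>R (u /\<^sub>R norm u)) (norm u *\<^sub>R (u /\<^sub>R norm u))"
      using False by simp
    also have "\<dots> = (norm u)\<^sup>2 * B (u /\<^sub>R norm u) (u /\<^sub>R norm u)"
      by (subst bilinear_simps[OF inner_productD(1)[OF B]])+ (simp add: power2_eq_square)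
    finally have "?f u = norm u * ?f (u /\<^sub>R norm u)" by (simp add: real_sqrt_mult)
    then show ?thesis using x(2)[of "u /\<^sub>R norm u"] False by (simp add: mult.commute mult_left_mono)
  qed
  ultimately show thesis by (rule that)
qed

section \<open>Lower bounds on the distance, and the metric topology\<close>

context riemannian
begin

text \<open>While the curve stays in the \<open>B\<close>-ball of radius \<open>r\<close>, its
  length controls the displacement, so a curve that is too short can never reach the boundary.
  \<open>B\<close> is left general to permit both the Euclidean inner product and a frozen
  metric.\<close>

lemma curve_stays_in_ball:
  assumes c: "c \<in> atlas M" and B: "inner_product B" and r: "\<kappa> > 0"
    and ball: "\<And>z. sqrt (B (z - z0) (z - z0)) < r \<Longrightarrow> z \<in> chart_im c"
    and le: "\<And>z u. sqrt (B (z - z0) (z - z0)) < r \<Longrightarrow> sqrt (B u u) \<le> \<kappa> * sqrt (coord_metric M c z u u)"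
    and \<gamma>: "pc_curve M \<gamma> a b" "\<gamma> a = chart_inv c z0"
    and L: "\<kappa> * integral {a..b} (speed M \<gamma>) < r"
  shows "\<gamma> b \<in> fst c"
    "sqrt (B (snd c (\<gamma> b) - z0) (snd c (\<gamma> b) - z0)) \<le> \<kappa> * integral {a..b} (speed M \<gamma>)"
proof -
  let ?n = "\<lambda>u. sqrt (B u u)" and ?L = "integral {a..b} (speed M \<gamma>)"
  note bl = inner_productD(1)[OF B]
  have ab: "a < b" using \<gamma> pc_curve_less by blast
  have r0: "r > 0" using L r length_nonneg[of a b \<gamma>] by (smt (verit) mult_nonneg_nonneg)
  have cn: "continuous_on S (\<lambda>z. ?n (z - z0))" for S
    by (intro continuous_intros continuous_on_inner_product B)
  have n0: "?n (z0 - z0) = 0" using inner_productD(5)[OF B] by simp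
  define W where "W = chart_inv c ` {z. ?n (z - z0) < r}"
  have "open {z. ?n (z - z0) < r}"
    using open_Collect_less[OF cn[of UNIV] continuous_on_const] by simp
  then have W: "open W" unfolding W_def using ball by (intro open_chart_inv_image c) auto
  have WD: "p \<in> fst c" "?n (snd c p - z0) < r" if "p \<in> W" for p
    using that ball chartD[OF c] by (auto simp: W_def)
  have cont: "continuous_on {a..b} \<gamma>" by (rule pc_curve_continuous_on[OF \<gamma>(1)])
  have est: "?n (snd c (\<gamma> t) - z0) \<le> \<kappa> * ?L" if t: "a < t" "t \<le> b" and in_W: "\<gamma> ` {a..t} \<subseteq> W" for t
  proof -
    have pct: "pc_curve M \<gamma> a t"
      using \<gamma>(1) t pc_curve_split(1)[OF \<gamma>(1), of t] by (cases "t = b") auto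
    obtain S where S: "finite S" "speed M \<gamma> integrable_on {a..t}"
      "\<forall>s\<in>{a..t} - S. s \<in> {a<..<t} \<and> (\<forall>c\<in>atlas M. \<gamma> s \<in> fst c \<longrightarrow>
       (\<exists>v. ((snd c \<circ> \<gamma>) has_vector_derivative v) (at s) \<and> speed M \<gamma> s = sqrt (metric M c (\<gamma> s) v v)))"
      using pc_curve_speed[OF pct] by blast
    \<comment> \<open>Pairing with the fixed end displacement \<open>w\<close> is linear in the
      position, so \<open>B w w\<close> is the integral of \<open>B v w\<close> over the velocities
      \<open>v\<close>; the norm itself is never differentiated.\<close>
    define w where "w = snd c (\<gamma> t) - z0"
    define D where "D s = (if s \<in> S then 0 else B (vector_derivative (snd c \<circ> \<gamma>) (at s)) w)" for s
    have inc: "\<gamma> s \<in> fst c" if "s \<in> {a..t}" for s using in_W WD that by blast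
    have "(D has_integral B (snd c (\<gamma> t) - z0) w - B (snd c (\<gamma> a) - z0) w) {a..t}"
    proof (rule fundamental_theorem_of_calculus_interior_strong[OF S(1)])
      show "((\<lambda>s. B (snd c (\<gamma> s) - z0) w) has_vector_derivative D s) (at s)" if s: "s \<in> {a<..<t} - S" for s
      proof -
        have "s \<in> {a..t} - S" using s by auto
        then obtain v where v: "((snd c \<circ> \<gamma>) has_vector_derivative v) (at s)"
          using S(3)[rule_format, of s] c inc[of s] by auto
        have "((\<lambda>s. snd c (\<gamma> s) - z0) has_vector_derivative v) (at s)"
          using v by (auto intro!: derivative_eq_intros simp: o_def)
        from bounded_linear.has_vector_derivative[OF bounded_linear_inner_product_left[OF B] this]
        show ?thesis using vector_derivative_at[OF v] s by (simp add: D_def)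
      qed
      show "continuous_on {a..t} (\<lambda>s. B (snd c (\<gamma> s) - z0) w)"
        using t inc by (intro continuous_on_inner_product B continuous_intros
          continuous_on_compose2[OF chartD(3)[OF c] continuous_on_subset[OF cont]]) auto
    qed (use t in auto)
    moreover have "((\<lambda>s. \<kappa> * ?n w * speed M \<gamma> s) has_integral \<kappa> * ?n w * integral {a..t} (speed M \<gamma>)) {a..t}"
      using S(2) by (intro has_integral_mult_right integrable_integral)
    moreover have "D s \<le> \<kappa> * ?n w * speed M \<gamma> s" if s: "s \<in> {a..t}" for s
    proof (cases "s \<in> S")
      case True
      then show ?thesis using r speed_nonneg inner_productD(4)[OF B] by (simp add: D_def)
    next
      case False
      then obtain v where v: "((snd c \<circ> \<gamma>) has_vector_derivative v) (at s)" "speed M \<gamma> s = sqrt (metric M c (\<gamma> s) v v)"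
        using S(3)[rule_format, of s] c inc[of s] s by blast
      have "D s = B v w" using vector_derivative_at[OF v(1)] False by (simp add: D_def)
      also have "\<dots> \<le> ?n v * ?n w" by (rule inner_product_Cauchy_Schwarz[OF B])
      also have "?n v * ?n w \<le> (\<kappa> * sqrt (coord_metric M c (snd c (\<gamma> s)) v v)) * ?n w"
        using in_W s inner_productD(4)[OF B, of w] by (intro mult_right_mono le WD(2)) auto
      finally show ?thesis
        using v(2) inc[OF s] c by (simp add: coord_metric_eq ac_simps)
    qed
    ultimately have "B (snd c (\<gamma> t) - z0) w - B (snd c (\<gamma> a) - z0) w \<le> \<kappa> * ?n w * integral {a..t} (speed M \<gamma>)"
      by (rule has_integral_le)
    moreover have "B (snd c (\<gamma> a) - z0) w = 0"
      using ball[of z0] n0 r0 chartD(7)[OF c] \<gamma>(2) inner_productD(5)[OF B] by simp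
    ultimately have *: "?n w * ?n w \<le> ?n w * (\<kappa> * integral {a..t} (speed M \<gamma>))"
      using inner_productD(4)[OF B, of w] by (simp add: w_def mult.commute mult.left_commute)
    have "?n w \<le> \<kappa> * integral {a..t} (speed M \<gamma>)"
    proof (cases "?n w > 0")
      case True
      show ?thesis by (rule mult_left_le_imp_le[OF * True])
    next
      case False
      moreover have "0 \<le> \<kappa> * integral {a..t} (speed M \<gamma>)"
        using length_nonneg[of a t \<gamma>] r by simp
      ultimately show ?thesis by linarith
    qed
    also have "\<kappa> * integral {a..t} (speed M \<gamma>) \<le> \<kappa> * ?L"
      using length_split[OF \<gamma>(1), of t] t length_nonneg[of t b \<gamma>] r
      by (intro mult_left_mono) (cases "t = b", auto)
    finally show ?thesis by (simp add: w_def)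
  qed
  have aW: "\<gamma> a \<in> W" using \<gamma>(2) n0 r0 by (auto simp: W_def)
  have all: "\<gamma> ` {a..b} \<subseteq> W"
  proof (rule ccontr)
    assume "\<not> \<gamma> ` {a..b} \<subseteq> W"
    define X where "X = {a..b} \<inter> \<gamma> -` (- W)"
    have "closed X" unfolding X_def using cont W by (intro continuous_closed_preimage) auto
    then have X: "compact X" by (auto simp: compact_eq_bounded_closed X_def intro: bounded_subset[OF bounded_closed_interval])
    have "X \<noteq> {}" using \<open>\<not> \<gamma> ` {a..b} \<subseteq> W\<close> by (auto simp: X_def)
    \<comment> \<open>The first exit time. Before it the curve stays in the smaller set
      \<open>W'\<close>, which is compact because \<open>B\<close>-balls are bounded in the
      Euclidean norm; by closedness \<open>\<gamma> t\<close> lies in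
      \<open>W' \<subseteq> W\<close> after all.\<close>
    then obtain t where t: "t \<in> X" "\<And>s. s \<in> X \<Longrightarrow> t \<le> s"
      using compact_attains_inf[OF X] by blast
    have ta: "a < t" "t \<le> b" "\<gamma> t \<notin> W" using t(1) aW by (auto simp: X_def less_le)
    define W' where "W' = chart_inv c ` {z. ?n (z - z0) \<le> \<kappa> * ?L}"
    have "compact {z. ?n (z - z0) \<le> \<kappa> * ?L}"
    proof -
      obtain k where k: "k > 0" "\<And>u. k * norm u \<le> ?n u" using inner_product_norm_equiv[OF B] by blast
      have "dist z0 z \<le> \<kappa> * ?L / k" if "?n (z - z0) \<le> \<kappa> * ?L" for z
        using k(2)[of "z - z0"] that k(1) by (simp add: field_simps dist_norm norm_minus_commute)
      then have "bounded {z. ?n (z - z0) \<le> \<kappa> * ?L}" unfolding bounded_def by blast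
      moreover have "closed {z. ?n (z - z0) \<le> \<kappa> * ?L}"
        using closed_Collect_le[OF cn[of UNIV] continuous_on_const] by simp
      ultimately show ?thesis by (simp add: compact_eq_bounded_closed)
    qed
    then have "compact W'" unfolding W'_def using ball L by (intro compact_chart_inv_image c) auto
    then have clW': "closed W'" by (rule compact_imp_closed)
    have W'W: "W' \<subseteq> W" using L by (auto simp: W'_def W_def)
    have in_W': "\<gamma> s \<in> W'" if s: "a < s" "s < t" for s
    proof -
      have "\<gamma> ` {a..s} \<subseteq> W"
      proof
        fix p assume "p \<in> \<gamma> ` {a..s}"
        then obtain s' where s': "s' \<in> {a..s}" "p = \<gamma> s'" by blast
        then have "s' \<notin> X" using t(2)[of s'] s by force
        then show "p \<in> W" using s' s ta by (auto simp: X_def)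
      qed
      moreover from this have "\<gamma> s \<in> W" using s by auto
      ultimately have "?n (snd c (\<gamma> s) - z0) \<le> \<kappa> * ?L" "\<gamma> s \<in> fst c"
        using est[of s] s ta WD(1)[of "\<gamma> s"] by auto
      then show ?thesis unfolding W'_def using chartD(5)[OF c] by (intro image_eqI[of _ _ "snd c (\<gamma> s)"]) auto
    qed
    have "((\<gamma>) \<longlongrightarrow> \<gamma> t) (at t within {a..b})" using cont ta by (simp add: continuous_on_def)
    then have lim: "(\<gamma> \<longlongrightarrow> \<gamma> t) (at t within {a<..<t})"
      by (rule tendsto_within_subset) (use ta in auto)
    have "\<gamma> t \<in> W'"
    proof (rule Lim_in_closed_set[OF clW' _ _ lim])
      show "\<forall>\<^sub>F s in at t within {a<..<t}. \<gamma> s \<in> W'"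
        unfolding eventually_at_topological by (intro exI[of _ UNIV]) (use in_W' in auto)
      show "at t within {a<..<t} \<noteq> bot"
        using ta by (simp add: at_within_eq_bot_iff)
    qed
    with W'W ta show False by blast
  qed
  show "\<gamma> b \<in> fst c" using all ab by (intro WD(1)) auto
  show "?n (snd c (\<gamma> b) - z0) \<le> \<kappa> * ?L" by (rule est) (use all ab in auto)
qed

text \<open>Connectedness: coordinate balls are reachable from their centres, so the points
  reachable from \<open>p\<close> form an open set with open complement. The infimum in
  \<open>riem_dist\<close> is thus over a nonempty set.\<close>

lemma ex_joins: "\<exists>L. joins p q L"
proof -
  define R where "R = {q. \<exists>L. joins p q L}"
  have nbhd: "\<exists>V. open V \<and> x \<in> V \<and> (\<forall>y\<in>V. \<exists>L. joins x y L)" for x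
  proof -
    obtain c where c: "c \<in> atlas M" "x \<in> fst c" by (rule ex_chart)
    then obtain \<rho> where \<rho>: "\<rho> > 0" "ball (snd c x) \<rho> \<subseteq> chart_im c"
      using chartD(2)[OF c(1)] by (metis image_eqI open_contains_ball)
    have "\<exists>L. joins x y L" if y: "y \<in> chart_inv c ` ball (snd c x) \<rho>" for y
    proof -
      obtain z where z: "z \<in> ball (snd c x) \<rho>" "y = chart_inv c z" using y by blast
      have "closed_segment (snd c x) z \<subseteq> ball (snd c x) \<rho>"
        using z \<rho> by (intro closed_segment_subset) auto
      then show ?thesis
        using joins_segment[OF c(1), of "snd c x" z] \<rho> chartD(5)[OF c] z by auto
    qed
    moreover have "x \<in> chart_inv c ` ball (snd c x) \<rho>"
      using \<rho> chartD(5)[OF c] by (metis centre_in_ball imageI)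
    ultimately show ?thesis
      using open_chart_inv_image[OF c(1) open_ball \<rho>(2)] by blast
  qed
  have "open R"
  proof (subst open_subopen, intro ballI)
    fix x assume x: "x \<in> R"
    obtain V where V: "open V" "x \<in> V" "\<forall>y\<in>V. \<exists>L. joins x y L" using nbhd by blast
    have "V \<subseteq> R" using V(3) x unfolding R_def by (blast intro: joins_trans)
    with V show "\<exists>T. open T \<and> x \<in> T \<and> T \<subseteq> R" by blast
  qed
  moreover have "open (- R)"
  proof (subst open_subopen, intro ballI)
    fix x assume x: "x \<in> - R"
    obtain V where V: "open V" "x \<in> V" "\<forall>y\<in>V. \<exists>L. joins x y L" using nbhd by blast
    have "V \<subseteq> - R" using V(3) x unfolding R_def by (blast intro: joins_trans joins_sym)
    with V show "\<exists>T. open T \<and> x \<in> T \<and> T \<subseteq> - R" by blast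
  qed
  moreover have "p \<in> R" using nbhd[of p] by (auto simp: R_def)
  moreover have "connected (UNIV :: 'p set)" using manifold by (simp add: riemannian_manifold_def)
  ultimately have "R = UNIV"
    unfolding connected_def by (metis Compl_disjoint Compl_partition Int_UNIV_right UNIV_I
      compl_bot_eq double_compl empty_iff inf_commute subset_UNIV)
  then show ?thesis by (auto simp: R_def)
qed

lemma ex_short_joins:
  assumes "riem_dist M p q < r"
  shows "\<exists>L. joins p q L \<and> L < r"
proof -
  have "{L. joins p q L} \<noteq> {}" using ex_joins by blast
  moreover have "Inf {L. joins p q L} < r" using assms by (simp add: riem_dist_eq)
  ultimately have "\<exists>L\<in>{L. joins p q L}. L < r" by (rule cInf_lessD)
  then show ?thesis by blast
qed

lemma riem_dist_nonneg: "riem_dist M p q \<ge> 0"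
  unfolding riem_dist_eq using ex_joins by (intro cInf_greatest) (auto intro: joins_nonneg)

lemma riem_dist_commute: "riem_dist M p q = riem_dist M q p"
proof -
  have "{L. joins p q L} = {L. joins q p L}" using joins_sym by blast
  then show ?thesis by (simp add: riem_dist_eq)
qed

lemma riem_dist_triangle: "riem_dist M p r \<le> riem_dist M p q + riem_dist M q r"
proof (rule field_le_epsilon)
  fix e :: real assume "e > 0"
  then have e2: "riem_dist M p q < riem_dist M p q + e / 2" "riem_dist M q r < riem_dist M q r + e / 2"
    by auto
  obtain L L' where L: "joins p q L" "L < riem_dist M p q + e / 2"
    "joins q r L'" "L' < riem_dist M q r + e / 2"
    using ex_short_joins[OF e2(1)] ex_short_joins[OF e2(2)] by blast
  then have "riem_dist M p r \<le> L + L'" by (intro riem_dist_le joins_trans)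
  with L show "riem_dist M p r \<le> riem_dist M p q + riem_dist M q r + e" by linarith
qed

text \<open>The infimum over the curves that are short enough for
  \<open>curve_stays_in_ball\<close>; by the strict inequality in \<open>q\<close> the nearly
  minimal ones are.\<close>

lemma riem_dist_chart_lower:
  assumes c: "c \<in> atlas M" and B: "inner_product B" and \<kappa>: "\<kappa> > 0"
    and ball: "\<And>z. sqrt (B (z - z0) (z - z0)) < r \<Longrightarrow> z \<in> chart_im c"
    and le: "\<And>z u. sqrt (B (z - z0) (z - z0)) < r \<Longrightarrow> sqrt (B u u) \<le> \<kappa> * sqrt (coord_metric M c z u u)"
    and q: "\<kappa> * riem_dist M (chart_inv c z0) q < r"
  shows "q \<in> fst c"
    "sqrt (B (snd c q - z0) (snd c q - z0)) \<le> \<kappa> * riem_dist M (chart_inv c z0) q"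
proof -
  let ?d = "riem_dist M (chart_inv c z0) q"
  have *: "q \<in> fst c \<and> sqrt (B (snd c q - z0) (snd c q - z0)) \<le> \<kappa> * L"
    if L: "joins (chart_inv c z0) q L" "\<kappa> * L < r" for L
  proof -
    obtain \<gamma> a b where "pc_curve M \<gamma> a b" "\<gamma> a = chart_inv c z0" "\<gamma> b = q" "integral {a..b} (speed M \<gamma>) = L"
      using L(1) unfolding joins_def by blast
    with curve_stays_in_ball[where B = B and ?z0.0 = z0 and r = r and \<kappa> = \<kappa> and \<gamma> = \<gamma> and a = a and b = b,
        OF c B \<kappa> ball le] L(2)
    show ?thesis by auto
  qed
  have "?d < r / \<kappa>" using q \<kappa> by (simp add: field_simps)
  then have ev: "\<exists>L. joins (chart_inv c z0) q L \<and> \<kappa> * L < r \<and> L < ?d + e" if "e > 0" for e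
    using ex_short_joins[of "chart_inv c z0" q "min (r / \<kappa>) (?d + e)"] that \<kappa> by (auto simp: field_simps)
  from ev[of 1] * show "q \<in> fst c" by auto
  show "sqrt (B (snd c q - z0) (snd c q - z0)) \<le> \<kappa> * ?d"
  proof (rule field_le_epsilon)
    fix e :: real assume "e > 0"
    then obtain L where "joins (chart_inv c z0) q L" "\<kappa> * L < r" "L < ?d + e / \<kappa>"
      using ev[of "e / \<kappa>"] \<kappa> by auto
    with * have "sqrt (B (snd c q - z0) (snd c q - z0)) \<le> \<kappa> * L" "\<kappa> * L \<le> \<kappa> * ?d + e"
      using \<kappa> by (auto simp: field_simps)
    then show "sqrt (B (snd c q - z0) (snd c q - z0)) \<le> \<kappa> * ?d + e" by linarith
  qed
qed

text \<open>One half of the equality of topologies, and the reason why distinct points have positive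
  distance: near \<open>p\<close> the coordinate distance is at most \<open>1 / k\<close> times the
  Riemannian one.\<close>

lemma open_contains_riem_ball:
  assumes "open S" "p \<in> S"
  obtains r where "r > 0" "{q. riem_dist M p q < r} \<subseteq> S"
proof -
  obtain c where c: "c \<in> atlas M" "p \<in> fst c" by (rule ex_chart)
  have "open (snd c ` (fst c \<inter> S))" by (intro open_chart_image c open_Int chartD(1) assms) auto
  then obtain \<rho> where \<rho>: "\<rho> > 0" "cball (snd c p) \<rho> \<subseteq> snd c ` (fst c \<inter> S)"
    using c assms by (metis IntI image_eqI open_contains_cball)
  then have sub: "cball (snd c p) \<rho> \<subseteq> chart_im c" by blast
  obtain k K where k: "k > 0" "\<And>z u. z \<in> cball (snd c p) \<rho> \<Longrightarrow> k * norm u \<le> sqrt (coord_metric M c z u u)"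
    using ellipticity[OF c(1) compact_cball sub] by metis
  have p: "chart_inv c (snd c p) = p" by (rule chartD(5)[OF c])
  have "q \<in> S" if q: "riem_dist M p q < k * \<rho>" for q
  proof -
    have in_cball: "z \<in> cball (snd c p) \<rho>" if "sqrt ((z - snd c p) \<bullet> (z - snd c p)) < \<rho>" for z
      using that by (simp add: norm_eq_sqrt_inner[symmetric] dist_norm norm_minus_commute)
    have *: "q \<in> fst c" "sqrt ((snd c q - snd c p) \<bullet> (snd c q - snd c p)) \<le> (1 / k) * riem_dist M (chart_inv c (snd c p)) q"
    proof (rule_tac [!] riem_dist_chart_lower[OF c(1) inner_product_inner, where r = \<rho>])
      show "sqrt (u \<bullet> u) \<le> 1 / k * sqrt (coord_metric M c z u u)"
        if "sqrt ((z - snd c p) \<bullet> (z - snd c p)) < \<rho>" for z u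
        using k(2)[OF in_cball[OF that], of u] k(1) by (simp add: norm_eq_sqrt_inner[symmetric] field_simps)
      then show "sqrt (u \<bullet> u) \<le> 1 / k * sqrt (coord_metric M c z u u)"
        if "sqrt ((z - snd c p) \<bullet> (z - snd c p)) < \<rho>" for z u using that by blast
    qed (use k(1) q in_cball sub in \<open>auto simp: p field_simps\<close>)
    have "k * norm (snd c q - snd c p) < k * \<rho>"
    proof (rule le_less_trans[OF _ q])
      show "k * norm (snd c q - snd c p) \<le> riem_dist M p q"
        using *(2) k(1) unfolding p norm_eq_sqrt_inner[symmetric] by (simp add: field_simps)
    qed
    then have "norm (snd c q - snd c p) < \<rho>" using k(1) by simp
    then have "snd c q \<in> snd c ` (fst c \<inter> S)"
      using \<rho>(2) by (auto simp: dist_norm norm_minus_commute)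
    then show ?thesis using *(1) inj_on_chart[OF c(1)] by (auto dest: inj_onD)
  qed
  then show thesis using that[of "k * \<rho>"] k(1) \<rho>(1) by auto
qed

text \<open>The other half: segments in a coordinate ball with \<open>K * \<sigma> \<le> r\<close>
  have length below \<open>r\<close>.\<close>

lemma riem_ball_contains_open:
  assumes "r > 0"
  obtains V where "open V" "p \<in> V" "V \<subseteq> {q. riem_dist M p q < r}"
proof -
  obtain c where c: "c \<in> atlas M" "p \<in> fst c" by (rule ex_chart)
  obtain \<rho> where \<rho>: "\<rho> > 0" "cball (snd c p) \<rho> \<subseteq> chart_im c"
    using chartD(2)[OF c(1)] c by (metis image_eqI open_contains_cball)
  obtain K where K: "K > 0" "\<And>z u. z \<in> cball (snd c p) \<rho> \<Longrightarrow> sqrt (coord_metric M c z u u) \<le> K * norm u"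
    using ellipticity[OF c(1) compact_cball \<rho>(2)] by metis
  define \<sigma> where "\<sigma> = min \<rho> (r / K)"
  have \<sigma>: "\<sigma> > 0" "\<sigma> \<le> \<rho>" "K * \<sigma> \<le> r" using \<rho> K assms by (auto simp: \<sigma>_def min_def field_simps)
  show thesis
  proof (rule that[of "chart_inv c ` ball (snd c p) \<sigma>"])
    show "open (chart_inv c ` ball (snd c p) \<sigma>)"
      using \<sigma> \<rho> by (intro open_chart_inv_image c) auto
    show "p \<in> chart_inv c ` ball (snd c p) \<sigma>"
      using \<sigma> chartD(5)[OF c] by (metis centre_in_ball imageI)
    show "chart_inv c ` ball (snd c p) \<sigma> \<subseteq> {q. riem_dist M p q < r}"
    proof (clarsimp simp del: mem_ball)
      fix z assume z: "z \<in> ball (snd c p) \<sigma>"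
      have seg: "closed_segment (snd c p) z \<subseteq> cball (snd c p) \<rho>"
        using z \<sigma> \<rho> by (intro closed_segment_subset) auto
      have "riem_dist M (chart_inv c (snd c p)) (chart_inv c z) \<le> K * norm (z - snd c p)"
        by (rule riem_dist_segment_le[OF c(1)]) (use seg \<rho> K(2) in auto)
      also have "\<dots> < K * \<sigma>"
        using z K(1) by (auto simp: dist_norm norm_minus_commute)
      finally show "riem_dist M p (chart_inv c z) < r" using \<sigma> chartD(5)[OF c] by simp
    qed
  qed
qed

text \<open>Opens the way to total boundedness in terms of the same metric in which
  \<open>complete_riem\<close> expresses completeness.\<close>

sublocale RM: Metric_space UNIV "riem_dist M"
proof
  fix x y z :: 'p
  have self: "riem_dist M x x \<le> e" if "e > 0" for x e
  proof -
    obtain V where "x \<in> V" "V \<subseteq> {q. riem_dist M x q < e}"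
      using riem_ball_contains_open[OF \<open>e > 0\<close>, of x] by blast
    then show ?thesis by (auto intro: less_imp_le)
  qed
  show "riem_dist M x y = 0 \<longleftrightarrow> x = y"
  proof
    assume 0: "riem_dist M x y = 0"
    show "x = y"
    proof (rule ccontr)
      assume "x \<noteq> y"
      then obtain r where "r > 0" "{q. riem_dist M x q < r} \<subseteq> - {y}"
        using open_contains_riem_ball[of "- {y}" x] by auto
      with 0 show False by auto
    qed
  next
    assume "x = y"
    then show "riem_dist M x y = 0"
      using self[of _ x] riem_dist_nonneg[of x x] field_le_epsilon[of "riem_dist M x x" 0]
      by (simp add: antisym)
  qed
qed (rule riem_dist_nonneg riem_dist_commute riem_dist_triangle)+

lemma mtopology_euclidean: "RM.mtopology = euclidean"
proof (rule topology_eq[THEN iffD2], intro allI)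
  fix S :: "'p set"
  have "(\<forall>x\<in>S. \<exists>r>0. RM.mball x r \<subseteq> S) \<longleftrightarrow> open S"
  proof
    assume *: "\<forall>x\<in>S. \<exists>r>0. RM.mball x r \<subseteq> S"
    show "open S"
    proof (subst open_subopen, intro ballI)
      fix x assume "x \<in> S"
      then obtain r where r: "r > 0" "RM.mball x r \<subseteq> S" using * by blast
      obtain V where "open V" "x \<in> V" "V \<subseteq> {q. riem_dist M x q < r}"
        using riem_ball_contains_open[OF r(1)] by blast
      with r(2) show "\<exists>T. open T \<and> x \<in> T \<and> T \<subseteq> S" by (intro exI[of _ V]) (auto simp: subset_eq)
    qed
  next
    assume "open S"
    then show "\<forall>x\<in>S. \<exists>r>0. RM.mball x r \<subseteq> S"
      using open_contains_riem_ball[of S] by (metis RM.in_mball mem_Collect_eq subset_iff)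
  qed
  then show "openin RM.mtopology S = openin euclidean S"
    by (auto simp: RM.openin_mtopology)
qed

lemma continuous_on_riem_dist: "continuous_on S (riem_dist M p)"
proof (rule continuous_on_subset[OF _ subset_UNIV], unfold continuous_on_def, intro ballI tendstoI)
  fix q and e :: real assume "e > 0"
  then obtain V where V: "open V" "q \<in> V" "V \<subseteq> {x. riem_dist M q x < e}"
    by (rule riem_ball_contains_open)
  have "dist (riem_dist M p x) (riem_dist M p q) < e" if "x \<in> V" for x
  proof -
    have "riem_dist M q x < e" using V that by blast
    then show ?thesis
      using riem_dist_triangle[of p x q] riem_dist_triangle[of p q x] riem_dist_commute[of x q]
      by (auto simp: dist_real_def)
  qed
  with V show "\<forall>\<^sub>F x in at q. dist (riem_dist M p x) (riem_dist M p q) < e"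
    unfolding eventually_at_topological by blast
qed

lemma open_geodesic_ball: "open (geodesic_ball M p r)"
  unfolding geodesic_ball_def
  using open_Collect_less[OF continuous_on_riem_dist[of UNIV p] continuous_on_const, of r] by simp

lemma closed_riem_cball: "closed {q. riem_dist M p q \<le> r}"
  using closed_Collect_le[OF continuous_on_riem_dist[of UNIV p] continuous_on_const, of r] by simp

section \<open>Hopf--Rinow: closed balls of a complete manifold are compact\<close>

text \<open>The substitute for minimising geodesics: cut a nearly shortest curve where its distance
  from \<open>p\<close> is exactly \<open>r\<close>; the remainder is shorter than
  \<open>2 * \<delta>\<close>.\<close>

lemma riem_dist_between:
  assumes d: "riem_dist M p q \<le> r + \<delta>" and r: "0 \<le> r" and \<delta>: "\<delta> > 0"
  obtains x where "riem_dist M p x \<le> r" "riem_dist M x q < 2 * \<delta>"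
proof (cases "riem_dist M p q \<le> r")
  case True
  then show thesis using that[of q] \<delta> by simp
next
  case False
  obtain L where L: "joins p q L" "L < r + 2 * \<delta>"
    using ex_short_joins[of p q "r + 2 * \<delta>"] d \<delta> by auto
  then obtain \<gamma> where \<gamma>: "pc_curve M \<gamma> 0 1" "\<gamma> 0 = p" "\<gamma> 1 = q" "integral {0..1} (speed M \<gamma>) = L"
    using joinsE[of p q L 0 1] by auto
  have "continuous_on {0..1} (\<lambda>s. riem_dist M p (\<gamma> s))"
    by (rule continuous_on_compose2[OF continuous_on_riem_dist pc_curve_continuous_on[OF \<gamma>(1)]]) auto
  then obtain s where s: "0 \<le> s" "s \<le> 1" "riem_dist M p (\<gamma> s) = r"
    using IVT'[of "\<lambda>s. riem_dist M p (\<gamma> s)" 0 r 1] \<gamma> False r by auto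
  have le: "riem_dist M (\<gamma> a) (\<gamma> b) \<le> integral {a..b} (speed M \<gamma>)" if "pc_curve M \<gamma> a b" for a b
    using that by (intro riem_dist_le) (auto simp: joins_def)
  have "s \<noteq> 1" using s False \<gamma> by auto
  show thesis
  proof (cases "s = 0")
    case True
    then have "r = 0" using s \<gamma> by simp
    moreover have "riem_dist M p q \<le> L" using L riem_dist_le by blast
    ultimately show thesis using that[of p] L by simp
  next
    case False
    then have s': "0 < s" "s < 1" using s \<open>s \<noteq> 1\<close> by auto
    have "r \<le> integral {0..s} (speed M \<gamma>)" "riem_dist M (\<gamma> s) q \<le> integral {s..1} (speed M \<gamma>)"
      using le[OF pc_curve_split(1)[OF \<gamma>(1) s']] le[OF pc_curve_split(2)[OF \<gamma>(1) s']] s \<gamma> by auto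
    with length_split[OF \<gamma>(1) s'] L \<gamma>(4) show thesis using that[of "\<gamma> s"] s by simp
  qed
qed

lemma locally_compact_riem_ball:
  obtains e where "e > 0" "compact {q. riem_dist M p q \<le> e}"
proof -
  obtain c where c: "c \<in> atlas M" "p \<in> fst c" by (rule ex_chart)
  obtain \<rho> where \<rho>: "\<rho> > 0" "cball (snd c p) \<rho> \<subseteq> chart_im c"
    using chartD(2)[OF c(1)] c by (metis image_eqI open_contains_cball)
  have "open (chart_inv c ` ball (snd c p) \<rho>)" using \<rho> by (intro open_chart_inv_image c) auto
  moreover have "p \<in> chart_inv c ` ball (snd c p) \<rho>"
    using \<rho> chartD(5)[OF c] by (metis centre_in_ball imageI)
  ultimately obtain r where r: "r > 0" "{q. riem_dist M p q < r} \<subseteq> chart_inv c ` ball (snd c p) \<rho>"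
    by (rule open_contains_riem_ball)
  have "compact (chart_inv c ` cball (snd c p) \<rho>)" by (intro compact_chart_inv_image c \<rho> compact_cball)
  moreover have "{q. riem_dist M p q \<le> r / 2} \<subseteq> chart_inv c ` cball (snd c p) \<rho>"
  proof -
    have "{q. riem_dist M p q \<le> r / 2} \<subseteq> {q. riem_dist M p q < r}" using r(1) by auto
    also note r(2)
    also have "chart_inv c ` ball (snd c p) \<rho> \<subseteq> chart_inv c ` cball (snd c p) \<rho>" by auto
    finally show ?thesis .
  qed
  then have "{q. riem_dist M p q \<le> r / 2} = {q. riem_dist M p q \<le> r / 2} \<inter> chart_inv c ` cball (snd c p) \<rho>"
    by blast
  ultimately have "compact {q. riem_dist M p q \<le> r / 2}"
    using closed_Int_compact[OF closed_riem_cball] by metis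
  with r(1) that[of "r / 2"] show thesis by simp
qed

text \<open>The length space argument, free of geodesics: a compact ball can be enlarged by local
  compactness, and a limit of compact balls is totally bounded by \<open>riem_dist_between\<close>,
  hence compact by completeness. So there is no first radius at which compactness fails.\<close>

theorem Hopf_Rinow:
  assumes complete: "complete_riem M"
  shows "compact {q. riem_dist M p q \<le> r}"
proof -
  define C where "C s = {q. riem_dist M p q \<le> s}" for s
  have cl: "closed (C s)" for s unfolding C_def by (rule closed_riem_cball)
  have mono: "compact (C s)" if "compact (C s')" "s \<le> s'" for s s'
  proof -
    have "C s = C s \<inter> C s'" using that by (auto simp: C_def)
    then show ?thesis using closed_Int_compact[OF cl that(1)] by metis
  qed
  have grow: "\<exists>\<delta>>0. compact (C (s + \<delta>))" if s: "s \<ge> 0" "compact (C s)" for s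
  proof -
    obtain e where e: "\<And>x. e x > 0" "\<And>x. compact {q. riem_dist M x q \<le> e x}"
    proof -
      have "\<forall>x. \<exists>e. e > 0 \<and> compact {q. riem_dist M x q \<le> e}" using locally_compact_riem_ball by blast
      from choice[OF this] that show thesis by blast
    qed
    have "\<exists>D. D \<subseteq> C s \<and> finite D \<and> C s \<subseteq> (\<Union>x\<in>D. geodesic_ball M x (e x / 2))"
    proof (rule compactE_image[OF s(2), of "C s" "\<lambda>x. geodesic_ball M x (e x / 2)"])
      show "C s \<subseteq> (\<Union>x\<in>C s. geodesic_ball M x (e x / 2))"
        using e(1) by (auto simp: geodesic_ball_def)
    qed (auto intro: open_geodesic_ball)
    then obtain D where D: "finite D" "C s \<subseteq> (\<Union>x\<in>D. geodesic_ball M x (e x / 2))" by blast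
    \<comment> \<open>A point of the enlarged ball is within
      \<open>2 * \<delta> \<le> e x / 2\<close> of some \<open>y\<close> in the old one, and
      \<open>y\<close> is within \<open>e x / 2\<close> of \<open>x\<close>. The entry 1 covers an
      empty \<open>D\<close>.\<close>
    define \<delta> where "\<delta> = Min (insert 1 ((\<lambda>x. e x / 4) ` D))"
    have \<delta>: "\<delta> > 0" "\<And>x. x \<in> D \<Longrightarrow> \<delta> \<le> e x / 4"
      unfolding \<delta>_def using D(1) e(1) by (simp, intro Min_le) auto
    have "C (s + \<delta>) \<subseteq> (\<Union>x\<in>D. {q. riem_dist M x q \<le> e x})"
    proof
      fix q assume "q \<in> C (s + \<delta>)"
      then obtain y where y: "riem_dist M p y \<le> s" "riem_dist M y q < 2 * \<delta>"
        using riem_dist_between[of p q s \<delta>] s \<delta> by (auto simp: C_def)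
      then obtain x where x: "x \<in> D" "riem_dist M x y < e x / 2"
        using D(2) by (auto simp: C_def geodesic_ball_def subset_iff)
      have "riem_dist M x q \<le> e x"
        using riem_dist_triangle[of x q y] x y \<delta>(2)[of x] by linarith
      then show "q \<in> (\<Union>x\<in>D. {q. riem_dist M x q \<le> e x})" using x by blast
    qed
    then have "C (s + \<delta>) = C (s + \<delta>) \<inter> (\<Union>x\<in>D. {q. riem_dist M x q \<le> e x})" by blast
    moreover have "compact (\<Union>x\<in>D. {q. riem_dist M x q \<le> e x})" using D e by (intro compact_UN) auto
    ultimately have "compact (C (s + \<delta>))" using closed_Int_compact[OF cl] by metis
    with \<delta> show ?thesis by blast
  qed
  have limit: "compact (C s)" if s: "s > 0" "\<And>s'. 0 \<le> s' \<Longrightarrow> s' < s \<Longrightarrow> compact (C s')" for s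
  proof -
    have "RM.mtotally_bounded (C s)"
      unfolding RM.mtotally_bounded_def
    proof (intro allI impI)
      fix e :: real assume e: "e > 0"
      \<comment> \<open>Points of \<open>C s\<close> are within \<open>2 * (e / 5)\<close> of the
        smaller ball, so its net of mesh \<open>e / 2\<close> serves \<open>C s\<close> with mesh
        below \<open>e\<close>; \<open>max 0\<close> keeps the radius nonnegative.\<close>
      define s' where "s' = max 0 (s - e / 5)"
      have s': "0 \<le> s'" "s' < s" "s \<le> s' + e / 5" using s e by (auto simp: s'_def)
      have "compactin RM.mtopology (C s')" using s(2)[OF s'(1,2)] by (simp add: mtopology_euclidean)
      then have "RM.mtotally_bounded (C s')" by (rule RM.compactin_imp_mtotally_bounded)
      then obtain D where D: "finite D" "D \<subseteq> C s'" "C s' \<subseteq> (\<Union>x\<in>D. RM.mball x (e / 2))"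
        using e unfolding RM.mtotally_bounded_def by (meson half_gt_zero)
      have "C s \<subseteq> (\<Union>x\<in>D. RM.mball x e)"
      proof
        fix q assume "q \<in> C s"
        then have "riem_dist M p q \<le> s' + e / 5" using s' by (simp add: C_def)
        then obtain y where y: "riem_dist M p y \<le> s'" "riem_dist M y q < 2 * (e / 5)"
          using riem_dist_between[of p q s' "e / 5"] s' e by auto
        then obtain x where x: "x \<in> D" "riem_dist M x y < e / 2"
          using D(3) by (auto simp: C_def subset_iff)
        have "riem_dist M x q < e" using riem_dist_triangle[of x q y] x y e by linarith
        then show "q \<in> (\<Union>x\<in>D. RM.mball x e)" using x by auto
      qed
      moreover have "D \<subseteq> C s" using D(2) s' by (auto simp: C_def)
      ultimately show "\<exists>K. finite K \<and> K \<subseteq> C s \<and> C s \<subseteq> (\<Union>x\<in>K. RM.mball x e)"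
        using D(1) by blast
    qed
    then have "compactin RM.mtopology (RM.mtopology closure_of C s)"
      using RM.mtotally_bounded_eq_compact_closure_of complete by (simp add: complete_riem_def)
    then show ?thesis using cl by (simp add: mtopology_euclidean closure_closed)
  qed
  have C0: "compact (C 0)"
  proof -
    have "x = p" if "riem_dist M p x \<le> 0" for x
      using that riem_dist_nonneg[of p x] RM.zero[of p x] by simp
    then have "C 0 = {p}" by (auto simp: C_def)
    then show ?thesis by simp
  qed
  have "compact (C r)" if r: "r \<ge> 0"
  proof (rule ccontr)
    assume nc: "\<not> compact (C r)"
    define X where "X = {s. 0 \<le> s \<and> \<not> compact (C s)}"
    have bdd: "bdd_below X" by (auto simp: X_def)
    have X: "r \<in> X" using nc r by (simp add: X_def)
    define s where "s = Inf X"
    have s0: "s \<ge> 0" unfolding s_def using X by (intro cInf_greatest) (auto simp: X_def)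
    have below: "compact (C s')" if "0 \<le> s'" "s' < s" for s'
      using cInf_lower[OF _ bdd, of s'] that by (auto simp: X_def s_def)
    have "compact (C s)" using limit[OF _ below] s0 C0 by (cases "s = 0") auto
    then obtain \<delta> where \<delta>: "\<delta> > 0" "compact (C (s + \<delta>))" using grow s0 by blast
    have "\<exists>x\<in>X. x < s + \<delta>"
      using cInf_lessD[of X "s + \<delta>"] X \<delta> by (auto simp: s_def)
    then show False using mono[OF \<delta>(2)] by (auto simp: X_def)
  qed
  moreover have "C r \<subseteq> {}" if "r < 0"
  proof
    fix x assume "x \<in> C r"
    then show "x \<in> {}" using riem_dist_nonneg[of p x] \<open>r < 0\<close> by (simp add: C_def)
  qed
  ultimately show ?thesis
    unfolding C_def by (cases "r \<ge> 0") auto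
qed

end

section \<open>Gram matrices and orthonormal bases\<close>

definition gram :: "(real^'m \<Rightarrow> real^'m \<Rightarrow> real) \<Rightarrow> real^'m^'m::finite" where
  "gram B = (\<chi> i j. B (axis i 1) (axis j 1))"

lemma gram_eq:
  assumes "bilinear B"
  shows "B u v = u \<bullet> (gram B *v v)"
  by (subst bilinear_expansion[OF assms])
    (simp add: inner_vec_def gram_def matrix_vector_mult_def sum_distrib_left ac_simps)

lemma matrix_vector_dot: "(A *v x) \<bullet> y = x \<bullet> (transpose A *v y)" for A :: "real^'m^'k::finite"
  using dot_lmul_matrix[of x "transpose A" y] by simp

lemma gram_matrix_mult:
  fixes A :: "real^'m^'m::finite"
  assumes "bilinear B"
  shows "gram (\<lambda>u v. B (A *v u) (A *v v)) = transpose A ** gram B ** A"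
proof -
  have "B (A *v axis i 1) (A *v axis j 1) = (transpose A ** gram B ** A) $ i $ j" for i j
  proof -
    have "B (A *v axis i 1) (A *v axis j 1) = axis i 1 \<bullet> (transpose A ** gram B ** A *v axis j 1)"
      by (subst gram_eq[OF assms]) (simp only: matrix_vector_dot matrix_vector_mul_assoc matrix_mul_assoc)
    also have "\<dots> = (transpose A ** gram B ** A) $ i $ j"
      by (simp add: inner_axis' matrix_vector_mult_basis column_def)
    finally show ?thesis .
  qed
  then show ?thesis by (simp add: gram_def[of "\<lambda>u v. B (A *v u) (A *v v)"] vec_eq_iff)
qed

text \<open>Gram-Schmidt, one normalised vector from outside the span at a time. It ensures that the
  choice operators in \<open>mean_curvature_vector\<close> and \<open>laplacian\<close> yield
  orthonormal bases.\<close>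

lemma orthonormal_family:
  fixes B :: "real^'m::finite \<Rightarrow> real^'m \<Rightarrow> real"
  assumes B: "inner_product B"
  shows "\<exists>E. orthonormal_basis B E"
proof -
  note bl = inner_productD(1)[OF B]
  have "k \<le> CARD('m) \<Longrightarrow> \<exists>E. finite E \<and> card E = k \<and> (\<forall>u\<in>E. \<forall>v\<in>E. B u v = (if u = v then 1 else 0))" for k
  proof (induction k)
    case 0
    then show ?case by (intro exI[of _ "{}"]) auto
  next
    case (Suc k)
    then obtain E where E: "finite E" "card E = k" "\<And>u v. u \<in> E \<Longrightarrow> v \<in> E \<Longrightarrow> B u v = (if u = v then 1 else 0)"
      by auto
    have "span E \<noteq> UNIV"
    proof
      assume "span E = UNIV"
      then have "dim (UNIV :: (real^'m) set) \<le> card E" using E(1) by (metis dim_le_card' dim_span)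
      then show False using E(2) Suc.prems by (simp add: dim_UNIV)
    qed
    then obtain x where x: "x \<notin> span E" by blast
    define y where "y = x - (\<Sum>e\<in>E. B x e *\<^sub>R e)"
    have "(\<Sum>e\<in>E. B x e *\<^sub>R e) \<in> span E" by (intro span_sum span_mul span_base)
    then have y0: "y \<noteq> 0" using x unfolding y_def by auto
    have By: "B y u = 0" if u: "u \<in> E" for u
    proof -
      have "B (\<Sum>e\<in>E. B x e *\<^sub>R e) u = (\<Sum>e\<in>E. B x e * B e u)"
        using linear_sum[of "\<lambda>v. B v u" "\<lambda>e. B x e *\<^sub>R e" E] bl
        by (simp add: bilinear_def bilinear_simps[OF bl])
      also have "\<dots> = (\<Sum>e\<in>E. if e = u then B x e else 0)"
        using E(3) u by (intro sum.cong) auto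
      also have "\<dots> = B x u" using E(1) u by (simp add: sum.delta)
      finally show ?thesis by (simp add: y_def bilinear_simps[OF bl])
    qed
    define z where "z = y /\<^sub>R sqrt (B y y)"
    have yy: "B y y > 0" using inner_productD(3)[OF B y0] .
    have "B z z = B y y / (sqrt (B y y))\<^sup>2"
      by (simp add: z_def bilinear_simps[OF bl] power2_eq_square field_simps)
    then have zz: "B z z = 1" using yy by simp
    have zu: "B z u = 0" "B u z = 0" if "u \<in> E" for u
      using By[OF that] inner_productD(2)[OF B, of u z] by (auto simp: z_def bilinear_simps[OF bl])
    have "z \<notin> E" using zu zz by force
    then show ?case
      using E zz zu by (intro exI[of _ "insert z E"]) auto
  qed
  from this[of "CARD('m)"] show ?thesis unfolding orthonormal_basis_def by auto
qed

text \<open>The matrix with the basis as columns normalises the Gram matrix, which turns sums over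
  an orthonormal basis into matrix algebra.\<close>

lemma orthonormal_basis_matrix:
  fixes B :: "real^'m::finite \<Rightarrow> real^'m \<Rightarrow> real"
  assumes B: "bilinear B" and E: "orthonormal_basis B E"
  obtains e A where "bij_betw e (UNIV :: 'm set) E" "A = (\<chi> i j. e j $ i)"
    "transpose A ** gram B ** A = mat 1"
proof -
  obtain e where e: "bij_betw e (UNIV :: 'm set) E"
    using E unfolding orthonormal_basis_def by (metis finite_same_card_bij finite_class.finite_UNIV)
  define A where "A = (\<chi> i j. e j $ i)"
  have Ae: "A *v axis j 1 = e j" for j
    by (simp add: A_def matrix_vector_mult_basis column_def vec_eq_iff)
  have "B (e i) (e j) = (if i = j then 1 else 0)" for i j
    using E e unfolding orthonormal_basis_def bij_betw_def by (auto simp: inj_eq)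
  then have "transpose A ** gram B ** A = mat 1"
    unfolding gram_matrix_mult[OF B, symmetric] gram_def[of "\<lambda>u v. B (A *v u) (A *v v)"] Ae
    by (simp add: mat_def vec_eq_iff)
  with e A_def that show thesis by blast
qed

text \<open>With \<open>A\<close> the matrix of an orthonormal frame, the determinant is the
  reciprocal of \<open>(det A)\<^sup>2\<close>.\<close>

lemma det_gram_pos:
  fixes B :: "real^'m::finite \<Rightarrow> real^'m \<Rightarrow> real"
  assumes "inner_product B"
  shows "det (gram B) > 0"
proof -
  obtain E where E: "orthonormal_basis B E" using orthonormal_family[OF assms] by blast
  obtain e and A :: "real^'m^'m" where A: "transpose A ** gram B ** A = mat 1"
    using orthonormal_basis_matrix[OF inner_productD(1)[OF assms] E] by blast
  have "det (transpose A ** gram B ** A) = 1" unfolding A by simp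
  then have "(det A)\<^sup>2 * det (gram B) = 1"
    by (simp add: det_mul power2_eq_square mult.commute mult.left_commute)
  then show ?thesis
    by (metis zero_le_power2 zero_less_mult_iff zero_less_one less_eq_real_def not_less mult_zero_left)
qed

lemma gram_compose:
  fixes L :: "real^'m \<Rightarrow> real^'m::finite"
  assumes B: "bilinear B" and L: "linear L"
  shows "gram (\<lambda>u v. B (L u) (L v)) = transpose (matrix L) ** gram B ** matrix L"
proof -
  have "L = (*v) (matrix L)" by (rule matrix_vector_mul(2)[OF L, symmetric])
  then show ?thesis using gram_matrix_mult[OF B, of "matrix L"] by simp
qed

lemma volume_density_gram: "volume_density M c z = sqrt (det (gram (coord_metric M c z)))"
  by (simp add: volume_density_def gram_def)

section \<open>The Riemannian volume\<close>

context riemannian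
begin

lemma volume_density_pos: "c \<in> atlas M \<Longrightarrow> z \<in> chart_im c \<Longrightarrow> volume_density M c z > 0"
  unfolding volume_density_gram by (intro real_sqrt_gt_zero det_gram_pos inner_product_coord_metric)

lemma continuous_on_volume_density: "c \<in> atlas M \<Longrightarrow> continuous_on (chart_im c) (volume_density M c)"
  unfolding volume_density_def det_def
  by (intro continuous_intros) auto

lemma volume_density_change:
  assumes c: "c \<in> atlas M" "d \<in> atlas M" and p: "p \<in> fst c \<inter> fst d"
  shows "volume_density M c (snd c p) =
    \<bar>det (matrix (frechet_derivative (transition c d) (at (snd c p))))\<bar> * volume_density M d (snd d p)"
proof -
  let ?T = "frechet_derivative (transition c d) (at (snd c p))"
  have lin: "linear ?T" by (intro linear_frechet transition_differentiable c p)
  have "metric M c p = (\<lambda>u v. metric M d p (?T u) (?T v))"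
    using metric_change[OF c p] by blast
  then have "gram (metric M c p) = transpose (matrix ?T) ** gram (metric M d p) ** matrix ?T"
    using gram_compose[OF inner_productD(1)[OF inner_product_metric] lin] c p by auto
  then have "det (gram (metric M c p)) = (det (matrix ?T))\<^sup>2 * det (gram (metric M d p))"
    by (simp add: det_mul power2_eq_square)
  then show ?thesis
    using c p by (simp add: volume_density_gram coord_metric_eq real_sqrt_mult)
qed

text \<open>A total version of the chart inverse, constant off the chart and therefore Borel on all
  of coordinate space; \<open>chart_weight\<close> gives the constant part no mass.\<close>

definition chart_param :: "('p, 'm) chart \<Rightarrow> real^'m \<Rightarrow> 'p" where
  "chart_param c z = (if z \<in> chart_im c then chart_inv c z else undefined)"

lemma measurable_chart_param [measurable]:
  assumes c: "c \<in> atlas M"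
  shows "chart_param c \<in> borel_measurable borel"
proof (rule borel_measurableI)
  fix S :: "'p set" assume S: "open S"
  have "chart_param c -` S = (chart_im c \<inter> chart_inv c -` S) \<union> (if undefined \<in> S then - chart_im c else {})"
    by (auto simp: chart_param_def split: if_splits)
  moreover have "open (chart_im c \<inter> chart_inv c -` S)"
    by (rule continuous_open_preimage[OF chartD(4)[OF c] chartD(2)[OF c] S])
  moreover have "- chart_im c \<in> sets borel" using chartD(2)[OF c] by auto
  ultimately show "chart_param c -` S \<inter> space borel \<in> sets borel" by auto
qed

definition chart_weight :: "('p, 'm) chart \<Rightarrow> real^'m \<Rightarrow> real" where
  "chart_weight c z = indicator (chart_im c) z *\<^sub>R volume_density M c z"

lemma measurable_chart_weight [measurable]:
  "c \<in> atlas M \<Longrightarrow> chart_weight c \<in> borel_measurable borel"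
  unfolding chart_weight_def
  by (intro borel_measurable_continuous_on_indicator continuous_on_volume_density borel_open chartD)

lemma chart_weight_nonneg: "c \<in> atlas M \<Longrightarrow> chart_weight c z \<ge> 0"
  using volume_density_pos[of c z] by (auto simp: chart_weight_def indicator_def less_imp_le)

definition chart_volume :: "('p, 'm) chart \<Rightarrow> 'p measure" where
  "chart_volume c = distr (density lborel (\<lambda>z. ennreal (chart_weight c z))) borel (chart_param c)"

lemma sets_chart_volume [simp]: "sets (chart_volume c) = sets borel"
  by (simp add: chart_volume_def)

lemma chart_image_iff:
  assumes c: "c \<in> atlas M" and A: "A \<subseteq> fst c"
  shows "z \<in> snd c ` A \<longleftrightarrow> z \<in> chart_im c \<and> chart_inv c z \<in> A"
proof
  assume "z \<in> snd c ` A"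
  then obtain p where "p \<in> A" "z = snd c p" by blast
  then show "z \<in> chart_im c \<and> chart_inv c z \<in> A" using A chartD(5)[OF c, of p] by auto
next
  assume "z \<in> chart_im c \<and> chart_inv c z \<in> A"
  then show "z \<in> snd c ` A" using chartD(7)[OF c, of z] by (intro image_eqI[of _ _ "chart_inv c z"]) auto
qed

lemma chart_image_borel:
  assumes "c \<in> atlas M" "A \<in> sets borel" "A \<subseteq> fst c"
  shows "snd c ` A \<in> sets borel"
proof -
  have "snd c ` A = chart_im c \<inter> chart_param c -` A"
    using chart_image_iff[OF assms(1,3)] by (intro set_eqI) (simp add: chart_param_def)
  then show ?thesis
    using measurable_sets[OF measurable_chart_param[OF assms(1)] assms(2)] chartD(2)[OF assms(1)]
    by (simp add: sets.Int borel_open)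
qed

lemma emeasure_chart_volume:
  assumes c: "c \<in> atlas M" and A: "A \<in> sets borel" "A \<subseteq> fst c"
  shows "emeasure (chart_volume c) A = (\<integral>\<^sup>+z\<in>snd c ` A. ennreal (volume_density M c z) \<partial>lborel)"
proof -
  have "chart_param c -` A \<in> sets borel"
    using measurable_sets[OF measurable_chart_param[OF c] A(1)] by simp
  then have "emeasure (chart_volume c) A =
      (\<integral>\<^sup>+z\<in>chart_param c -` A. ennreal (chart_weight c z) \<partial>lborel)"
    using A c by (simp add: chart_volume_def emeasure_distr emeasure_density)
  also have "\<dots> = (\<integral>\<^sup>+z\<in>snd c ` A. ennreal (volume_density M c z) \<partial>lborel)"
  proof (rule nn_integral_cong)
    fix z
    show "ennreal (chart_weight c z) * indicator (chart_param c -` A) z =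
        ennreal (volume_density M c z) * indicator (snd c ` A) z"
      using chart_image_iff[OF c A(2), of z] by (simp add: chart_weight_def chart_param_def indicator_def)
  qed
  finally show ?thesis .
qed

text \<open>The Jacobian in \<open>volume_density_change\<close> is exactly the one that the change
  of variables by the transition map produces on the overlap.\<close>

lemma chart_volume_change:
  assumes c: "c \<in> atlas M" and d: "d \<in> atlas M" and A: "A \<in> sets borel" "A \<subseteq> fst c \<inter> fst d"
  shows "emeasure (chart_volume c) A = emeasure (chart_volume d) A"
proof -
  define T where "T = transition c d"
  define O1 where "O1 = snd c ` (fst c \<inter> fst d)"
  define J where "J z = indicator O1 z *\<^sub>R \<bar>det (matrix (frechet_derivative T (at z)))\<bar>" for z
  define T' where "T' z = (if z \<in> O1 then T z else 0)" for z
  have openO: "open O1" unfolding O1_def by (intro open_chart_image c open_Int chartD(1) d) auto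
  have Tsm: "smooth_on T O1" unfolding T_def O1_def by (rule transition(1)[OF c d])
  have Tx: "T (snd c p) = snd d p" if "p \<in> fst c" for p
    unfolding T_def by (rule transition(2)[OF c d that])
  have TO: "T ` O1 = snd d ` (fst c \<inter> fst d)" by (auto simp: O1_def Tx image_iff intro!: bexI)
  have inj: "inj_on T O1"
    using inj_on_chart[OF d] by (auto simp: O1_def Tx inj_on_def)
  have openTO: "open (T ` O1)" unfolding TO by (intro open_chart_image c open_Int chartD(1) d) auto
  have "continuous_on O1 (\<lambda>z. \<bar>det (matrix (frechet_derivative T (at z)))\<bar>)"
    unfolding det_def matrix_def using smooth_onD(2)[OF Tsm] by (auto intro!: continuous_intros)
  then have Jm [measurable]: "J \<in> borel_measurable borel"
    unfolding J_def using openO by (intro borel_measurable_continuous_on_indicator) auto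
  have T'm [measurable]: "T' \<in> borel_measurable borel"
  proof -
    have "(\<lambda>z. indicator O1 z *\<^sub>R T z) \<in> borel_measurable borel"
      using openO smooth_onD(3)[OF Tsm] by (intro borel_measurable_continuous_on_indicator) auto
    moreover have "(\<lambda>z. indicator O1 z *\<^sub>R T z) = T'" by (auto simp: T'_def)
    ultimately show ?thesis by simp
  qed
  \<comment> \<open>Change of variables on the overlap as an identity of measures; \<open>J\<close>
    and \<open>T'\<close> extend the Jacobian and the transition map by 0 to keep them
    Borel.\<close>
  have eq: "distr (density lborel (\<lambda>z. ennreal (J z))) borel T' = density lborel (indicator (T ` O1))"
  proof (rule measure_eqI)
    fix A assume "A \<in> sets (distr (density lborel (\<lambda>z. ennreal (J z))) borel T')"
    then have A [measurable]: "A \<in> sets borel" by simp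
    have pre [measurable]: "T' -` A \<in> sets borel" using measurable_sets[OF T'm A] by simp
    define S where "S = O1 \<inter> T' -` A"
    have S: "S \<in> sets borel" unfolding S_def using openO by (intro sets.Int pre borel_open)
    have TS: "T ` S = T ` O1 \<inter> A" by (auto simp: S_def T'_def)
    have "emeasure (distr (density lborel (\<lambda>z. ennreal (J z))) borel T') A =
        (\<integral>\<^sup>+z\<in>T' -` A. ennreal (J z) \<partial>lborel)"
      by (simp add: emeasure_distr emeasure_density)
    also have "\<dots> = (\<integral>\<^sup>+z\<in>S. ennreal \<bar>det (matrix (frechet_derivative T (at z)))\<bar> \<partial>lborel)"
      by (intro nn_integral_cong) (auto simp: J_def S_def indicator_def)
    also have "\<dots> = emeasure lborel (T ` S)"
    proof (rule emeasure_lborel_image[symmetric, OF S])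
      show "T ` S \<in> sets borel" unfolding TS by (rule sets.Int[OF borel_open[OF openTO] A])
      show "inj_on T S" using inj by (rule inj_on_subset) (auto simp: S_def)
      show "(T has_derivative frechet_derivative T (at z)) (at z)" if "z \<in> S" for z
        using smooth_onD(1)[OF Tsm] that by (intro has_derivative_frechet) (auto simp: S_def)
      have "(\<lambda>z. indicator S z * J z) \<in> borel_measurable borel" using S by measurable
      moreover have "(\<lambda>z. indicator S z * J z) = (\<lambda>z. indicator S z * \<bar>det (matrix (frechet_derivative T (at z)))\<bar>)"
        by (auto simp: J_def S_def indicator_def)
      ultimately show "(\<lambda>z. indicator S z * \<bar>det (matrix (frechet_derivative T (at z)))\<bar>) \<in> borel_measurable borel"
        by simp
    qed
    also have "\<dots> = emeasure (density lborel (indicator (T ` O1))) A"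
      using openTO unfolding TS by (subst emeasure_density) (auto simp: indicator_inter_arith[symmetric])
    finally show "emeasure (distr (density lborel (\<lambda>z. ennreal (J z))) borel T') A =
        emeasure (density lborel (indicator (T ` O1))) A" .
  qed simp
  have cA: "snd c ` A \<in> sets borel" "snd d ` A \<in> sets borel"
    using A c d by (auto intro: chart_image_borel)
  have dA: "snd d ` A \<subseteq> T ` O1" using A(2) unfolding TO by blast
  have im: "T' z \<in> snd d ` A \<longleftrightarrow> z \<in> snd c ` A" if z: "z \<in> O1" for z
  proof -
    obtain p where p: "p \<in> fst c \<inter> fst d" "z = snd c p" using z by (auto simp: O1_def)
    have "T' z = snd d p" using z p by (simp add: T'_def Tx)
    moreover have "snd d p \<in> snd d ` A \<longleftrightarrow> p \<in> A"
      using inj_on_image_mem_iff[OF inj_on_chart[OF d]] p A(2) by auto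
    moreover have "snd c p \<in> snd c ` A \<longleftrightarrow> p \<in> A"
      using inj_on_image_mem_iff[OF inj_on_chart[OF c]] p A(2) by auto
    ultimately show ?thesis using p by simp
  qed
  let ?f = "\<lambda>w. ennreal (chart_weight d w) * indicator (snd d ` A) w"
  have fm [measurable]: "?f \<in> borel_measurable borel"
    using cA d by measurable
  have "emeasure (chart_volume d) A = (\<integral>\<^sup>+w\<in>snd d ` A. ennreal (volume_density M d w) \<partial>lborel)"
    using A by (intro emeasure_chart_volume d) auto
  also have "\<dots> = (\<integral>\<^sup>+w. ?f w * indicator (T ` O1) w \<partial>lborel)"
    using dA A by (intro nn_integral_cong) (auto simp: indicator_def chart_weight_def image_iff subset_iff)
  also have "\<dots> = (\<integral>\<^sup>+w. ?f w \<partial>density lborel (indicator (T ` O1)))"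
    using openTO by (subst nn_integral_density) (auto simp: mult.commute)
  also have "\<dots> = (\<integral>\<^sup>+w. ?f w \<partial>distr (density lborel (\<lambda>z. ennreal (J z))) borel T')"
    unfolding eq ..
  also have "\<dots> = (\<integral>\<^sup>+z. ennreal (J z) * ?f (T' z) \<partial>lborel)"
    using measurable_compose[OF T'm fm]
    by (subst nn_integral_distr) (simp_all add: nn_integral_density)
  also have "\<dots> = (\<integral>\<^sup>+z\<in>snd c ` A. ennreal (volume_density M c z) \<partial>lborel)"
  proof (rule nn_integral_cong)
    fix z
    show "ennreal (J z) * ?f (T' z) = ennreal (volume_density M c z) * indicator (snd c ` A) z"
    proof (cases "z \<in> O1")
      case True
      then obtain p where p: "p \<in> fst c \<inter> fst d" "z = snd c p" by (auto simp: O1_def)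
      have "T' z = snd d p" using True p by (simp add: T'_def Tx)
      then have "chart_weight d (T' z) = volume_density M d (snd d p)" using p by (simp add: chart_weight_def)
      then have "J z * chart_weight d (T' z) = volume_density M c z"
        using volume_density_change[OF c d p(1)] True p(2) by (simp add: J_def T_def)
      moreover have "0 \<le> J z" by (simp add: J_def)
      ultimately have "ennreal (J z) * ennreal (chart_weight d (T' z)) = ennreal (volume_density M c z)"
        using chart_weight_nonneg[OF d] by (metis ennreal_mult)
      then show ?thesis using im[OF True] by (auto simp: indicator_def mult.assoc[symmetric])
    next
      case False
      then have "z \<notin> snd c ` A" using A(2) by (auto simp: O1_def)
      with False show ?thesis by (simp add: J_def)
    qed
  qed
  also have "\<dots> = emeasure (chart_volume c) A"
    using A by (intro emeasure_chart_volume[symmetric] c) auto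
  finally show ?thesis by simp
qed

lemma countable_atlas:
  "\<exists>cs :: nat \<Rightarrow> ('p, 'm) chart. (\<forall>n. cs n \<in> atlas M) \<and> (\<Union>n. fst (cs n)) = UNIV"
proof -
  have "open S" if "S \<in> fst ` atlas M" for S using that chartD(1) by auto
  then obtain F where F: "F \<subseteq> fst ` atlas M" "countable F" "\<Union>F = \<Union>(fst ` atlas M)"
    by (rule Lindelof)
  have U: "\<Union>(fst ` atlas M) = UNIV" using ex_chart by blast
  then have "F \<noteq> {}" using F(3) by auto
  then obtain f :: "nat \<Rightarrow> 'p set" where f: "range f = F" by (rule that[OF range_from_nat_into[OF _ F(2)]])
  have "\<forall>n. \<exists>c. c \<in> atlas M \<and> fst c = f n"
  proof
    fix n
    have "f n \<in> fst ` atlas M" using F(1) f by blast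
    then show "\<exists>c. c \<in> atlas M \<and> fst c = f n" by (elim imageE) auto
  qed
  from choice[OF this] obtain cs where cs: "\<And>n. cs n \<in> atlas M \<and> fst (cs n) = f n" by blast
  have "(\<Union>n. fst (cs n)) = UNIV" using cs f F(3) U by auto
  with cs show ?thesis by blast
qed

text \<open>Justifies the description in \<open>riem_volume\<close>. Existence: add up the chart
  measures over a countable disjoint refinement of the chart domains;
  \<open>chart_volume_change\<close> makes the result correct in every chart. Uniqueness: the pieces
  decompose each Borel set.\<close>

lemma ex1_volume:
  "\<exists>!\<mu>. sets \<mu> = sets borel \<and>
        (\<forall>c\<in>atlas M. \<forall>A\<in>sets borel. A \<subseteq> fst c \<longrightarrow>
           emeasure \<mu> A = (\<integral>\<^sup>+z\<in>snd c ` A. ennreal (volume_density M c z) \<partial>lborel))" (is "\<exists>!\<mu>. ?P \<mu>")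
proof -
  obtain cs :: "nat \<Rightarrow> ('p, 'm) chart" where cs: "\<And>n. cs n \<in> atlas M" "(\<Union>n. fst (cs n)) = UNIV"
    using countable_atlas by blast
  define D where "D = disjointed (\<lambda>n. fst (cs n))"
  have Db: "D n \<in> sets borel" for n
  proof -
    have "range D \<subseteq> sets borel"
      unfolding D_def by (rule sets.range_disjointed_sets) (use chartD(1)[OF cs(1)] in auto)
    then show ?thesis by blast
  qed
  have Dsub: "D n \<subseteq> fst (cs n)" for n unfolding D_def by (rule disjointed_subset)
  have Ddisj: "disjoint_family D" unfolding D_def by (rule disjoint_family_disjointed)
  have DU: "(\<Union>n. D n) = UNIV" using cs(2) unfolding D_def by (simp add: UN_disjointed_eq)
  have split: "emeasure \<mu> A = (\<Sum>n. emeasure \<mu> (A \<inter> D n))" if "sets \<mu> = sets borel" "A \<in> sets borel" for \<mu> A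
  proof -
    have "disjoint_family (\<lambda>n. A \<inter> D n)" using Ddisj unfolding disjoint_family_on_def by blast
    then have "(\<Sum>n. emeasure \<mu> (A \<inter> D n)) = emeasure \<mu> (\<Union>n. A \<inter> D n)"
      using that Db by (intro suminf_emeasure) auto
    also have "(\<Union>n. A \<inter> D n) = A" using DU by auto
    finally show ?thesis by simp
  qed
  define f where "f A = (\<Sum>n. emeasure (chart_volume (cs n)) (A \<inter> D n))" for A
  define vol where "vol = measure_of UNIV (sets borel) f"
  have ca: "countably_additive (sets (borel :: 'p measure)) f"
  proof (rule countably_additiveI)
    fix A :: "nat \<Rightarrow> 'p set"
    assume A: "range A \<subseteq> sets borel" "disjoint_family A"
    let ?e = "\<lambda>n k. emeasure (chart_volume (cs n)) (A k \<inter> D n)"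
    \<comment> \<open>The double series of nonnegative terms is interchanged by reading one sum as
      an integral over counting measure.\<close>
    have "(\<Sum>k. f (A k)) = (\<integral>\<^sup>+k. (\<Sum>n. ?e n k) \<partial>count_space UNIV)"
      unfolding f_def by (simp add: nn_integral_count_space_nat)
    also have "\<dots> = (\<Sum>n. \<integral>\<^sup>+k. ?e n k \<partial>count_space UNIV)"
      by (rule nn_integral_suminf) simp
    also have "\<dots> = (\<Sum>n. emeasure (chart_volume (cs n)) (\<Union>k. A k \<inter> D n))"
      unfolding nn_integral_count_space_nat
    proof (intro suminf_cong suminf_emeasure)
      show "disjoint_family (\<lambda>k. A k \<inter> D n)" for n using A(2) unfolding disjoint_family_on_def by blast
    qed (use A Db in auto)
    also have "\<dots> = f (\<Union>k. A k)" unfolding f_def by simp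
    finally show "(\<Sum>k. f (A k)) = f (\<Union>k. A k)" .
  qed
  have sets_vol: "sets vol = sets borel"
    unfolding vol_def using sets.sigma_sets_eq[of "borel :: 'p measure"] sets.space_closed[of "borel :: 'p measure"]
    by (subst sets_measure_of) auto
  have em_vol: "emeasure vol A = f A" if "A \<in> sets borel" for A
  proof (rule emeasure_measure_of[OF vol_def])
    show "positive (sets vol) f" by (auto simp: positive_def f_def)
    show "countably_additive (sets vol) f" unfolding sets_vol by (rule ca)
  qed (use that sets_vol in auto)
  have vol: "?P vol"
  proof (intro conjI ballI impI sets_vol)
    fix c A assume c: "c \<in> atlas M" and A: "A \<in> sets borel" "A \<subseteq> fst c"
    have "emeasure vol A = (\<Sum>n. emeasure (chart_volume c) (A \<inter> D n))"
      unfolding em_vol[OF A(1)] f_def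
      using A Db Dsub by (intro suminf_cong chart_volume_change cs c) auto
    also have "\<dots> = emeasure (chart_volume c) A"
      by (rule split[symmetric]) (use A in auto)
    also have "\<dots> = (\<integral>\<^sup>+z\<in>snd c ` A. ennreal (volume_density M c z) \<partial>lborel)"
      by (rule emeasure_chart_volume[OF c A])
    finally show "emeasure vol A = (\<integral>\<^sup>+z\<in>snd c ` A. ennreal (volume_density M c z) \<partial>lborel)" .
  qed
  have unique: "\<mu> = vol" if \<mu>: "?P \<mu>" for \<mu>
  proof (rule measure_eqI)
    show "sets \<mu> = sets vol" using \<mu> sets_vol by simp
    fix A assume "A \<in> sets \<mu>"
    then have A: "A \<in> sets borel" using \<mu> by simp
    have "emeasure \<mu> (A \<inter> D n) = emeasure vol (A \<inter> D n)" for n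
    proof -
      have "A \<inter> D n \<in> sets borel" "A \<inter> D n \<subseteq> fst (cs n)" using A Db Dsub by auto
      then show ?thesis
        using \<mu>[THEN conjunct2, rule_format, OF cs(1)] vol[THEN conjunct2, rule_format, OF cs(1)] by simp
    qed
    then show "emeasure \<mu> A = emeasure vol A"
      using split[of \<mu> A] split[OF sets_vol A] \<mu> A by simp
  qed
  show ?thesis by (rule ex1I[of ?P, OF vol unique])
qed

lemma sets_riem_volume [simp, measurable_cong]: "sets (riem_volume M) = sets borel"
  using theI'[OF ex1_volume] unfolding riem_volume_def[symmetric] by blast

lemma emeasure_riem_volume:
  assumes "c \<in> atlas M" "A \<in> sets borel" "A \<subseteq> fst c"
  shows "emeasure (riem_volume M) A = (\<integral>\<^sup>+z\<in>snd c ` A. ennreal (volume_density M c z) \<partial>lborel)"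
  using theI'[OF ex1_volume] assms unfolding riem_volume_def[symmetric] by blast

lemma density_riem_volume:
  assumes c: "c \<in> atlas M"
  shows "density (riem_volume M) (indicator (fst c)) = chart_volume c"
proof (rule measure_eqI)
  fix A assume "A \<in> sets (density (riem_volume M) (indicator (fst c)))"
  then have A: "A \<in> sets borel" by simp
  have cb: "fst c \<in> sets borel" using chartD(1)[OF c] by auto
  have "emeasure (density (riem_volume M) (indicator (fst c))) A = emeasure (riem_volume M) (fst c \<inter> A)"
    using A cb by (subst emeasure_density) (auto simp: indicator_inter_arith[symmetric])
  also have "\<dots> = emeasure (chart_volume c) (fst c \<inter> A)"
    using A cb by (subst emeasure_riem_volume[OF c], simp_all add: emeasure_chart_volume[OF c])
  also have "\<dots> = emeasure (chart_volume c) A"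
  proof (rule emeasure_eq_AE)
    \<comment> \<open>\<open>chart_volume c\<close> is concentrated on the chart domain, since the
      weight vanishes where \<open>chart_param\<close> takes its default value.\<close>
    have "AE z in density lborel (\<lambda>z. ennreal (chart_weight c z)). chart_param c z \<in> fst c"
    proof (subst AE_density)
      show "(\<lambda>z. ennreal (chart_weight c z)) \<in> borel_measurable lborel" using c by measurable
      show "AE z in lborel. 0 < ennreal (chart_weight c z) \<longrightarrow> chart_param c z \<in> fst c"
        using chartD(6)[OF c] by (intro AE_I2) (auto simp: chart_weight_def chart_param_def indicator_def)
    qed
    then have "AE p in chart_volume c. p \<in> fst c"
      unfolding chart_volume_def using c cb by (subst AE_distr_iff) auto
    then show "AE p in chart_volume c. (p \<in> fst c \<inter> A) = (p \<in> A)" by eventually_elim auto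
  qed (use A cb in auto)
  finally show "emeasure (density (riem_volume M) (indicator (fst c))) A = emeasure (chart_volume c) A" .
qed simp

lemma integral_riem_volume_chart:
  fixes f :: "'p \<Rightarrow> real"
  assumes c: "c \<in> atlas M" and f: "f \<in> borel_measurable borel" and supp: "\<And>p. p \<notin> fst c \<Longrightarrow> f p = 0"
  shows "(LINT p|riem_volume M. f p) =
      (LINT z|lborel. indicator (chart_im c) z *\<^sub>R (volume_density M c z * f (chart_inv c z)))"
proof -
  have cb: "fst c \<in> sets borel" using chartD(1)[OF c] by auto
  have "(LINT p|riem_volume M. f p) = (LINT p|riem_volume M. indicator (fst c) p *\<^sub>R f p)"
    by (rule Bochner_Integration.integral_cong) (auto simp: indicator_def supp)
  also have "\<dots> = (LINT p|density (riem_volume M) (indicator (fst c)). f p)"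
    using cb f integral_density[of f "riem_volume M" "indicator (fst c)"] by (simp add: ennreal_indicator cong: measurable_cong_sets)
  also have "\<dots> = (LINT p|chart_volume c. f p)"
    unfolding density_riem_volume[OF c] ..
  also have "\<dots> = (LINT z|lborel. chart_weight c z *\<^sub>R f (chart_param c z))"
  proof -
    have m: "(\<lambda>z. f (chart_param c z)) \<in> borel_measurable borel"
      by (rule measurable_compose[OF measurable_chart_param[OF c] f])
    have "(LINT p|chart_volume c. f p) = (LINT z|density lborel (\<lambda>z. ennreal (chart_weight c z)). f (chart_param c z))"
      unfolding chart_volume_def by (rule integral_distr) (use f measurable_chart_param[OF c] in simp_all)
    also have "\<dots> = (LINT z|lborel. chart_weight c z *\<^sub>R f (chart_param c z))"
      by (rule integral_density) (use m measurable_chart_weight[OF c] chart_weight_nonneg[OF c] in auto)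
    finally show ?thesis .
  qed
  also have "\<dots> = (LINT z|lborel. indicator (chart_im c) z *\<^sub>R (volume_density M c z * f (chart_inv c z)))"
    by (rule Bochner_Integration.integral_cong) (auto simp: chart_weight_def chart_param_def indicator_def)
  finally show ?thesis .
qed

text \<open>Every point has a coordinate ball with bounded density around it, hence of finite
  volume; finitely many of them cover \<open>K\<close>.\<close>

lemma riem_volume_compact_finite:
  assumes K: "compact K"
  shows "emeasure (riem_volume M) K < \<infinity>"
proof -
  have "\<exists>V. open V \<and> p \<in> V \<and> emeasure (riem_volume M) V < \<infinity>" for p
  proof -
    obtain c where c: "c \<in> atlas M" "p \<in> fst c" by (rule ex_chart)
    obtain \<rho> where \<rho>: "\<rho> > 0" "cball (snd c p) \<rho> \<subseteq> chart_im c"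
      using chartD(2)[OF c(1)] c by (metis image_eqI open_contains_cball)
    let ?V = "chart_inv c ` ball (snd c p) \<rho>"
    have sub: "ball (snd c p) \<rho> \<subseteq> chart_im c" using \<rho> by auto
    have V: "open ?V" "?V \<subseteq> fst c"
      using open_chart_inv_image[OF c(1) open_ball sub] chartD(6)[OF c(1)] sub by blast+
    have pV: "p \<in> ?V"
      using \<rho>(1) chartD(5)[OF c] by (intro image_eqI[of _ _ "snd c p"]) auto
    have "bounded (volume_density M c ` cball (snd c p) \<rho>)"
      using \<rho> by (intro compact_imp_bounded compact_continuous_image
          continuous_on_subset[OF continuous_on_volume_density[OF c(1)]]) auto
    then obtain b where b: "b > 0" "\<And>z. z \<in> cball (snd c p) \<rho> \<Longrightarrow> norm (volume_density M c z) \<le> b"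
      by (auto simp: bounded_pos)
    have im: "snd c ` ?V = ball (snd c p) \<rho>"
      using chartD(7)[OF c(1)] sub by (force simp: image_iff)
    have "emeasure (riem_volume M) ?V = (\<integral>\<^sup>+z\<in>ball (snd c p) \<rho>. ennreal (volume_density M c z) \<partial>lborel)"
      using emeasure_riem_volume[OF c(1) borel_open[OF V(1)] V(2)] unfolding im .
    also have "\<dots> \<le> (\<integral>\<^sup>+z\<in>ball (snd c p) \<rho>. ennreal b \<partial>lborel)"
    proof (rule nn_integral_mono)
      fix z
      show "ennreal (volume_density M c z) * indicator (ball (snd c p) \<rho>) z \<le> ennreal b * indicator (ball (snd c p) \<rho>) z"
        using b(2)[of z] by (auto simp: indicator_def intro: ennreal_leI)
    qed
    also have "\<dots> = ennreal b * emeasure lborel (ball (snd c p) \<rho>)"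
      by (simp add: nn_integral_cmult_indicator)
    also have "\<dots> < \<infinity>"
      using emeasure_bounded_finite[OF bounded_ball, of "snd c p" \<rho>] by (simp add: ennreal_mult_less_top)
    finally show ?thesis using V pV by blast
  qed
  then have "\<forall>p. \<exists>V. open V \<and> p \<in> V \<and> emeasure (riem_volume M) V < \<infinity>" by blast
  from choice[OF this] obtain V where V: "\<And>p. open (V p) \<and> p \<in> V p \<and> emeasure (riem_volume M) (V p) < \<infinity>" by blast
  obtain D where D: "D \<subseteq> K" "finite D" "K \<subseteq> (\<Union>p\<in>D. V p)"
    using compactE_image[OF K, of K V] V by blast
  have "emeasure (riem_volume M) K \<le> emeasure (riem_volume M) (\<Union>p\<in>D. V p)"
    using D V by (intro emeasure_mono) auto
  also have "\<dots> \<le> (\<Sum>p\<in>D. emeasure (riem_volume M) (V p))"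
    using D V by (intro emeasure_subadditive_finite) auto
  also have "\<dots> < \<infinity>" using V D(2) by simp
  finally show ?thesis .
qed

end

section \<open>Continuously differentiable functions of several variables\<close>

abbreviation C1_on :: "('a::real_normed_vector \<Rightarrow> 'b::real_normed_vector) \<Rightarrow> 'a set \<Rightarrow> bool" where
  "C1_on f S \<equiv> Ck_on (Suc 0) f S"

lemma C1_onI:
  assumes f: "\<And>z. z \<in> S \<Longrightarrow> (f has_derivative f' z) (at z)" and c: "\<And>v. continuous_on S (\<lambda>z. f' z v)"
  shows "C1_on f S"
proof -
  have eq: "frechet_derivative f (at z) = f' z" if "z \<in> S" for z
    using frechet_derivative_at[OF f[OF that]] by simp
  have "continuous_on S (\<lambda>z. frechet_derivative f (at z) v)" for v
    by (rule continuous_on_eq[OF c[of v]]) (simp add: eq)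
  then show ?thesis using f by (auto simp: differentiable_def)
qed

lemma C1_onD:
  assumes "C1_on f S"
  shows "z \<in> S \<Longrightarrow> (f has_derivative frechet_derivative f (at z)) (at z)"
    and "continuous_on S (\<lambda>z. frechet_derivative f (at z) v)"
  using assms by (auto simp: has_derivative_frechet)

lemma C1_on_imp_continuous_on: "C1_on f S \<Longrightarrow> continuous_on S f"
  by (rule has_derivative_continuous_on[OF has_derivative_at_withinI[OF C1_onD(1)]])

lemma smooth_on_imp_C1_on: "smooth_on f S \<Longrightarrow> C1_on f S"
  unfolding smooth_on_def by blast

lemma C1_on_subset: "C1_on f S \<Longrightarrow> T \<subseteq> S \<Longrightarrow> C1_on f T"
  by (auto intro: continuous_on_subset)

lemma C1_on_cong:
  assumes "C1_on f S" "open S" "\<And>z. z \<in> S \<Longrightarrow> f z = g z"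
  shows "C1_on g S"
proof (rule C1_onI[OF _ C1_onD(2)[OF assms(1)]])
  show "(g has_derivative frechet_derivative f (at z)) (at z)" if "z \<in> S" for z
    by (rule has_derivative_transform_within_open[OF C1_onD(1)[OF assms(1) that] assms(2) that assms(3)])
qed

lemma C1_on_const: "C1_on (\<lambda>z. c) S"
  by (rule C1_onI[of _ _ "\<lambda>z v. 0"]) auto

lemma C1_on_add:
  assumes "C1_on f S" "C1_on g S"
  shows "C1_on (\<lambda>z. f z + g z) S"
  using C1_onD[OF assms(1)] C1_onD[OF assms(2)]
  by (intro C1_onI[of _ _ "\<lambda>z v. frechet_derivative f (at z) v + frechet_derivative g (at z) v"])
    (auto intro!: has_derivative_add continuous_on_add)

lemma C1_on_mult:
  fixes f g :: "'a::real_normed_vector \<Rightarrow> real"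
  assumes "C1_on f S" "C1_on g S"
  shows "C1_on (\<lambda>z. f z * g z) S"
  using C1_onD[OF assms(1)] C1_onD[OF assms(2)] C1_on_imp_continuous_on[OF assms(1)] C1_on_imp_continuous_on[OF assms(2)]
  by (intro C1_onI[of _ _ "\<lambda>z v. f z * frechet_derivative g (at z) v + frechet_derivative f (at z) v * g z"])
    (auto intro!: has_derivative_mult continuous_intros)

lemma C1_on_sum: "(\<And>i. i \<in> I \<Longrightarrow> C1_on (f i) S) \<Longrightarrow> C1_on (\<lambda>z. \<Sum>i\<in>I. f i z) S"
  by (induction I rule: infinite_finite_induct)
    (simp_all only: sum.infinite sum.empty sum.insert insertI1 insertI2 C1_on_const C1_on_add not_False_eq_True)

lemma C1_on_prod:
  fixes f :: "'i \<Rightarrow> 'a::real_normed_vector \<Rightarrow> real"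
  shows "(\<And>i. i \<in> I \<Longrightarrow> C1_on (f i) S) \<Longrightarrow> C1_on (\<lambda>z. \<Prod>i\<in>I. f i z) S"
  by (induction I rule: infinite_finite_induct)
    (simp_all only: prod.infinite prod.empty prod.insert insertI1 insertI2 C1_on_const C1_on_mult not_False_eq_True)

lemma C1_on_diff:
  assumes "C1_on f S" "C1_on g S"
  shows "C1_on (\<lambda>z. f z - g z) S"
  using C1_onD[OF assms(1)] C1_onD[OF assms(2)]
  by (intro C1_onI[of _ _ "\<lambda>z v. frechet_derivative f (at z) v - frechet_derivative g (at z) v"])
    (auto intro!: has_derivative_diff continuous_on_diff)

lemma C1_on_real_compose:
  fixes f :: "'a::real_normed_vector \<Rightarrow> real"
  assumes f: "C1_on f S" and h: "\<And>z. z \<in> S \<Longrightarrow> (h has_real_derivative h' (f z)) (at (f z))"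
    and h': "continuous_on S (\<lambda>z. h' (f z))"
  shows "C1_on (\<lambda>z. h (f z)) S"
proof (rule C1_onI[of _ _ "\<lambda>z v. frechet_derivative f (at z) v * h' (f z)"])
  show "((\<lambda>z. h (f z)) has_derivative (\<lambda>v. frechet_derivative f (at z) v * h' (f z))) (at z)" if "z \<in> S" for z
    using has_derivative_compose[OF C1_onD(1)[OF f that], of h "(*) (h' (f z))"] h[OF that]
    by (simp add: has_field_derivative_def mult.commute)
qed (intro continuous_intros h' C1_onD(2)[OF f])

lemma C1_on_divide:
  fixes f g :: "'a::real_normed_vector \<Rightarrow> real"
  assumes "C1_on f S" "C1_on g S" "\<And>z. z \<in> S \<Longrightarrow> g z \<noteq> 0"
  shows "C1_on (\<lambda>z. f z / g z) S"
proof -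
  have "C1_on (\<lambda>z. inverse (g z)) S"
  proof (rule C1_on_real_compose[OF assms(2), of inverse "\<lambda>x. - (inverse x ^ Suc (Suc 0))"])
    show "(inverse has_real_derivative - (inverse (g z) ^ Suc (Suc 0))) (at (g z))" if "z \<in> S" for z
      by (rule DERIV_inverse[OF assms(3)[OF that]])
    show "continuous_on S (\<lambda>z. - (inverse (g z) ^ Suc (Suc 0)))"
      using assms(3) by (intro continuous_intros C1_on_imp_continuous_on[OF assms(2)]) auto
  qed
  from C1_on_mult[OF assms(1) this] show ?thesis by (simp only: divide_inverse)
qed

lemma C1_on_sqrt:
  assumes "C1_on f S" "\<And>z. z \<in> S \<Longrightarrow> f z > 0"
  shows "C1_on (\<lambda>z. sqrt (f z)) S"
proof (rule C1_on_real_compose[OF assms(1), of sqrt "\<lambda>x. inverse (sqrt x) / 2"])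
  show "(sqrt has_real_derivative inverse (sqrt (f z)) / 2) (at (f z))" if "z \<in> S" for z
    by (rule DERIV_real_sqrt[OF assms(2)[OF that]])
  show "continuous_on S (\<lambda>z. inverse (sqrt (f z)) / 2)"
    using assms(2) by (intro continuous_intros C1_on_imp_continuous_on[OF assms(1)]) force+
qed

lemma has_derivative_vec_lambda:
  fixes f :: "'a::real_normed_vector \<Rightarrow> real^'k::finite"
  assumes "\<And>i. ((\<lambda>z. f z $ i) has_derivative (\<lambda>v. f' v $ i)) (at z)"
  shows "(f has_derivative f') (at z)"
  unfolding has_derivative_componentwise_within[of f]
  using assms by (auto simp: Basis_vec_def inner_axis)

lemma C1_on_vec:
  fixes f :: "'k::finite \<Rightarrow> 'a::real_normed_vector \<Rightarrow> real"
  assumes "\<And>i. C1_on (f i) S"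
  shows "C1_on (\<lambda>z. \<chi> i. f i z) S"
  by (rule C1_onI[of _ _ "\<lambda>z v. \<chi> i. frechet_derivative (f i) (at z) v"])
    (auto intro!: has_derivative_vec_lambda continuous_on_vec_lambda simp: C1_onD[OF assms])

lemma C1_on_component:
  fixes f :: "'a::real_normed_vector \<Rightarrow> real^'k::finite"
  assumes "C1_on f S"
  shows "C1_on (\<lambda>z. f z $ i) S"
  by (rule C1_onI[of _ _ "\<lambda>z v. frechet_derivative f (at z) v $ i"])
    (auto intro!: bounded_linear.has_derivative[OF bounded_linear_vec_nth] continuous_on_component simp: C1_onD[OF assms])

lemma linear_expansion:
  fixes L :: "real^'k::finite \<Rightarrow> 'b::real_vector"
  assumes "linear L"
  shows "L u = (\<Sum>i\<in>UNIV. u $ i *\<^sub>R L (axis i 1))"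
proof -
  have "L u = L (\<Sum>i\<in>UNIV. u $ i *\<^sub>R axis i 1)"
    using basis_expansion[of u] by (simp add: scalar_mult_eq_scaleR)
  then show ?thesis by (simp add: linear_sum[OF assms] linear_cmul[OF assms])
qed

lemma C1_on_compose:
  fixes f :: "'a::real_normed_vector \<Rightarrow> real^'k::finite"
  assumes f: "C1_on f S" and g: "C1_on g T" and fS: "f ` S \<subseteq> T"
  shows "C1_on (\<lambda>z. g (f z)) S"
proof (rule C1_onI[of _ _ "\<lambda>z v. frechet_derivative g (at (f z)) (frechet_derivative f (at z) v)"])
  show "((\<lambda>z. g (f z)) has_derivative (\<lambda>v. frechet_derivative g (at (f z)) (frechet_derivative f (at z) v))) (at z)"
    if "z \<in> S" for z
    using that fS by (intro has_derivative_compose[OF C1_onD(1)[OF f that] C1_onD(1)[OF g]]) auto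
  show "continuous_on S (\<lambda>z. frechet_derivative g (at (f z)) (frechet_derivative f (at z) v))" for v
  proof (rule continuous_on_eq)
    show "continuous_on S (\<lambda>z. \<Sum>i\<in>UNIV. frechet_derivative f (at z) v $ i *\<^sub>R frechet_derivative g (at (f z)) (axis i 1))"
      by (intro continuous_intros C1_onD(2)[OF f] continuous_on_compose2[OF C1_onD(2)[OF g] C1_on_imp_continuous_on[OF f] fS])
    fix z assume "z \<in> S"
    then have "linear (frechet_derivative g (at (f z)))"
      using C1_onD(1)[OF g, of "f z"] fS has_derivative_linear by blast
    then show "(\<Sum>i\<in>UNIV. frechet_derivative f (at z) v $ i *\<^sub>R frechet_derivative g (at (f z)) (axis i 1)) =
        frechet_derivative g (at (f z)) (frechet_derivative f (at z) v)"
      by (rule linear_expansion[symmetric])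
  qed
qed

text \<open>\<open>W\<close> and the complement of \<open>C\<close> are open and cover the space.
  This turns a compactly supported field in a chart into one on all of coordinate space, as
  \<open>divergence_inequality\<close> requires.\<close>

lemma C1_on_zero_extension:
  fixes f :: "'a::real_normed_vector \<Rightarrow> 'b::real_normed_vector"
  assumes f: "C1_on f W" and W: "open W" and C: "closed C" "C \<subseteq> W" and 0: "\<And>z. z \<in> W - C \<Longrightarrow> f z = 0"
  shows "C1_on (\<lambda>z. if z \<in> W then f z else 0) UNIV"
proof -
  let ?g = "\<lambda>z. if z \<in> W then f z else 0"
  have 1: "C1_on ?g W" by (rule C1_on_cong[OF f W]) simp
  have 2: "C1_on ?g (- C)"
    by (rule C1_on_cong[OF C1_on_const[of 0]]) (use C 0 in auto)
  have U: "W \<union> - C = UNIV" using C by auto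
  show ?thesis
  proof (rule C1_onI)
    show "(?g has_derivative frechet_derivative ?g (at z)) (at z)" for z
      using C1_onD(1)[OF 1, of z] C1_onD(1)[OF 2, of z] U by blast
    show "continuous_on UNIV (\<lambda>z. frechet_derivative ?g (at z) v)" for v
      using continuous_on_open_Un[OF W open_Compl[OF C(1)] C1_onD(2)[OF 1] C1_onD(2)[OF 2]] unfolding U .
  qed
qed

lemma C1_on_det:
  fixes A :: "'a::real_normed_vector \<Rightarrow> real^'k^'k::finite"
  assumes "\<And>i j. C1_on (\<lambda>z. A z $ i $ j) S"
  shows "C1_on (\<lambda>z. det (A z)) S"
  unfolding det_def by (intro C1_on_sum C1_on_mult C1_on_prod C1_on_const assms)

text \<open>Jacobi's formula at the identity; the product rule leaves the sum that
  \<open>det_line_deriv_0\<close> evaluates.\<close>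

lemma has_derivative_det_at_id:
  fixes A :: "'a::real_normed_vector \<Rightarrow> real^'k^'k::finite"
  assumes A: "\<And>i j. ((\<lambda>z. A z $ i $ j) has_derivative (\<lambda>v. A' v $ i $ j)) (at z)" and id: "A z = mat 1"
  shows "((\<lambda>z. det (A z)) has_derivative (\<lambda>v. trace (A' v))) (at z)"
proof -
  have "((\<lambda>z. det (A z)) has_derivative (\<lambda>v. \<Sum>p | p permutes (UNIV :: 'k set). of_int (sign p) *
     (\<Sum>i\<in>UNIV. A' v $ i $ p i * (\<Prod>j\<in>UNIV - {i}. A z $ j $ p j)))) (at z)"
    unfolding det_def by (intro has_derivative_sum has_derivative_mult_right has_derivative_prod A)
  then show ?thesis
    using det_line_deriv_0[where 'n = 'k] unfolding id det_line_deriv_def by simp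
qed

section \<open>Gradients and their divergence in a chart\<close>

text \<open>For the frame matrix \<open>A\<close>, \<open>transpose A ** gram B\<close> is the
  inverse of \<open>A\<close>, and the trace is invariant under conjugation.\<close>

lemma orthonormal_sum_gram:
  fixes B :: "real^'m::finite \<Rightarrow> real^'m \<Rightarrow> real"
  assumes B: "bilinear B" and E: "orthonormal_basis B E" and L: "linear L"
  shows "trace (matrix L) = (\<Sum>e\<in>E. B e (L e))"
proof -
  obtain e and A :: "real^'m^'m" where e: "bij_betw e UNIV E" "A = (\<chi> i j. e j $ i)"
    and A: "transpose A ** gram B ** A = mat 1"
    using orthonormal_basis_matrix[OF B E] by blast
  have Ae: "A *v axis j 1 = e j" for j
    by (simp add: e(2) matrix_vector_mult_basis column_def vec_eq_iff)
  have inv: "A ** (transpose A ** gram B) = mat 1"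
    using A matrix_left_right_inverse by blast
  have "trace (matrix L) = trace (matrix L ** (A ** (transpose A ** gram B)))"
    unfolding inv by simp
  also have "\<dots> = trace ((transpose A ** gram B) ** (matrix L ** A))"
    by (metis matrix_mul_assoc trace_mul_sym)
  also have "\<dots> = (\<Sum>j\<in>UNIV. B (e j) (L (e j)))"
    unfolding trace_def
  proof (rule sum.cong[OF refl])
    fix j
    have "(transpose A ** gram B ** (matrix L ** A)) $ j $ j
        = axis j 1 \<bullet> (transpose A ** gram B ** (matrix L ** A) *v axis j 1)"
      by (simp add: inner_axis' matrix_vector_mult_basis column_def)
    also have "\<dots> = (A *v axis j 1) \<bullet> (gram B *v (matrix L *v (A *v axis j 1)))"
      by (simp only: matrix_vector_dot matrix_vector_mul_assoc matrix_mul_assoc)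
    also have "\<dots> = B (e j) (L (e j))"
      unfolding Ae gram_eq[OF B, symmetric] using matrix_vector_mul(2)[OF L] by metis
    finally show "(transpose A ** gram B ** (matrix L ** A)) $ j $ j = B (e j) (L (e j))" .
  qed
  also have "\<dots> = (\<Sum>e\<in>E. B e (L e))"
    by (rule sum.reindex_bij_betw[OF e(1), of "\<lambda>e. B e (L e)"])
  finally show ?thesis .
qed

context riemannian
begin

text \<open>The first of the three vectors is the direction of differentiation, the other two are
  constant arguments of the metric.\<close>

definition dmet :: "('p, 'm) chart \<Rightarrow> real^'m \<Rightarrow> real^'m \<Rightarrow> real^'m \<Rightarrow> real^'m \<Rightarrow> real" where
  "dmet c z u v w = frechet_derivative (\<lambda>y. coord_metric M c y v w) (at z) u"

lemma coord_metric_has_derivative: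
  "c \<in> atlas M \<Longrightarrow> z \<in> chart_im c \<Longrightarrow>
    ((\<lambda>y. coord_metric M c y v w) has_derivative (\<lambda>u. dmet c z u v w)) (at z)"
  unfolding dmet_def by (rule has_derivative_frechet[OF smooth_onD(1)[OF smooth_coord_metric]])

lemma linear_dmet: "c \<in> atlas M \<Longrightarrow> z \<in> chart_im c \<Longrightarrow> linear (\<lambda>u. dmet c z u v w)"
  using coord_metric_has_derivative has_derivative_linear by blast

lemma dmet_expansion:
  assumes c: "c \<in> atlas M" and z: "z \<in> chart_im c"
  shows "dmet c z u v w = (\<Sum>i\<in>UNIV. \<Sum>j\<in>UNIV. v $ i * w $ j * dmet c z u (axis i 1) (axis j 1))"
proof -
  have "((\<lambda>y. \<Sum>i\<in>UNIV. \<Sum>j\<in>UNIV. v $ i * w $ j * coord_metric M c y (axis i 1) (axis j 1))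
      has_derivative (\<lambda>u. \<Sum>i\<in>UNIV. \<Sum>j\<in>UNIV. v $ i * w $ j * dmet c z u (axis i 1) (axis j 1))) (at z)"
    by (intro has_derivative_sum has_derivative_mult_right coord_metric_has_derivative c z)
  then have "((\<lambda>y. coord_metric M c y v w)
      has_derivative (\<lambda>u. \<Sum>i\<in>UNIV. \<Sum>j\<in>UNIV. v $ i * w $ j * dmet c z u (axis i 1) (axis j 1))) (at z)"
    by (rule has_derivative_transform_within_open[OF _ chartD(2)[OF c] z])
      (rule bilinear_expansion[OF inner_productD(1)[OF inner_product_coord_metric[OF c]], symmetric])
  from fun_cong[OF has_derivative_unique[OF coord_metric_has_derivative[OF c z] this], of u] show ?thesis .
qed

lemma bilinear_dmet:
  assumes c: "c \<in> atlas M" and z: "z \<in> chart_im c"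
  shows "bilinear (dmet c z u)"
proof -
  have 1: "bilinear (\<lambda>v w. \<Sum>i\<in>UNIV. \<Sum>j\<in>UNIV. v $ i * w $ j * k i j)" for k :: "'m \<Rightarrow> 'm \<Rightarrow> real"
    unfolding bilinear_def by (auto intro!: linearI simp: sum.distrib sum_distrib_left algebra_simps)
  have 2: "dmet c z u = (\<lambda>v w. \<Sum>i\<in>UNIV. \<Sum>j\<in>UNIV. v $ i * w $ j * dmet c z u (axis i 1) (axis j 1))"
    by (intro ext dmet_expansion c z)
  show ?thesis by (subst 2) (rule 1)
qed

lemma dmet_sym:
  assumes c: "c \<in> atlas M" and z: "z \<in> chart_im c"
  shows "dmet c z u v w = dmet c z u w v"
proof -
  have "((\<lambda>y. coord_metric M c y v w) has_derivative (\<lambda>u. dmet c z u w v)) (at z)"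
    by (rule has_derivative_transform_within_open[OF coord_metric_has_derivative[OF c z] chartD(2)[OF c] z])
      (rule inner_productD(2)[OF inner_product_coord_metric[OF c]])
  from fun_cong[OF has_derivative_unique[OF coord_metric_has_derivative[OF c z] this], of u] show ?thesis .
qed

text \<open>The vector dual to the linear form \<open>b\<close>, by Cramer's rule: as a quotient of
  determinants it visibly depends on the base point in a \<open>C1\<close> way.\<close>

definition grad :: "('p, 'm) chart \<Rightarrow> real^'m \<Rightarrow> (real^'m \<Rightarrow> real) \<Rightarrow> real^'m" where
  "grad c z b = (\<chi> k. det (\<chi> i j. if j = k then b (axis i 1) else gram (coord_metric M c z) $ i $ j)
     / det (gram (coord_metric M c z)))"

lemma coord_metric_grad:
  assumes c: "c \<in> atlas M" and z: "z \<in> chart_im c" and b: "linear b"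
  shows "coord_metric M c z (grad c z b) w = b w"
proof -
  let ?G = "gram (coord_metric M c z)"
  note ip = inner_product_coord_metric[OF c z]
  have "?G *v grad c z b = (\<chi> i. b (axis i 1))"
    using det_gram_pos[OF ip] by (subst cramer) (auto simp: grad_def vec_eq_iff cong: if_cong)
  then have "coord_metric M c z w (grad c z b) = w \<bullet> (\<chi> i. b (axis i 1))"
    by (simp add: gram_eq[OF inner_productD(1)[OF ip]])
  also have "\<dots> = b w"
    using linear_expansion[OF b, of w] by (simp add: inner_vec_def)
  finally show ?thesis using inner_productD(2)[OF ip] by metis
qed

lemma coord_metric_eq_iff:
  assumes c: "c \<in> atlas M" and z: "z \<in> chart_im c" and "\<And>w. coord_metric M c z a w = coord_metric M c z a' w"
  shows "a = a'"
proof (rule ccontr)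
  assume "a \<noteq> a'"
  then have "coord_metric M c z (a - a') (a - a') > 0"
    using inner_productD(3)[OF inner_product_coord_metric[OF c z]] by simp
  then show False
    using assms(3)[of "a - a'"] bilinear_lsub[OF inner_productD(1)[OF inner_product_coord_metric[OF c z]]] by simp
qed

text \<open>Gives meaning to the description in \<open>christoffel\<close>: the Koszul expression is
  linear in \<open>w\<close>, hence represented by exactly one vector.\<close>

lemma coord_metric_christoffel:
  assumes c: "c \<in> atlas M" and z: "z \<in> chart_im c"
  shows "coord_metric M c z (christoffel M c z u v) w = (dmet c z u v w + dmet c z v u w - dmet c z w u v) / 2"
proof -
  let ?K = "\<lambda>w. (dmet c z u v w + dmet c z v u w - dmet c z w u v) / 2"
  have "linear ?K"
    by (intro linearI) (simp_all add: bilinear_simps[OF bilinear_dmet[OF c z]]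
        linear_add[OF linear_dmet[OF c z]] linear_cmul[OF linear_dmet[OF c z]] algebra_simps add_divide_distrib diff_divide_distrib)
  then have K: "\<forall>w. coord_metric M c z (grad c z ?K) w = ?K w"
    using coord_metric_grad[OF c z] by blast
  have "\<exists>!a. \<forall>w. coord_metric M c z a w = ?K w"
  proof (rule ex1I[of "\<lambda>a. \<forall>w. coord_metric M c z a w = ?K w", OF K])
    fix a assume a: "\<forall>w. coord_metric M c z a w = ?K w"
    show "a = grad c z ?K"
      by (rule coord_metric_eq_iff[OF c z trans[OF a[rule_format] K[rule_format, symmetric]]])
  qed
  from theI'[OF this] show ?thesis
    unfolding christoffel_def dmet_def by blast
qed

lemma C1_on_grad:
  assumes c: "c \<in> atlas M" and W: "W \<subseteq> chart_im c"
    and \<beta>: "\<And>w. C1_on (\<lambda>y. \<beta> y w) W"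
  shows "C1_on (\<lambda>y. grad c y (\<beta> y)) W"
proof -
  have g: "C1_on (\<lambda>y. gram (coord_metric M c y) $ i $ j) W" for i j
    using C1_on_subset[OF smooth_on_imp_C1_on[OF smooth_coord_metric[OF c]] W] by (simp add: gram_def)
  have "C1_on (\<lambda>y. (\<chi> i j. if j = k then \<beta> y (axis i 1) else gram (coord_metric M c y) $ i $ j) $ i $ j) W" for i j k
    using g[of i j] \<beta>[of "axis i 1"] by (cases "j = k") (simp_all only: vec_lambda_beta if_True if_False simp_thms)
  then show ?thesis
    unfolding grad_def using det_gram_pos[OF inner_product_coord_metric[OF c]] W
    by (intro C1_on_vec C1_on_divide C1_on_det g) (auto simp: less_imp_neq[symmetric])
qed

text \<open>Differentiate \<open>coord_metric M c y (V y) w = \<beta> y w\<close>, put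
  \<open>u = w = e\<close> and sum. By the Koszul formula the derivatives of the metric combine into
  the Christoffel term and half the trace of \<open>dmet\<close> in direction \<open>V z\<close>;
  the latter is the logarithmic derivative of the volume density.\<close>

lemma divergence_grad:
  assumes c: "c \<in> atlas M" and W: "open W" "W \<subseteq> chart_im c" "z \<in> W"
    and lin: "\<And>y. y \<in> W \<Longrightarrow> linear (\<beta> y)" and \<beta>: "\<And>w. C1_on (\<lambda>y. \<beta> y w) W"
    and E: "orthonormal_basis (coord_metric M c z) E"
  defines "V \<equiv> \<lambda>y. grad c y (\<beta> y)"
  shows "trace (matrix (frechet_derivative V (at z))) + (\<Sum>e\<in>E. dmet c z (V z) e e) / 2 =
    (\<Sum>e\<in>E. frechet_derivative (\<lambda>y. \<beta> y e) (at z) e - \<beta> z (christoffel M c z e e))"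
proof -
  have z: "z \<in> chart_im c" using W by auto
  note ip = inner_product_coord_metric[OF c z]
  note bl = inner_productD(1)[OF ip]
  let ?V' = "frechet_derivative V (at z)"
  have C1V: "C1_on V W" unfolding V_def by (rule C1_on_grad[OF c W(2) \<beta>])
  have V': "(V has_derivative ?V') (at z)" by (rule C1_onD(1)[OF C1V W(3)])
  have V'i: "((\<lambda>y. V y $ i) has_derivative (\<lambda>u. ?V' u $ i)) (at z)" for i
    by (rule bounded_linear.has_derivative[OF bounded_linear_vec_nth V'])
  have linV': "linear ?V'" using V' has_derivative_linear by blast
  have Vw: "coord_metric M c y (V y) w = \<beta> y w" if "y \<in> W" for y w
    unfolding V_def using that W(2) lin by (intro coord_metric_grad[OF c]) auto
  have key: "coord_metric M c z (?V' u) w + dmet c z u (V z) w = frechet_derivative (\<lambda>y. \<beta> y w) (at z) u" for u w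
  proof -
    have "((\<lambda>y. \<Sum>i\<in>UNIV. V y $ i * coord_metric M c y (axis i 1) w) has_derivative
        (\<lambda>u. \<Sum>i\<in>UNIV. V z $ i * dmet c z u (axis i 1) w + ?V' u $ i * coord_metric M c z (axis i 1) w)) (at z)"
      by (intro has_derivative_sum has_derivative_mult V'i coord_metric_has_derivative c z)
    then have "((\<lambda>y. \<beta> y w) has_derivative
        (\<lambda>u. \<Sum>i\<in>UNIV. V z $ i * dmet c z u (axis i 1) w + ?V' u $ i * coord_metric M c z (axis i 1) w)) (at z)"
    proof (rule has_derivative_transform_within_open[OF _ W(1,3)])
      fix y assume y: "y \<in> W"
      have "linear (\<lambda>v. coord_metric M c y v w)"
        using inner_productD(1)[OF inner_product_coord_metric[OF c, of y]] y W by (auto simp: bilinear_def)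
      from linear_expansion[OF this, of "V y"] Vw[OF y]
      show "(\<Sum>i\<in>UNIV. V y $ i * coord_metric M c y (axis i 1) w) = \<beta> y w" by simp
    qed
    from has_derivative_unique[OF C1_onD(1)[OF \<beta> W(3)] this]
    have "frechet_derivative (\<lambda>y. \<beta> y w) (at z) u =
        (\<Sum>i\<in>UNIV. V z $ i * dmet c z u (axis i 1) w) + (\<Sum>i\<in>UNIV. ?V' u $ i * coord_metric M c z (axis i 1) w)"
      by (simp add: sum.distrib)
    moreover have "linear (\<lambda>v. coord_metric M c z v w)" "linear (\<lambda>v. dmet c z u v w)"
      using bl bilinear_dmet[OF c z] by (auto simp: bilinear_def)
    from linear_expansion[OF this(1), of "?V' u"] linear_expansion[OF this(2), of "V z"]
    have "coord_metric M c z (?V' u) w = (\<Sum>i\<in>UNIV. ?V' u $ i * coord_metric M c z (axis i 1) w)"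
      "dmet c z u (V z) w = (\<Sum>i\<in>UNIV. V z $ i * dmet c z u (axis i 1) w)" by auto
    ultimately show ?thesis by simp
  qed
  have "trace (matrix ?V') = (\<Sum>e\<in>E. coord_metric M c z e (?V' e))"
    by (rule orthonormal_sum_gram[OF bl E linV'])
  moreover have "coord_metric M c z e (?V' e) + dmet c z (V z) e e / 2 =
      frechet_derivative (\<lambda>y. \<beta> y e) (at z) e - \<beta> z (christoffel M c z e e)" for e
  proof -
    have "\<beta> z (christoffel M c z e e) = coord_metric M c z (christoffel M c z e e) (V z)"
      using Vw[OF W(3)] inner_productD(2)[OF ip] by metis
    also have "\<dots> = dmet c z e e (V z) - dmet c z (V z) e e / 2"
      by (simp add: coord_metric_christoffel[OF c z] field_simps)
    finally show ?thesis
      using key[of e e] inner_productD(2)[OF ip, of e "?V' e"] dmet_sym[OF c z, of e e "V z"] by simp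
  qed
  ultimately show ?thesis
    by (simp add: sum.distrib[symmetric] sum_divide_distrib)
qed

text \<open>A constant frame that is orthonormal at \<open>z\<close> makes the Gram matrix the
  identity at \<open>z\<close>, where the derivative of the determinant is a trace.\<close>

lemma volume_density_has_derivative:
  assumes c: "c \<in> atlas M" and z: "z \<in> chart_im c" and E: "orthonormal_basis (coord_metric M c z) E"
  shows "(volume_density M c has_derivative (\<lambda>u. volume_density M c z * (\<Sum>e\<in>E. dmet c z u e e) / 2)) (at z)"
proof -
  note ip = inner_product_coord_metric[OF c z]
  let ?D = "\<lambda>y. det (gram (coord_metric M c y))"
  obtain e and A :: "real^'m^'m" where e: "bij_betw e UNIV E" "A = (\<chi> i j. e j $ i)"
    and A: "transpose A ** gram (coord_metric M c z) ** A = mat 1"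
    using orthonormal_basis_matrix[OF inner_productD(1)[OF ip] E] by blast
  have Ae: "A *v axis j 1 = e j" for j
    by (simp add: e(2) matrix_vector_mult_basis column_def vec_eq_iff)
  define Q where "Q y = (\<chi> i j. coord_metric M c y (e i) (e j))" for y
  have Q: "Q y = transpose A ** gram (coord_metric M c y) ** A" if "y \<in> chart_im c" for y
    using gram_matrix_mult[OF inner_productD(1)[OF inner_product_coord_metric[OF c that]], of A]
    unfolding gram_def[of "\<lambda>u v. coord_metric M c y (A *v u) (A *v v)"] Ae Q_def by simp
  then have detQ: "det (Q y) = (det A)\<^sup>2 * ?D y" if "y \<in> chart_im c" for y
    using that by (simp add: det_mul power2_eq_square)
  have Qz: "Q z = mat 1" using Q[OF z] A by simp
  then have 1: "(det A)\<^sup>2 * ?D z = 1" using detQ[OF z] by simp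
  have "((\<lambda>y. det (Q y)) has_derivative (\<lambda>u. trace (\<chi> i j. dmet c z u (e i) (e j)))) (at z)"
    by (rule has_derivative_det_at_id[where A = Q and A' = "\<lambda>u. \<chi> i j. dmet c z u (e i) (e j)"])
      (simp add: Q_def coord_metric_has_derivative[OF c z], rule Qz)
  then have "((\<lambda>y. ?D z * det (Q y)) has_derivative (\<lambda>u. ?D z * trace (\<chi> i j. dmet c z u (e i) (e j)))) (at z)"
    by (rule has_derivative_mult_right)
  moreover have "trace (\<chi> i j. dmet c z u (e i) (e j)) = (\<Sum>e\<in>E. dmet c z u e e)" for u
    unfolding trace_def using sum.reindex_bij_betw[OF e(1), of "\<lambda>e. dmet c z u e e"] by simp
  ultimately have "((\<lambda>y. ?D z * det (Q y)) has_derivative (\<lambda>u. ?D z * (\<Sum>e\<in>E. dmet c z u e e))) (at z)"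
    by simp
  then have "(?D has_derivative (\<lambda>u. ?D z * (\<Sum>e\<in>E. dmet c z u e e))) (at z)"
  proof (rule has_derivative_transform_within_open[OF _ chartD(2)[OF c] z])
    fix y assume "y \<in> chart_im c"
    from detQ[OF this] show "?D z * det (Q y) = ?D y"
      using 1 by (simp add: algebra_simps)
  qed
  from has_derivative_compose[OF this DERIV_real_sqrt[OF det_gram_pos[OF ip], unfolded has_field_derivative_def]]
  have "((\<lambda>y. sqrt (?D y)) has_derivative (\<lambda>u. inverse (sqrt (?D z)) / 2 * (?D z * (\<Sum>e\<in>E. dmet c z u e e)))) (at z)" .
  note deriv = this
  have *: "inverse (sqrt (?D z)) * ?D z = sqrt (?D z)"
    using det_gram_pos[OF ip] real_sqrt_mult_self[of "?D z"] by (simp add: field_simps)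
  have **: "inverse (sqrt (?D z)) / 2 * (?D z * s) = sqrt (?D z) * s / 2" for s
  proof -
    have "inverse (sqrt (?D z)) / 2 * (?D z * s) = (inverse (sqrt (?D z)) * ?D z) * s / 2" by simp
    then show ?thesis by (simp only: *)
  qed
  show ?thesis
    unfolding volume_density_gram[abs_def] using deriv unfolding ** .
qed

lemma C1_on_volume_density: "c \<in> atlas M \<Longrightarrow> C1_on (volume_density M c) (chart_im c)"
  unfolding volume_density_gram[abs_def]
  by (intro C1_on_sqrt C1_on_det det_gram_pos inner_product_coord_metric)
    (simp_all only: gram_def vec_lambda_beta smooth_on_imp_C1_on[OF smooth_coord_metric])

lemma trace_product:
  fixes V :: "real^'m \<Rightarrow> real^'m"
  assumes \<rho>: "(\<rho> has_derivative \<rho>') (at z)" and V: "(V has_derivative V') (at z)"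
  shows "((\<lambda>y. \<rho> y *\<^sub>R V y) has_derivative (\<lambda>u. \<rho> z *\<^sub>R V' u + \<rho>' u *\<^sub>R V z)) (at z)"
    and "trace (matrix (\<lambda>u. \<rho> z *\<^sub>R V' u + \<rho>' u *\<^sub>R V z)) = \<rho> z * trace (matrix V') + \<rho>' (V z)"
proof -
  show "((\<lambda>y. \<rho> y *\<^sub>R V y) has_derivative (\<lambda>u. \<rho> z *\<^sub>R V' u + \<rho>' u *\<^sub>R V z)) (at z)"
    by (rule has_derivative_scaleR[OF \<rho> V])
  have "linear \<rho>'" using \<rho> has_derivative_linear by blast
  from linear_expansion[OF this, of "V z"] show
    "trace (matrix (\<lambda>u. \<rho> z *\<^sub>R V' u + \<rho>' u *\<^sub>R V z)) = \<rho> z * trace (matrix V') + \<rho>' (V z)"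
    by (simp add: trace_def matrix_def sum.distrib sum_distrib_left mult.commute)
qed

end

text \<open>An explicit quadratic remainder can be integrated over parameters, unlike mere
  differentiability; this is the bridge back to a derivative.\<close>

lemma has_real_derivative_quadratic_bound:
  fixes f :: "real \<Rightarrow> real"
  assumes "\<And>h. \<bar>h\<bar> \<le> 1 \<Longrightarrow> \<bar>f (x + h) - f x - D * h\<bar> \<le> C * h\<^sup>2"
  shows "(f has_real_derivative D) (at x)"
  unfolding DERIV_def
proof (rule Lim_null_comparison[where g = "\<lambda>h. \<bar>C\<bar> * \<bar>h\<bar>", THEN Lim_null[THEN iffD2]])
  show "\<forall>\<^sub>F h in at 0. norm ((f (x + h) - f x) / h - D) \<le> \<bar>C\<bar> * \<bar>h\<bar>"
    unfolding eventually_at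
  proof (intro exI[of _ 1] conjI ballI impI)
    fix h :: real assume h: "h \<noteq> 0 \<and> dist h 0 < 1"
    have "\<bar>(f (x + h) - f x) / h - D\<bar> = \<bar>f (x + h) - f x - D * h\<bar> / \<bar>h\<bar>"
      using h by (simp add: field_simps flip: abs_divide)
    also have "\<dots> \<le> \<bar>C\<bar> * h\<^sup>2 / \<bar>h\<bar>"
    proof (rule divide_right_mono)
      have C: "C * h\<^sup>2 \<le> \<bar>C\<bar> * h\<^sup>2" by (intro mult_right_mono) auto
      show "\<bar>f (x + h) - f x - D * h\<bar> \<le> \<bar>C\<bar> * h\<^sup>2"
        by (rule order_trans[OF assms C]) (use h in simp)
    qed simp
    also have "h\<^sup>2 = \<bar>h\<bar> * \<bar>h\<bar>" by (simp add: power2_eq_square)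
    also have "\<bar>C\<bar> * (\<bar>h\<bar> * \<bar>h\<bar>) / \<bar>h\<bar> = \<bar>C\<bar> * \<bar>h\<bar>" using h by (simp del: abs_mult_self_eq)
    finally show "norm ((f (x + h) - f x) / h - D) \<le> \<bar>C\<bar> * \<bar>h\<bar>" by simp
  qed simp
  show "((\<lambda>h. \<bar>C\<bar> * \<bar>h\<bar>) \<longlongrightarrow> 0) (at 0)"
    by (auto intro!: tendsto_eq_intros)
qed

text \<open>The bound does not involve \<open>t\<close>, so it can be integrated over the manifold
  with \<open>t\<close> the radius minus the distance.\<close>

lemma pos_part_square_bound:
  fixes t h :: real
  shows "\<bar>(max 0 (t + h))\<^sup>2 - (max 0 t)\<^sup>2 - 2 * max 0 t * h\<bar> \<le> h\<^sup>2"
proof -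
  consider "t \<ge> 0" "t + h \<ge> 0" | "t \<ge> 0" "t + h < 0" | "t < 0" "t + h \<ge> 0" | "t < 0" "t + h < 0" by linarith
  then show ?thesis
  proof cases
    case 1
    then show ?thesis by (simp add: power2_eq_square algebra_simps)
  next
    case 2
    then have "\<bar>- t\<^sup>2 - 2 * t * h\<bar> \<le> h\<^sup>2"
    proof -
      have "0 \<le> (t + h)\<^sup>2" by simp
      then have "- t\<^sup>2 - 2 * t * h \<le> h\<^sup>2" by (simp add: power2_eq_square algebra_simps)
      moreover have "t * (t + 2 * h) \<le> 0" using 2 by (intro mult_nonneg_nonpos) auto
      then have "0 \<le> - t\<^sup>2 - 2 * t * h" by (simp add: power2_eq_square algebra_simps)
      ultimately show ?thesis by simp
    qed
    with 2 show ?thesis by simp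
  next
    case 3
    then have "(t + h)\<^sup>2 \<le> h\<^sup>2" by (intro power_mono) auto
    with 3 show ?thesis by simp
  qed simp
qed

lemma pos_part_square_deriv: "((\<lambda>t::real. (max 0 t)\<^sup>2) has_real_derivative 2 * max 0 t) (at t)"
  by (rule has_real_derivative_quadratic_bound[where C = 1]) (simp add: pos_part_square_bound)

context riemannian
begin

section \<open>Differentiable functions on the manifold\<close>

definition C1_fun :: "('p \<Rightarrow> real) \<Rightarrow> bool" where
  "C1_fun f \<longleftrightarrow> (\<forall>c\<in>atlas M. C1_on (\<lambda>z. f (chart_inv c z)) (chart_im c))"

definition dfun :: "('p, 'm) chart \<Rightarrow> ('p \<Rightarrow> real) \<Rightarrow> real^'m \<Rightarrow> real^'m \<Rightarrow> real" where
  "dfun c f z = frechet_derivative (\<lambda>y. f (chart_inv c y)) (at z)"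

definition C2_fun_on :: "'p set \<Rightarrow> ('p \<Rightarrow> real) \<Rightarrow> bool" where
  "C2_fun_on U F \<longleftrightarrow> open U \<and> (\<forall>c\<in>atlas M.
     C1_on (\<lambda>z. F (chart_inv c z)) (snd c ` (fst c \<inter> U)) \<and>
     (\<forall>w. C1_on (\<lambda>z. dfun c F z w) (snd c ` (fst c \<inter> U))))"

definition gradient :: "('p, 'm) chart \<Rightarrow> ('p \<Rightarrow> real) \<Rightarrow> real^'m \<Rightarrow> real^'m" where
  "gradient c F z = grad c z (dfun c F z)"

text \<open>The trace of the Hessian; the Christoffel term turns the second coordinate derivative
  into the covariant one.\<close>

definition laplacian :: "('p, 'm) chart \<Rightarrow> ('p \<Rightarrow> real) \<Rightarrow> real^'m \<Rightarrow> real" where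
  "laplacian c F z = (\<Sum>e\<in>(SOME E. orthonormal_basis (coord_metric M c z) E).
     frechet_derivative (\<lambda>y. dfun c F y e) (at z) e - dfun c F z (christoffel M c z e e))"

text \<open>The inner product of the gradients of \<open>F\<close> and \<open>f\<close>, as the
  differential of \<open>f\<close> on the gradient of \<open>F\<close>. It is a function on the
  manifold, since contributions from different charts have to be added under one integral.\<close>

definition grad_pairing :: "('p \<Rightarrow> real) \<Rightarrow> ('p \<Rightarrow> real) \<Rightarrow> 'p \<Rightarrow> real" where
  "grad_pairing F f p = (let c = (SOME c. c \<in> atlas M \<and> p \<in> fst c) in
     dfun c f (snd c p) (gradient c F (snd c p)))"

lemma C1_funD:
  assumes "C1_fun f" "c \<in> atlas M"
  shows "C1_on (\<lambda>z. f (chart_inv c z)) (chart_im c)"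
    and "z \<in> chart_im c \<Longrightarrow> ((\<lambda>y. f (chart_inv c y)) has_derivative dfun c f z) (at z)"
proof -
  show "C1_on (\<lambda>z. f (chart_inv c z)) (chart_im c)" using assms by (auto simp: C1_fun_def)
  from C1_onD(1)[OF this]
  show "z \<in> chart_im c \<Longrightarrow> ((\<lambda>y. f (chart_inv c y)) has_derivative dfun c f z) (at z)"
    unfolding dfun_def .
qed

lemma continuous_on_from_charts:
  fixes f :: "'p \<Rightarrow> 'b::topological_space"
  assumes "\<And>p. p \<in> S \<Longrightarrow> \<exists>c U. c \<in> atlas M \<and> open U \<and> p \<in> U \<and> U \<subseteq> fst c \<and>
     continuous_on (snd c ` U) (\<lambda>z. f (chart_inv c z))"
  shows "continuous_on S f"
proof (rule continuous_on_locally)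
  fix p assume "p \<in> S"
  from assms[OF this] obtain c U where cU: "c \<in> atlas M" "open U" "p \<in> U" "U \<subseteq> fst c"
    "continuous_on (snd c ` U) (\<lambda>z. f (chart_inv c z))" by blast
  have "continuous_on U (\<lambda>q. f (chart_inv c (snd c q)))"
    by (rule continuous_on_compose2[OF cU(5) continuous_on_subset[OF chartD(3)[OF cU(1)] cU(4)]]) auto
  then have "continuous_on U f"
    by (rule continuous_on_eq) (use cU chartD(5)[OF cU(1)] in auto)
  then show "\<exists>W. open W \<and> p \<in> W \<and> continuous_on (S \<inter> W) f"
    using cU by (intro exI[of _ U]) (auto intro: continuous_on_subset)
qed

lemma C1_fun_continuous: "C1_fun f \<Longrightarrow> continuous_on S f"
proof (rule continuous_on_from_charts)
  fix p assume f: "C1_fun f"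
  obtain c where c: "c \<in> atlas M" "p \<in> fst c" by (rule ex_chart)
  then show "\<exists>c U. c \<in> atlas M \<and> open U \<and> p \<in> U \<and> U \<subseteq> fst c \<and>
     continuous_on (snd c ` U) (\<lambda>z. f (chart_inv c z))"
    using chartD(1) C1_on_imp_continuous_on[OF C1_funD(1)[OF f c(1)]] by (intro exI[of _ c] exI[of _ "fst c"]) auto
qed

lemma C1_fun_mult: "C1_fun f \<Longrightarrow> C1_fun g \<Longrightarrow> C1_fun (\<lambda>p. f p * g p)"
  unfolding C1_fun_def by (intro ballI C1_on_mult) blast+

lemma C1_fun_diff: "C1_fun f \<Longrightarrow> C1_fun g \<Longrightarrow> C1_fun (\<lambda>p. f p - g p)"
  unfolding C1_fun_def by (intro ballI C1_on_diff) blast+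

lemma C1_fun_const: "C1_fun (\<lambda>p. k)"
  unfolding C1_fun_def by (blast intro: C1_on_const)

lemma C1_fun_prod: "(\<And>i. i \<in> I \<Longrightarrow> C1_fun (f i)) \<Longrightarrow> C1_fun (\<lambda>p. \<Prod>i\<in>I. f i p)"
  unfolding C1_fun_def by (intro ballI C1_on_prod) blast

lemma C2_fun_onD:
  assumes F: "C2_fun_on U F" and c: "c \<in> atlas M"
  shows "open U" "open (snd c ` (fst c \<inter> U))" "snd c ` (fst c \<inter> U) \<subseteq> chart_im c"
    "z \<in> snd c ` (fst c \<inter> U) \<Longrightarrow> ((\<lambda>y. F (chart_inv c y)) has_derivative dfun c F z) (at z)"
    "z \<in> snd c ` (fst c \<inter> U) \<Longrightarrow> linear (dfun c F z)"
    "C1_on (\<lambda>z. dfun c F z w) (snd c ` (fst c \<inter> U))"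
    "C1_on (gradient c F) (snd c ` (fst c \<inter> U))"
proof -
  show U: "open U" using F by (simp add: C2_fun_on_def)
  show "open (snd c ` (fst c \<inter> U))" by (intro open_chart_image c open_Int chartD(1) U) auto
  show sub: "snd c ` (fst c \<inter> U) \<subseteq> chart_im c" by auto
  have "C1_on (\<lambda>z. F (chart_inv c z)) (snd c ` (fst c \<inter> U))" using F c by (simp add: C2_fun_on_def)
  from C1_onD(1)[OF this]
  show d: "z \<in> snd c ` (fst c \<inter> U) \<Longrightarrow> ((\<lambda>y. F (chart_inv c y)) has_derivative dfun c F z) (at z)" for z
    unfolding dfun_def .
  show "z \<in> snd c ` (fst c \<inter> U) \<Longrightarrow> linear (dfun c F z)" using d has_derivative_linear by blast
  show C1: "C1_on (\<lambda>z. dfun c F z w) (snd c ` (fst c \<inter> U))" for w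
    using F c unfolding C2_fun_on_def by blast
  show "C1_on (gradient c F) (snd c ` (fst c \<inter> U))"
    using C1_on_grad[OF c sub C1] unfolding gradient_def[abs_def] .
qed

lemma coord_metric_gradient:
  assumes "C2_fun_on U F" "c \<in> atlas M" "z \<in> snd c ` (fst c \<inter> U)"
  shows "coord_metric M c z (gradient c F z) w = dfun c F z w"
  unfolding gradient_def
  using coord_metric_grad[OF assms(2) _ C2_fun_onD(5)[OF assms]] C2_fun_onD(3)[OF assms(1,2)] assms(3) by blast

lemma dfun_change:
  assumes c: "c \<in> atlas M" "d \<in> atlas M" and p: "p \<in> fst c \<inter> fst d"
    and f: "((\<lambda>y. f (chart_inv d y)) has_derivative dfun d f (snd d p)) (at (snd d p))"
  shows "dfun c f (snd c p) w = dfun d f (snd d p) (frechet_derivative (transition c d) (at (snd c p)) w)"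
proof -
  let ?T = "transition c d" and ?z = "snd c p"
  have "(?T has_derivative frechet_derivative ?T (at ?z)) (at ?z)"
    by (intro has_derivative_frechet transition_differentiable c p)
  then have "((\<lambda>y. f (chart_inv d (?T y))) has_derivative (\<lambda>w. dfun d f (snd d p) (frechet_derivative ?T (at ?z) w))) (at ?z)"
    by (rule has_derivative_compose) (use f transition(2)[OF c] p in simp)
  then have "((\<lambda>y. f (chart_inv c y)) has_derivative (\<lambda>w. dfun d f (snd d p) (frechet_derivative ?T (at ?z) w))) (at ?z)"
  proof (rule has_derivative_transform_within_open)
    show "open (snd c ` (fst c \<inter> fst d))" by (intro open_chart_image c open_Int chartD(1)) auto
    fix y assume "y \<in> snd c ` (fst c \<inter> fst d)"
    then obtain q where "q \<in> fst c \<inter> fst d" "y = snd c q" by blast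
    then show "f (chart_inv d (?T y)) = f (chart_inv c y)"
      using transition(2)[OF c] chartD(5) c by simp
  qed (use p in auto)
  from fun_cong[OF frechet_derivative_at[OF this], of w] show ?thesis by (simp add: dfun_def)
qed

text \<open>The differential of a transition map is isometric, hence bijective, and carries the
  defining property of the gradient from one chart to the other.\<close>

lemma gradient_change:
  assumes F: "C2_fun_on U F" and c: "c \<in> atlas M" "d \<in> atlas M" and p: "p \<in> fst c \<inter> fst d" "p \<in> U"
  shows "frechet_derivative (transition c d) (at (snd c p)) (gradient c F (snd c p)) = gradient d F (snd d p)"
proof -
  let ?T = "frechet_derivative (transition c d) (at (snd c p))"
  have linT: "linear ?T" by (intro linear_frechet transition_differentiable c p)
  have zc: "snd c p \<in> snd c ` (fst c \<inter> U)" and zd: "snd d p \<in> snd d ` (fst d \<inter> U)" using p by auto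
  have cm: "coord_metric M c (snd c p) = metric M c p" "coord_metric M d (snd d p) = metric M d p"
    using c p by (auto intro: coord_metric_eq)
  have "inj ?T"
  proof (rule linear_injective_0[OF linT, THEN iffD2], intro allI impI)
    fix u assume "?T u = 0"
    then have "metric M c p u u = 0"
      using metric_change[OF c p(1), of u u] inner_productD(5)[OF inner_product_metric[OF c(2)]] p by simp
    then show "u = 0" using inner_productD(3)[OF inner_product_metric[OF c(1)], of p u] p by force
  qed
  then have surj: "surj ?T" using linear_injective_imp_surjective[OF linT] by simp
  show ?thesis
  proof (rule coord_metric_eq_iff[OF c(2)])
    show "snd d p \<in> chart_im d" using p by auto
    fix w
    obtain u where u: "w = ?T u" using surj by (rule surjE)
    have "coord_metric M d (snd d p) (?T (gradient c F (snd c p))) w = coord_metric M c (snd c p) (gradient c F (snd c p)) u"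
      unfolding cm u metric_change[OF c p(1)] ..
    also have "\<dots> = dfun c F (snd c p) u" by (rule coord_metric_gradient[OF F c(1) zc])
    also have "\<dots> = dfun d F (snd d p) w"
      unfolding u by (rule dfun_change[OF c p(1) C2_fun_onD(4)[OF F c(2) zd]])
    also have "\<dots> = coord_metric M d (snd d p) (gradient d F (snd d p)) w"
      by (rule coord_metric_gradient[OF F c(2) zd, symmetric])
    finally show "coord_metric M d (snd d p) (?T (gradient c F (snd c p))) w = coord_metric M d (snd d p) (gradient d F (snd d p)) w" .
  qed
qed

lemma grad_pairing_chart:
  assumes F: "C2_fun_on U F" and f: "C1_fun f" and c: "c \<in> atlas M" and p: "p \<in> fst c" "p \<in> U"
  shows "grad_pairing F f p = dfun c f (snd c p) (gradient c F (snd c p))"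
proof -
  define d where "d = (SOME c. c \<in> atlas M \<and> p \<in> fst c)"
  note d = some_chart[OF d_def]
  have pdc: "p \<in> fst d \<inter> fst c" using d p by auto
  have "dfun d f (snd d p) (gradient d F (snd d p)) = dfun c f (snd c p) (gradient c F (snd c p))"
    unfolding gradient_change[OF F d(1) c pdc p(2), symmetric]
    by (rule dfun_change[OF d(1) c pdc C1_funD(2)[OF f c]]) (use p in auto)
  then show ?thesis by (simp add: grad_pairing_def d_def[symmetric])
qed

lemma grad_pairing_locally_const:
  assumes V: "open V" "p \<in> V" and f: "\<And>q. q \<in> V \<Longrightarrow> f q = k"
  shows "grad_pairing F f p = 0"
proof -
  define c where "c = (SOME c. c \<in> atlas M \<and> p \<in> fst c)"
  note c = some_chart[OF c_def]
  have "((\<lambda>y. f (chart_inv c y)) has_derivative (\<lambda>v. 0)) (at (snd c p))"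
  proof (rule has_derivative_transform_within_open[OF has_derivative_const[of k]])
    show "open (snd c ` (fst c \<inter> V))" by (intro open_chart_image c open_Int chartD(1) V) auto
    show "snd c p \<in> snd c ` (fst c \<inter> V)" using c V by auto
    show "k = f (chart_inv c y)" if "y \<in> snd c ` (fst c \<inter> V)" for y
      using that f chartD(5)[OF c(1)] by auto
  qed
  from frechet_derivative_at[OF this] have "dfun c f (snd c p) = (\<lambda>v. 0)" by (simp add: dfun_def)
  then show ?thesis by (simp add: grad_pairing_def c_def[symmetric])
qed

lemma grad_pairing_sum:
  assumes F: "C2_fun_on U F" and f: "\<And>i. i \<in> I \<Longrightarrow> C1_fun (f i)" and p: "p \<in> U"
  shows "grad_pairing F (\<lambda>p. \<Sum>i\<in>I. f i p) p = (\<Sum>i\<in>I. grad_pairing F (f i) p)"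
proof -
  obtain c where c: "c \<in> atlas M" "p \<in> fst c" by (rule ex_chart)
  have sum: "C1_fun (\<lambda>p. \<Sum>i\<in>I. f i p)" using f unfolding C1_fun_def by (intro ballI C1_on_sum) blast
  have z: "snd c p \<in> chart_im c" using c by auto
  have "((\<lambda>y. \<Sum>i\<in>I. f i (chart_inv c y)) has_derivative (\<lambda>v. \<Sum>i\<in>I. dfun c (f i) (snd c p) v)) (at (snd c p))"
    by (intro has_derivative_sum C1_funD(2)[OF f c(1) z])
  from frechet_derivative_at[OF this]
  have "dfun c (\<lambda>p. \<Sum>i\<in>I. f i p) (snd c p) = (\<lambda>v. \<Sum>i\<in>I. dfun c (f i) (snd c p) v)" by (simp add: dfun_def)
  then show ?thesis
    using grad_pairing_chart[OF F sum c p] grad_pairing_chart[OF F f c p] by simp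
qed

text \<open>In the chart, continuity is that of \<open>dfun\<close> and the gradient; off
  \<open>K\<close> the pairing vanishes. These two open sets cover the manifold.\<close>

lemma continuous_on_grad_pairing:
  assumes F: "C2_fun_on U F" and f: "C1_fun f" and c: "c \<in> atlas M" and K: "compact K" "K \<subseteq> fst c \<inter> U"
    and supp: "\<And>p. p \<notin> K \<Longrightarrow> f p = 0"
  shows "continuous_on S (grad_pairing F f)" and "p \<notin> K \<Longrightarrow> grad_pairing F f p = 0"
proof -
  have opK: "open (- K)" using K by (simp add: compact_imp_closed open_Compl)
  show 0: "grad_pairing F f p = 0" if "p \<notin> K" for p
    by (rule grad_pairing_locally_const[OF opK, of p f 0]) (use that supp in auto)
  let ?V = "fst c \<inter> U"
  have V: "open ?V" using C2_fun_onD(1)[OF F c] chartD(1)[OF c] by auto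
  have 1: "continuous_on ?V (grad_pairing F f)"
  proof (rule continuous_on_from_charts)
    fix p assume p: "p \<in> ?V"
    have "continuous_on (snd c ` ?V) (\<lambda>z. \<Sum>i\<in>UNIV. gradient c F z $ i *\<^sub>R dfun c f z (axis i 1))"
      using C1_onD(2)[OF C1_funD(1)[OF f c]] unfolding dfun_def[symmetric]
      by (intro continuous_intros C1_on_imp_continuous_on[OF C2_fun_onD(7)[OF F c]])
        (auto intro: continuous_on_subset)
    then have "continuous_on (snd c ` ?V) (\<lambda>z. grad_pairing F f (chart_inv c z))"
    proof (rule continuous_on_eq)
      fix z assume z: "z \<in> snd c ` ?V"
      then obtain q where q: "q \<in> ?V" "z = snd c q" by blast
      have "linear (dfun c f z)" using C1_funD(2)[OF f c, of z] z has_derivative_linear by blast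
      from linear_expansion[OF this, of "gradient c F z"] grad_pairing_chart[OF F f c, of q] q chartD(5)[OF c, of q]
      show "(\<Sum>i\<in>UNIV. gradient c F z $ i *\<^sub>R dfun c f z (axis i 1)) = grad_pairing F f (chart_inv c z)"
        by simp
    qed
    then show "\<exists>c U. c \<in> atlas M \<and> open U \<and> p \<in> U \<and> U \<subseteq> fst c \<and>
       continuous_on (snd c ` U) (\<lambda>z. grad_pairing F f (chart_inv c z))"
      using c V p by (intro exI[of _ c] exI[of _ ?V]) auto
  qed
  have 2: "continuous_on (- K) (grad_pairing F f)"
    by (rule continuous_on_eq[OF continuous_on_const[of _ 0]]) (use 0 in auto)
  have "continuous_on (?V \<union> - K) (grad_pairing F f)"
    by (rule continuous_on_open_Un[OF V opK 1 2])
  moreover have "?V \<union> - K = UNIV" using K by auto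
  ultimately show "continuous_on S (grad_pairing F f)" by (metis continuous_on_subset subset_UNIV)
qed

lemma integral_compact_chart:
  fixes f :: "'p \<Rightarrow> real"
  assumes c: "c \<in> atlas M" and C: "compact C" "C \<subseteq> chart_im c"
    and f: "continuous_on UNIV f" and supp: "\<And>p. p \<notin> chart_inv c ` C \<Longrightarrow> f p = 0"
  shows "(LINT p|riem_volume M. f p) = (LINT z:C|lborel. volume_density M c z * f (chart_inv c z))"
proof -
  have fm: "f \<in> borel_measurable borel" using f by (rule borel_measurable_continuous_onI)
  have fc: "f p = 0" if "p \<notin> fst c" for p
    using supp[of p] that C(2) chartD(6)[OF c] by blast
  have "(LINT p|riem_volume M. f p) =
      (LINT z|lborel. indicator (chart_im c) z *\<^sub>R (volume_density M c z * f (chart_inv c z)))"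
    by (rule integral_riem_volume_chart[OF c fm fc])
  also have "\<dots> = (LINT z:C|lborel. volume_density M c z * f (chart_inv c z))"
    unfolding set_lebesgue_integral_def
  proof (rule Bochner_Integration.integral_cong[OF refl])
    fix z
    have "f (chart_inv c z) = 0" if "z \<in> chart_im c" "z \<notin> C"
    proof (rule supp)
      show "chart_inv c z \<notin> chart_inv c ` C"
      proof
        assume "chart_inv c z \<in> chart_inv c ` C"
        then obtain y where "y \<in> C" "chart_inv c z = chart_inv c y" by blast
        then show False using chartD(7)[OF c] that C(2) by (metis subsetD)
      qed
    qed
    then show "indicator (chart_im c) z *\<^sub>R (volume_density M c z * f (chart_inv c z)) =
        indicator C z *\<^sub>R (volume_density M c z * f (chart_inv c z))"
      using C(2) by (auto simp: indicator_def)
  qed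
  finally show ?thesis .
qed

end

section \<open>Cutoff functions and the divergence inequality in a chart\<close>

lemma C1_on_Un:
  assumes "C1_on f S" "C1_on f T" "open S" "open T"
  shows "C1_on f (S \<union> T)"
proof (rule C1_onI)
  show "(f has_derivative frechet_derivative f (at z)) (at z)" if "z \<in> S \<union> T" for z
    using that C1_onD(1)[OF assms(1), of z] C1_onD(1)[OF assms(2), of z] by auto
  show "continuous_on (S \<union> T) (\<lambda>z. frechet_derivative f (at z) v)" for v
    by (rule continuous_on_open_Un[OF assms(3,4) C1_onD(2)[OF assms(1)] C1_onD(2)[OF assms(2)]])
qed

text \<open>A step from 1 to 0 between \<open>t = 1\<close> and \<open>t = 2\<close>. Squared
  positive parts are \<open>C1\<close>, and only first derivatives of the bumps built from it
  occur.\<close>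

definition smooth_step :: "real \<Rightarrow> real" where
  "smooth_step t = (max 0 (2 - t))\<^sup>2 / ((max 0 (2 - t))\<^sup>2 + (max 0 (t - 1))\<^sup>2)"

lemma smooth_step_denom: "(max 0 (2 - t))\<^sup>2 + (max 0 (t - 1))\<^sup>2 > (0::real)"
  by (cases "t < 2") (auto intro: add_pos_nonneg add_nonneg_pos)

lemma smooth_step:
  "0 \<le> smooth_step t" "smooth_step t \<le> 1" "t \<le> 1 \<Longrightarrow> smooth_step t = 1" "2 \<le> t \<Longrightarrow> smooth_step t = 0"
  using smooth_step_denom[of t] by (auto simp: smooth_step_def divide_le_eq)

lemma C1_on_smooth_step:
  fixes f :: "'a::real_normed_vector \<Rightarrow> real"
  assumes f: "C1_on f S"
  shows "C1_on (\<lambda>z. smooth_step (f z)) S"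
proof -
  have sq: "C1_on (\<lambda>z. (max 0 (g z))\<^sup>2) S" if "C1_on g S" for g :: "'a \<Rightarrow> real"
    by (rule C1_on_real_compose[OF that pos_part_square_deriv])
      (intro continuous_intros C1_on_imp_continuous_on[OF that])
  show ?thesis
    unfolding smooth_step_def
    by (intro C1_on_divide C1_on_add sq C1_on_diff f C1_on_const) (use smooth_step_denom in \<open>force simp: less_imp_neq\<close>)
qed

context riemannian
begin

text \<open>The cutoff \<open>((R - d(p\<^sub>0, \<cdot>))\<^sub>+)\<^sup>2\<close> is only Lipschitz, but its decrease along a vector field is
  controlled by the Riemannian length of the field.\<close>

definition cutoff :: "'p \<Rightarrow> real \<Rightarrow> 'p \<Rightarrow> real" where
  "cutoff p0 R p = max 0 (R - riem_dist M p0 p)"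

lemma cutoff_nonneg: "0 \<le> cutoff p0 R p" and cutoff_le: "0 \<le> R \<Longrightarrow> cutoff p0 R p \<le> R"
  and cutoff_eq_0: "R \<le> riem_dist M p0 p \<Longrightarrow> cutoff p0 R p = 0"
  using riem_dist_nonneg[of p0 p] by (auto simp: cutoff_def)

lemma continuous_on_cutoff [continuous_intros]: "continuous_on S (cutoff p0 R)"
  unfolding cutoff_def[abs_def] by (intro continuous_intros continuous_on_riem_dist)

lemma cutoff_diff: "cutoff p0 R p - cutoff p0 R q \<le> riem_dist M p q"
  unfolding cutoff_def using riem_dist_triangle[of p0 q p] riem_dist_nonneg[of p q] by (smt (verit))

text \<open>Provides \<open>step\<close> of \<open>divergence_inequality\<close> for the squared
  cutoff: by uniform continuity of the metric, the segment from \<open>z\<close> to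
  \<open>z + h *\<^sub>R X z\<close> has length at most \<open>h\<close> times the norm of
  \<open>X z\<close> plus a small error.\<close>

lemma cutoff_step:
  assumes c: "c \<in> atlas M" and C: "compact C" "C \<subseteq> chart_im c" and X: "continuous_on C X"
    and R: "0 \<le> R" and \<epsilon>: "0 < \<epsilon>"
  shows "\<forall>\<^sub>F h in at_right 0. \<forall>z\<in>C. (cutoff p0 R (chart_inv c z))\<^sup>2 - (cutoff p0 R (chart_inv c (z + h *\<^sub>R X z)))\<^sup>2
     \<le> h * (2 * cutoff p0 R (chart_inv c z) * sqrt (coord_metric M c z (X z) (X z)) + \<epsilon>)"
proof -
  obtain r0 where r0: "r0 > 0" "(\<Union>x\<in>C. cball x r0) \<subseteq> chart_im c"
    by (rule compact_subset_open_imp_cball_epsilon_subset[OF C(1) chartD(2)[OF c] C(2)])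
  obtain b where b: "b > 0" "\<And>z. z \<in> C \<Longrightarrow> norm (X z) \<le> b"
    using compact_imp_bounded[OF compact_continuous_image[OF X C(1)]] unfolding bounded_pos by auto
  \<comment> \<open>Steps up to \<open>h0\<close> move no point of \<open>C\<close> by more than
    \<open>r0\<close>, so they stay in the chart.\<close>
  define h0 where "h0 = r0 / b"
  have h0: "h0 > 0" using r0 b by (simp add: h0_def)
  have mem: "z + s *\<^sub>R X z \<in> chart_im c" if "z \<in> C" "s \<in> {0..h0}" for z s
  proof -
    have "norm (s *\<^sub>R X z) \<le> h0 * b" using that b(2)[OF that(1)] h0 by (auto intro!: mult_mono)
    then have "z + s *\<^sub>R X z \<in> cball z r0" using b(1) by (simp add: h0_def dist_norm)
    then show ?thesis using r0(2) that(1) by blast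
  qed
  define n where "n = (\<lambda>(z, s). sqrt (coord_metric M c (z + s *\<^sub>R X z) (X z) (X z)))"
  have cX: "continuous_on (C \<times> {0..h0}) (\<lambda>x. X (fst x))"
    by (rule continuous_on_compose2[OF X]) (auto intro: continuous_intros)
  have cn: "continuous_on (C \<times> {0..h0}) n"
    unfolding n_def case_prod_unfold by (intro continuous_intros c cX) (use mem in auto)
  have cK: "compact (C \<times> {0..h0})" by (intro compact_Times C compact_Icc)
  have n0: "0 \<le> n x" if "x \<in> C \<times> {0..h0}" for x
    using that mem inner_productD(4)[OF inner_product_coord_metric[OF c]] by (auto simp: n_def)
  obtain N where N: "N > 0" "\<And>x. x \<in> C \<times> {0..h0} \<Longrightarrow> n x \<le> N"
  proof -
    obtain N where "N > 0" "\<And>x. x \<in> C \<times> {0..h0} \<Longrightarrow> norm (n x) \<le> N"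
      using compact_imp_bounded[OF compact_continuous_image[OF cn cK]] unfolding bounded_pos by auto
    then show thesis using that[of N] by force
  qed
  \<comment> \<open>Half of \<open>\<epsilon>\<close> pays for the variation \<open>e\<close> of the
    norm of \<open>X\<close> along the step, the other half, through \<open>h1\<close>, for the term
    of second order in \<open>h\<close>.\<close>
  define e where "e = min 1 (\<epsilon> / (4 * R + 4))"
  have e: "0 < e" "e \<le> 1" "2 * R * e \<le> \<epsilon> / 2"
  proof -
    show "0 < e" "e \<le> 1" using \<epsilon> R by (auto simp: e_def)
    have "2 * R * e \<le> 2 * R * (\<epsilon> / (4 * R + 4))" using R by (intro mult_left_mono) (auto simp: e_def)
    also have "\<dots> \<le> \<epsilon> / 2" using R \<epsilon> by (simp add: field_simps)
    finally show "2 * R * e \<le> \<epsilon> / 2" .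
  qed
  obtain \<delta> where \<delta>: "\<delta> > 0" "\<And>x y. x \<in> C \<times> {0..h0} \<Longrightarrow> y \<in> C \<times> {0..h0} \<Longrightarrow> dist y x < \<delta> \<Longrightarrow> dist (n y) (n x) < e"
    using compact_uniformly_continuous[OF cn cK] e(1) unfolding uniformly_continuous_on_def by metis
  define h1 where "h1 = Min {h0, \<delta>, \<epsilon> / (2 * (N + 1)\<^sup>2)}"
  have h1: "h1 > 0" "h1 \<le> h0" "h1 \<le> \<delta>" "h1 * (N + 1)\<^sup>2 \<le> \<epsilon> / 2"
  proof -
    have "(N + 1)\<^sup>2 > 0" using N by simp
    moreover have "h1 \<le> \<epsilon> / (2 * (N + 1)\<^sup>2)" by (simp add: h1_def)
    ultimately show "h1 * (N + 1)\<^sup>2 \<le> \<epsilon> / 2" by (simp add: field_simps)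
  qed (use h0 \<delta> \<epsilon> N in \<open>auto simp: h1_def\<close>)
  have main: "(cutoff p0 R (chart_inv c z))\<^sup>2 - (cutoff p0 R (chart_inv c (z + h *\<^sub>R X z)))\<^sup>2
     \<le> h * (2 * cutoff p0 R (chart_inv c z) * sqrt (coord_metric M c z (X z) (X z)) + \<epsilon>)"
    if h: "0 < h" "h < h1" and z: "z \<in> C" for h z
  proof -
    let ?w = "z + h *\<^sub>R X z" and ?n = "n (z, 0)"
    let ?a = "cutoff p0 R (chart_inv c z)" and ?b = "cutoff p0 R (chart_inv c (z + h *\<^sub>R X z))"
    have zim: "z \<in> chart_im c" using z C by auto
    have seg: "\<exists>s\<in>{0..h}. y = z + s *\<^sub>R X z" if "y \<in> closed_segment z ?w" for y
    proof -
      obtain t where t: "0 \<le> t" "t \<le> 1" "y = (1 - t) *\<^sub>R z + t *\<^sub>R ?w" using \<open>y \<in> closed_segment z ?w\<close> by (auto simp: closed_segment_def)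
      then have "y = z + (t * h) *\<^sub>R X z" by (simp add: algebra_simps)
      moreover have "t * h \<in> {0..h}" using t h by (auto intro: mult_left_le_one_le)
      ultimately show ?thesis by blast
    qed
    have D: "riem_dist M (chart_inv c z) (chart_inv c ?w) \<le> h * (?n + e)"
    proof (rule riem_dist_segment_le[OF c])
      show "closed_segment z ?w \<subseteq> chart_im c"
      proof
        fix y assume "y \<in> closed_segment z ?w"
        then obtain s where "s \<in> {0..h}" "y = z + s *\<^sub>R X z" using seg by blast
        then show "y \<in> chart_im c" using mem[OF z, of s] h h1 by auto
      qed
      fix y assume "y \<in> closed_segment z ?w"
      then obtain s where s: "s \<in> {0..h}" "y = z + s *\<^sub>R X z" using seg by blast
      have sh: "s \<in> {0..h0}" using s h h1 by auto
      have yim: "y \<in> chart_im c" unfolding s(2) by (rule mem[OF z sh])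
      have "sqrt (coord_metric M c y (?w - z) (?w - z)) = h * n (z, s)"
        using metric_scale[OF c chartD(6)[OF c yim], of h "X z"] h
        by (simp add: n_def s(2) coord_metric_def real_sqrt_mult)
      also have "n (z, s) \<le> ?n + e"
        using \<delta>(2)[of "(z, 0)" "(z, s)"] z sh h0 h h1 s by (auto simp: dist_Pair_Pair dist_real_def)
      finally show "sqrt (coord_metric M c y (?w - z) (?w - z)) \<le> h * (?n + e)" using h by simp
    qed
    have a: "0 \<le> ?a" "0 \<le> ?b" "?a \<le> R" by (auto intro: cutoff_nonneg cutoff_le R)
    have n: "0 \<le> ?n" "?n \<le> N" using n0[of "(z, 0)"] N(2)[of "(z, 0)"] z h0 by auto
    have "?a\<^sup>2 - ?b\<^sup>2 \<le> h * (?n + e) * (2 * ?a + h * (?n + e))"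
    proof (cases "?a \<le> ?b")
      case True
      then have "?a\<^sup>2 - ?b\<^sup>2 \<le> 0" using a by (simp add: power_mono)
      also have "0 \<le> h * (?n + e) * (2 * ?a + h * (?n + e))" using a n e h by simp
      finally show ?thesis .
    next
      case False
      have d: "?a - ?b \<le> h * (?n + e)" using cutoff_diff D by (rule order_trans)
      have "?a\<^sup>2 - ?b\<^sup>2 = (?a - ?b) * (?a + ?b)" by (simp add: power2_eq_square algebra_simps)
      also have "\<dots> \<le> (h * (?n + e)) * (2 * ?a + h * (?n + e))"
        using d False a n e h by (intro mult_mono) auto
      finally show ?thesis .
    qed
    also have "\<dots> = h * (2 * ?a * ?n + (2 * ?a * e + h * (?n + e)\<^sup>2))"
      by (simp add: power2_eq_square algebra_simps)
    also have "\<dots> \<le> h * (2 * ?a * ?n + \<epsilon>)"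
    proof -
      have "2 * ?a * e \<le> 2 * R * e" using a e by (intro mult_right_mono) auto
      moreover have "h * (?n + e)\<^sup>2 \<le> h1 * (N + 1)\<^sup>2" using h n e by (intro mult_mono power_mono) auto
      ultimately have "2 * ?a * e + h * (?n + e)\<^sup>2 \<le> \<epsilon>" using e(3) h1(4) by linarith
      then show ?thesis using h by (intro mult_left_mono) auto
    qed
    finally show ?thesis by (simp add: n_def)
  qed
  then show ?thesis using h1(1) unfolding eventually_at_right_field by blast
qed

text \<open>\<open>divergence_inequality\<close> for the field \<theta> grad F times the volume
  density, tested with the squared cutoff. With this weight the coordinate divergence is the density
  times the Riemannian divergence.\<close>

lemma local_divergence:
  assumes F: "C2_fun_on U F" and \<theta>: "C1_fun \<theta>" "\<And>p. \<theta> p \<ge> 0" and c: "c \<in> atlas M"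
    and C: "compact C" "C \<subseteq> snd c ` (fst c \<inter> U)" and supp: "\<And>p. p \<notin> chart_inv c ` C \<Longrightarrow> \<theta> p = 0"
    and R: "R \<ge> 0"
    and lap: "\<And>z. z \<in> C \<Longrightarrow> riem_dist M p0 (chart_inv c z) < R \<Longrightarrow> s0 \<le> laplacian c F z"
    and gr: "\<And>z. z \<in> C \<Longrightarrow> riem_dist M p0 (chart_inv c z) < R \<Longrightarrow>
      sqrt (coord_metric M c z (gradient c F z) (gradient c F z)) \<le> \<kappa> * riem_dist M p0 (chart_inv c z)"
  shows "s0 * (LINT p|riem_volume M. \<theta> p * (cutoff p0 R p)\<^sup>2)
     + (LINT p|riem_volume M. (cutoff p0 R p)\<^sup>2 * grad_pairing F \<theta> p)
     \<le> (LINT p|riem_volume M. \<theta> p * (2 * cutoff p0 R p * (\<kappa> * riem_dist M p0 p)))"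
proof -
  let ?\<iota> = "chart_inv c" and ?vd = "volume_density M c" and ?a = "cutoff p0 R" and ?V = "gradient c F"
  define W where "W = snd c ` (fst c \<inter> U)"
  have W: "open W" "W \<subseteq> chart_im c" "C \<subseteq> W" unfolding W_def using C2_fun_onD(2,3)[OF F c] C by auto
  have CV: "C1_on ?V W" unfolding W_def by (rule C2_fun_onD(7)[OF F c])
  define \<rho> where "\<rho> z = \<theta> (?\<iota> z) * ?vd z" for z
  have C\<rho>: "C1_on \<rho> W" unfolding \<rho>_def[abs_def]
    by (intro C1_on_mult C1_on_subset[OF C1_funD(1)[OF \<theta>(1) c] W(2)] C1_on_subset[OF C1_on_volume_density[OF c] W(2)])
  have \<theta>0: "\<theta> (?\<iota> z) = 0" if "z \<in> chart_im c" "z \<notin> C" for z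
  proof (rule supp)
    show "?\<iota> z \<notin> ?\<iota> ` C"
    proof
      assume "?\<iota> z \<in> ?\<iota> ` C"
      then obtain y where "y \<in> C" "?\<iota> z = ?\<iota> y" by blast
      then show False using chartD(7)[OF c] that W by (metis subsetD)
    qed
  qed
  define X where "X z = (if z \<in> W then \<rho> z *\<^sub>R ?V z else 0)" for z
  have "C1_on (\<lambda>z. \<rho> z *\<^sub>R ?V z) W"
  proof -
    have "C1_on (\<lambda>z. \<chi> k. \<rho> z * ?V z $ k) W" by (intro C1_on_vec C1_on_mult C\<rho> C1_on_component CV)
    moreover have "(\<lambda>z. \<chi> k. \<rho> z * ?V z $ k) = (\<lambda>z. \<rho> z *\<^sub>R ?V z)" by (simp add: vec_eq_iff fun_eq_iff)
    ultimately show ?thesis by simp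
  qed
  then have CX: "C1_on X UNIV"
    unfolding X_def[abs_def]
    by (rule C1_on_zero_extension[OF _ W(1) compact_imp_closed[OF C(1)] W(3)])
      (use \<theta>0 W in \<open>auto simp: \<rho>_def\<close>)
  let ?X' = "\<lambda>z. frechet_derivative X (at z)"
  have X0: "X z = 0" if "z \<notin> C" for z using \<theta>0[of z] that W by (auto simp: X_def \<rho>_def)
  have cX: "continuous_on S X" for S using C1_on_imp_continuous_on[OF CX] continuous_on_subset by blast
  have c\<iota>: "continuous_on C ?\<iota>" using chartD(4)[OF c] W by (meson continuous_on_subset order_trans)
  have ca: "continuous_on C (\<lambda>z. ?a (?\<iota> z))"
    by (rule continuous_on_compose2[OF continuous_on_cutoff c\<iota>]) auto
  have cl: "continuous_on C (\<lambda>z. 2 * ?a (?\<iota> z) * sqrt (coord_metric M c z (X z) (X z)))"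
    by (intro continuous_intros ca c cX) (use W in auto)
  have ineq: "(LINT z:C|lborel. (?a (?\<iota> z))\<^sup>2 * trace (matrix (?X' z)))
      \<le> (LINT z:C|lborel. 2 * ?a (?\<iota> z) * sqrt (coord_metric M c z (X z) (X z)))"
  proof (rule divergence_inequality[where X = X])
    show "(X has_derivative ?X' z) (at z)" for z by (rule C1_onD(1)[OF CX]) simp
    show "continuous_on UNIV (\<lambda>z. ?X' z v)" for v by (rule C1_onD(2)[OF CX])
    show "continuous_on C (\<lambda>z. (?a (?\<iota> z))\<^sup>2)" by (intro continuous_intros ca)
    show "\<forall>\<^sub>F h in at_right 0. \<forall>z\<in>C. (?a (?\<iota> z))\<^sup>2 - (?a (?\<iota> (z + h *\<^sub>R X z)))\<^sup>2
        \<le> h * (2 * ?a (?\<iota> z) * sqrt (coord_metric M c z (X z) (X z)) + \<epsilon>)" if "\<epsilon> > 0" for \<epsilon>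
      by (rule cutoff_step[OF c C(1) _ cX R that]) (use W in auto)
  qed (use C cl X0 in auto)
  \<comment> \<open>Product rule: the derivative of the density completes the trace in
    \<open>divergence_grad\<close> to the Laplacian, and the derivative of \<open>\<theta>\<close>
    leaves the gradient pairing.\<close>
  have tr: "trace (matrix (?X' z)) = ?vd z * (\<theta> (?\<iota> z) * laplacian c F z + grad_pairing F \<theta> (?\<iota> z))"
    if z: "z \<in> C" for z
  proof -
    have zW: "z \<in> W" and zim: "z \<in> chart_im c" using z W by auto
    let ?E = "SOME E. orthonormal_basis (coord_metric M c z) E"
    have E: "orthonormal_basis (coord_metric M c z) ?E"
      using orthonormal_family[OF inner_product_coord_metric[OF c zim]] by (rule someI_ex)
    let ?V' = "frechet_derivative ?V (at z)"
    let ?\<rho>' = "\<lambda>u. \<theta> (?\<iota> z) * (?vd z * (\<Sum>e\<in>?E. dmet c z u e e) / 2) + dfun c \<theta> z u * ?vd z"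
    have \<rho>': "(\<rho> has_derivative ?\<rho>') (at z)"
      unfolding \<rho>_def[abs_def]
      by (intro has_derivative_mult C1_funD(2)[OF \<theta>(1) c zim] volume_density_has_derivative[OF c zim E])
    have V': "(?V has_derivative ?V') (at z)" by (rule C1_onD(1)[OF CV zW])
    have "(X has_derivative (\<lambda>u. \<rho> z *\<^sub>R ?V' u + ?\<rho>' u *\<^sub>R ?V z)) (at z)"
      by (rule has_derivative_transform_within_open[OF trace_product(1)[OF \<rho>' V'] W(1) zW]) (simp add: X_def)
    from frechet_derivative_at[OF this]
    have "trace (matrix (?X' z)) = \<rho> z * trace (matrix ?V') + ?\<rho>' (?V z)"
      using trace_product(2)[OF \<rho>' V'] by simp
    moreover have "trace (matrix ?V') + (\<Sum>e\<in>?E. dmet c z (?V z) e e) / 2 = laplacian c F z"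
      unfolding laplacian_def gradient_def[abs_def]
      using divergence_grad[OF c W(1,2) zW _ _ E, of "dfun c F"] C2_fun_onD(5,6)[OF F c] unfolding W_def by simp
    moreover have "?\<iota> z \<in> fst c" "?\<iota> z \<in> U" "snd c (?\<iota> z) = z"
      using zW chartD(5,6,7)[OF c] unfolding W_def by auto
    with grad_pairing_chart[OF F \<theta>(1) c, of "?\<iota> z"]
    have "grad_pairing F \<theta> (?\<iota> z) = dfun c \<theta> z (?V z)" by simp
    ultimately show ?thesis
      by (simp add: \<rho>_def algebra_simps flip: \<open>trace (matrix ?V') + (\<Sum>e\<in>?E. dmet c z (?V z) e e) / 2 = laplacian c F z\<close>)
  qed
  have Xl: "sqrt (coord_metric M c z (X z) (X z)) = \<theta> (?\<iota> z) * ?vd z * sqrt (coord_metric M c z (?V z) (?V z))"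
    if z: "z \<in> C" for z
  proof -
    have zim: "z \<in> chart_im c" using z W by auto
    have "\<rho> z \<ge> 0" using \<theta>(2) volume_density_pos[OF c zim] by (simp add: \<rho>_def)
    then show ?thesis
      using metric_scale[OF c chartD(6)[OF c zim], of "\<rho> z" "?V z"] z W
      by (simp add: X_def subset_iff coord_metric_def real_sqrt_mult) (simp add: \<rho>_def)
  qed
  have K: "compact (?\<iota> ` C)" "?\<iota> ` C \<subseteq> fst c \<inter> U"
    using compact_chart_inv_image[OF c C(1)] W chartD(5)[OF c] unfolding W_def by auto
  have cA: "continuous_on UNIV (grad_pairing F \<theta>)" "\<And>p. p \<notin> ?\<iota> ` C \<Longrightarrow> grad_pairing F \<theta> p = 0"
    using continuous_on_grad_pairing[OF F \<theta>(1) c K supp] by auto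
  have c\<theta>: "continuous_on UNIV \<theta>" by (rule C1_fun_continuous[OF \<theta>(1)])
  let ?f1 = "\<lambda>p. \<theta> p * (?a p)\<^sup>2" and ?f2 = "\<lambda>p. (?a p)\<^sup>2 * grad_pairing F \<theta> p"
    and ?f3 = "\<lambda>p. \<theta> p * (2 * ?a p * (\<kappa> * riem_dist M p0 p))"
  have cf: "continuous_on UNIV ?f1" "continuous_on UNIV ?f2" "continuous_on UNIV ?f3"
    by (intro continuous_intros c\<theta> cA continuous_on_riem_dist)+
  have conv: "(LINT p|riem_volume M. f p) = (LINT z:C|lborel. ?vd z * f (?\<iota> z))"
    "set_integrable lborel C (\<lambda>z. ?vd z * f (?\<iota> z))"
    if "continuous_on UNIV f" "\<And>p. p \<notin> ?\<iota> ` C \<Longrightarrow> f p = 0" for f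
  proof -
    show "(LINT p|riem_volume M. f p) = (LINT z:C|lborel. ?vd z * f (?\<iota> z))"
      by (rule integral_compact_chart[OF c C(1) _ that]) (use W in auto)
    have "continuous_on C (\<lambda>z. ?vd z * f (?\<iota> z))"
      using continuous_on_subset[OF continuous_on_volume_density[OF c], of C] W
      by (intro continuous_intros continuous_on_compose2[OF that(1) c\<iota>]) auto
    then show "set_integrable lborel C (\<lambda>z. ?vd z * f (?\<iota> z))"
      unfolding set_integrable_def by (rule borel_integrable_compact[OF C(1)])
  qed
  have "s0 * (LINT p|riem_volume M. ?f1 p) + (LINT p|riem_volume M. ?f2 p)
     = s0 * (LINT z:C|lborel. ?vd z * ?f1 (?\<iota> z)) + (LINT z:C|lborel. ?vd z * ?f2 (?\<iota> z))"
    using conv(1)[OF cf(1)] conv(1)[OF cf(2)] supp cA(2) by simp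
  also have "\<dots> = (LINT z:C|lborel. s0 * (?vd z * ?f1 (?\<iota> z)) + ?vd z * ?f2 (?\<iota> z))"
    using conv(2)[OF cf(1)] conv(2)[OF cf(2)] supp cA(2) by (simp add: set_integral_add)
  also have "\<dots> \<le> (LINT z:C|lborel. (?a (?\<iota> z))\<^sup>2 * trace (matrix (?X' z)))"
  proof (rule set_integral_mono)
    show "set_integrable lborel C (\<lambda>z. s0 * (?vd z * ?f1 (?\<iota> z)) + ?vd z * ?f2 (?\<iota> z))"
      using conv(2)[OF cf(1)] conv(2)[OF cf(2)] supp cA(2) by (intro set_integral_add set_integrable_mult_right) auto
    have "continuous_on C (\<lambda>z. (?a (?\<iota> z))\<^sup>2 * trace (matrix (?X' z)))"
      unfolding trace_def matrix_def
      by (auto intro!: continuous_intros ca continuous_on_subset[OF C1_onD(2)[OF CX]])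
    then show "set_integrable lborel C (\<lambda>z. (?a (?\<iota> z))\<^sup>2 * trace (matrix (?X' z)))"
      unfolding set_integrable_def by (rule borel_integrable_compact[OF C(1)])
    fix z assume z: "z \<in> C"
    show "s0 * (?vd z * ?f1 (?\<iota> z)) + ?vd z * ?f2 (?\<iota> z) \<le> (?a (?\<iota> z))\<^sup>2 * trace (matrix (?X' z))"
    \<comment> \<open>Where \<open>lap\<close> says nothing, the cutoff makes both sides
      vanish.\<close>
    proof (cases "riem_dist M p0 (?\<iota> z) < R")
      case True
      have vd: "0 < ?vd z" using volume_density_pos[OF c] z W by auto
      have le: "(?a (?\<iota> z))\<^sup>2 * \<theta> (?\<iota> z) * s0 \<le> (?a (?\<iota> z))\<^sup>2 * \<theta> (?\<iota> z) * laplacian c F z"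
        using lap[OF z True] \<theta>(2) by (intro mult_left_mono) auto
      have "?vd z * ((?a (?\<iota> z))\<^sup>2 * \<theta> (?\<iota> z) * s0) \<le> ?vd z * ((?a (?\<iota> z))\<^sup>2 * \<theta> (?\<iota> z) * laplacian c F z)"
        by (rule mult_left_mono[OF le less_imp_le[OF vd]])
      then show ?thesis unfolding tr[OF z] by (simp add: algebra_simps)
    qed (simp add: cutoff_eq_0)
  qed
  also note ineq
  also have "(LINT z:C|lborel. 2 * ?a (?\<iota> z) * sqrt (coord_metric M c z (X z) (X z))) \<le> (LINT z:C|lborel. ?vd z * ?f3 (?\<iota> z))"
  proof (rule set_integral_mono)
    show "set_integrable lborel C (\<lambda>z. 2 * ?a (?\<iota> z) * sqrt (coord_metric M c z (X z) (X z)))"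
      using cl unfolding set_integrable_def by (rule borel_integrable_compact[OF C(1)])
    show "set_integrable lborel C (\<lambda>z. ?vd z * ?f3 (?\<iota> z))" using conv(2)[OF cf(3)] supp by simp
    fix z assume z: "z \<in> C"
    show "2 * ?a (?\<iota> z) * sqrt (coord_metric M c z (X z) (X z)) \<le> ?vd z * ?f3 (?\<iota> z)"
    proof (cases "riem_dist M p0 (?\<iota> z) < R")
      case True
      have "0 < ?vd z" using volume_density_pos[OF c] z W by auto
      then have "2 * ?a (?\<iota> z) * (\<theta> (?\<iota> z) * ?vd z) * sqrt (coord_metric M c z (?V z) (?V z))
          \<le> 2 * ?a (?\<iota> z) * (\<theta> (?\<iota> z) * ?vd z) * (\<kappa> * riem_dist M p0 (?\<iota> z))"
        using gr[OF z True] \<theta>(2) cutoff_nonneg by (intro mult_left_mono) auto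
      then show ?thesis unfolding Xl[OF z] by (simp add: ac_simps)
    qed (simp add: cutoff_eq_0)
  qed
  also have "\<dots> = (LINT p|riem_volume M. ?f3 p)"
    using conv(1)[OF cf(3)] supp by simp
  finally show ?thesis .
qed

section \<open>Partitions of unity\<close>

lemma ex_bump:
  assumes U: "open U" "p \<in> U"
  shows "\<exists>b c C V. C1_fun b \<and> (\<forall>q. 0 \<le> b q \<and> b q \<le> 1) \<and> c \<in> atlas M \<and> compact C \<and> C \<subseteq> snd c ` (fst c \<inter> U)
    \<and> (\<forall>q. q \<notin> chart_inv c ` C \<longrightarrow> b q = 0) \<and> open V \<and> p \<in> V \<and> (\<forall>q\<in>V. b q = 1)"
proof -
  obtain c where c: "c \<in> atlas M" "p \<in> fst c" by (rule ex_chart)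
  let ?x = "snd c p"
  have "open (snd c ` (fst c \<inter> U))" by (intro open_chart_image c open_Int chartD(1) U) auto
  then obtain r where r: "r > 0" "cball ?x r \<subseteq> snd c ` (fst c \<inter> U)"
    using c U by (metis IntI image_eqI open_contains_cball)
  have rim: "cball ?x r \<subseteq> chart_im c" using r by auto
  \<comment> \<open>The squared distance, scaled so that radius \<open>r\<close> has
    \<open>t = 2\<close> and radius \<open>r / 2\<close> has \<open>t = 1 / 2\<close>, both in flat
    parts of \<open>smooth_step\<close>; written in coordinates to suit the \<open>C1\<close>
    rules.\<close>
  define t where "t z = (2 / r\<^sup>2) * (\<Sum>i\<in>UNIV. (z $ i - ?x $ i) * (z $ i - ?x $ i))" for z
  have t: "t z = 2 / r\<^sup>2 * (dist ?x z)\<^sup>2" for z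
    by (simp add: t_def dist_norm norm_minus_commute power2_norm_eq_inner inner_vec_def)
  have C1i: "C1_on (\<lambda>z. z $ i) S" for i and S :: "(real^'m) set"
    by (rule C1_onI[of _ _ "\<lambda>z v. v $ i"])
      (auto intro: bounded_linear_imp_has_derivative bounded_linear_vec_nth)
  have C1t: "C1_on t UNIV"
    unfolding t_def[abs_def] by (intro C1_on_mult C1_on_const C1_on_sum C1_on_diff C1i)
  define b where "b q = (if q \<in> fst c then smooth_step (t (snd c q)) else 0)" for q
  let ?C = "cball ?x r" and ?V = "chart_inv c ` ball ?x (r / 2)"
  have supp: "b q = 0" if "q \<notin> chart_inv c ` ?C" for q
  proof (cases "q \<in> fst c")
    case True
    then have "snd c q \<notin> ?C" using that chartD(5)[OF c(1) True] by (metis imageI)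
    then have "r\<^sup>2 \<le> (dist ?x (snd c q))\<^sup>2" using r by (intro power_mono) auto
    then have "2 \<le> t (snd c q)" using r by (simp add: t field_simps)
    then show ?thesis using True by (simp add: b_def smooth_step)
  qed (simp add: b_def)
  have one: "b q = 1" if q: "q \<in> ?V" for q
  proof -
    obtain z where z: "z \<in> ball ?x (r / 2)" "q = chart_inv c z" using q by blast
    have zim: "z \<in> chart_im c" using z rim r by auto
    have "(dist ?x z)\<^sup>2 \<le> (r / 2)\<^sup>2" using z by (intro power_mono) auto
    then have "4 * (dist ?x z)\<^sup>2 \<le> r\<^sup>2" by (simp add: power_divide)
    then have "2 * (dist ?x z)\<^sup>2 \<le> r\<^sup>2" using zero_le_power2[of "dist ?x z"] by linarith
    then have "t z \<le> 1" using r by (simp add: t field_simps)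
    then show ?thesis using z zim chartD(6,7)[OF c(1) zim] by (simp add: b_def smooth_step)
  qed
  have clK: "closed (chart_inv c ` ?C)"
    by (rule compact_imp_closed[OF compact_chart_inv_image[OF c(1) compact_cball rim]])
  have "C1_fun b"
    unfolding C1_fun_def
  proof
    fix d assume d: "d \<in> atlas M"
    let ?S = "snd d ` (fst d \<inter> fst c)" and ?T = "snd d ` (fst d \<inter> - (chart_inv c ` ?C))"
    have oS: "open ?S" by (intro open_chart_image d open_Int chartD(1) c) auto
    have oT: "open ?T" by (intro open_chart_image d open_Int chartD(1) open_Compl clK) auto
    have "C1_on (\<lambda>z. smooth_step (t (transition d c z))) ?S"
      by (intro C1_on_smooth_step C1_on_compose[OF smooth_on_imp_C1_on[OF transition(1)[OF d c(1)]] C1t]) auto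
    then have 1: "C1_on (\<lambda>z. b (chart_inv d z)) ?S"
      by (rule C1_on_cong[OF _ oS]) (use transition(2)[OF d c(1)] chartD(5)[OF d] in \<open>auto simp: b_def\<close>)
    have 2: "C1_on (\<lambda>z. b (chart_inv d z)) ?T"
      by (rule C1_on_cong[OF C1_on_const[of 0] oT]) (use chartD(5)[OF d] supp in auto)
    have "?S \<union> ?T = chart_im d"
    proof -
      have "chart_inv c ` ?C \<subseteq> fst c" using rim chartD(6)[OF c(1)] by blast
      then show ?thesis by blast
    qed
    with C1_on_Un[OF 1 2 oS oT] show "C1_on (\<lambda>z. b (chart_inv d z)) (chart_im d)" by simp
  qed
  moreover have "open ?V" using rim r by (intro open_chart_inv_image c) auto
  moreover have "p \<in> ?V" using r chartD(5)[OF c] by (intro image_eqI[of _ _ ?x]) auto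
  moreover have "0 \<le> b q \<and> b q \<le> 1" for q by (auto simp: b_def smooth_step)
  ultimately show ?thesis
    using c(1) r(2) supp one compact_cball by (intro exI[of _ b] exI[of _ c] exI[of _ ?C] exI[of _ ?V]) blast
qed

text \<open>Each new factor \<open>1 - b j\<close> lowers the remaining product by precisely the new
  summand.\<close>

lemma sum_telescoping_partition:
  fixes b :: "nat \<Rightarrow> real"
  shows "(\<Sum>j<n. b j * (\<Prod>i<j. 1 - b i)) = 1 - (\<Prod>i<n. 1 - b i)"
  by (induction n) (auto simp: algebra_simps)

text \<open>The sum is 1 on a neighbourhood of \<open>K\<close> and not merely on \<open>K\<close>,
  so that its derivative vanishes on \<open>K\<close>; this cancels the gradient terms in
  \<open>global_divergence\<close>.\<close>

lemma partition_of_unity: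
  assumes K: "compact K" "K \<subseteq> U" and U: "open U"
  shows "\<exists>(n::nat) \<theta> c C V. (\<forall>j<n. C1_fun (\<theta> j) \<and> (\<forall>q. 0 \<le> \<theta> j q) \<and> c j \<in> atlas M \<and> compact (C j) \<and>
      C j \<subseteq> snd (c j) ` (fst (c j) \<inter> U) \<and> (\<forall>q. q \<notin> chart_inv (c j) ` C j \<longrightarrow> \<theta> j q = 0)) \<and>
    open V \<and> K \<subseteq> V \<and> (\<forall>q\<in>V. (\<Sum>j<n. \<theta> j q) = 1)"
proof -
  have "\<forall>p\<in>K. \<exists>x. case x of (b, c, C, V) \<Rightarrow> C1_fun b \<and> (\<forall>q. 0 \<le> b q \<and> b q \<le> 1) \<and> c \<in> atlas M \<and> compact C \<and> C \<subseteq> snd c ` (fst c \<inter> U)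
    \<and> (\<forall>q. q \<notin> chart_inv c ` C \<longrightarrow> b q = 0) \<and> open V \<and> p \<in> V \<and> (\<forall>q\<in>V. b q = 1)"
  proof
    fix p assume "p \<in> K"
    then have pU: "p \<in> U" using K by auto
    obtain b c C V where "C1_fun b \<and> (\<forall>q. 0 \<le> b q \<and> b q \<le> 1) \<and> c \<in> atlas M \<and> compact C \<and> C \<subseteq> snd c ` (fst c \<inter> U)
    \<and> (\<forall>q. q \<notin> chart_inv c ` C \<longrightarrow> b q = 0) \<and> open V \<and> p \<in> V \<and> (\<forall>q\<in>V. b q = 1)"
      using ex_bump[OF U pU] by (elim exE) (rule that)
    then show "\<exists>x. case x of (b, c, C, V) \<Rightarrow> C1_fun b \<and> (\<forall>q. 0 \<le> b q \<and> b q \<le> 1) \<and> c \<in> atlas M \<and> compact C \<and> C \<subseteq> snd c ` (fst c \<inter> U)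
    \<and> (\<forall>q. q \<notin> chart_inv c ` C \<longrightarrow> b q = 0) \<and> open V \<and> p \<in> V \<and> (\<forall>q\<in>V. b q = 1)"
      by (intro exI[of _ "(b, c, C, V)"]) (unfold prod.case)
  qed
  from bchoice[OF this] obtain X where X: "\<forall>p\<in>K. case X p of (b, c, C, V) \<Rightarrow> C1_fun b \<and> (\<forall>q. 0 \<le> b q \<and> b q \<le> 1) \<and> c \<in> atlas M \<and> compact C \<and> C \<subseteq> snd c ` (fst c \<inter> U)
    \<and> (\<forall>q. q \<notin> chart_inv c ` C \<longrightarrow> b q = 0) \<and> open V \<and> p \<in> V \<and> (\<forall>q\<in>V. b q = 1)" by blast
  define B where "B p = fst (X p)" for p
  define c where "c p = fst (snd (X p))" for p
  define C where "C p = fst (snd (snd (X p)))" for p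
  define V where "V p = snd (snd (snd (X p)))" for p
  have B: "C1_fun (B p)" "\<And>q. 0 \<le> B p q" "\<And>q. B p q \<le> 1" "c p \<in> atlas M" "compact (C p)" "C p \<subseteq> snd (c p) ` (fst (c p) \<inter> U)"
    "\<And>q. q \<notin> chart_inv (c p) ` C p \<Longrightarrow> B p q = 0" "open (V p)" "p \<in> V p" "\<And>q. q \<in> V p \<Longrightarrow> B p q = 1" if "p \<in> K" for p
  proof -
    note * = X[rule_format, OF that, unfolded case_prod_unfold, folded B_def c_def C_def V_def]
    show "C1_fun (B p)" "c p \<in> atlas M" "compact (C p)" "C p \<subseteq> snd (c p) ` (fst (c p) \<inter> U)" "open (V p)" "p \<in> V p"
      using * by - (elim conjE, assumption)+
    have 1: "\<forall>q. 0 \<le> B p q \<and> B p q \<le> 1" and 2: "\<forall>q. q \<notin> chart_inv (c p) ` C p \<longrightarrow> B p q = 0" and 3: "\<forall>q\<in>V p. B p q = 1"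
      using * by - (elim conjE, assumption)+
    from 1 show "0 \<le> B p q" "B p q \<le> 1" for q by auto
    from 2 show "q \<notin> chart_inv (c p) ` C p \<Longrightarrow> B p q = 0" for q by blast
    from 3 show "q \<in> V p \<Longrightarrow> B p q = 1" for q by blast
  qed
  obtain D where D: "D \<subseteq> K" "finite D" "K \<subseteq> (\<Union>p\<in>D. V p)"
    using compactE_image[OF K(1), of K V] B(8,9) by blast
  obtain f n where f: "D = f ` {..<n::nat}" using D(2) by (metis finite_imp_nat_seg_image_inj_on lessThan_def)
  have fK: "f j \<in> K" if "j < n" for j using D(1) f that by auto
  \<comment> \<open>Where some bump equals 1 the product of all \<open>1 - B (f i) q\<close> is 0
    and the telescoping sum is 1; no division by a total is involved.\<close>
  define \<theta> where "\<theta> j q = B (f j) q * (\<Prod>i<j. 1 - B (f i) q)" for j q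
  have "C1_fun (\<theta> j) \<and> (\<forall>q. 0 \<le> \<theta> j q) \<and> c (f j) \<in> atlas M \<and> compact (C (f j)) \<and>
      C (f j) \<subseteq> snd (c (f j)) ` (fst (c (f j)) \<inter> U) \<and> (\<forall>q. q \<notin> chart_inv (c (f j)) ` C (f j) \<longrightarrow> \<theta> j q = 0)" if j: "j < n" for j
  proof (intro conjI allI impI)
    show "C1_fun (\<theta> j)" unfolding \<theta>_def[abs_def]
      using j by (intro C1_fun_mult C1_fun_prod C1_fun_diff C1_fun_const B(1) fK) auto
    show "0 \<le> \<theta> j q" for q unfolding \<theta>_def
      using j B(2,3) fK by (intro mult_nonneg_nonneg prod_nonneg) (auto simp: order.strict_trans)
    show "\<theta> j q = 0" if "q \<notin> chart_inv (c (f j)) ` C (f j)" for q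
      using B(7)[OF fK[OF j] that] by (simp add: \<theta>_def)
  qed (use B(4,5,6)[OF fK[OF j]] in auto)
  moreover have "open (\<Union>p\<in>D. V p)" using B(8) D(1) by blast
  moreover have "(\<Sum>j<n. \<theta> j q) = 1" if q: "q \<in> (\<Union>p\<in>D. V p)" for q
  proof -
    obtain j where j: "j < n" "q \<in> V (f j)" using q f by auto
    then have "(\<Prod>i<n. 1 - B (f i) q) = 0"
      using B(10)[OF fK[OF j(1)] j(2)] by (intro prod_zero) auto
    then show ?thesis unfolding \<theta>_def sum_telescoping_partition[of "\<lambda>j. B (f j) q"] by simp
  qed
  ultimately show ?thesis
    using D(3) by (intro exI[of _ n] exI[of _ \<theta>] exI[of _ "c \<circ> f"] exI[of _ "C \<circ> f"] exI[of _ "\<Union>p\<in>D. V p"]) auto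
qed

lemma integrable_compact_support:
  fixes f :: "'p \<Rightarrow> real"
  assumes f: "continuous_on UNIV f" and K: "compact K" and supp: "\<And>p. p \<notin> K \<Longrightarrow> f p = 0"
  shows "integrable (riem_volume M) f"
proof -
  obtain B where B: "\<And>p. p \<in> K \<Longrightarrow> norm (f p) \<le> B"
    using compact_imp_bounded[OF compact_continuous_image[OF continuous_on_subset[OF f] K]] unfolding bounded_iff by auto
  show ?thesis
  proof (rule integrableI_bounded_set[where A = K and B = B])
    show "K \<in> sets (riem_volume M)" using K by (simp add: borel_compact)
    show "f \<in> borel_measurable (riem_volume M)"
      using borel_measurable_continuous_onI[OF f] by (simp cong: measurable_cong_sets)
  qed (use riem_volume_compact_finite[OF K] B supp in auto)
qed

text \<open>The sum of the local inequalities. The pairings with the \<open>\<theta> j\<close> add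
  up to the pairing with a function that is constant near the closed ball, and off the ball the
  cutoff vanishes.\<close>

lemma global_divergence:
  assumes complete: "complete_riem M" and F: "C2_fun_on U F" and U: "{p. riem_dist M p0 p \<le> R} \<subseteq> U"
    and R: "R \<ge> 0"
    and lap: "\<And>c p. c \<in> atlas M \<Longrightarrow> p \<in> fst c \<Longrightarrow> riem_dist M p0 p < R \<Longrightarrow> s0 \<le> laplacian c F (snd c p)"
    and gr: "\<And>c p. c \<in> atlas M \<Longrightarrow> p \<in> fst c \<Longrightarrow> riem_dist M p0 p < R \<Longrightarrow>
      sqrt (metric M c p (gradient c F (snd c p)) (gradient c F (snd c p))) \<le> \<kappa> * riem_dist M p0 p"
  shows "s0 * (LINT p|riem_volume M. (cutoff p0 R p)\<^sup>2)
     \<le> (LINT p|riem_volume M. 2 * cutoff p0 R p * (\<kappa> * riem_dist M p0 p))"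
proof -
  let ?K = "{p. riem_dist M p0 p \<le> R}" and ?a = "cutoff p0 R"
  have K: "compact ?K" by (rule Hopf_Rinow[OF complete])
  have openU: "open U" using F by (simp add: C2_fun_on_def)
  obtain n \<theta> c C V where part: "\<And>j::nat. j < n \<Longrightarrow> C1_fun (\<theta> j) \<and> (\<forall>q. 0 \<le> \<theta> j q) \<and> c j \<in> atlas M \<and> compact (C j) \<and>
      C j \<subseteq> snd (c j) ` (fst (c j) \<inter> U) \<and> (\<forall>q. q \<notin> chart_inv (c j) ` C j \<longrightarrow> \<theta> j q = 0)"
    and V: "open V" "?K \<subseteq> V" "\<And>q. q \<in> V \<Longrightarrow> (\<Sum>j<n. \<theta> j q) = 1"
    using partition_of_unity[OF K U openU] by blast
  have loc: "s0 * (LINT p|riem_volume M. \<theta> j p * (?a p)\<^sup>2) + (LINT p|riem_volume M. (?a p)\<^sup>2 * grad_pairing F (\<theta> j) p)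
     \<le> (LINT p|riem_volume M. \<theta> j p * (2 * ?a p * (\<kappa> * riem_dist M p0 p)))" if j: "j < n" for j
  proof (rule local_divergence[OF F])
    note P = part[OF j]
    show "C1_fun (\<theta> j)" "\<And>p. 0 \<le> \<theta> j p" "c j \<in> atlas M" "compact (C j)" "C j \<subseteq> snd (c j) ` (fst (c j) \<inter> U)"
      "\<And>p. p \<notin> chart_inv (c j) ` C j \<Longrightarrow> \<theta> j p = 0" using P by blast+
    fix z assume z: "z \<in> C j" "riem_dist M p0 (chart_inv (c j) z) < R"
    have zim: "z \<in> chart_im (c j)" and cj: "c j \<in> atlas M" using P z(1) by auto
    note i = chartD(6)[OF cj zim] chartD(7)[OF cj zim]
    show "s0 \<le> laplacian (c j) F z" using lap[OF cj i(1) z(2)] i(2) by simp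
    show "sqrt (coord_metric M (c j) z (gradient (c j) F z) (gradient (c j) F z)) \<le> \<kappa> * riem_dist M p0 (chart_inv (c j) z)"
      using gr[OF cj i(1) z(2)] i(2) by (simp add: coord_metric_def)
  qed (rule R)
  have a0: "?a p = 0" if "p \<notin> ?K" for p using that by (simp add: cutoff_eq_0)
  have cA: "continuous_on UNIV (grad_pairing F (\<theta> j))" if "j < n" for j
  proof -
    note P = part[OF that]
    have cj: "c j \<in> atlas M" and "compact (C j)" and sub: "C j \<subseteq> snd (c j) ` (fst (c j) \<inter> U)" using P by blast+
    have "compact (chart_inv (c j) ` C j)"
      by (rule compact_chart_inv_image[OF cj \<open>compact (C j)\<close>]) (use sub in blast)
    moreover have "chart_inv (c j) ` C j \<subseteq> fst (c j) \<inter> U"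
    proof
      fix q assume "q \<in> chart_inv (c j) ` C j"
      then obtain y where "y \<in> fst (c j) \<inter> U" "q = chart_inv (c j) (snd (c j) y)" using sub by blast
      then show "q \<in> fst (c j) \<inter> U" using chartD(5)[OF cj, of y] by simp
    qed
    ultimately have "compact (chart_inv (c j) ` C j)" "chart_inv (c j) ` C j \<subseteq> fst (c j) \<inter> U" by auto
    with continuous_on_grad_pairing(1)[OF F, of "\<theta> j" "c j" "chart_inv (c j) ` C j"] P show ?thesis by blast
  qed
  have int: "integrable (riem_volume M) (\<lambda>p. \<theta> j p * (?a p)\<^sup>2)"
    "integrable (riem_volume M) (\<lambda>p. (?a p)\<^sup>2 * grad_pairing F (\<theta> j) p)"
    "integrable (riem_volume M) (\<lambda>p. \<theta> j p * (2 * ?a p * (\<kappa> * riem_dist M p0 p)))" if "j < n" for j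
  proof -
    have c\<theta>: "continuous_on UNIV (\<theta> j)" using part[OF that] C1_fun_continuous by blast
    show "integrable (riem_volume M) (\<lambda>p. \<theta> j p * (?a p)\<^sup>2)"
      by (rule integrable_compact_support[OF _ K], intro continuous_intros c\<theta>, simp add: a0)
    show "integrable (riem_volume M) (\<lambda>p. (?a p)\<^sup>2 * grad_pairing F (\<theta> j) p)"
      by (rule integrable_compact_support[OF _ K], intro continuous_intros cA[OF that], simp add: a0)
    show "integrable (riem_volume M) (\<lambda>p. \<theta> j p * (2 * ?a p * (\<kappa> * riem_dist M p0 p)))"
      by (rule integrable_compact_support[OF _ K], intro continuous_intros c\<theta> continuous_on_riem_dist, simp add: a0)
  qed
  have "s0 * (\<Sum>j<n. LINT p|riem_volume M. \<theta> j p * (?a p)\<^sup>2) + (\<Sum>j<n. LINT p|riem_volume M. (?a p)\<^sup>2 * grad_pairing F (\<theta> j) p)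
     \<le> (\<Sum>j<n. LINT p|riem_volume M. \<theta> j p * (2 * ?a p * (\<kappa> * riem_dist M p0 p)))"
    unfolding sum_distrib_left sum.distrib[symmetric] by (intro sum_mono loc) simp
  moreover have "(\<Sum>j<n. LINT p|riem_volume M. \<theta> j p * (?a p)\<^sup>2) = (LINT p|riem_volume M. (?a p)\<^sup>2)"
  proof -
    have "(\<Sum>j<n. LINT p|riem_volume M. \<theta> j p * (?a p)\<^sup>2) = (LINT p|riem_volume M. (\<Sum>j<n. \<theta> j p * (?a p)\<^sup>2))"
      by (rule Bochner_Integration.integral_sum[symmetric]) (use int in auto)
    also have "\<dots> = (LINT p|riem_volume M. (?a p)\<^sup>2)"
    proof (rule Bochner_Integration.integral_cong[OF refl])
      fix p
      show "(\<Sum>j<n. \<theta> j p * (?a p)\<^sup>2) = (?a p)\<^sup>2"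
        using V(2,3) a0[of p] by (cases "p \<in> ?K") (auto simp: sum_distrib_right[symmetric] subset_iff)
    qed
    finally show ?thesis .
  qed
  moreover have "(\<Sum>j<n. LINT p|riem_volume M. (?a p)\<^sup>2 * grad_pairing F (\<theta> j) p) = 0"
  proof -
    have "(\<Sum>j<n. LINT p|riem_volume M. (?a p)\<^sup>2 * grad_pairing F (\<theta> j) p) =
        (LINT p|riem_volume M. (\<Sum>j<n. (?a p)\<^sup>2 * grad_pairing F (\<theta> j) p))"
      by (rule Bochner_Integration.integral_sum[symmetric]) (use int in auto)
    also have "\<dots> = (LINT p|riem_volume M. 0)"
    proof (rule Bochner_Integration.integral_cong[OF refl])
      fix p
      show "(\<Sum>j<n. (?a p)\<^sup>2 * grad_pairing F (\<theta> j) p) = 0"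
      proof (cases "p \<in> ?K")
        case True
        then have p: "p \<in> V" "p \<in> U" using V U by auto
        have "(\<Sum>j<n. grad_pairing F (\<theta> j) p) = grad_pairing F (\<lambda>q. \<Sum>j<n. \<theta> j q) p"
          by (rule grad_pairing_sum[OF F _ p(2), symmetric]) (use part in auto)
        also have "\<dots> = 0" by (rule grad_pairing_locally_const[OF V(1) p(1) V(3)])
        finally show ?thesis by (simp add: sum_distrib_left[symmetric])
      qed (simp add: a0)
    qed
    finally show ?thesis by simp
  qed
  moreover have "(\<Sum>j<n. LINT p|riem_volume M. \<theta> j p * (2 * ?a p * (\<kappa> * riem_dist M p0 p))) =
      (LINT p|riem_volume M. 2 * ?a p * (\<kappa> * riem_dist M p0 p))"
  proof -
    have "(\<Sum>j<n. LINT p|riem_volume M. \<theta> j p * (2 * ?a p * (\<kappa> * riem_dist M p0 p))) =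
        (LINT p|riem_volume M. (\<Sum>j<n. \<theta> j p * (2 * ?a p * (\<kappa> * riem_dist M p0 p))))"
      by (rule Bochner_Integration.integral_sum[symmetric]) (use int in auto)
    also have "\<dots> = (LINT p|riem_volume M. 2 * ?a p * (\<kappa> * riem_dist M p0 p))"
    proof (rule Bochner_Integration.integral_cong[OF refl])
      fix p
      show "(\<Sum>j<n. \<theta> j p * (2 * ?a p * (\<kappa> * riem_dist M p0 p))) = 2 * ?a p * (\<kappa> * riem_dist M p0 p)"
      proof (cases "p \<in> ?K")
        case True
        then have "(\<Sum>j<n. \<theta> j p) = 1" using V by auto
        then show ?thesis by (simp only: sum_distrib_right[symmetric] mult_1)
      qed (simp add: a0)
    qed
    finally show ?thesis .
  qed
  ultimately show ?thesis by simp
qed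

section \<open>Local bounds for the metric\<close>

text \<open>Trilinearity reduces this to finitely many continuous coefficients on a compact
  set.\<close>

lemma dmet_bound:
  assumes c: "c \<in> atlas M" and C: "compact C" "C \<subseteq> chart_im c"
  shows "\<exists>L\<ge>0. \<forall>y\<in>C. \<forall>w u v. \<bar>dmet c y w u v\<bar> \<le> L * norm w * norm u * norm v"
proof -
  have "\<exists>b\<ge>0. \<forall>y\<in>C. \<bar>dmet c y (axis k 1) (axis i 1) (axis j 1)\<bar> \<le> b" for i j k
  proof -
    have "continuous_on C (\<lambda>y. dmet c y (axis k 1) (axis i 1) (axis j 1))"
      unfolding dmet_def by (rule continuous_on_subset[OF smooth_onD(2)[OF smooth_coord_metric[OF c]] C(2)])
    from compact_imp_bounded[OF compact_continuous_image[OF this C(1)]]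
    obtain b where "b > 0" "\<forall>x\<in>C. norm (dmet c x (axis k 1) (axis i 1) (axis j 1)) \<le> b" unfolding bounded_pos by auto
    then show ?thesis by (intro exI[of _ b]) auto
  qed
  then have "\<forall>x. \<exists>b\<ge>0. \<forall>y\<in>C. \<bar>dmet c y (axis (snd (snd x)) 1) (axis (fst x) 1) (axis (fst (snd x)) 1)\<bar> \<le> b"
    by blast
  from choice[OF this] obtain b' where b': "\<And>x. 0 \<le> b' x"
    "\<And>x y. y \<in> C \<Longrightarrow> \<bar>dmet c y (axis (snd (snd x)) 1) (axis (fst x) 1) (axis (fst (snd x)) 1)\<bar> \<le> b' x" by blast
  define b where "b i j k = b' (i, j, k)" for i j k
  have b: "0 \<le> b i j k" "y \<in> C \<Longrightarrow> \<bar>dmet c y (axis k 1) (axis i 1) (axis j 1)\<bar> \<le> b i j k" for i j k y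
    using b'(1)[of "(i, j, k)"] b'(2)[of y "(i, j, k)"] by (auto simp: b_def)
  let ?L = "\<Sum>i\<in>UNIV. \<Sum>j\<in>UNIV. \<Sum>k\<in>UNIV. b i j k"
  have "\<bar>dmet c y w u v\<bar> \<le> ?L * norm w * norm u * norm v" if y: "y \<in> C" for y w u v
  proof -
    have yim: "y \<in> chart_im c" using y C by auto
    have "dmet c y w u v = (\<Sum>i\<in>UNIV. \<Sum>j\<in>UNIV. \<Sum>k\<in>UNIV. u $ i * v $ j * (w $ k * dmet c y (axis k 1) (axis i 1) (axis j 1)))"
    proof -
      have lw: "dmet c y w u' v' = (\<Sum>k\<in>UNIV. w $ k * dmet c y (axis k 1) u' v')" for u' v'
        using linear_expansion[OF linear_dmet[OF c yim, where v = u' and w = v'], of w] by simp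
      show ?thesis by (subst dmet_expansion[OF c yim]) (simp only: lw sum_distrib_left)
    qed
    also have "\<bar>\<dots>\<bar> \<le> (\<Sum>i\<in>UNIV. \<Sum>j\<in>UNIV. \<Sum>k\<in>UNIV. norm u * norm v * (norm w * b i j k))"
      by (intro order_trans[OF sum_abs] sum_mono) (auto simp: abs_mult intro!: mult_mono component_le_norm_cart b y)
    also have "\<dots> = ?L * norm w * norm u * norm v"
      by (simp add: sum_distrib_left sum_distrib_right ac_simps)
    finally show ?thesis .
  qed
  moreover have "0 \<le> ?L" by (intro sum_nonneg b)
  ultimately show ?thesis by blast
qed

lemma coord_metric_Lipschitz:
  assumes c: "c \<in> atlas M" and C: "convex C" "C \<subseteq> chart_im c"
    and L: "0 \<le> L" "\<And>y w u v. y \<in> C \<Longrightarrow> \<bar>dmet c y w u v\<bar> \<le> L * norm w * norm u * norm v"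
    and y: "y \<in> C" "y' \<in> C"
  shows "\<bar>coord_metric M c y u u - coord_metric M c y' u u\<bar> \<le> L * norm (y - y') * (norm u)\<^sup>2"
proof -
  have "norm (coord_metric M c y u u - coord_metric M c y' u u) \<le> (L * (norm u)\<^sup>2) * norm (y - y')"
  proof (rule differentiable_bound[OF C(1) _ _ y, where f' = "\<lambda>z w. dmet c z w u u"])
    fix z assume z: "z \<in> C"
    then have "z \<in> chart_im c" using C by auto
    from coord_metric_has_derivative[OF c this]
    show "((\<lambda>z. coord_metric M c z u u) has_derivative (\<lambda>w. dmet c z w u u)) (at z within C)"
      by (rule has_derivative_at_withinI)
    show "onorm (\<lambda>w. dmet c z w u u) \<le> L * (norm u)\<^sup>2"
      by (rule onorm_le) (use L(2)[OF z, of _ u u] in \<open>simp add: power2_eq_square ac_simps\<close>)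
  qed
  then show ?thesis by (simp add: ac_simps)
qed

text \<open>Test the Koszul formula with the Christoffel vector itself and divide by its norm. The
  three halved terms give \<open>3 / 2 * L\<close>, rounded up to \<open>2 * L\<close>.\<close>

lemma christoffel_bound:
  assumes c: "c \<in> atlas M" and y: "y \<in> chart_im c" and k: "0 < k" "\<And>u. k * norm u \<le> sqrt (coord_metric M c y u u)"
    and L: "0 \<le> L" "\<And>w u v. \<bar>dmet c y w u v\<bar> \<le> L * norm w * norm u * norm v"
  shows "norm (christoffel M c y u u) \<le> 2 * L / k\<^sup>2 * (norm u)\<^sup>2"
proof -
  let ?G = "christoffel M c y u u"
  have "k\<^sup>2 * (norm ?G)\<^sup>2 = (k * norm ?G)\<^sup>2" by (simp add: power_mult_distrib)
  also have "\<dots> \<le> (sqrt (coord_metric M c y ?G ?G))\<^sup>2" using k by (intro power_mono) auto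
  also have "\<dots> = coord_metric M c y ?G ?G"
    using inner_productD(4)[OF inner_product_coord_metric[OF c y]] by simp
  also have "\<dots> = (dmet c y u u ?G + dmet c y u u ?G - dmet c y ?G u u) / 2"
    by (rule coord_metric_christoffel[OF c y])
  also have "\<dots> \<le> 2 * L * (norm u)\<^sup>2 * norm ?G"
    using L(2)[of u u ?G] L(2)[of ?G u u] abs_ge_zero[of "dmet c y ?G u u"] by (simp add: power2_eq_square ac_simps)
  finally have "k\<^sup>2 * norm ?G * norm ?G \<le> 2 * L * (norm u)\<^sup>2 * norm ?G" by (simp add: power2_eq_square ac_simps)
  then have "norm ?G = 0 \<or> k\<^sup>2 * norm ?G \<le> 2 * L * (norm u)\<^sup>2" by (auto simp: mult_le_cancel_right)
  moreover have "0 \<le> L * (norm u)\<^sup>2" using L(1) by simp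
  ultimately show ?thesis using k(1) by (auto simp: field_simps)
qed

text \<open>All bounds hold with the same constant \<open>A\<close> for all base points \<open>q\<^sub>0\<close> near \<open>q\<close>; the metric at \<open>q\<^sub>0\<close>
  serves as a constant comparison inner product.\<close>

lemma normal_bounds:
  assumes d: "d \<in> atlas M" and q: "q \<in> fst d"
  shows "\<exists>\<rho> A V. 0 < \<rho> \<and> 0 < A \<and> A * \<rho> \<le> 1 \<and> open V \<and> q \<in> V \<and>
    (\<forall>q0\<in>V. q0 \<in> fst d \<and> (\<forall>R y. 0 < R \<longrightarrow> R < \<rho> \<longrightarrow> riem_dist M q0 y < R \<longrightarrow> y \<in> fst d \<and>
       sqrt (metric M d q0 (snd d y - snd d q0) (snd d y - snd d q0)) \<le> (1 + A * R) * riem_dist M q0 y \<and>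
       (\<forall>u. sqrt (metric M d q0 u u) \<le> (1 + A * R) * sqrt (metric M d y u u) \<and>
          (1 - A * R) * metric M d y u u \<le> metric M d q0 u u \<and>
          \<bar>metric M d q0 (christoffel M d (snd d y) u u) (snd d y - snd d q0)\<bar> \<le> A * R * metric M d y u u)))"
proof -
  let ?g = "coord_metric M d"
  obtain \<sigma> where \<sigma>: "\<sigma> > 0" "cball (snd d q) \<sigma> \<subseteq> chart_im d"
    using chartD(2)[OF d] q by (metis image_eqI open_contains_cball)
  let ?C = "cball (snd d q) \<sigma>"
  obtain k K where k: "k > 0" "\<And>z u. z \<in> ?C \<Longrightarrow> k * norm u \<le> sqrt (?g z u u)"
    and K: "K > 0" "\<And>z u. z \<in> ?C \<Longrightarrow> sqrt (?g z u u) \<le> K * norm u"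
    using ellipticity[OF d compact_cball \<sigma>(2)] by metis
  obtain L where L: "0 \<le> L" "\<And>y w u v. y \<in> ?C \<Longrightarrow> \<bar>dmet d y w u v\<bar> \<le> L * norm w * norm u * norm v"
    using dmet_bound[OF d compact_cball \<sigma>(2)] by blast
  have g0: "0 \<le> ?g y u u" if "y \<in> ?C" for y u
    using inner_productD(4)[OF inner_product_coord_metric[OF d]] that \<sigma> by blast
  have norm_le: "(norm u)\<^sup>2 \<le> ?g y u u / k\<^sup>2" if "y \<in> ?C" for y u
  proof -
    have "(k * norm u)\<^sup>2 \<le> (sqrt (?g y u u))\<^sup>2" using k(1) k(2)[OF that] by (intro power_mono) auto
    then show ?thesis using g0[OF that] k(1) by (simp add: field_simps power_mult_distrib)
  qed
  \<comment> \<open>A relative Lipschitz constant: \<open>L\<close> controls the metric in terms of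
    \<open>(norm u)\<^sup>2\<close>, and \<open>1 / k\<^sup>2\<close> converts this into the metric
    at \<open>y\<close>.\<close>
  define a where "a = L / k\<^sup>2"
  have a0: "0 \<le> a" using L by (simp add: a_def)
  have diff: "\<bar>?g y u u - ?g y0 u u\<bar> \<le> a * norm (y - y0) * ?g y u u" if y: "y \<in> ?C" "y0 \<in> ?C" for y y0 u
  proof -
    have "\<bar>?g y u u - ?g y0 u u\<bar> \<le> L * norm (y - y0) * (norm u)\<^sup>2"
      by (rule coord_metric_Lipschitz[OF d convex_cball \<sigma>(2) L y])
    also have "\<dots> \<le> L * norm (y - y0) * (?g y u u / k\<^sup>2)"
      using L(1) norm_le[OF y(1)] by (intro mult_left_mono) auto
    finally show ?thesis by (simp add: a_def)
  qed
  have sq: "sqrt (?g y0 u u) \<le> (1 + a * norm (y - y0)) * sqrt (?g y u u)" if y: "y \<in> ?C" "y0 \<in> ?C" for y y0 u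
  proof (rule real_le_lsqrt)
    let ?t = "a * norm (y - y0)"
    have t: "0 \<le> ?t" using a0 by simp
    have "?g y0 u u \<le> (1 + ?t) * ?g y u u" using diff[OF y, of u] by (simp add: algebra_simps)
    also have "\<dots> \<le> (1 + ?t)\<^sup>2 * ?g y u u"
      using t g0[OF y(1), of u] self_le_power[of "1 + ?t" 2] by (intro mult_right_mono) auto
    finally show "?g y0 u u \<le> ((1 + ?t) * sqrt (?g y u u))\<^sup>2" using g0[OF y(1), of u] by (simp add: power_mult_distrib)
    show "0 \<le> (1 + ?t) * sqrt (?g y u u)" using t g0[OF y(1), of u] by simp
  qed
  \<comment> \<open>The factors for the Christoffel term: \<open>christoffel_bound\<close>, the
    conversion \<open>1 / k\<^sup>2\<close> of \<open>(norm u)\<^sup>2\<close>, the comparison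
    \<open>K\<close> of norms, and 2 because the radial vector is shorter than
    \<open>2 * R\<close>.\<close>
  define b where "b = K * (2 * L / k\<^sup>2 / k\<^sup>2) * 2"
  have b0: "0 \<le> b" using K L by (simp add: b_def)
  \<comment> \<open>\<open>2 * a / k\<close> because frozen distance \<open>2 * R\<close> means
    coordinate distance at most \<open>2 * R / k\<close>; the 1 makes \<open>A\<close>
    positive.\<close>
  define A where "A = 1 + 2 * a / k + b"
  have A: "A > 0" "2 * a / k \<le> A" "b \<le> A" using a0 b0 k by (auto simp: A_def add_pos_nonneg)
  define \<rho> where "\<rho> = min (k * \<sigma> / 4) (1 / (2 * A))"
  have \<rho>: "\<rho> > 0" "A * \<rho> \<le> 1 / 2" "\<rho> \<le> k * \<sigma> / 4"
  proof -
    have "\<rho> \<le> 1 / (2 * A)" by (simp add: \<rho>_def)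
    then show "A * \<rho> \<le> 1 / 2" using A(1) by (simp add: field_simps)
  qed (use k \<sigma> A in \<open>auto simp: \<rho>_def\<close>)
  define V where "V = chart_inv d ` ball (snd d q) (\<sigma> / 2)"
  have sub: "ball (snd d q) (\<sigma> / 2) \<subseteq> ?C" using \<sigma> by auto
  have V: "open V" "q \<in> V"
  proof -
    show "open V" unfolding V_def using sub \<sigma> by (intro open_chart_inv_image d) auto
    show "q \<in> V" unfolding V_def using \<sigma> chartD(5)[OF d q] by (intro image_eqI[of _ _ "snd d q"]) auto
  qed
  have main: "q0 \<in> fst d \<and> (\<forall>R y. 0 < R \<longrightarrow> R < \<rho> \<longrightarrow> riem_dist M q0 y < R \<longrightarrow> y \<in> fst d \<and>
       sqrt (metric M d q0 (snd d y - snd d q0) (snd d y - snd d q0)) \<le> (1 + A * R) * riem_dist M q0 y \<and>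
       (\<forall>u. sqrt (metric M d q0 u u) \<le> (1 + A * R) * sqrt (metric M d y u u) \<and>
          (1 - A * R) * metric M d y u u \<le> metric M d q0 u u \<and>
          \<bar>metric M d q0 (christoffel M d (snd d y) u u) (snd d y - snd d q0)\<bar> \<le> A * R * metric M d y u u))"
    if q0V: "q0 \<in> V" for q0
  proof -
    obtain y0 where y0: "y0 \<in> ball (snd d q) (\<sigma> / 2)" "q0 = chart_inv d y0" using q0V by (auto simp: V_def)
    have y0C: "y0 \<in> ?C" using y0 sub by blast
    then have y0im: "y0 \<in> chart_im d" using \<sigma> by blast
    have q0: "q0 \<in> fst d" "snd d q0 = y0" using chartD(6,7)[OF d y0im] y0 by auto
    note ip = inner_product_coord_metric[OF d y0im]
    have g_q0: "metric M d q0 = ?g y0" using coord_metric_eq[OF d q0(1)] q0(2) by simp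
    have close: "z \<in> ?C \<and> norm (z - y0) \<le> r / k" if "sqrt (?g y0 (z - y0) (z - y0)) \<le> r" "r \<le> k * \<sigma> / 2" for z r
    proof -
      have "k * norm (z - y0) \<le> r" using k(2)[OF y0C, of "z - y0"] that by linarith
      then have *: "norm (z - y0) \<le> r / k" using k(1) by (simp add: field_simps)
      also have "r / k \<le> \<sigma> / 2" using that(2) k(1) by (simp add: field_simps)
      finally have "dist y0 z \<le> \<sigma> / 2" by (simp add: dist_norm norm_minus_commute)
      then have "dist (snd d q) z \<le> \<sigma>" using y0(1) dist_triangle[of "snd d q" z y0] by simp
      with * show ?thesis by simp
    qed
    have "y \<in> fst d \<and> sqrt (metric M d q0 (snd d y - snd d q0) (snd d y - snd d q0)) \<le> (1 + A * R) * riem_dist M q0 y \<and>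
       (\<forall>u. sqrt (metric M d q0 u u) \<le> (1 + A * R) * sqrt (metric M d y u u) \<and>
          (1 - A * R) * metric M d y u u \<le> metric M d q0 u u \<and>
          \<bar>metric M d q0 (christoffel M d (snd d y) u u) (snd d y - snd d q0)\<bar> \<le> A * R * metric M d y u u)"
      if R: "0 < R" "R < \<rho>" and y: "riem_dist M q0 y < R" for R y
    proof -
      have R2: "2 * R \<le> k * \<sigma> / 2" using R \<rho> by linarith
      have "A * R \<le> A * \<rho>" using R A by (intro mult_left_mono) auto
      then have AR: "A * R \<le> 1 / 2" using \<rho>(2) by linarith
      have AR0: "0 < A * R" using R A by simp
      have step: "1 + a * norm (z - y0) \<le> 1 + A * R" if "norm (z - y0) \<le> 2 * R / k" for z
      proof -
        have "a * norm (z - y0) \<le> a * (2 * R / k)" using that a0 by (intro mult_left_mono) auto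
        also have "\<dots> = (2 * a / k) * R" by simp
        also have "\<dots> \<le> A * R" using A R by (intro mult_right_mono) auto
        finally show ?thesis by simp
      qed
      have ball: "z \<in> chart_im d" and le: "sqrt (?g y0 u u) \<le> (1 + A * R) * sqrt (?g z u u)"
        if "sqrt (?g y0 (z - y0) (z - y0)) < 2 * R" for z u
      proof -
        have z: "z \<in> ?C" "norm (z - y0) \<le> 2 * R / k" using close[OF less_imp_le[OF that] R2] by auto
        then show "z \<in> chart_im d" using \<sigma> by blast
        have "sqrt (?g y0 u u) \<le> (1 + a * norm (z - y0)) * sqrt (?g z u u)" by (rule sq[OF z(1) y0C])
        also have "\<dots> \<le> (1 + A * R) * sqrt (?g z u u)"
          using step[OF z(2)] g0[OF z(1)] by (intro mult_right_mono) auto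
        finally show "sqrt (?g y0 u u) \<le> (1 + A * R) * sqrt (?g z u u)" .
      qed
      have "(1 + A * R) * riem_dist M q0 y \<le> (3 / 2) * R"
        using AR AR0 y riem_dist_nonneg[of q0 y] R by (intro mult_mono) auto
      then have small: "(1 + A * R) * riem_dist M (chart_inv d y0) y < 2 * R" using R y0(2) by simp
      have pos: "1 + A * R > 0" using AR0 by simp
      note lower = riem_dist_chart_lower[OF d ip pos ball le small]
      have yd: "y \<in> fst d" and nB: "sqrt (?g y0 (snd d y - y0) (snd d y - y0)) \<le> (1 + A * R) * riem_dist M q0 y"
        using lower y0(2) by auto
      have nB2: "sqrt (?g y0 (snd d y - y0) (snd d y - y0)) < 2 * R" using nB small y0(2) by simp
      let ?y = "snd d y"
      have yC: "?y \<in> ?C" "norm (?y - y0) \<le> 2 * R / k" using close[OF less_imp_le[OF nB2] R2] by auto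
      have yim: "?y \<in> chart_im d" using yd by auto
      have g_y: "metric M d y = ?g ?y" using coord_metric_eq[OF d yd] by simp
      have "(1 - A * R) * ?g ?y u u \<le> ?g y0 u u" for u
      proof -
        have "a * norm (?y - y0) * ?g ?y u u \<le> A * R * ?g ?y u u"
          using step[OF yC(2)] g0[OF yC(1)] by (intro mult_right_mono) auto
        then show ?thesis using diff[OF yC(1) y0C, of u] by (simp add: algebra_simps)
      qed
      moreover have "\<bar>?g y0 (christoffel M d ?y u u) (?y - y0)\<bar> \<le> A * R * ?g ?y u u" for u
      proof -
        let ?G = "christoffel M d ?y u u"
        have "\<bar>?g y0 ?G (?y - y0)\<bar> \<le> sqrt (?g y0 ?G ?G) * sqrt (?g y0 (?y - y0) (?y - y0))"
          using inner_product_Cauchy_Schwarz[OF ip, of ?G "?y - y0"] inner_product_Cauchy_Schwarz[OF ip, of "- ?G" "?y - y0"]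
          by (simp add: bilinear_simps[OF inner_productD(1)[OF ip]])
        also have "\<dots> \<le> (K * (2 * L / k\<^sup>2 * (?g ?y u u / k\<^sup>2))) * (2 * R)"
        proof (intro mult_mono)
          have "sqrt (?g y0 ?G ?G) \<le> K * norm ?G" by (rule K(2)[OF y0C])
          also have "norm ?G \<le> 2 * L / k\<^sup>2 * (norm u)\<^sup>2"
            by (rule christoffel_bound[OF d yim k(1) k(2)[OF yC(1)] L(1) L(2)[OF yC(1)]])
          also have "\<dots> \<le> 2 * L / k\<^sup>2 * (?g ?y u u / k\<^sup>2)"
            using L(1) norm_le[OF yC(1)] by (intro mult_left_mono) auto
          finally show "sqrt (?g y0 ?G ?G) \<le> K * (2 * L / k\<^sup>2 * (?g ?y u u / k\<^sup>2))" using K(1) by simp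
        qed (use nB2 K L g0[OF yC(1)] inner_productD(4)[OF ip] in auto)
        also have "\<dots> = b * R * ?g ?y u u" by (simp add: b_def)
        also have "\<dots> \<le> A * R * ?g ?y u u" using A R g0[OF yC(1)] by (intro mult_right_mono) auto
        finally show ?thesis .
      qed
      ultimately show ?thesis
        using yd nB le[OF nB2] unfolding g_q0 g_y q0(2) by blast
    qed
    with q0(1) show ?thesis by blast
  qed
  have "A * \<rho> \<le> 1" using \<rho> by simp
  with \<rho>(1) A(1) V main show ?thesis by blast
qed

section \<open>Volume growth of balls\<close>

text \<open>The initial condition for the growth estimate. A frame orthonormal at \<open>p\<close>
  maps the Euclidean ball of radius \<open>s / 2\<close> into the geodesic ball, as norms near
  \<open>p\<close> are at most twice those at \<open>p\<close>; the density is at least half its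
  value at \<open>p\<close>. The threshold depends on \<open>p\<close>, the constant does
  not.\<close>

lemma small_ball_volume:
  "\<exists>\<epsilon>>0. \<forall>s. 0 < s \<longrightarrow> s < \<epsilon> \<longrightarrow>
     ennreal (unit_ball_vol (real CARD('m)) / 2 * (s / 2) ^ CARD('m)) \<le> emeasure (riem_volume M) (geodesic_ball M p s)"
proof -
  obtain c where c: "c \<in> atlas M" "p \<in> fst c" by (rule ex_chart)
  let ?z = "snd c p" and ?vd = "volume_density M c"
  have zim: "?z \<in> chart_im c" using c by auto
  note ip = inner_product_coord_metric[OF c(1) zim]
  obtain \<sigma> where \<sigma>: "\<sigma> > 0" "cball ?z \<sigma> \<subseteq> chart_im c"
    using chartD(2)[OF c(1)] zim by (metis open_contains_cball)
  let ?B = "coord_metric M c ?z"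
  obtain k where k: "k > 0" "\<And>u. k * norm u \<le> sqrt (?B u u)" using inner_product_norm_equiv[OF ip] by blast
  have "continuous_on (cball ?z \<sigma> \<times> sphere 0 1) (\<lambda>x. sqrt (coord_metric M c (fst x) (snd x) (snd x)))"
    by (intro continuous_intros c) (use \<sigma> in auto)
  then have uc: "uniformly_continuous_on (cball ?z \<sigma> \<times> sphere 0 1) (\<lambda>x. sqrt (coord_metric M c (fst x) (snd x) (snd x)))"
    by (intro compact_uniformly_continuous compact_Times) auto
  \<comment> \<open>On unit vectors the norm at the centre is at least \<open>k\<close>, so a
    deviation below \<open>k\<close> amounts to at most a factor of 2.\<close>
  obtain \<delta> where \<delta>: "\<delta> > 0" "\<And>x y. x \<in> cball ?z \<sigma> \<times> sphere 0 1 \<Longrightarrow> y \<in> cball ?z \<sigma> \<times> sphere 0 1 \<Longrightarrow> dist y x < \<delta> \<Longrightarrow>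
      dist (sqrt (coord_metric M c (fst y) (snd y) (snd y))) (sqrt (coord_metric M c (fst x) (snd x) (snd x))) < k"
    using uc k(1) unfolding uniformly_continuous_on_def by metis
  have twice: "sqrt (coord_metric M c y u u) \<le> 2 * sqrt (?B u u)" if y: "y \<in> cball ?z \<sigma>" "dist y ?z < \<delta>" for y u
  proof (cases "u = 0")
    case True
    then show ?thesis using inner_productD(5)[OF ip] inner_productD(5)[OF inner_product_coord_metric[OF c(1)], of y] y \<sigma> by auto
  next
    case False
    let ?v = "u /\<^sub>R norm u"
    have nv: "norm ?v = 1" using False by simp
    have scale: "sqrt (coord_metric M c w u u) = norm u * sqrt (coord_metric M c w ?v ?v)" if "w \<in> chart_im c" for w
      using metric_scale[OF c(1) chartD(6)[OF c(1) that], of "norm u" ?v] False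
      by (simp add: coord_metric_def real_sqrt_mult)
    have "dist (sqrt (coord_metric M c y ?v ?v)) (sqrt (?B ?v ?v)) < k"
      using \<delta>(2)[of "(?z, ?v)" "(y, ?v)"] y nv \<sigma>(1) by (simp add: dist_Pair_Pair)
    moreover have "k \<le> sqrt (?B ?v ?v)" using k(2)[of ?v] nv by simp
    ultimately have "sqrt (coord_metric M c y ?v ?v) \<le> 2 * sqrt (?B ?v ?v)" by (simp add: dist_real_def)
    from mult_left_mono[OF this norm_ge_zero[of u]] show ?thesis
      using scale[of y] scale[OF zim] y(1) \<sigma>(2) by (simp add: subset_iff)
  qed
  have vd0: "?vd ?z > 0" by (rule volume_density_pos[OF c(1) zim])
  have "continuous (at ?z) ?vd"
    using continuous_on_eq_continuous_at[THEN iffD1, OF chartD(2)[OF c(1)] continuous_on_volume_density[OF c(1)]] zim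
    by blast
  then obtain \<eta> where \<eta>: "\<eta> > 0" "\<And>y. dist y ?z < \<eta> \<Longrightarrow> dist (?vd y) (?vd ?z) < ?vd ?z / 2"
    using vd0 unfolding continuous_at_eps_delta by (metis half_gt_zero dist_norm)
  have half: "?vd ?z / 2 \<le> ?vd y" if "dist y ?z < \<eta>" for y
    using \<eta>(2)[OF that] unfolding dist_real_def by linarith
  define \<epsilon> where "\<epsilon> = k * Min {\<sigma>, \<delta>, \<eta>}"
  have \<epsilon>: "\<epsilon> > 0" using k \<sigma> \<delta> \<eta> by (simp add: \<epsilon>_def)
  obtain E where E: "orthonormal_basis ?B E" using orthonormal_family[OF ip] by blast
  obtain e and Q :: "real^'m^'m" where Q: "transpose Q ** gram ?B ** Q = mat 1"
    using orthonormal_basis_matrix[OF inner_productD(1)[OF ip] E] by blast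
  have BQ: "?B (Q *v t) (Q *v t) = t \<bullet> t" for t
  proof -
    have "?B (Q *v t) (Q *v t) = t \<bullet> (transpose Q ** gram ?B ** Q *v t)"
      by (subst gram_eq[OF inner_productD(1)[OF ip]]) (simp only: matrix_vector_dot matrix_vector_mul_assoc matrix_mul_assoc)
    then show ?thesis by (simp add: Q)
  qed
  \<comment> \<open>The frame has unit Riemannian volume, so the density at \<open>p\<close> cancels
    from the final constant.\<close>
  have detQ: "\<bar>det Q\<bar> * ?vd ?z = 1"
  proof -
    have "det (transpose Q ** gram ?B ** Q) = 1" unfolding Q by simp
    then have "(det Q)\<^sup>2 * det (gram ?B) = 1" by (simp add: det_mul power2_eq_square ac_simps)
    then have "sqrt ((det Q)\<^sup>2 * det (gram ?B)) = 1" by simp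
    then show ?thesis by (simp add: real_sqrt_mult volume_density_gram)
  qed
  have "ennreal (unit_ball_vol (real CARD('m)) / 2 * (s / 2) ^ CARD('m)) \<le> emeasure (riem_volume M) (geodesic_ball M p s)"
    if s: "0 < s" "s < \<epsilon>" for s
  proof -
    define T where "T t = ?z + Q *v t" for t
    let ?D = "ball (0 :: real^'m) (s / 2)"
    have Tn: "norm (T t - ?z) < Min {\<sigma>, \<delta>, \<eta>}" if "t \<in> ?D" for t
    proof -
      have "k * norm (Q *v t) \<le> norm t" using k(2)[of "Q *v t"] by (simp add: BQ norm_eq_sqrt_inner)
      also have "\<dots> < k * Min {\<sigma>, \<delta>, \<eta>}" using that s by (simp add: \<epsilon>_def)
      finally show ?thesis using k(1) by (simp add: T_def)
    qed
    have TC: "T t \<in> cball ?z \<sigma>" "dist (T t) ?z < \<delta>" "dist (T t) ?z < \<eta>" if "t \<in> ?D" for t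
      using Tn[OF that] by (simp_all add: dist_norm norm_minus_commute[of ?z])
    then have Tim: "T t \<in> chart_im c" if "t \<in> ?D" for t using that \<sigma> by blast
    let ?W = "T ` ?D"
    have injT: "inj_on T S" for S
    proof (rule inj_onI)
      fix t t' assume "T t = T t'"
      then have "Q *v (t - t') = 0" by (simp add: T_def matrix_vector_mult_diff_distrib)
      then have "(t - t') \<bullet> (t - t') = 0" using BQ[of "t - t'"] inner_productD(5)[OF ip] by simp
      then show "t = t'" by simp
    qed
    have T': "(T has_derivative (*v) Q) (at t)" for t
      unfolding T_def by (auto intro!: derivative_eq_intros bounded_linear_imp_has_derivative matrix_vector_mul_bounded_linear)
    have cT: "continuous_on ?D T" by (rule has_derivative_continuous_on[OF has_derivative_at_withinI[OF T']])
    have oW: "open ?W" by (rule invariance_of_domain[OF cT open_ball injT])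
    have emW: "emeasure lborel ?W = ennreal (\<bar>det Q\<bar> * (unit_ball_vol (real CARD('m)) * (s / 2) ^ CARD('m)))"
    proof -
      have "emeasure lborel ?W = (\<integral>\<^sup>+t\<in>?D. ennreal \<bar>det (matrix ((*v) Q))\<bar> \<partial>lborel)"
      proof (rule emeasure_lborel_image[OF _ _ injT T'])
        show "(\<lambda>z. indicator ?D z * \<bar>det (matrix ((*v) Q))\<bar>) \<in> borel_measurable borel"
          by (intro borel_measurable_times borel_measurable_indicator borel_measurable_const) auto
      qed (use oW in auto)
      also have "\<dots> = ennreal \<bar>det Q\<bar> * emeasure lborel ?D" by (simp add: nn_integral_cmult_indicator matrix_of_matrix_vector_mul)
      finally show ?thesis using s by (simp add: emeasure_ball ennreal_mult[symmetric] unit_ball_vol_nonneg)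
    qed
    let ?G = "geodesic_ball M p s"
    have sub: "chart_inv c ` ?W \<subseteq> ?G"
    proof
      fix q assume "q \<in> chart_inv c ` ?W"
      then obtain t where t: "t \<in> ?D" "q = chart_inv c (T t)" by blast
      have seg: "closed_segment ?z (T t) \<subseteq> T ` ?D"
      proof
        fix y assume "y \<in> closed_segment ?z (T t)"
        then obtain r where r: "0 \<le> r" "r \<le> 1" "y = (1 - r) *\<^sub>R ?z + r *\<^sub>R T t" by (auto simp: closed_segment_def)
        then have "y = T (r *\<^sub>R t)" by (simp add: T_def algebra_simps matrix_vector_mult_scaleR)
        moreover have "norm (r *\<^sub>R t) \<le> norm t" using r by (simp add: mult_left_le_one_le)
        then have "r *\<^sub>R t \<in> ?D" using t by simp
        ultimately show "y \<in> T ` ?D" by blast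
      qed
      have "riem_dist M (chart_inv c ?z) (chart_inv c (T t)) \<le> 2 * norm t"
      proof (rule riem_dist_segment_le[OF c(1)])
        show "closed_segment ?z (T t) \<subseteq> chart_im c" using seg Tim by blast
        fix y assume "y \<in> closed_segment ?z (T t)"
        then obtain r where r: "r \<in> ?D" "y = T r" using seg by blast
        have "sqrt (coord_metric M c y (T t - ?z) (T t - ?z)) \<le> 2 * sqrt (?B (T t - ?z) (T t - ?z))"
          unfolding r(2) by (rule twice[OF TC(1,2)[OF r(1)]])
        also have "\<dots> = 2 * norm t" by (simp add: T_def BQ norm_eq_sqrt_inner)
        finally show "sqrt (coord_metric M c y (T t - ?z) (T t - ?z)) \<le> 2 * norm t" .
      qed
      then show "q \<in> ?G" using t chartD(5)[OF c] by (simp add: geodesic_ball_def)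
    qed
    have oG: "open (chart_inv c ` ?W)" using oW Tim by (intro open_chart_inv_image c) auto
    have im: "snd c ` chart_inv c ` ?W = ?W" using chartD(7)[OF c(1) Tim] by (force simp: image_iff)
    have "ennreal (unit_ball_vol (real CARD('m)) / 2 * (s / 2) ^ CARD('m)) = ennreal (?vd ?z / 2) * emeasure lborel ?W"
    proof -
      have "unit_ball_vol (real CARD('m)) / 2 * (s / 2) ^ CARD('m) =
         (\<bar>det Q\<bar> * ?vd ?z) * (unit_ball_vol (real CARD('m)) * (s / 2) ^ CARD('m) / 2)"
        by (simp add: detQ)
      then show ?thesis unfolding emW using vd0 s
        by (subst ennreal_mult[symmetric]) (auto simp: unit_ball_vol_nonneg ac_simps)
    qed
    also have "\<dots> = (\<integral>\<^sup>+y\<in>?W. ennreal (?vd ?z / 2) \<partial>lborel)"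
      using oW by (subst nn_integral_cmult_indicator) auto
    also have "\<dots> \<le> (\<integral>\<^sup>+y\<in>?W. ennreal (?vd y) \<partial>lborel)"
    proof (rule nn_integral_mono)
      fix y
      show "ennreal (?vd ?z / 2) * indicator ?W y \<le> ennreal (?vd y) * indicator ?W y"
        using half TC(3) by (auto simp: indicator_def intro!: ennreal_leI)
    qed
    also have "\<dots> = emeasure (riem_volume M) (chart_inv c ` ?W)"
    proof -
      have "chart_inv c ` ?W \<subseteq> fst c" using Tim chartD(6)[OF c(1)] by blast
      from emeasure_riem_volume[OF c(1) borel_open[OF oG] this] show ?thesis unfolding im by simp
    qed
    also have "\<dots> \<le> emeasure (riem_volume M) ?G"
      using sub open_geodesic_ball by (intro emeasure_mono) auto
    finally show ?thesis .
  qed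
  with \<epsilon> show ?thesis by blast
qed

lemma integrable_cutoff:
  assumes complete: "complete_riem M" and f: "continuous_on UNIV f"
    and supp: "\<And>p. R \<le> riem_dist M p0 p \<Longrightarrow> f p = 0"
  shows "integrable (riem_volume M) (f :: 'p \<Rightarrow> real)"
  by (rule integrable_compact_support[OF f Hopf_Rinow[OF complete, of p0 R]]) (simp add: supp)

text \<open>Integrate \<open>pos_part_square_bound\<close>: for increments up to 1 everything lives
  in the ball of radius \<open>R + 1\<close>, which is compact by \<open>Hopf_Rinow\<close> and
  whose volume is the constant.\<close>

lemma cutoff_integral_derivative:
  assumes complete: "complete_riem M"
  shows "((\<lambda>R. LINT p|riem_volume M. (cutoff p0 R p)\<^sup>2) has_real_derivative
    2 * (LINT p|riem_volume M. cutoff p0 R p)) (at R)"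
proof (rule has_real_derivative_quadratic_bound)
  fix h :: real assume h: "\<bar>h\<bar> \<le> 1"
  let ?K = "{p. riem_dist M p0 p \<le> R + 1}"
  have K: "compact ?K" by (rule Hopf_Rinow[OF complete])
  have Kb: "?K \<in> sets (riem_volume M)" using closed_riem_cball by simp
  have int2: "integrable (riem_volume M) (\<lambda>p. (cutoff p0 r p)\<^sup>2)" for r
    by (rule integrable_cutoff[OF complete, of _ r p0]) (auto intro!: continuous_intros simp: cutoff_eq_0)
  have int1: "integrable (riem_volume M) (cutoff p0 R)"
    by (rule integrable_cutoff[OF complete, of _ R p0]) (auto intro!: continuous_intros simp: cutoff_eq_0)
  let ?e = "\<lambda>p. (cutoff p0 (R + h) p)\<^sup>2 - (cutoff p0 R p)\<^sup>2 - 2 * cutoff p0 R p * h"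
  have inte: "integrable (riem_volume M) ?e"
    using int2[of "R + h"] int2[of R] int1 by simp
  have "(LINT p|riem_volume M. (cutoff p0 (R + h) p)\<^sup>2) - (LINT p|riem_volume M. (cutoff p0 R p)\<^sup>2)
      - 2 * (LINT p|riem_volume M. cutoff p0 R p) * h = (LINT p|riem_volume M. ?e p)"
    using int2[of "R + h"] int2[of R] int1 by simp
  also have "\<bar>\<dots>\<bar> \<le> (LINT p|riem_volume M. \<bar>?e p\<bar>)" by (rule integral_abs_bound)
  also have "\<dots> \<le> (LINT p|riem_volume M. h\<^sup>2 * indicator ?K p)"
  proof (rule integral_mono)
    show "integrable (riem_volume M) (\<lambda>p. \<bar>?e p\<bar>)" using inte by (rule integrable_abs)
    show "integrable (riem_volume M) (\<lambda>p. h\<^sup>2 * indicator ?K p)"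
      using Kb riem_volume_compact_finite[OF K] by simp
    fix p
    show "\<bar>?e p\<bar> \<le> h\<^sup>2 * indicator ?K p"
    proof (cases "p \<in> ?K")
      case True
      have eq: "R + h - riem_dist M p0 p = (R - riem_dist M p0 p) + h" by simp
      show ?thesis
        using pos_part_square_bound[of "R - riem_dist M p0 p" h] True unfolding cutoff_def eq by simp
    next
      case False
      then show ?thesis using h by (simp add: cutoff_eq_0)
    qed
  qed
  also have "\<dots> = measure (riem_volume M) ?K * h\<^sup>2" using Kb by simp
  finally show "\<bar>(LINT p|riem_volume M. (cutoff p0 (R + h) p)\<^sup>2) - (LINT p|riem_volume M. (cutoff p0 R p)\<^sup>2)
      - 2 * (LINT p|riem_volume M. cutoff p0 R p) * h\<bar> \<le> measure (riem_volume M) ?K * h\<^sup>2" .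
qed

text \<open>The differential inequality makes \<open>exp (2 m A R) R\<^sup>-\<^sup>m\<^sup>-\<^sup>2 \<integral> ((R - d)\<^sub>+)\<^sup>2\<close> monotone in \<open>R\<close>; its limit at \<open>0\<close>
  is a positive constant that depends only on the dimension \<open>m\<close>.\<close>

lemma volume_growth:
  assumes complete: "complete_riem M" and A: "0 \<le> A" "A * R1 \<le> 1"
    and key: "\<And>R. 0 < R \<Longrightarrow> R < R1 \<Longrightarrow>
      real CARD('m) * (1 - A * R) * (LINT p|riem_volume M. (cutoff p0 R p)\<^sup>2)
        \<le> (LINT p|riem_volume M. 2 * cutoff p0 R p * ((1 + A * R) * riem_dist M p0 p))"
    and R: "0 < R" "R < R1"
  shows "ennreal (exp (- 2 * real CARD('m)) * unit_ball_vol (real CARD('m)) / (8 * 4 ^ CARD('m)) * R ^ CARD('m))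
    \<le> emeasure (riem_volume M) (geodesic_ball M p0 R)"
proof -
  let ?\<mu> = "riem_volume M" and ?a = "cutoff p0" and ?\<omega> = "unit_ball_vol (real CARD('m))"
  define m where "m = CARD('m)"
  define I1 where "I1 r = (LINT p|?\<mu>. ?a r p)" for r
  define I2 where "I2 r = (LINT p|?\<mu>. (?a r p)\<^sup>2)" for r
  have int2: "integrable ?\<mu> (\<lambda>p. (?a r p)\<^sup>2)" for r
    by (rule integrable_cutoff[OF complete, of _ r p0]) (auto intro!: continuous_intros simp: cutoff_eq_0)
  have int1: "integrable ?\<mu> (?a r)" for r
    by (rule integrable_cutoff[OF complete, of _ r p0]) (auto intro!: continuous_intros simp: cutoff_eq_0)
  have I2_nonneg: "0 \<le> I2 r" for r unfolding I2_def by simp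
  have I2': "(I2 has_real_derivative 2 * I1 r) (at r)" for r
    unfolding I1_def I2_def[abs_def] by (rule cutoff_integral_derivative[OF complete])
  \<comment> \<open>On the support of the cutoff the distance is \<open>r\<close> minus the cutoff,
    so the right side of \<open>key\<close> is expressed by \<open>I1\<close> and
    \<open>I2\<close>.\<close>
  have rhs: "(LINT p|?\<mu>. 2 * ?a r p * ((1 + A * r) * riem_dist M p0 p)) = (1 + A * r) * (2 * r * I1 r - 2 * I2 r)" for r
  proof -
    have eq: "2 * ?a r p * ((1 + A * r) * riem_dist M p0 p) = (1 + A * r) * (2 * r * ?a r p - 2 * (?a r p)\<^sup>2)" for p
      by (cases "riem_dist M p0 p < r") (auto simp: cutoff_def power2_eq_square algebra_simps)
    show ?thesis unfolding eq using int1[of r] int2[of r] by (simp add: I1_def I2_def)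
  qed
  \<comment> \<open>\<open>2 * I1 r\<close> is the derivative of \<open>I2\<close>. The factor
    \<open>1 + t\<close> is divided out by dropping the nonnegative term
    \<open>2 * real m * (t * t)\<close>.\<close>
  have ode: "(real m + 2 - 2 * real m * (A * r)) * I2 r \<le> r * (2 * I1 r)" if r: "0 < r" "r < R1" for r
  proof -
    define t where "t = A * r"
    have "t \<le> A * R1" using A r unfolding t_def by (intro mult_left_mono) auto
    then have t: "0 \<le> t" "t \<le> 1" using A r by (auto simp: t_def)
    have "real m * (1 - t) * I2 r \<le> (1 + t) * (2 * r * I1 r - 2 * I2 r)"
      using key[OF r] unfolding rhs I2_def[symmetric] t_def m_def .
    then have "(real m * (1 - t) + 2 * (1 + t)) * I2 r \<le> (1 + t) * (r * (2 * I1 r))"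
      by (simp add: algebra_simps)
    moreover have "(1 + t) * (real m + 2 - 2 * real m * t) * I2 r \<le> (real m * (1 - t) + 2 * (1 + t)) * I2 r"
    proof (rule mult_right_mono[OF _ I2_nonneg])
      have "0 \<le> 2 * real m * (t * t)" by simp
      then show "(1 + t) * (real m + 2 - 2 * real m * t) \<le> real m * (1 - t) + 2 * (1 + t)"
        by (simp add: algebra_simps)
    qed
    ultimately have "(1 + t) * ((real m + 2 - 2 * real m * t) * I2 r) \<le> (1 + t) * (r * (2 * I1 r))"
      by (simp add: mult.assoc)
    then show ?thesis using t by (simp add: t_def)
  qed
  \<comment> \<open>The integrating factor of \<open>ode\<close>: the power takes care of
    \<open>m + 2\<close>, the exponential of the error linear in \<open>r\<close>.\<close>
  define f where "f r = I2 r * exp (2 * real m * A * r) / r ^ (m + 2)" for r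
  have mono: "f \<epsilon> \<le> f R" if \<epsilon>: "0 < \<epsilon>" "\<epsilon> \<le> R" for \<epsilon>
  proof (rule DERIV_nonneg_imp_nondecreasing[OF \<epsilon>(2)])
    fix r assume r: "\<epsilon> \<le> r" "r \<le> R"
    then have r0: "0 < r" "r < R1" using \<epsilon> R by auto
    let ?E = "exp (2 * real m * A * r)"
    let ?D = "((2 * I1 r * ?E + ?E * (2 * real m * A) * I2 r) * r ^ (m + 2)
        - I2 r * ?E * (real (m + 2) * r ^ (m + 1))) / (r ^ (m + 2) * r ^ (m + 2))"
    have "((\<lambda>r. exp (2 * real m * A * r)) has_real_derivative ?E * (2 * real m * A)) (at r)"
      by (auto intro!: derivative_eq_intros)
    moreover have "((\<lambda>r. r ^ (m + 2)) has_real_derivative real (m + 2) * r ^ (m + 1)) (at r)"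
      using DERIV_pow[of "m + 2" r] by simp
    ultimately have "(f has_real_derivative ?D) (at r)"
      unfolding f_def[abs_def] using r0 by (intro DERIV_divide DERIV_mult I2') auto
    moreover have "(2 * I1 r * ?E + ?E * (2 * real m * A) * I2 r) * r ^ (m + 2) - I2 r * ?E * (real (m + 2) * r ^ (m + 1))
        = ?E * r ^ (m + 1) * (r * (2 * I1 r) - (real m + 2 - 2 * real m * (A * r)) * I2 r)"
      by (simp add: algebra_simps)
    then have "0 \<le> ?D" using ode[OF r0] r0 by simp
    ultimately show "\<exists>y. (f has_real_derivative y) (at r) \<and> 0 \<le> y" by blast
  qed
  define vol where "vol r = measure ?\<mu> (geodesic_ball M p0 r)" for r
  have ball_sets: "geodesic_ball M p0 r \<in> sets ?\<mu>" for r using open_geodesic_ball by simp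
  have fin: "emeasure ?\<mu> (geodesic_ball M p0 r) < \<infinity>" for r
  proof -
    have "emeasure ?\<mu> (geodesic_ball M p0 r) \<le> emeasure ?\<mu> {p. riem_dist M p0 p \<le> r}"
      using closed_riem_cball by (intro emeasure_mono) (auto simp: geodesic_ball_def)
    then show ?thesis
      using riem_volume_compact_finite[OF Hopf_Rinow[OF complete, of p0 r]] by (rule le_less_trans)
  qed
  have vol: "emeasure ?\<mu> (geodesic_ball M p0 r) = ennreal (vol r)" for r
    unfolding vol_def using fin[of r] by (intro emeasure_eq_ennreal_measure) (simp add: less_top)
  have upper: "I2 R \<le> R\<^sup>2 * vol R"
  proof -
    have "I2 R \<le> (LINT p|?\<mu>. R\<^sup>2 * indicator (geodesic_ball M p0 R) p)"
      unfolding I2_def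
    proof (rule integral_mono[OF int2])
      show "integrable ?\<mu> (\<lambda>p. R\<^sup>2 * indicator (geodesic_ball M p0 R) p)"
        using ball_sets fin by simp
      show "(?a R p)\<^sup>2 \<le> R\<^sup>2 * indicator (geodesic_ball M p0 R) p" for p
        using R cutoff_le[of R p0 p] cutoff_nonneg[of p0 R p] cutoff_eq_0[of R p0 p]
        by (auto simp: indicator_def geodesic_ball_def intro!: power_mono)
    qed
    then show ?thesis using ball_sets by (simp add: vol_def)
  qed
  have lower: "(\<epsilon> / 2)\<^sup>2 * vol (\<epsilon> / 2) \<le> I2 \<epsilon>" if "0 < \<epsilon>" for \<epsilon>
  proof -
    have "(LINT p|?\<mu>. (\<epsilon> / 2)\<^sup>2 * indicator (geodesic_ball M p0 (\<epsilon> / 2)) p) \<le> I2 \<epsilon>"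
      unfolding I2_def
    proof (rule integral_mono[OF _ int2])
      show "integrable ?\<mu> (\<lambda>p. (\<epsilon> / 2)\<^sup>2 * indicator (geodesic_ball M p0 (\<epsilon> / 2)) p)"
        using ball_sets fin by simp
      show "(\<epsilon> / 2)\<^sup>2 * indicator (geodesic_ball M p0 (\<epsilon> / 2)) p \<le> (?a \<epsilon> p)\<^sup>2" for p
        using that by (auto simp: indicator_def geodesic_ball_def cutoff_def intro!: power_mono)
    qed
    then show ?thesis using ball_sets by (simp add: vol_def)
  qed
  obtain \<epsilon>0 where \<epsilon>0: "\<epsilon>0 > 0" "\<And>s. 0 < s \<Longrightarrow> s < \<epsilon>0 \<Longrightarrow> ennreal (?\<omega> / 2 * (s / 2) ^ m) \<le> emeasure ?\<mu> (geodesic_ball M p0 s)"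
    using small_ball_volume[of p0] unfolding m_def by blast
  \<comment> \<open>One small radius replaces the limit at 0: there \<open>f\<close> already is at
    least \<open>?c\<close>, a constant that does not depend on the radius or on
    \<open>p0\<close>.\<close>
  define \<epsilon> where "\<epsilon> = min R \<epsilon>0"
  have \<epsilon>: "0 < \<epsilon>" "\<epsilon> \<le> R" "\<epsilon> / 2 < \<epsilon>0" using R \<epsilon>0(1) by (auto simp: \<epsilon>_def)
  have \<omega>: "0 \<le> ?\<omega>" by (simp add: unit_ball_vol_nonneg)
  have "ennreal (?\<omega> / 2 * (\<epsilon> / 4) ^ m) \<le> ennreal (vol (\<epsilon> / 2))"
    using \<epsilon>0(2)[of "\<epsilon> / 2"] \<epsilon> vol by simp
  then have v: "?\<omega> / 2 * (\<epsilon> / 4) ^ m \<le> vol (\<epsilon> / 2)" by (subst (asm) ennreal_le_iff) (auto simp: vol_def)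
  \<comment> \<open>\<open>8 = 4 * 2\<close>, with 4 from \<open>(\<epsilon> / 2)\<^sup>2\<close>
    and 2 from \<open>small_ball_volume\<close>; \<open>4 ^ m\<close> since that lemma halves the
    radius \<open>\<epsilon> / 2\<close> once more.\<close>
  let ?c = "?\<omega> / (8 * 4 ^ m)"
  have "?c * \<epsilon> ^ (m + 2) = (\<epsilon> / 2)\<^sup>2 * (?\<omega> / 2 * (\<epsilon> / 4) ^ m)"
    by (simp add: power_divide power_add power2_eq_square)
  also have "\<dots> \<le> (\<epsilon> / 2)\<^sup>2 * vol (\<epsilon> / 2)" using v by (intro mult_left_mono) auto
  also have "\<dots> \<le> I2 \<epsilon>" by (rule lower[OF \<epsilon>(1)])
  finally have "?c \<le> I2 \<epsilon> / \<epsilon> ^ (m + 2)" using \<epsilon>(1) by (simp add: le_divide_eq)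
  also have "\<dots> \<le> f \<epsilon>"
    unfolding f_def using I2_nonneg[of \<epsilon>] \<epsilon>(1) A by (intro divide_right_mono) (auto simp: mult_le_cancel_left1)
  also have "\<dots> \<le> f R" by (rule mono[OF \<epsilon>(1,2)])
  also have "\<dots> \<le> R\<^sup>2 * vol R * exp (2 * real m) / R ^ (m + 2)"
  proof -
    \<comment> \<open>As \<open>A * R1 \<le> 1\<close>, the exponential costs at most
      \<open>exp (2 * real m)\<close>, whatever \<open>R\<close> is.\<close>
    have "A * R \<le> A * R1" using A R by (intro mult_left_mono) auto
    then have "real m * (A * R) \<le> real m * 1" using A by (intro mult_left_mono) auto
    then show ?thesis
      unfolding f_def using upper R I2_nonneg[of R]
      by (intro divide_right_mono mult_mono) (auto simp: ac_simps vol_def)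
  qed
  also have "\<dots> = vol R * exp (2 * real m) / R ^ m" using R by (simp add: power_add power2_eq_square)
  finally have "exp (- 2 * real m) * ?c * R ^ m \<le> vol R"
    using R by (simp add: exp_minus field_simps)
  then have "ennreal (exp (- 2 * real m) * ?c * R ^ m) \<le> ennreal (vol R)" by (rule ennreal_leI)
  then show ?thesis unfolding vol m_def by simp
qed

end

lemma bilinear_has_derivative:
  fixes B :: "real^'k::finite \<Rightarrow> real^'k \<Rightarrow> real"
  assumes B: "inner_product B" and "(f has_derivative f') (at z)" "(g has_derivative g') (at z)"
  shows "((\<lambda>y. B (f y) (g y)) has_derivative (\<lambda>v. B (f z) (g' v) + B (f' v) (g z))) (at z)"
  using inner_productD(1)[OF B] assms(2,3)
  by (intro bounded_bilinear.FDERIV) (simp_all add: bilinear_conv_bounded_bilinear)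

lemma C1_on_bilinear:
  fixes B :: "real^'k::finite \<Rightarrow> real^'k \<Rightarrow> real"
  assumes B: "inner_product B" and f: "C1_on f S" and g: "C1_on g S"
  shows "C1_on (\<lambda>y. B (f y) (g y)) S"
  by (rule C1_onI[OF bilinear_has_derivative[OF B C1_onD(1)[OF f] C1_onD(1)[OF g]]])
    (auto intro!: continuous_on_add continuous_on_inner_product[OF B] C1_onD(2)[OF f] C1_onD(2)[OF g]
      C1_on_imp_continuous_on[OF f] C1_on_imp_continuous_on[OF g])

section \<open>Isometric immersions\<close>

locale immersion = P: riemannian P + N: riemannian N
  for P :: "('p::{t2_space,second_countable_topology}, 'm::finite) riem"
    and N :: "('q::{t2_space,second_countable_topology}, 'n::finite) riem" +
  fixes \<phi> :: "'p \<Rightarrow> 'q"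
  assumes iso: "isometric_immersion P N \<phi>"
begin

lemma continuous_phi: "continuous_on S \<phi>"
  using iso by (auto simp: isometric_immersion_def smooth_map_def intro: continuous_on_subset)

lemma open_vimage_phi: "open V \<Longrightarrow> open (\<phi> -` V)"
  using continuous_phi[of UNIV] by (simp add: continuous_on_open_vimage[OF open_UNIV])

lemma local_rep_eq: "local_rep \<phi> c d z = snd d (\<phi> (chart_inv c z))"
  by (simp add: local_rep_def)

lemma local_rep_chart: "c \<in> atlas P \<Longrightarrow> p \<in> fst c \<Longrightarrow> local_rep \<phi> c d (snd c p) = snd d (\<phi> p)"
  by (simp add: local_rep_eq P.chartD)

lemma smooth_local_rep:
  "c \<in> atlas P \<Longrightarrow> d \<in> atlas N \<Longrightarrow> smooth_on (local_rep \<phi> c d) (snd c ` (fst c \<inter> \<phi> -` fst d))"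
  using iso by (auto simp: isometric_immersion_def smooth_map_def)

lemma local_rep_has_derivative:
  assumes "c \<in> atlas P" "d \<in> atlas N" "p \<in> fst c" "\<phi> p \<in> fst d"
  shows "(local_rep \<phi> c d has_derivative differential \<phi> c d p) (at (snd c p))"
  unfolding differential_def
  by (rule has_derivative_frechet[OF smooth_onD(1)[OF smooth_local_rep[OF assms(1,2)]]]) (use assms in auto)

lemma metric_differential:
  assumes "c \<in> atlas P" "d \<in> atlas N" "p \<in> fst c" "\<phi> p \<in> fst d"
  shows "metric N d (\<phi> p) (differential \<phi> c d p u) (differential \<phi> c d p v) = metric P c p u v"
  using iso assms unfolding isometric_immersion_def by blast

lemma phi_curve_derivative:
  assumes "c \<in> atlas P" "d \<in> atlas N" "\<gamma> s \<in> fst c" "\<phi> (\<gamma> s) \<in> fst d"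
    and "continuous_on A \<gamma>" "s \<in> A" "((snd c \<circ> \<gamma>) has_vector_derivative v) (at s within A)"
  shows "((snd d \<circ> (\<phi> \<circ> \<gamma>)) has_vector_derivative differential \<phi> c d (\<gamma> s) v) (at s within A)"
proof -
  have "(((snd d \<circ> \<phi>) \<circ> \<gamma>) has_vector_derivative differential \<phi> c d (\<gamma> s) v) (at s within A)"
  proof (rule curve_chart_change[where V = "fst c \<inter> \<phi> -` fst d" and h = "local_rep \<phi> c d" and x = "snd c"])
    show "open (fst c \<inter> \<phi> -` fst d)"
      by (intro open_Int P.chartD(1) open_vimage_phi N.chartD(1) assms(1,2))
    show "(local_rep \<phi> c d has_derivative differential \<phi> c d (\<gamma> s)) (at (snd c (\<gamma> s)))"
      by (rule local_rep_has_derivative[OF assms(1-4)])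
    show "local_rep \<phi> c d (snd c p) = (snd d \<circ> \<phi>) p" if "p \<in> fst c \<inter> \<phi> -` fst d" for p
      using local_rep_chart[OF assms(1), of p] that by simp
    show "\<gamma> s \<in> fst c \<inter> \<phi> -` fst d" using assms(3,4) by simp
  qed (fact assms(5-7))+
  then show ?thesis by (simp add: o_assoc)
qed

text \<open>Locally, the velocity of the image combines the components of the velocity in a chart of
  \<open>P\<close> with partial derivatives of the local representative, both continuous along the
  curve.\<close>

lemma C1_segment_phi:
  assumes ab: "a < b" and \<gamma>: "C1_segment P a b \<gamma>"
  shows "C1_segment N a b (\<phi> \<circ> \<gamma>)"
proof (rule C1_segmentI[where v = "\<lambda>d s. vector_derivative (snd d \<circ> (\<phi> \<circ> \<gamma>)) (at s within {a..b})"])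
  note cont = P.C1_segmentD(1)[OF \<gamma>]
  let ?vc = "\<lambda>c s. vector_derivative (snd c \<circ> \<gamma>) (at s within {a..b})"
  have hd: "((snd d \<circ> (\<phi> \<circ> \<gamma>)) has_vector_derivative differential \<phi> c d (\<gamma> s) (?vc c s)) (at s within {a..b})"
    if "c \<in> atlas P" "d \<in> atlas N" "s \<in> {a..b}" "\<gamma> s \<in> fst c" "\<phi> (\<gamma> s) \<in> fst d" for c d s
    by (rule phi_curve_derivative[OF that(1,2,4,5) cont that(3) P.C1_segmentD(2)[OF \<gamma> that(1,3,4)]])
  show "continuous_on {a..b} (\<phi> \<circ> \<gamma>)"
    using cont continuous_phi by (rule continuous_on_compose)
  show "((snd d \<circ> (\<phi> \<circ> \<gamma>)) has_vector_derivative vector_derivative (snd d \<circ> (\<phi> \<circ> \<gamma>)) (at s within {a..b})) (at s within {a..b})"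
    if d: "d \<in> atlas N" "s \<in> {a..b}" "(\<phi> \<circ> \<gamma>) s \<in> fst d" for d s
  proof -
    obtain c where c: "c \<in> atlas P" "\<gamma> s \<in> fst c" by (rule P.ex_chart)
    have "\<phi> (\<gamma> s) \<in> fst d" using d by simp
    from hd[OF c(1) d(1,2) c(2) this] show ?thesis
      by (metis differentiableI_vector vector_derivative_works)
  qed
  show "continuous_on {s \<in> {a..b}. (\<phi> \<circ> \<gamma>) s \<in> fst d} (\<lambda>s. vector_derivative (snd d \<circ> (\<phi> \<circ> \<gamma>)) (at s within {a..b}))"
    (is "continuous_on ?J _") if d: "d \<in> atlas N" for d
  proof (rule continuous_on_locally)
    fix s assume s: "s \<in> ?J"
    obtain c where c: "c \<in> atlas P" "\<gamma> s \<in> fst c" by (rule P.ex_chart)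
    obtain W where W: "open W" "W \<inter> {a..b} = \<gamma> -` fst c \<inter> {a..b}"
      using continuous_on_open_invariant[THEN iffD1, OF cont, rule_format, OF P.chartD(1)[OF c(1)]] by auto
    let ?K = "{s \<in> {a..b}. \<gamma> s \<in> fst c}"
    have JW: "?J \<inter> W \<subseteq> ?K"
    proof
      fix t assume "t \<in> ?J \<inter> W"
      then have "t \<in> W \<inter> {a..b}" "t \<in> {a..b}" by simp_all
      then show "t \<in> ?K" unfolding W(2) by simp
    qed
    have mem: "snd c (\<gamma> t) \<in> snd c ` (fst c \<inter> \<phi> -` fst d)" if t: "t \<in> ?J \<inter> W" for t
    proof (rule imageI)
      show "\<gamma> t \<in> fst c \<inter> \<phi> -` fst d" using t subsetD[OF JW t] by simp
    qed
    have subab: "?J \<inter> W \<subseteq> {a..b}" by auto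
    have im1: "\<gamma> ` (?J \<inter> W) \<subseteq> fst c"
    proof (rule image_subsetI)
      show "\<gamma> t \<in> fst c" if "t \<in> ?J \<inter> W" for t using subsetD[OF JW that] by simp
    qed
    have im2: "(\<lambda>s. snd c (\<gamma> s)) ` (?J \<inter> W) \<subseteq> snd c ` (fst c \<inter> \<phi> -` fst d)"
      by (rule image_subsetI) (rule mem)
    have cx: "continuous_on (?J \<inter> W) (\<lambda>s. snd c (\<gamma> s))"
      by (rule continuous_on_compose2[OF P.chartD(3)[OF c(1)] continuous_on_subset[OF cont subab] im1])
    have "continuous_on (?J \<inter> W) (\<lambda>t. \<Sum>i\<in>UNIV. ?vc c t $ i *\<^sub>R frechet_derivative (local_rep \<phi> c d) (at (snd c (\<gamma> t))) (axis i 1))"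
      by (intro continuous_intros continuous_on_subset[OF P.C1_segmentD(3)[OF \<gamma> c(1)] JW]
        continuous_on_compose2[OF smooth_onD(2)[OF smooth_local_rep[OF c(1) d]] cx im2])
    then have "continuous_on (?J \<inter> W) (\<lambda>s. vector_derivative (snd d \<circ> (\<phi> \<circ> \<gamma>)) (at s within {a..b}))"
    proof (rule continuous_on_eq)
      fix t assume t: "t \<in> ?J \<inter> W"
      then have t': "t \<in> {a..b}" "\<gamma> t \<in> fst c" "\<phi> (\<gamma> t) \<in> fst d" using subsetD[OF JW t] by simp_all
      have lin: "linear (differential \<phi> c d (\<gamma> t))"
        using local_rep_has_derivative[OF c(1) d t'(2,3)] has_derivative_linear by blast
      have "vector_derivative (snd d \<circ> (\<phi> \<circ> \<gamma>)) (at t within {a..b}) = differential \<phi> c d (\<gamma> t) (?vc c t)"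
        using vector_derivative_within_cbox[of a b t] hd[OF c(1) d t'] ab t'(1) by simp
      then show "(\<Sum>i\<in>UNIV. ?vc c t $ i *\<^sub>R frechet_derivative (local_rep \<phi> c d) (at (snd c (\<gamma> t))) (axis i 1)) =
          vector_derivative (snd d \<circ> (\<phi> \<circ> \<gamma>)) (at t within {a..b})"
        using linear_expansion[OF lin, of "?vc c t"] by (simp add: differential_def)
    qed
    moreover have "s \<in> W \<inter> {a..b}" unfolding W(2) using s c(2) by simp
    ultimately show "\<exists>W. open W \<and> s \<in> W \<and> continuous_on (?J \<inter> W) (\<lambda>s. vector_derivative (snd d \<circ> (\<phi> \<circ> \<gamma>)) (at s within {a..b}))"
      using W(1) by (intro exI[of _ W]) simp
  qed
qed fact

lemma pc_curve_phi: "pc_curve P \<gamma> a b \<Longrightarrow> pc_curve N (\<phi> \<circ> \<gamma>) a b"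
proof (induction rule: pc_curve.induct)
  case (seg a b)
  then show ?case by (intro pc_curve.seg C1_segment_phi)
next
  case (join a b c)
  show ?case by (rule pc_curve.join[OF join.IH])
qed

lemma length_phi:
  assumes \<gamma>: "pc_curve P \<gamma> a b"
  shows "integral {a..b} (speed N (\<phi> \<circ> \<gamma>)) = integral {a..b} (speed P \<gamma>)"
proof -
  obtain S where S: "finite S"
    "\<forall>s\<in>{a..b} - S. s \<in> {a<..<b} \<and> (\<forall>c\<in>atlas P. \<gamma> s \<in> fst c \<longrightarrow>
       (\<exists>v. ((snd c \<circ> \<gamma>) has_vector_derivative v) (at s) \<and> speed P \<gamma> s = sqrt (metric P c (\<gamma> s) v v)))"
    using P.pc_curve_speed[OF \<gamma>] by blast
  show ?thesis
  proof (rule integral_spike[OF negligible_finite[OF S(1)]])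
    fix s assume s: "s \<in> {a..b} - S"
    obtain c where c: "c \<in> atlas P" "\<gamma> s \<in> fst c" by (rule P.ex_chart)
    have sab: "s \<in> {a<..<b}" using bspec[OF S(2) s] by (rule conjunct1)
    obtain v where v: "((snd c \<circ> \<gamma>) has_vector_derivative v) (at s)" "speed P \<gamma> s = sqrt (metric P c (\<gamma> s) v v)"
      using bspec[OF bspec[OF S(2) s, THEN conjunct2] c(1)] c(2) by blast
    define d where "d = (SOME d. d \<in> atlas N \<and> \<phi> (\<gamma> s) \<in> fst d)"
    note d = N.some_chart[OF d_def]
    have within: "at s within {a<..<b} = at s" by (rule at_within_open[OF sab open_greaterThanLessThan])
    have cont: "continuous_on {a<..<b} \<gamma>"
      by (rule continuous_on_subset[OF pc_curve_continuous_on[OF \<gamma>]]) auto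
    have "((snd d \<circ> (\<phi> \<circ> \<gamma>)) has_vector_derivative differential \<phi> c d (\<gamma> s) v) (at s)"
      using phi_curve_derivative[OF c(1) d(1) c(2) _ cont sab, of v] v(1) d(2) unfolding within by simp
    then have "vector_derivative (snd d \<circ> (\<phi> \<circ> \<gamma>)) (at s) = differential \<phi> c d (\<gamma> s) v"
      by (rule vector_derivative_at)
    then show "speed P \<gamma> s = speed N (\<phi> \<circ> \<gamma>) s"
      using metric_differential[OF c(1) d(1) c(2), of v v] d(2) v(2)
      unfolding speed_def[of N] Let_def o_apply[of \<phi> \<gamma> s] d_def[symmetric] by simp
  qed
qed

text \<open>Images of curves in \<open>P\<close> are curves in \<open>N\<close> of the same length,
  and the infimum in \<open>N\<close> may run over further curves.\<close>

lemma riem_dist_phi_le: "riem_dist N (\<phi> p) (\<phi> q) \<le> riem_dist P p q"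
proof -
  have "riem_dist N (\<phi> p) (\<phi> q) \<le> L" if L: "P.joins p q L" for L
  proof (rule N.riem_dist_le)
    obtain \<gamma> a b where "pc_curve P \<gamma> a b" "\<gamma> a = p" "\<gamma> b = q" "integral {a..b} (speed P \<gamma>) = L"
      using L unfolding P.joins_def by blast
    then show "N.joins (\<phi> p) (\<phi> q) L"
      unfolding N.joins_def using pc_curve_phi length_phi by (intro exI[of _ "\<phi> \<circ> \<gamma>"] exI[of _ a] exI[of _ b]) auto
  qed
  moreover have "{L. P.joins p q L} \<noteq> {}" using P.ex_joins by blast
  ultimately show ?thesis unfolding P.riem_dist_eq[of p q] by (intro cInf_greatest) auto
qed

text \<open>The function F of the monotonicity formula. The metric is taken at \<open>q0\<close> for
  every \<open>p\<close>, so it is differentiated as a constant bilinear form.\<close>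

definition half_sq :: "('q, 'n) chart \<Rightarrow> 'q \<Rightarrow> 'p \<Rightarrow> real" where
  "half_sq d q0 p = metric N d q0 (snd d (\<phi> p) - snd d q0) (snd d (\<phi> p) - snd d q0) / 2"

context
  fixes d q0
  assumes d: "d \<in> atlas N" and q0: "q0 \<in> fst d"
begin

private abbreviation "B \<equiv> metric N d q0"
private abbreviation "rad p \<equiv> snd d (\<phi> p) - snd d q0"

lemma inner_product_B: "inner_product B"
  by (rule N.inner_product_metric[OF d q0])

lemma half_sq_derivative:
  assumes c: "c \<in> atlas P" and z: "z \<in> snd c ` (fst c \<inter> \<phi> -` fst d)"
  shows "((\<lambda>y. half_sq d q0 (chart_inv c y)) has_derivative
      (\<lambda>w. B (frechet_derivative (local_rep \<phi> c d) (at z) w) (local_rep \<phi> c d z - snd d q0))) (at z)"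
proof -
  let ?f = "\<lambda>y. local_rep \<phi> c d y - snd d q0" and ?f' = "frechet_derivative (local_rep \<phi> c d) (at z)"
  have "(?f has_derivative ?f') (at z)"
    using has_derivative_diff[OF has_derivative_frechet[OF smooth_onD(1)[OF smooth_local_rep[OF c d] z]] has_derivative_const[of "snd d q0"]]
    by simp
  from bounded_linear.has_derivative[OF bounded_linear_divide[of 2] bilinear_has_derivative[OF inner_product_B this this]]
  show ?thesis
    using inner_productD(2)[OF inner_product_B, of "?f z"] by (simp add: half_sq_def local_rep_eq)
qed

lemma dfun_half_sq:
  assumes "c \<in> atlas P" "z \<in> snd c ` (fst c \<inter> \<phi> -` fst d)"
  shows "P.dfun c (half_sq d q0) z w = B (frechet_derivative (local_rep \<phi> c d) (at z) w) (local_rep \<phi> c d z - snd d q0)"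
  using fun_cong[OF frechet_derivative_at[OF half_sq_derivative[OF assms]], of w] by (simp add: P.dfun_def)

lemma open_chart_dom: "c \<in> atlas P \<Longrightarrow> open (snd c ` (fst c \<inter> \<phi> -` fst d))"
  by (intro P.open_chart_image open_Int P.chartD(1) open_vimage_phi N.chartD(1) d) auto

lemma C1_local_rep:
  assumes c: "c \<in> atlas P"
  shows "C1_on (\<lambda>y. local_rep \<phi> c d y - snd d q0) (snd c ` (fst c \<inter> \<phi> -` fst d))"
    and "C1_on (\<lambda>y. frechet_derivative (local_rep \<phi> c d) (at y) w) (snd c ` (fst c \<inter> \<phi> -` fst d))"
  by (intro C1_on_diff smooth_on_imp_C1_on smooth_local_rep c d C1_on_const)
    (intro smooth_on_imp_C1_on smooth_onD(4)[OF smooth_local_rep] c d)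

lemma C2_half_sq: "P.C2_fun_on (\<phi> -` fst d) (half_sq d q0)"
  unfolding P.C2_fun_on_def
proof (intro conjI ballI allI)
  show "open (\<phi> -` fst d)" by (intro open_vimage_phi N.chartD(1) d)
  fix c assume c: "c \<in> atlas P"
  show "C1_on (\<lambda>z. half_sq d q0 (chart_inv c z)) (snd c ` (fst c \<inter> \<phi> -` fst d))"
    by (rule C1_onI[OF half_sq_derivative[OF c]])
      (assumption, intro continuous_on_inner_product[OF inner_product_B] C1_on_imp_continuous_on C1_local_rep c)
  show "C1_on (\<lambda>z. P.dfun c (half_sq d q0) z w) (snd c ` (fst c \<inter> \<phi> -` fst d))" for w
    by (rule C1_on_cong[OF C1_on_bilinear[OF inner_product_B C1_local_rep(2)[OF c, of w] C1_local_rep(1)[OF c]] open_chart_dom[OF c]])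
      (simp add: dfun_half_sq[OF c])
qed

text \<open>The Gauss formula turns the Laplacian on \<open>P\<close> into the trace of a Hessian on \<open>N\<close> plus a
  mean curvature term.\<close>

lemma laplacian_half_sq:
  assumes c: "c \<in> atlas P" and p: "p \<in> fst c" "\<phi> p \<in> fst d"
  defines "E \<equiv> (SOME E. orthonormal_basis (metric P c p) E)" and "D \<equiv> differential \<phi> c d p"
  shows "P.laplacian c (half_sq d q0) (snd c p) =
    (\<Sum>e\<in>E. B (D e) (D e) - B (christoffel N d (snd d (\<phi> p)) (D e) (D e)) (rad p))
     + real CARD('m) * B (mean_curvature_vector P N \<phi> c d p) (rad p)"
proof -
  let ?z = "snd c p" and ?W = "snd c ` (fst c \<inter> \<phi> -` fst d)"
  have z: "?z \<in> ?W" using p by auto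
  have lr: "local_rep \<phi> c d ?z = snd d (\<phi> p)" by (rule local_rep_chart[OF c p(1)])
  have D: "frechet_derivative (local_rep \<phi> c d) (at ?z) = D" by (simp add: D_def differential_def)
  note bl = inner_productD(1)[OF inner_product_B]
  let ?D2 = "\<lambda>e. frechet_derivative (\<lambda>y. frechet_derivative (local_rep \<phi> c d) (at y) e) (at ?z) e"
  have second: "frechet_derivative (\<lambda>y. P.dfun c (half_sq d q0) y e) (at ?z) e = B (D e) (D e) + B (?D2 e) (rad p)" for e
  proof -
    have f: "((\<lambda>y. local_rep \<phi> c d y - snd d q0) has_derivative D) (at ?z)"
      using has_derivative_diff[OF local_rep_has_derivative[OF c d p] has_derivative_const[of "snd d q0"]] by (simp add: D_def)
    have "((\<lambda>y. B (frechet_derivative (local_rep \<phi> c d) (at y) e) (local_rep \<phi> c d y - snd d q0)) has_derivative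
       (\<lambda>v. B (frechet_derivative (local_rep \<phi> c d) (at ?z) e) (D v) +
          B (frechet_derivative (\<lambda>y. frechet_derivative (local_rep \<phi> c d) (at y) e) (at ?z) v) (local_rep \<phi> c d ?z - snd d q0))) (at ?z)"
      by (rule bilinear_has_derivative[OF inner_product_B C1_onD(1)[OF C1_local_rep(2)[OF c] z] f])
    then have "((\<lambda>y. P.dfun c (half_sq d q0) y e) has_derivative
       (\<lambda>v. B (frechet_derivative (local_rep \<phi> c d) (at ?z) e) (D v) +
          B (frechet_derivative (\<lambda>y. frechet_derivative (local_rep \<phi> c d) (at y) e) (at ?z) v) (local_rep \<phi> c d ?z - snd d q0))) (at ?z)"
      by (rule has_derivative_transform_within_open[OF _ open_chart_dom[OF c] z]) (simp add: dfun_half_sq[OF c])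
    from fun_cong[OF frechet_derivative_at[OF this], of e] show ?thesis by (simp add: D lr)
  qed
  let ?II = "\<lambda>e. second_fundamental_form P N \<phi> c d p e e"
  let ?\<Gamma> = "\<lambda>e. christoffel N d (snd d (\<phi> p)) (D e) (D e)"
  have summand: "frechet_derivative (\<lambda>y. P.dfun c (half_sq d q0) y e) (at ?z) e - P.dfun c (half_sq d q0) ?z (christoffel P c ?z e e)
      = (B (D e) (D e) - B (?\<Gamma> e) (rad p)) + B (?II e) (rad p)" for e
    unfolding second dfun_half_sq[OF c z] lr D second_fundamental_form_def D_def[symmetric]
    by (simp add: bilinear_simps[OF bl])
  have linB: "linear (\<lambda>v. B v (rad p))" using bl by (simp add: bilinear_def)
  have "(\<Sum>e\<in>E. B (?II e) (rad p)) = B (\<Sum>e\<in>E. ?II e) (rad p)"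
    by (rule linear_sum[OF linB, symmetric])
  also have "(\<Sum>e\<in>E. ?II e) = real CARD('m) *\<^sub>R mean_curvature_vector P N \<phi> c d p"
    unfolding mean_curvature_vector_def E_def by simp
  finally have H: "(\<Sum>e\<in>E. B (?II e) (rad p)) = real CARD('m) * B (mean_curvature_vector P N \<phi> c d p) (rad p)"
    by (simp add: bilinear_simps[OF bl] right_diff_distrib)
  have "P.laplacian c (half_sq d q0) ?z = (\<Sum>e\<in>E. (B (D e) (D e) - B (?\<Gamma> e) (rad p)) + B (?II e) (rad p))"
    unfolding P.laplacian_def P.coord_metric_eq[OF c p(1)] E_def[symmetric] summand ..
  then show ?thesis by (simp only: sum.distrib H)
qed

end

text \<open>Supplies \<open>volume_growth\<close> with constants that serve all \<open>p0\<close>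
  whose images lie near \<open>q\<close>; without this uniformity the volumes of infinitely many
  disjoint balls might have a finite sum.\<close>

lemma uniform_volume_bound:
  assumes complete: "complete_riem P" and cmc: "constant_mean_curvature_length P N \<phi>" and \<epsilon>: "0 < \<epsilon>"
  shows "\<exists>V. open V \<and> q \<in> V \<and> (\<exists>R k. 0 < R \<and> R < \<epsilon> \<and> 0 < k \<and>
    (\<forall>p0. \<phi> p0 \<in> V \<longrightarrow> ennreal k \<le> emeasure (riem_volume P) (geodesic_ball P p0 R)))"
proof -
  obtain d where d: "d \<in> atlas N" "q \<in> fst d" by (rule N.ex_chart)
  obtain \<rho> A V where nb: "0 < \<rho>" "0 < A" "A * \<rho> \<le> 1" "open V" "q \<in> V"
    "\<forall>q0\<in>V. q0 \<in> fst d \<and> (\<forall>R y. 0 < R \<longrightarrow> R < \<rho> \<longrightarrow> riem_dist N q0 y < R \<longrightarrow> y \<in> fst d \<and>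
       sqrt (metric N d q0 (snd d y - snd d q0) (snd d y - snd d q0)) \<le> (1 + A * R) * riem_dist N q0 y \<and>
       (\<forall>u. sqrt (metric N d q0 u u) \<le> (1 + A * R) * sqrt (metric N d y u u) \<and>
          (1 - A * R) * metric N d y u u \<le> metric N d q0 u u \<and>
          \<bar>metric N d q0 (christoffel N d (snd d y) u u) (snd d y - snd d q0)\<bar> \<le> A * R * metric N d y u u))"
    using N.normal_bounds[OF d] by blast
  obtain h0 where h0: "\<forall>c\<in>atlas P. \<forall>d\<in>atlas N. \<forall>p\<in>fst c \<inter> \<phi> -` fst d.
      sqrt (metric N d (\<phi> p) (mean_curvature_vector P N \<phi> c d p) (mean_curvature_vector P N \<phi> c d p)) = h0"
    using cmc unfolding constant_mean_curvature_length_def Let_def by blast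
  define h where "h = \<bar>h0\<bar>"
  define A1 where "A1 = 6 * A + 4 * h"
  define R1 where "R1 = min (\<rho> / 2) (1 / A1)"
  have A1: "A1 > 0" "6 * A \<le> A1" "4 * A + 4 * h \<le> A1" using nb by (auto simp: A1_def h_def add_pos_nonneg)
  have "A1 * R1 \<le> A1 * (1 / A1)" using A1 by (intro mult_left_mono) (auto simp: R1_def)
  then have R1: "0 < R1" "A1 * R1 \<le> 1" "2 * R1 \<le> \<rho>" using A1 nb by (auto simp: R1_def)
  have key: "real CARD('m) * (1 - A1 * R) * (LINT p|riem_volume P. (P.cutoff p0 R p)\<^sup>2)
        \<le> (LINT p|riem_volume P. 2 * P.cutoff p0 R p * ((1 + A1 * R) * riem_dist P p0 p))"
    if p0: "\<phi> p0 \<in> V" and R: "0 < R" "R < R1" for p0 R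
  proof (rule P.global_divergence[OF complete])
    let ?q0 = "\<phi> p0" and ?F = "half_sq d (\<phi> p0)"
    have q0: "?q0 \<in> fst d" using nb(6) p0 by blast
    note ip = inner_product_B[OF d(1) q0]
    let ?B = "metric N d ?q0" and ?r = "\<lambda>p. snd d (\<phi> p) - snd d ?q0"
    have AR: "A * (2 * R) \<le> 1" "0 < A * R"
    proof -
      have "A * (2 * R) \<le> A * \<rho>" using R R1 nb by (intro mult_left_mono) auto
      then show "A * (2 * R) \<le> 1" using nb(3) by linarith
    qed (use nb R in auto)
    \<comment> \<open>The bounds near \<open>q\<close> are used with radius \<open>2 * R\<close>:
      they concern open balls, whereas the closed ball of radius \<open>R\<close> has to lie in the
      domain of \<open>?F\<close>.\<close>
    have nbR: "\<phi> p \<in> fst d" "sqrt (?B (?r p) (?r p)) \<le> (1 + A * (2 * R)) * riem_dist N ?q0 (\<phi> p)"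
       "sqrt (?B u u) \<le> (1 + A * (2 * R)) * sqrt (metric N d (\<phi> p) u u)"
       "(1 - A * (2 * R)) * metric N d (\<phi> p) u u \<le> ?B u u"
       "\<bar>?B (christoffel N d (snd d (\<phi> p)) u u) (?r p)\<bar> \<le> A * (2 * R) * metric N d (\<phi> p) u u"
      if p: "riem_dist P p0 p \<le> R" for p u
    proof -
      have "riem_dist N ?q0 (\<phi> p) \<le> R" using riem_dist_phi_le[of p0 p] p by linarith
      then have "0 < 2 * R" "2 * R < \<rho>" "riem_dist N ?q0 (\<phi> p) < 2 * R" using R R1 by auto
      with nb(6) p0 have *: "\<phi> p \<in> fst d \<and>
       sqrt (?B (?r p) (?r p)) \<le> (1 + A * (2 * R)) * riem_dist N ?q0 (\<phi> p) \<and>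
       (\<forall>u. sqrt (?B u u) \<le> (1 + A * (2 * R)) * sqrt (metric N d (\<phi> p) u u) \<and>
          (1 - A * (2 * R)) * metric N d (\<phi> p) u u \<le> ?B u u \<and>
          \<bar>?B (christoffel N d (snd d (\<phi> p)) u u) (?r p)\<bar> \<le> A * (2 * R) * metric N d (\<phi> p) u u)" by blast
      from * show "\<phi> p \<in> fst d" by (rule conjunct1)
      from *[THEN conjunct2] show "sqrt (?B (?r p) (?r p)) \<le> (1 + A * (2 * R)) * riem_dist N ?q0 (\<phi> p)" by (rule conjunct1)
      note u = *[THEN conjunct2, THEN conjunct2, rule_format, of u]
      from u show "sqrt (?B u u) \<le> (1 + A * (2 * R)) * sqrt (metric N d (\<phi> p) u u)" by (rule conjunct1)
      from u[THEN conjunct2] show "(1 - A * (2 * R)) * metric N d (\<phi> p) u u \<le> ?B u u" by (rule conjunct1)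
      from u[THEN conjunct2] show "\<bar>?B (christoffel N d (snd d (\<phi> p)) u u) (?r p)\<bar> \<le> A * (2 * R) * metric N d (\<phi> p) u u"
        by (rule conjunct2)
    qed
    have rad: "sqrt (?B (?r p) (?r p)) \<le> (1 + A * (2 * R)) * riem_dist P p0 p" if p: "riem_dist P p0 p \<le> R" for p
    proof (rule order_trans[OF nbR(2)[OF p]])
      show "(1 + A * (2 * R)) * riem_dist N ?q0 (\<phi> p) \<le> (1 + A * (2 * R)) * riem_dist P p0 p"
        using AR riem_dist_phi_le[of p0 p] by (intro mult_left_mono) simp_all
    qed
    show "P.C2_fun_on (\<phi> -` fst d) ?F" by (rule C2_half_sq[OF d(1) q0])
    show "{p. riem_dist P p0 p \<le> R} \<subseteq> \<phi> -` fst d" using nbR(1) by auto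
    show "0 \<le> R" using R by simp
    fix c p assume c: "c \<in> atlas P" "p \<in> fst c" and pR: "riem_dist P p0 p < R"
    have pR': "riem_dist P p0 p \<le> R" using pR by simp
    have pd: "\<phi> p \<in> fst d" by (rule nbR(1)[OF pR'])
    let ?D = "differential \<phi> c d p" and ?H = "mean_curvature_vector P N \<phi> c d p"
    let ?E = "SOME E. orthonormal_basis (metric P c p) E"
    have E: "orthonormal_basis (metric P c p) ?E"
      using orthonormal_family[OF P.inner_product_metric[OF c]] by (rule someI_ex)
    have cE: "card ?E = CARD('m)" using E unfolding orthonormal_basis_def by (elim conjE)
    have on: "metric P c p u v = (if u = v then 1 else 0)" if "u \<in> ?E" "v \<in> ?E" for u v
      by (rule bspec[OF bspec[OF orthonormal_basis_def[THEN iffD1, OF E, THEN conjunct2, THEN conjunct2] that(1)] that(2)])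
    have De: "metric N d (\<phi> p) (?D e) (?D e) = 1" if "e \<in> ?E" for e
      using metric_differential[OF c(1) d(1) c(2) pd, of e e] on[OF that that] by simp
    have rad2: "sqrt (?B (?r p) (?r p)) \<le> 2 * R"
    proof -
      have "(1 + A * (2 * R)) * riem_dist P p0 p \<le> 2 * R"
        using AR pR' P.riem_dist_nonneg[of p0 p] R by (intro mult_mono) auto
      with rad[OF pR'] show ?thesis by linarith
    qed
    have "sqrt (?B ?H ?H) \<le> (1 + A * (2 * R)) * h"
    proof -
      have "sqrt (metric N d (\<phi> p) ?H ?H) = h0" using h0 c d(1) pd by blast
      then have "(1 + A * (2 * R)) * sqrt (metric N d (\<phi> p) ?H ?H) \<le> (1 + A * (2 * R)) * h"
        using AR by (intro mult_left_mono) (auto simp: h_def)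
      with nbR(3)[OF pR', of ?H] show ?thesis by linarith
    qed
    also have "\<dots> \<le> 2 * h" using AR by (intro mult_right_mono) (auto simp: h_def)
    finally have H: "sqrt (?B ?H ?H) \<le> 2 * h" .
    have "- ?B ?H (?r p) \<le> sqrt (?B ?H ?H) * sqrt (?B (?r p) (?r p))"
      using inner_product_Cauchy_Schwarz[OF ip, of "- ?H" "?r p"] by (simp add: bilinear_simps[OF inner_productD(1)[OF ip]])
    also have "\<dots> \<le> (2 * h) * (2 * R)"
      using H rad2 inner_productD(4)[OF ip] by (intro mult_mono) (auto simp: h_def)
    finally have BH: "- (4 * h * R) \<le> ?B ?H (?r p)" by simp
    have "1 - 4 * A * R \<le> ?B (?D e) (?D e) - ?B (christoffel N d (snd d (\<phi> p)) (?D e) (?D e)) (?r p)" if e: "e \<in> ?E" for e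
    proof -
      have "4 * A * R = 2 * (A * (2 * R))" by simp
      moreover have "1 - A * (2 * R) \<le> ?B (?D e) (?D e)"
        "\<bar>?B (christoffel N d (snd d (\<phi> p)) (?D e) (?D e)) (?r p)\<bar> \<le> A * (2 * R)"
        using nbR(4)[OF pR', of "?D e"] nbR(5)[OF pR', of "?D e"] unfolding De[OF e] by simp_all
      ultimately show ?thesis by linarith
    qed
    then have "(\<Sum>e\<in>?E. 1 - 4 * A * R) \<le>
        (\<Sum>e\<in>?E. ?B (?D e) (?D e) - ?B (christoffel N d (snd d (\<phi> p)) (?D e) (?D e)) (?r p))"
      by (rule sum_mono)
    moreover have "(\<Sum>e\<in>?E. 1 - 4 * A * R) = real CARD('m) * (1 - 4 * A * R)"
      by (simp add: cE)
    moreover have "real CARD('m) * (- (4 * h * R)) \<le> real CARD('m) * ?B ?H (?r p)"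
      using BH by (intro mult_left_mono) auto
    ultimately have "real CARD('m) * (1 - 4 * A * R) + real CARD('m) * (- (4 * h * R)) \<le> P.laplacian c ?F (snd c p)"
      unfolding laplacian_half_sq[OF d(1) q0 c pd] by linarith
    moreover have "real CARD('m) * (1 - A1 * R) \<le> real CARD('m) * (1 - (4 * A + 4 * h) * R)"
      using A1 R by (intro mult_left_mono diff_left_mono mult_right_mono) auto
    ultimately show "real CARD('m) * (1 - A1 * R) \<le> P.laplacian c ?F (snd c p)"
      by (simp add: algebra_simps)
    let ?V = "P.gradient c ?F (snd c p)"
    have z: "snd c p \<in> snd c ` (fst c \<inter> \<phi> -` fst d)" using c pd by auto
    \<comment> \<open>The squared length of the gradient is a pairing of its image with the radial
      vector. Cauchy-Schwarz and division by the length give the bound, with a factor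
      \<open>1 + A * (2 * R)\<close> from each of the two vectors.\<close>
    have "metric P c p ?V ?V = P.dfun c ?F (snd c p) ?V"
      using P.coord_metric_gradient[OF C2_half_sq[OF d(1) q0] c(1) z] P.coord_metric_eq[OF c] by simp
    also have "\<dots> = ?B (?D ?V) (?r p)"
      unfolding dfun_half_sq[OF d(1) q0 c(1) z] local_rep_chart[OF c] differential_def ..
    also have "\<dots> \<le> sqrt (?B (?D ?V) (?D ?V)) * sqrt (?B (?r p) (?r p))" by (rule inner_product_Cauchy_Schwarz[OF ip])
    also have "\<dots> \<le> ((1 + A * (2 * R)) * sqrt (metric P c p ?V ?V)) * ((1 + A * (2 * R)) * riem_dist P p0 p)"
      using nbR(3)[OF pR', of "?D ?V"] rad[OF pR'] AR inner_productD(4)[OF ip] inner_productD(4)[OF P.inner_product_metric[OF c]]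
      unfolding metric_differential[OF c(1) d(1) c(2) pd] by (intro mult_mono) auto
    finally have "metric P c p ?V ?V \<le> sqrt (metric P c p ?V ?V) * ((1 + A * (2 * R))\<^sup>2 * riem_dist P p0 p)"
      by (simp add: power2_eq_square ac_simps)
    then have "sqrt (metric P c p ?V ?V) * sqrt (metric P c p ?V ?V) \<le> sqrt (metric P c p ?V ?V) * ((1 + A * (2 * R))\<^sup>2 * riem_dist P p0 p)"
      using inner_productD(4)[OF P.inner_product_metric[OF c], of ?V] by simp
    then have "sqrt (metric P c p ?V ?V) \<le> (1 + A * (2 * R))\<^sup>2 * riem_dist P p0 p"
      using P.riem_dist_nonneg[of p0 p] inner_productD(4)[OF P.inner_product_metric[OF c], of ?V]
      by (cases "sqrt (metric P c p ?V ?V) > 0") (auto intro: mult_left_le_imp_le simp del: real_sqrt_mult_self)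
    also have "\<dots> \<le> (1 + A1 * R) * riem_dist P p0 p"
    proof (rule mult_right_mono[OF _ P.riem_dist_nonneg])
      have "(A * (2 * R)) * (A * (2 * R)) \<le> (A * (2 * R)) * 1" using AR by (intro mult_left_mono) auto
      then have "(1 + A * (2 * R))\<^sup>2 \<le> 1 + 6 * A * R" by (simp add: power2_eq_square algebra_simps)
      also have "\<dots> \<le> 1 + A1 * R" using A1 R by (intro add_left_mono mult_right_mono) auto
      finally show "(1 + A * (2 * R))\<^sup>2 \<le> 1 + A1 * R" .
    qed
    finally show "sqrt (metric P c p ?V ?V) \<le> (1 + A1 * R) * riem_dist P p0 p" .
  qed
  define R where "R = min (R1 / 2) (\<epsilon> / 2)"
  have R: "0 < R" "R < R1" "R < \<epsilon>" using R1(1) \<epsilon> by (auto simp: R_def)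
  define k where "k = exp (- 2 * real CARD('m)) * unit_ball_vol (real CARD('m)) / (8 * 4 ^ CARD('m)) * R ^ CARD('m)"
  have "0 < k" using R by (simp add: k_def)
  moreover have "ennreal k \<le> emeasure (riem_volume P) (geodesic_ball P p0 R)" if "\<phi> p0 \<in> V" for p0
    unfolding k_def using A1(1) by (intro P.volume_growth[OF complete _ R1(2) key[OF that] R(1,2)]) simp_all
  ultimately have "\<exists>k. 0 < R \<and> R < \<epsilon> \<and> 0 < k \<and>
      (\<forall>p0. \<phi> p0 \<in> V \<longrightarrow> ennreal k \<le> emeasure (riem_volume P) (geodesic_ball P p0 R))"
    using R(1,3) by (intro exI[of _ k]) simp
  then show ?thesis using nb(4,5) by blast
qed

text \<open>By \<open>Hopf_Rinow\<close> a closed noncompact set is unbounded; letting the distance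
  from a base point grow by at least 1 each time separates the points.\<close>

lemma separated_sequence:
  assumes complete: "complete_riem P" and X: "closed X" "\<not> compact X"
  shows "\<exists>x :: nat \<Rightarrow> 'p. (\<forall>n. x n \<in> X) \<and> (\<forall>i j. i \<noteq> j \<longrightarrow> 1 \<le> riem_dist P (x i) (x j))"
proof -
  fix p :: 'p
  have far: "\<exists>y\<in>X. r < riem_dist P p y" for r
  proof (rule ccontr)
    assume "\<not> (\<exists>y\<in>X. r < riem_dist P p y)"
    then have "X = X \<inter> {q. riem_dist P p q \<le> r}" by force
    then show False using closed_Int_compact[OF X(1) P.Hopf_Rinow[OF complete, of p r]] X(2) by simp
  qed
  have "\<exists>x. \<forall>n. x n \<in> X \<and> riem_dist P p (x n) + 1 \<le> riem_dist P p (x (Suc n))"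
  proof (rule dependent_nat_choice[of "\<lambda>_ y. y \<in> X" "\<lambda>_ y y'. riem_dist P p y + 1 \<le> riem_dist P p y'"])
    show "\<exists>y. y \<in> X" using far by blast
    show "\<exists>y'. y' \<in> X \<and> riem_dist P p y + 1 \<le> riem_dist P p y'" for y
      using far[of "riem_dist P p y + 1"] by force
  qed
  then obtain x where x: "\<And>n. x n \<in> X" "\<And>n. riem_dist P p (x n) + 1 \<le> riem_dist P p (x (Suc n))" by blast
  have inc: "riem_dist P p (x i) + 1 \<le> riem_dist P p (x j)" if "i < j" for i j
    using that
  proof (induction j)
    case (Suc j)
    then show ?case using x(2)[of j] by (cases "i = j") auto
  qed simp
  have "1 \<le> riem_dist P (x i) (x j)" if "i \<noteq> j" for i j
  proof (cases "i < j")
    case True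
    then show ?thesis using inc[OF True] P.riem_dist_triangle[of p "x j" "x i"] by linarith
  next
    case False
    then have "j < i" using that by simp
    then show ?thesis
      using inc[of j i] P.riem_dist_triangle[of p "x i" "x j"] P.riem_dist_commute[of "x i" "x j"] by linarith
  qed
  with x(1) show ?thesis by (intro exI[of _ x]) simp
qed

section \<open>The two directions of the equivalence\<close>

lemma finite_volume_if_proper:
  assumes complete: "complete_riem N" and proper: "proper_map euclidean euclidean \<phi>"
  shows "emeasure (riem_volume P) (\<phi> -` geodesic_ball N q t) < \<infinity>"
proof -
  let ?K = "{y. riem_dist N q y \<le> t}"
  have K: "compact (\<phi> -` ?K)"
    using proper N.Hopf_Rinow[OF complete] proper_map_iff_compact_vimage[OF continuous_phi] by blast
  have "emeasure (riem_volume P) (\<phi> -` geodesic_ball N q t) \<le> emeasure (riem_volume P) (\<phi> -` ?K)"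
    using K by (intro emeasure_mono) (auto simp: geodesic_ball_def borel_compact)
  then show ?thesis using P.riem_volume_compact_finite[OF K] by (rule le_less_trans)
qed

lemma proper_if_finite_volume:
  assumes complete: "complete_riem P" and cmc: "constant_mean_curvature_length P N \<phi>"
    and vol: "\<And>t q. 0 < t \<Longrightarrow> emeasure (riem_volume P) (\<phi> -` geodesic_ball N q t) < \<infinity>"
  shows "proper_map euclidean euclidean \<phi>"
  unfolding proper_map_iff_compact_vimage[OF continuous_phi]
proof (intro allI impI, rule ccontr)
  fix K assume K: "compact K" and nc: "\<not> compact (\<phi> -` K)"
  have "closed (\<phi> -` K)"
    by (rule closed_vimage[OF compact_imp_closed[OF K] continuous_phi])
  from separated_sequence[OF complete this nc] obtain x :: "nat \<Rightarrow> 'p"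
    where "(\<forall>n. x n \<in> \<phi> -` K) \<and> (\<forall>i j. i \<noteq> j \<longrightarrow> 1 \<le> riem_dist P (x i) (x j))" ..
  then have x: "x n \<in> \<phi> -` K" "i \<noteq> j \<Longrightarrow> 1 \<le> riem_dist P (x i) (x j)" for n i j by simp_all
  \<comment> \<open>A radius below \<open>1 / 2\<close>, half the least mutual distance of the
    \<open>x n\<close>, makes the balls disjoint.\<close>
  let ?ok = "\<lambda>V R k. 0 < R \<and> R < 1 / 2 \<and> 0 < k \<and>
    (\<forall>p0. \<phi> p0 \<in> V \<longrightarrow> ennreal k \<le> emeasure (riem_volume P) (geodesic_ball P p0 R))"
  have "\<forall>q. \<exists>V. open V \<and> q \<in> V \<and> (\<exists>R k. ?ok V R k)"
    using uniform_volume_bound[OF complete cmc, of "1 / 2"] by simp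
  from choice[OF this] obtain V where "\<forall>q. open (V q) \<and> q \<in> V q \<and> (\<exists>R k. ?ok (V q) R k)" ..
  then have V: "open (V q)" "q \<in> V q" "\<exists>R k. ?ok (V q) R k" for q by simp_all
  have cov: "K \<subseteq> (\<Union>q\<in>K. V q)" using V(2) by (intro subsetI UN_I)
  obtain Q where Q: "Q \<subseteq> K" "finite Q" "K \<subseteq> (\<Union>q\<in>Q. V q)"
    by (rule compactE_image[OF K V(1) cov])
  \<comment> \<open>The pigeonhole principle replaces a convergent subsequence: one of finitely many
    \<open>V q\<close>, with a single pair of constants \<open>R\<close> and \<open>k\<close>,
    receives infinitely many images.\<close>
  have "\<exists>q\<in>Q. infinite {n. \<phi> (x n) \<in> V q}"
  proof (rule ccontr)
    assume "\<not> (\<exists>q\<in>Q. infinite {n. \<phi> (x n) \<in> V q})"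
    then have "finite (\<Union>q\<in>Q. {n. \<phi> (x n) \<in> V q})" using Q(2) by simp
    moreover have "(\<Union>q\<in>Q. {n. \<phi> (x n) \<in> V q}) = UNIV"
    proof (intro equalityI subset_UNIV subsetI)
      fix n
      have "\<phi> (x n) \<in> (\<Union>q\<in>Q. V q)" using x(1)[of n] Q(3) by (intro subsetD[OF Q(3)]) simp
      then show "n \<in> (\<Union>q\<in>Q. {n. \<phi> (x n) \<in> V q})" by simp
    qed
    ultimately show False by simp
  qed
  then obtain q where q: "infinite {n. \<phi> (x n) \<in> V q}" ..
  obtain R k where "?ok (V q) R k" using V(3)[of q] by (elim exE)
  then have R: "0 < R" "R \<le> 1 / 2" and k: "0 < k"
    "\<And>p0. \<phi> p0 \<in> V q \<Longrightarrow> ennreal k \<le> emeasure (riem_volume P) (geodesic_ball P p0 R)" by simp_all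
  obtain t0 where t0: "t0 > 0" "\<And>y. y \<in> K \<Longrightarrow> riem_dist N q y \<le> t0"
    using compact_imp_bounded[OF compact_continuous_image[OF N.continuous_on_riem_dist K, of q]]
    unfolding bounded_pos by auto
  \<comment> \<open>The images of the \<open>x n\<close> lie in \<open>K\<close>, hence within
    \<open>t0\<close> of \<open>q\<close>, and points of the balls are less than
    \<open>R < 1\<close> further away.\<close>
  let ?S = "\<phi> -` geodesic_ball N q (t0 + 1)" and ?b = "\<lambda>n. geodesic_ball P (x n) R"
  have sub: "?b n \<subseteq> ?S" for n
  proof
    fix y assume "y \<in> ?b n"
    then have "riem_dist P (x n) y < R" by (simp add: geodesic_ball_def)
    then have "riem_dist N (\<phi> (x n)) (\<phi> y) < R" using riem_dist_phi_le[of "x n" y] by linarith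
    moreover have "riem_dist N q (\<phi> (x n)) \<le> t0" using x(1)[of n] t0(2) by simp
    ultimately have "riem_dist N q (\<phi> y) < t0 + 1"
      using N.riem_dist_triangle[of q "\<phi> y" "\<phi> (x n)"] R by linarith
    then show "y \<in> ?S" by (simp add: geodesic_ball_def)
  qed
  have disj: "disjoint_family_on ?b I" for I
  proof (unfold disjoint_family_on_def, intro ballI impI)
    fix i j :: nat assume "i \<noteq> j"
    show "?b i \<inter> ?b j = {}"
    proof (rule ccontr)
      assume "?b i \<inter> ?b j \<noteq> {}"
      then obtain y where "riem_dist P (x i) y < R" "riem_dist P (x j) y < R" by (auto simp: geodesic_ball_def)
      then show False
        using P.riem_dist_triangle[of "x i" "x j" y] P.riem_dist_commute[of "x j" y] x(2)[OF \<open>i \<noteq> j\<close>] R by linarith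
    qed
  qed
  have bS: "?b n \<in> sets (riem_volume P)" for n using P.open_geodesic_ball by simp
  have SS: "?S \<in> sets (riem_volume P)" using open_vimage_phi[OF N.open_geodesic_ball] by simp
  have fin: "emeasure (riem_volume P) ?S < \<infinity>" using vol[of "t0 + 1" q] t0 by simp
  then obtain v where v: "0 \<le> v" "emeasure (riem_volume P) ?S = ennreal v"
    by (cases "emeasure (riem_volume P) ?S" rule: ennreal_cases) auto
  \<comment> \<open>Finitely many balls already exceed the volume \<open>v\<close> of the extrinsic
    ball.\<close>
  obtain m :: nat where m: "v < real m * k" using reals_Archimedean3[OF k(1)] by blast
  obtain I where I: "I \<subseteq> {n. \<phi> (x n) \<in> V q}" "finite I" "card I = m"
    using infinite_arbitrarily_large[OF q, of m] by blast
  have "ennreal (real m * k) = (\<Sum>i\<in>I. ennreal k)"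
    using I k by (simp add: ennreal_of_nat_eq_real_of_nat ennreal_mult)
  also have "\<dots> \<le> (\<Sum>i\<in>I. emeasure (riem_volume P) (?b i))"
    using I k(2) by (intro sum_mono) auto
  also have "\<dots> = emeasure (riem_volume P) (\<Union>i\<in>I. ?b i)"
    using bS disj I by (intro sum_emeasure) auto
  also have "\<dots> \<le> emeasure (riem_volume P) ?S"
    using sub SS by (intro emeasure_mono) auto
  also have "\<dots> = ennreal v" by (rule v(2))
  finally have "real m * k \<le> v" using v(1) by (simp add: ennreal_le_iff)
  with m show False by simp
qed

end

theorem corollary1p3:
  fixes P :: "('p::{t2_space,second_countable_topology}, 'm::finite) riem"
    and N :: "('q::{t2_space,second_countable_topology}, 'n::finite) riem"
    and \<phi> :: "'p \<Rightarrow> 'q"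
  assumes "riemannian_manifold P" "complete_riem P" "\<not> compact (UNIV :: 'p set)"
    and "riemannian_manifold N" "bounded_geometry N"
    and "isometric_immersion P N \<phi>"
    and "constant_mean_curvature_length P N \<phi>"
  shows "proper_map euclidean euclidean \<phi> \<longleftrightarrow>
    (\<forall>t>0. \<forall>q. emeasure (riem_volume P) (\<phi> -` geodesic_ball N q t) < \<infinity>)"
proof -
  interpret immersion P N \<phi>
    using assms by unfold_locales
  have "complete_riem N" using assms(5) by (simp add: bounded_geometry_def)
  then show ?thesis
    using finite_volume_if_proper proper_if_finite_volume[OF assms(2,7)] by blast
qed

end
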